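(* Let $F$ be a finite group with $\mathrm{Irr}\,F=\{U_1,\ldots,U_l\}$, let ${\bf n}=(n_1,\ldots,n_l)$ be an integer composition of $n$ and let $\Lambda=(\lambda_1,\ldots,\lambda_l)\Vdash{\bf n}$ be a multipartition. Then $$\mathrm{Ind}_{F\wr S_n}^{F\wr S_{n+1}}\Phi_\Lambda\cong\bigoplus_{i=1}^{l}\Big(\dim U_i\bigoplus_{\gamma\in Y^+(\lambda_i)}\Phi_{(\lambda_1,\ldots,\gamma,\ldots,\lambda_l)}\Big),$$ where $\gamma$ is in the $i$-th position of $(\lambda_1,\ldots,\gamma,\ldots,\lambda_l)$, i.e. it replaces $\lambda_i$.
   Context: All representations are finite dimensional over $\mathbb{C}$; $\mathrm{Irr}\,G$ is the set of irreducible representations of $G$ up to isomorphism; $\boxtimes$ is the outer and $\otimes$ the inner tensor product; $mV$ means the direct sum of $m$ copies of $V$. Wreath product: if a group $G$ acts on the left on a finite set $X$, $F\wr_X G$ is the set $F^X\times G$ with $(f,g)(f',g')=(f\cdot(g\ast f'),gg')$, where $(g\ast f)(x)=f(g^{-1}x)$. $F\wr S_n$ is the case $G=S_n$, $X=\{1,\ldots,n\}$; for $H\le S_n$, $F\wr H=F\wr_{\{1,\ldots,n\}}H\le F\wr S_n$. ($F\wr S_0$ is trivial.) $F\wr S_n$ is embedded in $F\wr S_{n+1}$ in the natural way, as the pairs $(f,\pi)$ with $f(n+1)=1_F$ and $\pi(n+1)=n+1$. An integer composition of $n$ is a tuple of non-negative integers with sum $n$. A multipartition $\Lambda=(\lambda_1,\ldots,\lambda_l)$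 of ${\bf n}=(n_1,\ldots,n_l)$, written $\Lambda\Vdash{\bf n}$, is a tuple with $\lambda_i\vdash n_i$ for all $i$ ($\varnothing$ is the only partition of $0$). $S^\lambda$ is the Specht module. Partitions are identified with Young diagrams; $Y^+(\lambda)$ is the set of Young diagrams obtained from $\lambda$ by adding one box. Irreducible representations of $F\wr S_n$: fix an indexing $\mathrm{Irr}\,F=\{U_1,\ldots,U_l\}$. Let ${\bf n}=(n_1,\ldots,n_l)$ be a composition of $n$ and $\Lambda\Vdash{\bf n}$. Let $S_{n_1}\times\cdots\times S_{n_l}\le S_n$ be the subgroup permuting consecutive blocks of sizes $n_1,\ldots,n_l$. Let $U_{\bf n}=U_1^{\boxtimes n_1}\boxtimes\cdots\boxtimes U_l^{\boxtimes n_l}$ and let $\widetilde{U_{\bf n}}$ be the $F\wr(S_{n_1}\times\cdots\times S_{n_l})$-representation on the space $U_{\bf n}$ with $(f,h)\cdot(u_1\boxtimes\cdots\boxtimes u_n)=\boxtimes_{x=1}^n f(x)u_{h^{-1}x}$. Let $S^\Lambda=S^{\lambda_1}\boxtimes\cdots\boxtimes S^{\lambda_l}$ and let $\overline{S^\Lambda}$ be the same space with $(f,h)\cdot v=h\cdot v$. Define $\Phi_\Lambda=\mathrm{Ind}_{F\wr(S_{n_1}\times\cdots\times S_{n_l})}^{F\wr S_n}(\widetilde{U_{\bf n}}\otimes\overline{S^\Lambda})$. The $\Phi_\Lambda$ form a complete list of pairwise non-isomorphic irreducible representations of $F\wr S_n$. *)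

theory Defs
  imports Complex_Main "HOL-Library.Function_Algebras" "HOL-Library.FuncSet"
    "HOL-Algebra.Sym_Groups"
begin

section \<open>Complex vector spaces\<close>

class complex_vector = ab_group_add +
  fixes scaleC :: "complex \<Rightarrow> 'a \<Rightarrow> 'a" (infixr "*\<^sub>C" 75)
  assumes scaleC_add_right: "a *\<^sub>C (x + y) = a *\<^sub>C x + a *\<^sub>C y"
    and scaleC_add_left: "(a + b) *\<^sub>C x = a *\<^sub>C x + b *\<^sub>C x"
    and scaleC_scaleC: "a *\<^sub>C (b *\<^sub>C x) = (a * b) *\<^sub>C x"
    and scaleC_one: "1 *\<^sub>C x = x"

global_interpretation complex_vector:
  vector_space "scaleC :: complex \<Rightarrow> 'a \<Rightarrow> 'a::complex_vector"
  by unfold_locales (rule scaleC_add_right scaleC_add_left scaleC_scaleC scaleC_one)+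

instantiation complex :: complex_vector
begin
definition scaleC_complex_def: "c *\<^sub>C (z::complex) = c * z"
instance by standard (simp_all add: scaleC_complex_def algebra_simps)
end

instantiation "fun" :: (type, complex_vector) complex_vector
begin
definition scaleC_fun_def: "c *\<^sub>C f = (\<lambda>x. c *\<^sub>C f x)"
instance
  by standard
    (simp_all add: scaleC_fun_def fun_eq_iff scaleC_add_right scaleC_add_left scaleC_scaleC
      scaleC_one)
end

definition linear_on :: "'v::complex_vector set \<Rightarrow> ('v \<Rightarrow> 'w::complex_vector) \<Rightarrow> bool" where
  "linear_on V T \<longleftrightarrow>
     (\<forall>v\<in>V. \<forall>w\<in>V. T (v + w) = T v + T w) \<and> (\<forall>c. \<forall>v\<in>V. T (c *\<^sub>C v) = c *\<^sub>C T v)"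


section \<open>Representations\<close>

text \<open>The space of a representation is a linear subspace of the ambient type \<open>'v\<close>; the value of
  \<open>rep_act R g v\<close> is irrelevant when \<open>v\<close> is outside the space or \<open>g\<close> is outside the group.\<close>

record ('g, 'v) rep =
  rep_space :: "'v set"
  rep_act :: "'g \<Rightarrow> 'v \<Rightarrow> 'v"

definition is_rep :: "('g, 'm) monoid_scheme \<Rightarrow> ('g, 'v::complex_vector) rep \<Rightarrow> bool" where
  "is_rep G R \<longleftrightarrow>
     complex_vector.subspace (rep_space R) \<and>
     (\<exists>B. finite B \<and> rep_space R = complex_vector.span B) \<and>
     (\<forall>g\<in>carrier G. linear_on (rep_space R) (rep_act R g)) \<and>
     (\<forall>g\<in>carrier G. \<forall>v\<in>rep_space R. rep_act R g v \<in> rep_space R) \<and>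
     (\<forall>v\<in>rep_space R. rep_act R \<one>\<^bsub>G\<^esub> v = v) \<and>
     (\<forall>g\<in>carrier G. \<forall>h\<in>carrier G. \<forall>v\<in>rep_space R.
        rep_act R (g \<otimes>\<^bsub>G\<^esub> h) v = rep_act R g (rep_act R h v))"

definition rep_dim :: "('g, 'v::complex_vector) rep \<Rightarrow> nat" where
  "rep_dim R = complex_vector.dim (rep_space R)"

definition irreducible_rep ::
  "('g, 'm) monoid_scheme \<Rightarrow> ('g, 'v::complex_vector) rep \<Rightarrow> bool" where
  "irreducible_rep G R \<longleftrightarrow>
     is_rep G R \<and> rep_space R \<noteq> {0} \<and>
     (\<forall>W. complex_vector.subspace W \<and> W \<subseteq> rep_space R \<and>
          (\<forall>g\<in>carrier G. \<forall>w\<in>W. rep_act R g w \<in> W) \<longrightarrow> W = {0} \<or> W = rep_space R)"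

definition rep_iso ::
  "('g, 'm) monoid_scheme \<Rightarrow> ('g, 'v::complex_vector) rep \<Rightarrow> ('g, 'w::complex_vector) rep \<Rightarrow> bool"
where
  "rep_iso G R S \<longleftrightarrow>
     is_rep G R \<and> is_rep G S \<and>
     (\<exists>T. linear_on (rep_space R) T \<and> bij_betw T (rep_space R) (rep_space S) \<and>
          (\<forall>g\<in>carrier G. \<forall>v\<in>rep_space R. T (rep_act R g v) = rep_act S g (T v)))"

text \<open>\<open>Irr G = {U\<^sub>1, \<dots>, U\<^sub>l}\<close>, as an indexing without repetitions. Completeness is tested on
  representations inside \<open>nat \<Rightarrow> complex\<close>, which contains a copy of every finite dimensional
  complex vector space.\<close>

definition is_Irr ::
  "('g, 'm) monoid_scheme \<Rightarrow> ('g, 'v::complex_vector) rep list \<Rightarrow> bool" where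
  "is_Irr G Us \<longleftrightarrow>
     (\<forall>i<length Us. irreducible_rep G (Us ! i)) \<and>
     (\<forall>i<length Us. \<forall>j<length Us. i \<noteq> j \<longrightarrow> \<not> rep_iso G (Us ! i) (Us ! j)) \<and>
     (\<forall>R :: ('g, nat \<Rightarrow> complex) rep. irreducible_rep G R \<longrightarrow>
        (\<exists>i<length Us. rep_iso G R (Us ! i)))"

definition direct_sum :: "'i set \<Rightarrow> ('i \<Rightarrow> ('g, 'v::complex_vector) rep) \<Rightarrow> ('g, 'i \<Rightarrow> 'v) rep" where
  "direct_sum I R =
     \<lparr> rep_space = {\<phi>. (\<forall>i\<in>I. \<phi> i \<in> rep_space (R i)) \<and> (\<forall>i. i \<notin> I \<longrightarrow> \<phi> i = 0)},
       rep_act = (\<lambda>g \<phi> i. if i \<in> I then rep_act (R i) g (\<phi> i) else 0) \<rparr>"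

definition copies :: "nat \<Rightarrow> ('g, 'v::complex_vector) rep \<Rightarrow> ('g, nat \<Rightarrow> 'v) rep" where
  "copies m R = direct_sum {..<m} (\<lambda>_. R)"

text \<open>\<open>Ind\<^sub>H\<^sup>G R\<close>: the functions \<open>\<phi> : G \<rightarrow> R\<close> with \<open>\<phi>(xh) = h\<^sup>-\<^sup>1\<phi>(x)\<close> for \<open>h \<in> H\<close>, with
  \<open>(g\<phi>)(x) = \<phi>(g\<^sup>-\<^sup>1x)\<close>. The functions supported on a single coset \<open>gH\<close> form the summand \<open>gR\<close> of
  \<open>Ind R = \<Oplus> gR\<close>.\<close>

definition induced ::
  "('g, 'm) monoid_scheme \<Rightarrow> 'g set \<Rightarrow> ('g, 'v::complex_vector) rep \<Rightarrow> ('g, 'g \<Rightarrow> 'v) rep" where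
  "induced G H R =
     \<lparr> rep_space = {\<phi>. (\<forall>x\<in>carrier G. \<phi> x \<in> rep_space R) \<and> (\<forall>x. x \<notin> carrier G \<longrightarrow> \<phi> x = 0) \<and>
         (\<forall>x\<in>carrier G. \<forall>h\<in>H. \<phi> (x \<otimes>\<^bsub>G\<^esub> h) = rep_act R (inv\<^bsub>G\<^esub> h) (\<phi> x))},
       rep_act = (\<lambda>g \<phi> x. if x \<in> carrier G then \<phi> (inv\<^bsub>G\<^esub> g \<otimes>\<^bsub>G\<^esub> x) else 0) \<rparr>"


section \<open>Tensor products\<close>

text \<open>The tensor product of the spaces \<open>V i\<close>, \<open>i \<in> I\<close> (\<open>I\<close> finite), is realised inside the dual of the
  space of multilinear forms on \<open>\<Prod>\<^sub>i V i\<close>: the pure tensor of a tuple \<open>u\<close> is evaluation at \<open>u\<close>, and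
  the tensor product is the span of the pure tensors. A map \<open>A\<close> of tuples such that \<open>M \<circ> A\<close> is
  multilinear for all multilinear \<open>M\<close> acts on it by sending the pure tensor of \<open>u\<close> to that of
  \<open>A u\<close>.\<close>

definition multilinear_forms ::
  "'i set \<Rightarrow> ('i \<Rightarrow> 'v::complex_vector set) \<Rightarrow> (('i \<Rightarrow> 'v) \<Rightarrow> complex) set" where
  "multilinear_forms I V = {M. \<forall>u\<in>Pi\<^sub>E I V. \<forall>i\<in>I. linear_on (V i) (\<lambda>v. M (u(i := v)))}"

definition pure_tensor ::
  "'i set \<Rightarrow> ('i \<Rightarrow> 'v::complex_vector set) \<Rightarrow> ('i \<Rightarrow> 'v) \<Rightarrow> (('i \<Rightarrow> 'v) \<Rightarrow> complex) \<Rightarrow> complex"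
where
  "pure_tensor I V u = (\<lambda>M. if M \<in> multilinear_forms I V then M u else 0)"

definition tensor_space ::
  "'i set \<Rightarrow> ('i \<Rightarrow> 'v::complex_vector set) \<Rightarrow> ((('i \<Rightarrow> 'v) \<Rightarrow> complex) \<Rightarrow> complex) set" where
  "tensor_space I V = complex_vector.span (pure_tensor I V ` Pi\<^sub>E I V)"

definition tensor_map ::
  "'i set \<Rightarrow> ('i \<Rightarrow> 'v::complex_vector set) \<Rightarrow> (('i \<Rightarrow> 'v) \<Rightarrow> ('i \<Rightarrow> 'v)) \<Rightarrow>
   ((('i \<Rightarrow> 'v) \<Rightarrow> complex) \<Rightarrow> complex) \<Rightarrow> (('i \<Rightarrow> 'v) \<Rightarrow> complex) \<Rightarrow> complex" where
  "tensor_map I V A t =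
     (\<lambda>M. if M \<in> multilinear_forms I V then t (\<lambda>u. M (A u)) else 0)"

lemma tensor_map_pure_tensor:
  assumes "\<And>M. M \<in> multilinear_forms I V \<Longrightarrow> (\<lambda>u. M (A u)) \<in> multilinear_forms I V"
  shows "tensor_map I V A (pure_tensor I V u) = pure_tensor I V (A u)"
  using assms by (auto simp: tensor_map_def pure_tensor_def)

text \<open>The outer tensor product of representations \<open>R i\<close> of groups \<open>G\<^sub>i\<close>, with the elements of
  \<open>\<Prod>\<^sub>i G\<^sub>i\<close> given as functions of \<open>i\<close>.\<close>

definition outer_tensor ::
  "'i set \<Rightarrow> ('i \<Rightarrow> ('g, 'v::complex_vector) rep) \<Rightarrow>
   ('i \<Rightarrow> 'g, (('i \<Rightarrow> 'v) \<Rightarrow> complex) \<Rightarrow> complex) rep" where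
  "outer_tensor I R =
     \<lparr> rep_space = tensor_space I (\<lambda>i. rep_space (R i)),
       rep_act = (\<lambda>g. tensor_map I (\<lambda>i. rep_space (R i))
                        (\<lambda>u. \<lambda>i\<in>I. rep_act (R i) (g i) (u i))) \<rparr>"

text \<open>The same realisation of the tensor product for two factors in different ambient types.\<close>

definition bilinear_forms ::
  "'v::complex_vector set \<Rightarrow> 'w::complex_vector set \<Rightarrow> ('v \<Rightarrow> 'w \<Rightarrow> complex) set" where
  "bilinear_forms V W =
     {B. (\<forall>w\<in>W. linear_on V (\<lambda>v. B v w)) \<and> (\<forall>v\<in>V. linear_on W (\<lambda>w. B v w))}"

definition pure_tensor2 ::
  "'v::complex_vector set \<Rightarrow> 'w::complex_vector set \<Rightarrow> 'v \<Rightarrow> 'w \<Rightarrow>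
   ('v \<Rightarrow> 'w \<Rightarrow> complex) \<Rightarrow> complex" where
  "pure_tensor2 V W v w = (\<lambda>B. if B \<in> bilinear_forms V W then B v w else 0)"

definition inner_tensor ::
  "('g, 'v::complex_vector) rep \<Rightarrow> ('g, 'w::complex_vector) rep \<Rightarrow>
   ('g, ('v \<Rightarrow> 'w \<Rightarrow> complex) \<Rightarrow> complex) rep" where
  "inner_tensor R S =
     \<lparr> rep_space = complex_vector.span
         {pure_tensor2 (rep_space R) (rep_space S) v w | v w. v \<in> rep_space R \<and> w \<in> rep_space S},
       rep_act = (\<lambda>g t B. if B \<in> bilinear_forms (rep_space R) (rep_space S)
                          then t (\<lambda>v w. B (rep_act R g v) (rep_act S g w)) else 0) \<rparr>"

lemma inner_tensor_pure_tensor2: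
  assumes "is_rep G R" "is_rep G S" "g \<in> carrier G"
  shows "rep_act (inner_tensor R S) g (pure_tensor2 (rep_space R) (rep_space S) v w) =
         pure_tensor2 (rep_space R) (rep_space S) (rep_act R g v) (rep_act S g w)"
  using assms by (auto simp: inner_tensor_def pure_tensor2_def bilinear_forms_def linear_on_def
    is_rep_def fun_eq_iff)


section \<open>Partitions and Specht modules\<close>

text \<open>A partition is the list of its nonzero parts; rows and columns are numbered from \<open>0\<close>.\<close>

definition is_partition :: "nat list \<Rightarrow> nat \<Rightarrow> bool" where
  "is_partition \<mu> n \<longleftrightarrow> sorted_wrt (\<ge>) \<mu> \<and> (\<forall>p\<in>set \<mu>. 0 < p) \<and> sum_list \<mu> = n"

definition is_multipartition :: "nat list list \<Rightarrow> nat list \<Rightarrow> bool" where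
  "is_multipartition \<Lambda> ns \<longleftrightarrow>
     length \<Lambda> = length ns \<and> (\<forall>i<length ns. is_partition (\<Lambda> ! i) (ns ! i))"

definition is_composition :: "nat list \<Rightarrow> nat \<Rightarrow> bool" where
  "is_composition ns n \<longleftrightarrow> sum_list ns = n"

definition diagram :: "nat list \<Rightarrow> (nat \<times> nat) set" where
  "diagram \<mu> = {(i, j). i < length \<mu> \<and> j < \<mu> ! i}"

definition Yplus :: "nat list \<Rightarrow> nat list set" where
  "Yplus \<mu> = {\<gamma>. is_partition \<gamma> (Suc (sum_list \<mu>)) \<and>
                (\<exists>b. b \<notin> diagram \<mu> \<and> diagram \<gamma> = insert b (diagram \<mu>))}"

definition tableaux :: "nat list \<Rightarrow> (nat \<times> nat \<Rightarrow> nat) set" where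
  "tableaux \<mu> = {t. bij_betw t (diagram \<mu>) {1..sum_list \<mu>}}"

text \<open>The tabloid \<open>{t}\<close> is the list of the sets of entries of the rows of \<open>t\<close>.\<close>

definition tabloid :: "nat list \<Rightarrow> (nat \<times> nat \<Rightarrow> nat) \<Rightarrow> nat set list" where
  "tabloid \<mu> t = map (\<lambda>i. {t (i, j) | j. j < \<mu> ! i}) [0..<length \<mu>]"

definition column_stabilizer :: "nat list \<Rightarrow> (nat \<times> nat \<Rightarrow> nat) \<Rightarrow> (nat \<Rightarrow> nat) set" where
  "column_stabilizer \<mu> t =
     {\<sigma>. \<sigma> permutes {1..sum_list \<mu>} \<and>
         (\<forall>j. \<sigma> ` {t (i, j) | i. (i, j) \<in> diagram \<mu>} = {t (i, j) | i. (i, j) \<in> diagram \<mu>})}"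

text \<open>\<open>e\<^sub>t = \<Sum>\<^sub>\<sigma> sgn(\<sigma>) \<sigma>{t}\<close>, the sum being over the column stabilizer of \<open>t\<close>; elements of the
  permutation module on tabloids are written as coefficient functions.\<close>

definition polytabloid :: "nat list \<Rightarrow> (nat \<times> nat \<Rightarrow> nat) \<Rightarrow> nat set list \<Rightarrow> complex" where
  "polytabloid \<mu> t =
     (\<lambda>T. \<Sum>\<sigma>\<in>column_stabilizer \<mu> t.
        if T = map (image \<sigma>) (tabloid \<mu> t) then of_int (sign \<sigma>) else 0)"

definition specht :: "nat list \<Rightarrow> (nat \<Rightarrow> nat, nat set list \<Rightarrow> complex) rep" where
  "specht \<mu> =
     \<lparr> rep_space = complex_vector.span (polytabloid \<mu> ` tableaux \<mu>),
       rep_act = (\<lambda>\<pi> v T. v (map (image (Hilbert_Choice.inv \<pi>)) T)) \<rparr>"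


section \<open>Wreath products\<close>

text \<open>For a set \<open>H\<close> of permutations of \<open>{1..n}\<close>, \<open>wreath F n H\<close> is \<open>F \<wr> H\<close>. Functions \<open>{1..n} \<rightarrow> F\<close>
  are extended to all of \<open>nat\<close> by \<open>1\<^sub>F\<close>, so that the natural embedding of \<open>F \<wr> S\<^sub>n\<close> into
  \<open>F \<wr> S\<^sub>n\<^sub>+\<^sub>1\<close> is the inclusion of carriers.\<close>

definition wreath ::
  "('f, 'm) monoid_scheme \<Rightarrow> nat \<Rightarrow> (nat \<Rightarrow> nat) set \<Rightarrow> ((nat \<Rightarrow> 'f) \<times> (nat \<Rightarrow> nat)) monoid" where
  "wreath F n H =
     \<lparr> carrier = {(f, \<pi>). (\<forall>x\<in>{1..n}. f x \<in> carrier F) \<and> (\<forall>x. x \<notin> {1..n} \<longrightarrow> f x = \<one>\<^bsub>F\<^esub>) \<and> \<pi> \<in> H},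
       mult = (\<lambda>(f, \<pi>) (f', \<pi>'). (\<lambda>x. f x \<otimes>\<^bsub>F\<^esub> f' (Hilbert_Choice.inv \<pi> x), \<pi> \<circ> \<pi>')),
       one = (\<lambda>_. \<one>\<^bsub>F\<^esub>, id) \<rparr>"

abbreviation wreath_sym ::
  "('f, 'm) monoid_scheme \<Rightarrow> nat \<Rightarrow> ((nat \<Rightarrow> 'f) \<times> (nat \<Rightarrow> nat)) monoid" where
  "wreath_sym F n \<equiv> wreath F n (carrier (sym_group n))"

definition offset :: "nat list \<Rightarrow> nat \<Rightarrow> nat" where
  "offset ns i = sum_list (take i ns)"

definition block :: "nat list \<Rightarrow> nat \<Rightarrow> nat set" where
  "block ns i = {offset ns i + 1..offset ns i + ns ! i}"

definition young_subgroup :: "nat list \<Rightarrow> (nat \<Rightarrow> nat) set" where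
  "young_subgroup ns =
     {h. h permutes {1..sum_list ns} \<and> (\<forall>i<length ns. h ` block ns i = block ns i)}"

text \<open>The component of \<open>h \<in> S\<^bsub>n\<^sub>1\<^esub> \<times> \<dots> \<times> S\<^bsub>n\<^sub>l\<^esub>\<close> in the factor with index \<open>i\<close>, as a permutation
  of \<open>{1..ns ! i}\<close>.\<close>

definition block_perm :: "nat list \<Rightarrow> nat \<Rightarrow> (nat \<Rightarrow> nat) \<Rightarrow> nat \<Rightarrow> nat" where
  "block_perm ns i h =
     (\<lambda>y. if y \<in> {1..ns ! i} then h (offset ns i + y) - offset ns i else y)"


section \<open>The irreducible representations of \<open>F \<wr> S\<^sub>n\<close>\<close>

text \<open>The tensor factor of \<open>U\<^sub>1\<^bsup>\<boxtimes>n\<^sub>1\<^esup> \<boxtimes> \<dots> \<boxtimes> U\<^sub>l\<^bsup>\<boxtimes>n\<^sub>l\<^esup>\<close> in position \<open>x \<in> {1..n}\<close>.\<close>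

definition factor_rep :: "('f, 'v) rep list \<Rightarrow> nat list \<Rightarrow> nat \<Rightarrow> ('f, 'v) rep" where
  "factor_rep Us ns x = concat (map2 replicate ns Us) ! (x - 1)"

definition U_tilde ::
  "('f, 'v::complex_vector) rep list \<Rightarrow> nat list \<Rightarrow>
   ((nat \<Rightarrow> 'f) \<times> (nat \<Rightarrow> nat), ((nat \<Rightarrow> 'v) \<Rightarrow> complex) \<Rightarrow> complex) rep" where
  "U_tilde Us ns =
     \<lparr> rep_space = rep_space (outer_tensor {1..sum_list ns} (factor_rep Us ns)),
       rep_act = (\<lambda>(f, h). tensor_map {1..sum_list ns} (\<lambda>x. rep_space (factor_rep Us ns x))
          (\<lambda>u. \<lambda>x\<in>{1..sum_list ns}.
             rep_act (factor_rep Us ns x) (f x) (u (Hilbert_Choice.inv h x)))) \<rparr>"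

definition S_bar ::
  "nat list list \<Rightarrow> ((nat \<Rightarrow> 'f) \<times> (nat \<Rightarrow> nat),
     ((nat \<Rightarrow> nat set list \<Rightarrow> complex) \<Rightarrow> complex) \<Rightarrow> complex) rep" where
  "S_bar \<Lambda> =
     (let S = outer_tensor {..<length \<Lambda>} (\<lambda>i. specht (\<Lambda> ! i))
      in \<lparr> rep_space = rep_space S,
           rep_act = (\<lambda>(f, h). rep_act S (\<lambda>i. block_perm (map sum_list \<Lambda>) i h)) \<rparr>)"

text \<open>Here \<open>ns\<close> is recovered from \<open>\<Lambda> \<tturnstile> ns\<close> as the list of sizes of the partitions.\<close>

definition Phi ::
  "('f, 'm) monoid_scheme \<Rightarrow> ('f, 'v::complex_vector) rep list \<Rightarrow> nat list list \<Rightarrow>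
   ((nat \<Rightarrow> 'f) \<times> (nat \<Rightarrow> nat),
    (nat \<Rightarrow> 'f) \<times> (nat \<Rightarrow> nat) \<Rightarrow>
      ((((nat \<Rightarrow> 'v) \<Rightarrow> complex) \<Rightarrow> complex) \<Rightarrow>
       (((nat \<Rightarrow> nat set list \<Rightarrow> complex) \<Rightarrow> complex) \<Rightarrow> complex) \<Rightarrow> complex) \<Rightarrow> complex) rep" where
  "Phi F Us \<Lambda> =
     (let ns = map sum_list \<Lambda>; n = sum_list ns
      in induced (wreath_sym F n) (carrier (wreath F n (young_subgroup ns)))
           (inner_tensor (U_tilde Us ns) (S_bar \<Lambda>)))"

end

theory Submission
  imports Defs "HOL-Computational_Algebra.Fundamental_Theorem_Algebra"
begin

text \<open>Two representations of a finite group are isomorphic iff they have the same character, and traces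
  are computed with frames: families \<open>(e\<^sub>k, \<xi>\<^sub>k)\<close> with \<open>v = \<Sum>\<^sub>k \<xi>\<^sub>k(v) e\<^sub>k\<close>, which exist for induced
  representations and tensor products without choosing bases of the latter. By transitivity of
  induction, the left-hand side has the character induced from \<open>F \<wr> (S\<^bsub>n\<^sub>1\<^esub> \<times> \<dots> \<times> S\<^bsub>n\<^sub>l\<^esub>)\<close>.
  On the right-hand side, the branching rule for Specht modules turns the sum over \<open>\<gamma>\<close> into an
  average over the conjugates by the symmetric group of the \<open>i\<close>-th block of a character supported on
  the stabilizer of the last point of that block; conjugating this point to \<open>n + 1\<close> splits off the
  factor \<open>dim U\<^sub>i \<chi>\<^sub>i(f(n + 1))\<close>, and the sum of these factors over \<open>i\<close> is the regular character of
  \<open>F\<close>. The branching rule itself follows from nonzero homomorphisms between \<open>S\<^sup>\<gamma>\<close> restricted to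
  \<open>S\<^sub>n\<close> and \<open>S\<^sup>\<lambda>\<close>, together with a dimension count based on the commutation relation of Young's
  lattice.\<close>

section \<open>Frames and traces\<close>

text \<open>The two sides live in different ambient types, and an explicit isomorphism would have to
  carry coset representatives, multilinear forms and tabloids along; equality of characters avoids
  this. To keep coset representatives out of the characters too, frames may be overcomplete: an
  induced representation gets one vector for each group element and basis index, weighted by 1 /
  |H|. So every induced character is a sum of conjugates over the whole group, divided by |H|, and
  in such a sum (\<open>conj_sum\<close>) a function may be replaced by any of its conjugates. Both
  sides become sums of this kind over F wr S_{n+1}, and only constants remain to be matched:
  averaging over the symmetric group of the enlarged block gives (n_i + 1)! / n_i! = n_i + 1, the
  order of the Young subgroup grows by the same factor, and the additional coordinate of f
  contributes |F|. The regular character is |F| at the unit and 0 elsewhere; it cancels this last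
  factor and at the same time produces the condition f(n + 1) = 1 that cuts F wr S_n out of F wr
  S_{n+1}.\<close>

abbreviation csubspace :: "'v::complex_vector set \<Rightarrow> bool" where
  "csubspace \<equiv> complex_vector.subspace"

abbreviation cspan :: "'v::complex_vector set \<Rightarrow> 'v set" where
  "cspan \<equiv> complex_vector.span"

abbreviation cdim :: "'v::complex_vector set \<Rightarrow> nat" where
  "cdim \<equiv> complex_vector.dim"

lemma csubspace_I:
  assumes "0 \<in> V" "\<And>x y. x \<in> V \<Longrightarrow> y \<in> V \<Longrightarrow> x + y \<in> V" "\<And>c x. x \<in> V \<Longrightarrow> c *\<^sub>C x \<in> V"
  shows "csubspace V"
  using assms unfolding complex_vector.subspace_def by blast

section \<open>Maps that are linear on a subspace\<close>

lemma linear_onI: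
  assumes "\<And>v w. v \<in> V \<Longrightarrow> w \<in> V \<Longrightarrow> T (v + w) = T v + T w"
    and "\<And>c v. v \<in> V \<Longrightarrow> T (c *\<^sub>C v) = c *\<^sub>C T v"
  shows "linear_on V T"
  using assms unfolding linear_on_def by blast

lemma linear_on_add: "linear_on V T \<Longrightarrow> v \<in> V \<Longrightarrow> w \<in> V \<Longrightarrow> T (v + w) = T v + T w"
  by (simp add: linear_on_def)

lemma linear_on_scale: "linear_on V T \<Longrightarrow> v \<in> V \<Longrightarrow> T (c *\<^sub>C v) = c *\<^sub>C T v"
  by (simp add: linear_on_def)

lemma linear_on_scale_complex:
  fixes T :: "'v::complex_vector \<Rightarrow> complex"
  shows "linear_on V T \<Longrightarrow> v \<in> V \<Longrightarrow> T (c *\<^sub>C v) = c * T v"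
  by (simp add: linear_on_def scaleC_complex_def)

lemma linear_on_zero:
  assumes "linear_on V T" "v \<in> V"
  shows "T 0 = 0"
  using linear_on_scale[OF assms, of 0] by simp

lemma linear_on_subset: "linear_on V T \<Longrightarrow> W \<subseteq> V \<Longrightarrow> linear_on W T"
  unfolding linear_on_def by blast

lemma linear_on_sum:
  assumes "linear_on V T" "csubspace V" "\<And>i. i \<in> I \<Longrightarrow> f i \<in> V"
  shows "T (\<Sum>i\<in>I. f i) = (\<Sum>i\<in>I. T (f i))"
  using assms(3)
proof (induction I rule: infinite_finite_induct)
  case (insert x F)
  then show ?case
    using assms by (simp add: linear_on_add complex_vector.subspace_sum)
qed (use assms linear_on_zero[OF assms(1) complex_vector.subspace_0] in auto)

lemma linear_on_sum_scale:
  assumes "linear_on V T" "csubspace V" "\<And>i. i \<in> I \<Longrightarrow> f i \<in> V"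
  shows "T (\<Sum>i\<in>I. c i *\<^sub>C f i) = (\<Sum>i\<in>I. c i *\<^sub>C T (f i))"
  using assms by (simp add: linear_on_sum linear_on_scale complex_vector.subspace_scale)

lemma linear_on_uminus:
  assumes "linear_on V T" "v \<in> V"
  shows "T (- v) = - T v"
  using linear_on_scale[OF assms, of "-1"] by (simp add: complex_vector.scale_minus_left)

lemma linear_on_diff:
  assumes "linear_on V T" "csubspace V" "v \<in> V" "w \<in> V"
  shows "T (v - w) = T v - T w"
  using linear_on_add[OF assms(1,3), of "- w"] linear_on_uminus[OF assms(1,4)] assms
  by (simp add: complex_vector.subspace_neg)

lemma linear_on_compose:
  assumes "linear_on V S" "linear_on W T" "S \<in> V \<rightarrow> W"
  shows "linear_on V (\<lambda>v. T (S v))"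
  using assms by (simp add: linear_on_def Pi_iff)

lemma linear_on_plus:
  "linear_on V S \<Longrightarrow> linear_on V T \<Longrightarrow> linear_on V (\<lambda>v. S v + T v)"
  by (simp add: linear_on_def scaleC_add_right algebra_simps)

lemma linear_on_minus:
  "linear_on V S \<Longrightarrow> linear_on V T \<Longrightarrow> linear_on V (\<lambda>v. S v - T v)"
  by (simp add: linear_on_def complex_vector.scale_right_diff_distrib algebra_simps)

lemma linear_on_scaled: "linear_on V S \<Longrightarrow> linear_on V (\<lambda>v. c *\<^sub>C S v)"
  by (simp add: linear_on_def scaleC_add_right scaleC_scaleC mult.commute)

lemma linear_on_sum_fun:
  "(\<And>i. i \<in> I \<Longrightarrow> linear_on V (S i)) \<Longrightarrow> linear_on V (\<lambda>v. \<Sum>i\<in>I. S i v)"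
  by (simp add: linear_on_def sum.distrib complex_vector.scale_sum_right)

lemma linear_on_id: "linear_on V (\<lambda>v. v)"
  by (simp add: linear_on_def)

lemma linear_on_rank_one:
  assumes "linear_on V (\<xi> :: _ \<Rightarrow> complex)"
  shows "linear_on V (\<lambda>v. \<xi> v *\<^sub>C w)"
  using assms by (simp add: linear_on_def scaleC_add_left scaleC_scaleC scaleC_complex_def)

text \<open>Identities on tensor spaces and on Specht modules are checked on pure tensors and on
  polytabloids and carried over to the span in this way.\<close>

lemma linear_on_span_eq:
  assumes "linear_on (cspan B) S" "linear_on (cspan B) T" "\<And>b. b \<in> B \<Longrightarrow> S b = T b" "v \<in> cspan B"
  shows "S v = T v"
proof -
  have "csubspace {v \<in> cspan B. S v = T v}"
    using assms(1,2) linear_on_zero[OF assms(1) complex_vector.span_zero]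
      linear_on_zero[OF assms(2) complex_vector.span_zero]
    by (intro csubspace_I)
      (auto simp: linear_on_add linear_on_scale
        intro: complex_vector.span_zero complex_vector.span_add complex_vector.span_scale)
  moreover have "B \<subseteq> {v \<in> cspan B. S v = T v}"
    using assms(3) complex_vector.span_base by blast
  ultimately have "cspan B \<subseteq> {v \<in> cspan B. S v = T v}"
    by (rule complex_vector.span_minimal[rotated])
  then show ?thesis
    using assms(4) by blast
qed

lemma linear_on_span_closed:
  assumes "linear_on (cspan B) T" "\<And>b. b \<in> B \<Longrightarrow> T b \<in> W" "csubspace W" "v \<in> cspan B"
  shows "T v \<in> W"
proof -
  have "csubspace {v \<in> cspan B. T v \<in> W}"
    using assms(1,3) linear_on_zero[OF assms(1) complex_vector.span_zero]
    by (intro csubspace_I)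
      (auto simp: linear_on_add linear_on_scale complex_vector.subspace_0 complex_vector.subspace_add
        complex_vector.subspace_scale
        intro: complex_vector.span_zero complex_vector.span_add complex_vector.span_scale)
  moreover have "B \<subseteq> {v \<in> cspan B. T v \<in> W}"
    using assms(2) complex_vector.span_base by blast
  ultimately have "cspan B \<subseteq> {v \<in> cspan B. T v \<in> W}"
    by (rule complex_vector.span_minimal[rotated])
  then show ?thesis
    using assms(4) by blast
qed

section \<open>Finite frames and the trace\<close>

definition fin_dim :: "'v::complex_vector set \<Rightarrow> bool" where
  "fin_dim V \<longleftrightarrow> csubspace V \<and> (\<exists>B. finite B \<and> V = cspan B)"

definition frame ::
  "'k set \<Rightarrow> ('k \<Rightarrow> 'v::complex_vector) \<Rightarrow> ('k \<Rightarrow> 'v \<Rightarrow> complex) \<Rightarrow> 'v set \<Rightarrow> bool" where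
  "frame K e \<xi> V \<longleftrightarrow> finite K \<and> csubspace V \<and> (\<forall>k\<in>K. e k \<in> V) \<and> (\<forall>k\<in>K. linear_on V (\<xi> k)) \<and>
     (\<forall>v\<in>V. (\<Sum>k\<in>K. \<xi> k v *\<^sub>C e k) = v)"

lemma frameD:
  assumes "frame K e \<xi> V"
  shows "finite K" "csubspace V" "\<And>k. k \<in> K \<Longrightarrow> e k \<in> V" "\<And>k. k \<in> K \<Longrightarrow> linear_on V (\<xi> k)"
    "\<And>v. v \<in> V \<Longrightarrow> (\<Sum>k\<in>K. \<xi> k v *\<^sub>C e k) = v"
  using assms by (auto simp: frame_def)

lemma fin_dim_subspace: "fin_dim V \<Longrightarrow> csubspace V"
  by (simp add: fin_dim_def)

lemma frame_fin_dim:
  assumes "frame K e \<xi> V"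
  shows "fin_dim V"
proof -
  note f = frameD[OF assms]
  have "v \<in> cspan (e ` K)" if "v \<in> V" for v
  proof -
    have "(\<Sum>k\<in>K. \<xi> k v *\<^sub>C e k) \<in> cspan (e ` K)"
      by (intro complex_vector.span_sum complex_vector.span_scale complex_vector.span_base) auto
    then show ?thesis
      using f(5)[OF that] by simp
  qed
  moreover have "cspan (e ` K) \<subseteq> V"
    using f by (intro complex_vector.span_minimal) auto
  ultimately have "V = cspan (e ` K)"
    by blast
  then show ?thesis
    using f unfolding fin_dim_def by blast
qed

lemma frame_linear:
  assumes "frame K e \<xi> V" "linear_on V T" "v \<in> V"
  shows "T v = (\<Sum>k\<in>K. \<xi> k v *\<^sub>C T (e k))"
proof -
  note f = frameD[OF assms(1)]
  show ?thesis
    using linear_on_sum_scale[OF assms(2) f(2), of K e "\<lambda>k. \<xi> k v"] f assms(3) by simp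
qed

lemma frame_linear_complex:
  fixes T :: "'v::complex_vector \<Rightarrow> complex"
  assumes "frame K e \<xi> V" "linear_on V T" "v \<in> V"
  shows "T v = (\<Sum>k\<in>K. \<xi> k v * T (e k))"
  using frame_linear[OF assms] by (simp add: scaleC_complex_def)

text \<open>Expanding \<open>S (e k)\<close> in the frame of W and \<open>T (f l)\<close> in the
  frame of V turns both sides into the same double sum. Independence of the trace from the frame and
  its invariance under isomorphisms are special cases.\<close>

lemma frame_trace_commute:
  assumes e: "frame K e \<xi> V" and f: "frame L f \<eta> W"
    and S: "linear_on V S" "S \<in> V \<rightarrow> W" and T: "linear_on W T" "T \<in> W \<rightarrow> V"
  shows "(\<Sum>k\<in>K. \<xi> k (T (S (e k)))) = (\<Sum>l\<in>L. \<eta> l (S (T (f l))))"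
proof -
  note fe = frameD[OF e] and ff = frameD[OF f]
  have 1: "\<xi> k (T (S (e k))) = (\<Sum>l\<in>L. \<eta> l (S (e k)) * \<xi> k (T (f l)))" if "k \<in> K" for k
    using frame_linear_complex[OF f linear_on_compose[OF T(1) fe(4)[OF that] T(2)], of "S (e k)"]
      that fe(3) S(2) by (auto simp: Pi_iff)
  have 2: "\<eta> l (S (T (f l))) = (\<Sum>k\<in>K. \<xi> k (T (f l)) * \<eta> l (S (e k)))" if "l \<in> L" for l
    using frame_linear_complex[OF e linear_on_compose[OF S(1) ff(4)[OF that] S(2)], of "T (f l)"]
      that ff(3) T(2) by (auto simp: Pi_iff)
  have "(\<Sum>k\<in>K. \<xi> k (T (S (e k)))) = (\<Sum>k\<in>K. \<Sum>l\<in>L. \<eta> l (S (e k)) * \<xi> k (T (f l)))"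
    using 1 by simp
  also have "\<dots> = (\<Sum>l\<in>L. \<Sum>k\<in>K. \<xi> k (T (f l)) * \<eta> l (S (e k)))"
    by (subst sum.swap) (simp add: mult.commute)
  also have "\<dots> = (\<Sum>l\<in>L. \<eta> l (S (T (f l))))"
    using 2 by simp
  finally show ?thesis .
qed

lemma basis_frame:
  assumes "fin_dim V"
  obtains e \<xi> where "frame {..<cdim V} e \<xi> V"
    "\<And>k l. k < cdim V \<Longrightarrow> l < cdim V \<Longrightarrow> \<xi> k (e l) = (if k = l then 1 else 0)"
proof -
  obtain B0 where B0: "finite B0" "V = cspan B0" and V: "csubspace V"
    using assms by (auto simp: fin_dim_def)
  obtain B where B: "B \<subseteq> V" "complex_vector.independent B" "V \<subseteq> cspan B" "card B = cdim V"
    using complex_vector.basis_exists by blast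
  have fB: "finite B"
    using complex_vector.independent_span_bound[OF B0(1) B(2)] B B0 by auto
  have VB: "cspan B = V"
    using B V complex_vector.span_minimal by blast
  obtain e where e: "bij_betw e {0..<card B} B"
    using ex_bij_betw_nat_finite[OF fB] by blast
  have e': "bij_betw e {..<cdim V} B"
    using e B(4) by (simp add: atLeast0LessThan)
  have eB: "e k \<in> B" if "k < cdim V" for k
    using bij_betwE[OF e'] that by auto
  define \<xi> where "\<xi> k v = complex_vector.representation B v (e k)" for k v
  have "frame {..<cdim V} e \<xi> V"
    unfolding frame_def
  proof (intro conjI ballI)
    fix k assume "k \<in> {..<cdim V}"
    then show "e k \<in> V"
      using eB B(1) by auto
    show "linear_on V (\<xi> k)"
      using B(2) VB
      by (intro linear_onI)
        (simp_all add: \<xi>_def complex_vector.representation_add complex_vector.representation_scale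
          scaleC_complex_def)
  next
    fix v assume v: "v \<in> V"
    have "(\<Sum>k<cdim V. \<xi> k v *\<^sub>C e k) = (\<Sum>b\<in>B. complex_vector.representation B v b *\<^sub>C b)"
      unfolding \<xi>_def by (rule sum.reindex_bij_betw[OF e'])
    also have "\<dots> = v"
      using v VB fB B(2) by (intro complex_vector.sum_representation_eq) auto
    finally show "(\<Sum>k<cdim V. \<xi> k v *\<^sub>C e k) = v" .
  qed (use V in auto)
  moreover have "\<xi> k (e l) = (if k = l then 1 else 0)" if "k < cdim V" "l < cdim V" for k l
    using complex_vector.representation_basis[OF B(2) eB[OF that(2)]] e' that
    by (auto simp: \<xi>_def bij_betw_def inj_on_def)
  ultimately show thesis
    using that by blast
qed

text \<open>Vectors and functionals are chosen as one pair, so that the functionals are the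
  coordinates with respect to these very vectors.\<close>

definition basis_coord :: "'v::complex_vector set \<Rightarrow> (nat \<Rightarrow> 'v) \<times> (nat \<Rightarrow> 'v \<Rightarrow> complex)" where
  "basis_coord V = (SOME p. frame {..<cdim V} (fst p) (snd p) V \<and>
     (\<forall>k<cdim V. \<forall>l<cdim V. snd p k (fst p l) = (if k = l then 1 else 0)))"

definition basis_vec :: "'v::complex_vector set \<Rightarrow> nat \<Rightarrow> 'v" where
  "basis_vec V = fst (basis_coord V)"

definition coord :: "'v::complex_vector set \<Rightarrow> nat \<Rightarrow> 'v \<Rightarrow> complex" where
  "coord V = snd (basis_coord V)"

lemma basis_coord_frame:
  assumes "fin_dim V"
  shows "frame {..<cdim V} (basis_vec V) (coord V) V"
    and "k < cdim V \<Longrightarrow> l < cdim V \<Longrightarrow> coord V k (basis_vec V l) = (if k = l then 1 else 0)"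
proof -
  obtain e and \<xi> :: "nat \<Rightarrow> 'a \<Rightarrow> complex" where "frame {..<cdim V} e \<xi> V"
    "\<And>k l. k < cdim V \<Longrightarrow> l < cdim V \<Longrightarrow> \<xi> k (e l) = (if k = l then 1 else 0)"
    using basis_frame[OF assms] by blast
  then have "\<exists>p. frame {..<cdim V} (fst p) (snd p) V \<and>
     (\<forall>k<cdim V. \<forall>l<cdim V. snd p k (fst p l) = (if k = l then 1 else (0::complex)))"
    by (intro exI[of _ "(e, \<xi>)"]) simp
  from someI_ex[OF this]
  show "frame {..<cdim V} (basis_vec V) (coord V) V"
    and "k < cdim V \<Longrightarrow> l < cdim V \<Longrightarrow> coord V k (basis_vec V l) = (if k = l then 1 else 0)"
    unfolding basis_vec_def coord_def basis_coord_def by auto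
qed

definition trace_on :: "'v::complex_vector set \<Rightarrow> ('v \<Rightarrow> 'v) \<Rightarrow> complex" where
  "trace_on V T = (\<Sum>k<cdim V. coord V k (T (basis_vec V k)))"

text \<open>The case of \<open>frame_trace_commute\<close> in which both spaces are V and the second
  map is the identity.\<close>

lemma trace_on_frame:
  assumes "frame K e \<xi> V" "linear_on V T" "T \<in> V \<rightarrow> V"
  shows "trace_on V T = (\<Sum>k\<in>K. \<xi> k (T (e k)))"
  unfolding trace_on_def
  using frame_trace_commute[OF basis_coord_frame(1)[OF frame_fin_dim[OF assms(1)]] assms(1) assms(2,3)
      linear_on_id] by simp

lemma trace_on_cong:
  assumes "fin_dim V" "\<And>v. v \<in> V \<Longrightarrow> S v = T v"
  shows "trace_on V S = trace_on V T"
  using assms frameD(3)[OF basis_coord_frame(1)[OF assms(1)]] by (simp add: trace_on_def)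

lemma trace_on_id: "fin_dim V \<Longrightarrow> trace_on V (\<lambda>v. v) = of_nat (cdim V)"
  by (simp add: trace_on_def basis_coord_frame(2))

text \<open>Cyclicity: tr A = tr (A T S) = tr (S A T). The map \<open>A'\<close> is compared with S
  A T on W alone, because actions have unspecified values outside their spaces.\<close>

lemma trace_on_iso:
  assumes "fin_dim V" "fin_dim W"
    and S: "linear_on V S" "S \<in> V \<rightarrow> W" and T: "linear_on W T" "T \<in> W \<rightarrow> V"
    and TS: "\<And>v. v \<in> V \<Longrightarrow> T (S v) = v"
    and A: "linear_on V A" "A \<in> V \<rightarrow> V" and A': "\<And>w. w \<in> W \<Longrightarrow> A' w = S (A (T w))"
  shows "trace_on V A = trace_on W A'"
proof -
  note fV = basis_coord_frame(1)[OF assms(1)] and fW = basis_coord_frame(1)[OF assms(2)]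
  have "trace_on V A = (\<Sum>k<cdim V. coord V k (A (T (S (basis_vec V k)))))"
    using TS frameD(3)[OF fV] by (simp add: trace_on_def)
  also have "\<dots> = (\<Sum>l<cdim W. coord W l (S (A (T (basis_vec W l)))))"
    using frame_trace_commute[OF fV fW S, of "\<lambda>w. A (T w)"] T A by (auto intro: linear_on_compose)
  also have "\<dots> = trace_on W A'"
    using A' frameD(3)[OF fW] by (simp add: trace_on_def)
  finally show ?thesis .
qed

section \<open>Subspaces, projections and dimension\<close>

lemma fin_dim_mono:
  assumes "fin_dim V" "csubspace W" "W \<subseteq> V"
  shows "fin_dim W"
proof -
  obtain B0 where B0: "finite B0" "V = cspan B0"
    using assms by (auto simp: fin_dim_def)
  obtain B where B: "B \<subseteq> W" "complex_vector.independent B" "W \<subseteq> cspan B" "card B = cdim W"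
    using complex_vector.basis_exists by blast
  have "finite B"
    using complex_vector.independent_span_bound[OF B0(1) B(2)] B B0 assms by auto
  moreover have "W = cspan B"
    using B assms complex_vector.span_minimal by blast
  ultimately show ?thesis
    using assms by (auto simp: fin_dim_def)
qed

lemma cdim_eq_0:
  assumes "fin_dim V" "cdim V = 0"
  shows "V = {0}"
  using frameD[OF basis_coord_frame(1)[OF assms(1)]] assms(2) complex_vector.subspace_0 by fastforce

lemma cdim_pos:
  assumes "fin_dim V" "V \<noteq> {0}"
  shows "0 < cdim V"
  using cdim_eq_0[OF assms(1)] assms(2) by blast

text \<open>Extend a basis B of W to an independent set C that spans V, and forget the coordinates
  outside B.\<close>

lemma projection_exists:
  assumes "fin_dim V" "csubspace W" "W \<subseteq> V"
  obtains p where "linear_on V p" "p \<in> V \<rightarrow> W" "\<forall>w\<in>W. p w = w"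
proof -
  have W: "fin_dim W"
    using fin_dim_mono[OF assms] .
  obtain B where B: "B \<subseteq> W" "complex_vector.independent B" "W \<subseteq> cspan B" "card B = cdim W"
    using complex_vector.basis_exists by blast
  have "B \<subseteq> V"
    using B assms by blast
  then obtain C where C: "B \<subseteq> C" "C \<subseteq> V" "complex_vector.independent C" "V \<subseteq> cspan C"
    using complex_vector.maximal_independent_subset_extend[OF _ B(2)] by metis
  obtain B0 where B0: "finite B0" "V = cspan B0"
    using assms by (auto simp: fin_dim_def)
  have "finite C"
    using complex_vector.independent_span_bound[OF B0(1) C(3)] C B0 by auto
  then have fB: "finite B"
    using C finite_subset by blast
  define p where "p v = (\<Sum>b\<in>B. complex_vector.representation C v b *\<^sub>C b)" for v
  have "linear_on V p"
    using C(3,4) unfolding p_def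
    by (intro linear_on_sum_fun linear_on_rank_one linear_onI)
      (simp_all add: complex_vector.representation_add complex_vector.representation_scale
        scaleC_complex_def subset_iff)
  moreover have "p \<in> V \<rightarrow> W"
    using B(1) assms(2) unfolding p_def
    by (auto intro!: complex_vector.subspace_sum complex_vector.subspace_scale)
  moreover have "p w = w" if "w \<in> W" for w
  proof -
    have "w \<in> cspan B"
      using B that by auto
    then have "complex_vector.representation C w = complex_vector.representation B w"
      using complex_vector.representation_extend[OF C(3) _ C(1)] by simp
    then show ?thesis
      using complex_vector.sum_representation_eq[OF B(2) \<open>w \<in> cspan B\<close> fB] by (simp add: p_def)
  qed
  ultimately show thesis
    using that by blast
qed

lemma linear_on_inv_into:
  assumes "linear_on V T" "bij_betw T V W" "csubspace V"
  shows "linear_on W (inv_into V T)"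
proof (rule linear_onI)
  fix v w assume vw: "v \<in> W" "w \<in> W"
  obtain a b where ab: "a \<in> V" "b \<in> V" "v = T a" "w = T b"
    using vw assms(2) by (auto simp: bij_betw_def)
  have "a + b \<in> V"
    using ab assms(3) by (simp add: complex_vector.subspace_add)
  then show "inv_into V T (v + w) = inv_into V T v + inv_into V T w"
    using ab assms linear_on_add[OF assms(1) ab(1,2)]
    by (metis bij_betw_inv_into_left)
next
  fix c v assume v: "v \<in> W"
  obtain a where a: "a \<in> V" "v = T a"
    using v assms(2) by (auto simp: bij_betw_def)
  have "c *\<^sub>C a \<in> V"
    using a assms(3) by (simp add: complex_vector.subspace_scale)
  then show "inv_into V T (c *\<^sub>C v) = c *\<^sub>C inv_into V T v"
    using a assms linear_on_scale[OF assms(1) a(1)]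
    by (metis bij_betw_inv_into_left)
qed

lemma linear_on_inj_on:
  assumes "linear_on V T" "csubspace V" "\<And>v. v \<in> V \<Longrightarrow> T v = 0 \<Longrightarrow> v = 0"
  shows "inj_on T V"
proof (rule inj_onI)
  fix x y assume "x \<in> V" "y \<in> V" "T x = T y"
  then have "T (x - y) = 0" "x - y \<in> V"
    using linear_on_diff[OF assms(1,2)] assms(2) by (auto simp: complex_vector.subspace_diff)
  then show "x = y"
    using assms(3) by fastforce
qed

lemma csubspace_kernel:
  assumes "linear_on V T" "csubspace V"
  shows "csubspace {v \<in> V. T v = 0}"
  using assms linear_on_zero[OF assms(1) complex_vector.subspace_0[OF assms(2)]]
  by (intro csubspace_I)
    (auto simp: complex_vector.subspace_0 complex_vector.subspace_add complex_vector.subspace_scale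
      linear_on_add linear_on_scale)

lemma csubspace_image:
  assumes "linear_on V T" "csubspace V"
  shows "csubspace (T ` V)"
proof (rule csubspace_I)
  show "0 \<in> T ` V"
    using linear_on_zero[OF assms(1) complex_vector.subspace_0[OF assms(2)]]
      complex_vector.subspace_0[OF assms(2)] by (metis imageI)
next
  fix x y assume "x \<in> T ` V" "y \<in> T ` V"
  then obtain a b where "a \<in> V" "b \<in> V" "x = T a" "y = T b"
    by auto
  then show "x + y \<in> T ` V"
    using assms by (intro image_eqI[of _ _ "a + b"])
      (auto simp: linear_on_add complex_vector.subspace_add)
next
  fix c x assume "x \<in> T ` V"
  then obtain a where "a \<in> V" "x = T a"
    by auto
  then show "c *\<^sub>C x \<in> T ` V"
    using assms by (intro image_eqI[of _ _ "c *\<^sub>C a"])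
      (auto simp: linear_on_scale complex_vector.subspace_scale)
qed

text \<open>Bases of W and of the kernel of P, with the coordinates of \<open>P v\<close> and of
  \<open>v - P v\<close>, form a frame of V indexed by a disjoint union. As T preserves both
  summands, its matrix in this frame is block diagonal.\<close>

lemma trace_on_split:
  assumes V: "fin_dim V" and W: "csubspace W" "W \<subseteq> V"
    and P: "linear_on V P" "P \<in> V \<rightarrow> W" "\<forall>w\<in>W. P w = w"
    and T: "linear_on V T" "T \<in> W \<rightarrow> W" "T \<in> {v \<in> V. P v = 0} \<rightarrow> {v \<in> V. P v = 0}"
  shows "trace_on V T = trace_on W T + trace_on {v \<in> V. P v = 0} T"
proof -
  define K where "K = {v \<in> V. P v = 0}"
  have sV: "csubspace V"
    using V by (rule fin_dim_subspace)
  have sK: "csubspace K"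
    unfolding K_def by (rule csubspace_kernel[OF P(1) sV])
  have fW: "fin_dim W" and fK: "fin_dim K"
    using fin_dim_mono[OF V] W sK by (auto simp: K_def)
  note bW = basis_coord_frame(1)[OF fW] and bK = basis_coord_frame(1)[OF fK]
  note dW = frameD[OF bW] and dK = frameD[OF bK]
  define e where "e = case_sum (basis_vec W) (basis_vec K)"
  define \<xi> where "\<xi> = case_sum (\<lambda>k v. coord W k (P v)) (\<lambda>k v. coord K k (v - P v))"
  have PK: "(\<lambda>v. v - P v) \<in> V \<rightarrow> K"
    using P W sV by (auto simp: K_def Pi_iff linear_on_diff complex_vector.subspace_diff subset_iff)
  have linK: "linear_on V (\<lambda>v. v - P v)"
    by (intro linear_on_minus linear_on_id P(1))
  have "frame ({..<cdim W} <+> {..<cdim K}) e \<xi> V"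
    unfolding frame_def
  proof (intro conjI ballI)
    fix k assume k: "k \<in> {..<cdim W} <+> {..<cdim K}"
    show "e k \<in> V"
      using k dW(3) dK(3) W unfolding e_def K_def by auto
    show "linear_on V (\<xi> k)"
      using k linear_on_compose[OF P(1) dW(4) P(2)] linear_on_compose[OF linK dK(4) PK]
      unfolding \<xi>_def by auto
  next
    fix v assume v: "v \<in> V"
    have "(\<Sum>k\<in>{..<cdim W} <+> {..<cdim K}. \<xi> k v *\<^sub>C e k) =
      (\<Sum>k<cdim W. coord W k (P v) *\<^sub>C basis_vec W k) +
      (\<Sum>k<cdim K. coord K k (v - P v) *\<^sub>C basis_vec K k)"
      by (subst sum.Plus) (simp_all add: e_def \<xi>_def)
    also have "\<dots> = P v + (v - P v)"
      using v P(2) PK dW(5)[of "P v"] dK(5)[of "v - P v"] by (auto simp: Pi_iff)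
    finally show "(\<Sum>k\<in>{..<cdim W} <+> {..<cdim K}. \<xi> k v *\<^sub>C e k) = v"
      by simp
  qed (use sV in auto)
  moreover have "T \<in> V \<rightarrow> V"
  proof
    fix v assume v: "v \<in> V"
    then have "P v \<in> W" "v - P v \<in> K"
      using P(2) PK by auto
    then have "T (P v) \<in> V" "T (v - P v) \<in> V" "P v \<in> V" "v - P v \<in> V"
      using T W by (auto simp: K_def)
    then show "T v \<in> V"
      using sV linear_on_add[OF T(1), of "P v" "v - P v"] by (simp add: complex_vector.subspace_add)
  qed
  ultimately have "trace_on V T = (\<Sum>k\<in>{..<cdim W} <+> {..<cdim K}. \<xi> k (T (e k)))"
    by (intro trace_on_frame T(1))
  also have "\<dots> = (\<Sum>k<cdim W. coord W k (P (T (basis_vec W k)))) +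
      (\<Sum>k<cdim K. coord K k (T (basis_vec K k) - P (T (basis_vec K k))))"
    by (subst sum.Plus) (simp_all add: e_def \<xi>_def)
  also have "\<dots> = trace_on W T + trace_on K T"
    using dW(3) dK(3) T P(3) unfolding trace_on_def K_def
    by (intro arg_cong2[of _ _ _ _ "(+)"] sum.cong) (auto simp: Pi_iff)
  finally show ?thesis
    by (simp add: K_def)
qed

text \<open>The dimension is the trace of the identity, so this is the case T = id of
  \<open>trace_on_split\<close>, read off in the complex numbers.\<close>

lemma cdim_split:
  assumes V: "fin_dim V" and W: "csubspace W" "W \<subseteq> V"
    and P: "linear_on V P" "P \<in> V \<rightarrow> W" "\<forall>w\<in>W. P w = w"
  shows "cdim V = cdim W + cdim {v \<in> V. P v = 0}"
proof -
  have "csubspace {v \<in> V. P v = 0}"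
    by (rule csubspace_kernel[OF P(1) fin_dim_subspace[OF V]])
  then have "fin_dim W" "fin_dim {v \<in> V. P v = 0}"
    using fin_dim_mono[OF V] W by auto
  then have "(of_nat (cdim V) :: complex) = of_nat (cdim W) + of_nat (cdim {v \<in> V. P v = 0})"
    using trace_on_split[OF assms linear_on_id] V by (simp add: trace_on_id)
  then show ?thesis
    by (metis of_nat_add of_nat_eq_iff)
qed

lemma cdim_psubset:
  assumes V: "fin_dim V" and W: "csubspace W" "W \<subset> V"
  shows "cdim W < cdim V"
proof -
  obtain p where p: "linear_on V p" "p \<in> V \<rightarrow> W" "\<forall>w\<in>W. p w = w"
    using projection_exists[OF V W(1)] W(2) by blast
  obtain v where v: "v \<in> V" "v \<notin> W"
    using W by blast
  have pv: "p v \<in> W" "p v \<in> V"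
    using p v W by auto
  \<comment> \<open>A vector outside W leaves a nonzero remainder in the complement, whose dimension
    is therefore positive.\<close>
  have "v - p v \<in> V" "p (v - p v) = 0" "v - p v \<noteq> 0"
    using p v pv fin_dim_subspace[OF V]
    by (auto simp: complex_vector.subspace_diff linear_on_diff)
  then have "{v \<in> V. p v = 0} \<noteq> {0}"
    by blast
  moreover have "fin_dim {v \<in> V. p v = 0}"
    by (rule fin_dim_mono[OF V csubspace_kernel[OF p(1) fin_dim_subspace[OF V]]]) auto
  ultimately have "0 < cdim {v \<in> V. p v = 0}"
    by (rule cdim_pos[rotated])
  then show ?thesis
    using cdim_split[OF V W(1) _ p] W(2) by simp
qed

lemma linear_bij_dim:
  assumes "linear_on V T" "bij_betw T V W" "fin_dim V" "fin_dim W"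
  shows "cdim V = cdim W"
proof -
  have T': "linear_on W (inv_into V T)" "inv_into V T \<in> W \<rightarrow> V"
    using assms linear_on_inv_into[OF assms(1,2)] bij_betw_inv_into[OF assms(2)]
    by (auto simp: fin_dim_subspace bij_betw_def)
  have T: "T \<in> V \<rightarrow> W"
    using assms(2) by (auto simp: bij_betw_def)
  have "trace_on V (\<lambda>v. v) = trace_on W (\<lambda>v. v)"
    by (rule trace_on_iso[OF assms(3,4,1) T T' _ linear_on_id])
      (use assms(2) in \<open>auto simp: bij_betw_inv_into_left bij_betw_inv_into_right\<close>)
  then show ?thesis
    using assms by (simp add: trace_on_id)
qed

lemma fin_dim_image:
  assumes "linear_on V T" "fin_dim V"
  shows "fin_dim (T ` V)"
proof -
  note f = frameD[OF basis_coord_frame(1)[OF assms(2)]]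
  have "T ` V \<subseteq> cspan ((\<lambda>k. T (basis_vec V k)) ` {..<cdim V})"
  proof
    fix w assume "w \<in> T ` V"
    then obtain v where v: "v \<in> V" "w = T v" by auto
    show "w \<in> cspan ((\<lambda>k. T (basis_vec V k)) ` {..<cdim V})"
      unfolding v(2) frame_linear[OF basis_coord_frame(1)[OF assms(2)] assms(1) v(1)]
      by (intro complex_vector.span_sum complex_vector.span_scale complex_vector.span_base) auto
  qed
  moreover have "csubspace (T ` V)"
    using csubspace_image[OF assms(1) fin_dim_subspace[OF assms(2)]] .
  moreover have "fin_dim (cspan ((\<lambda>k. T (basis_vec V k)) ` {..<cdim V}))"
    unfolding fin_dim_def by (auto simp: complex_vector.subspace_span)
  ultimately show ?thesis
    using fin_dim_mono by blast
qed

text \<open>Among all nonzero polynomials that annihilate some nonzero vector take one of least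
  degree, p, with its vector v. It has a root a, and if p = (X - a) q, then q(T) v is nonzero by
  minimality and is an eigenvector for a. Such polynomials exist because V cannot contain more
  independent powers of T applied to v than it has generators.\<close>

lemma linear_exists_eigenvector:
  assumes "fin_dim V" "V \<noteq> {0}" "linear_on V T" "T \<in> V \<rightarrow> V"
  obtains a v where "v \<in> V" "v \<noteq> 0" "T v = a *\<^sub>C v"
proof -
  note V = fin_dim_subspace[OF assms(1)]
  define ev where "ev p v = (\<Sum>i\<le>degree p. coeff p i *\<^sub>C (T ^^ i) v)" for p :: "complex poly" and v
  have pow: "(T ^^ i) v \<in> V" if "v \<in> V" for i v
    using that assms(4) by (induction i) auto
  have evV: "ev p v \<in> V" if "v \<in> V" for p v
    using V pow that by (auto simp: ev_def intro!: complex_vector.subspace_sum complex_vector.subspace_scale)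
  \<comment> \<open>\<open>ev\<close> sums up to the degree, which varies under sums and multiples;
    every larger bound gives the same value.\<close>
  have ev_ge: "ev p v = (\<Sum>i\<le>m. coeff p i *\<^sub>C (T ^^ i) v)" if "degree p \<le> m" for p v m
    unfolding ev_def using that by (intro sum.mono_neutral_left) (auto simp: coeff_eq_0)
  have ev_pCons: "ev (pCons c p) v = c *\<^sub>C v + T (ev p v)" if "v \<in> V" for c p v
  proof -
    have "ev (pCons c p) v = (\<Sum>i\<le>Suc (degree p). coeff (pCons c p) i *\<^sub>C (T ^^ i) v)"
      by (rule ev_ge) (simp add: degree_pCons_le)
    also have "\<dots> = c *\<^sub>C v + (\<Sum>i\<le>degree p. coeff p i *\<^sub>C T ((T ^^ i) v))"
      by (simp only: sum.atMost_Suc_shift) simp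
    also have "(\<Sum>i\<le>degree p. coeff p i *\<^sub>C T ((T ^^ i) v)) = T (ev p v)"
      unfolding ev_def
      using linear_on_sum_scale[OF assms(3) V, of "{..degree p}" "\<lambda>i. (T ^^ i) v" "coeff p"] pow that
      by simp
    finally show ?thesis .
  qed
  have ev_add: "ev (p + q) v = ev p v + ev q v" for p q v
    using ev_ge[of "p + q" "max (degree p) (degree q)" v] ev_ge[of p "max (degree p) (degree q)" v]
      ev_ge[of q "max (degree p) (degree q)" v]
    by (simp add: degree_add_le scaleC_add_left sum.distrib)
  have ev_smult: "ev (smult c p) v = c *\<^sub>C ev p v" for c p v
    using ev_ge[of "smult c p" "degree p" v]
    by (simp add: degree_smult_le ev_def complex_vector.scale_sum_right scaleC_scaleC)
  have ex: "\<exists>p v. p \<noteq> 0 \<and> v \<in> V \<and> v \<noteq> 0 \<and> ev p v = 0"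
  proof -
    obtain v where v: "v \<in> V" "v \<noteq> 0"
      using assms(2) V complex_vector.subspace_0 by blast
    obtain B where B: "finite B" "V = cspan B"
      using assms(1) by (auto simp: fin_dim_def)
    let ?A = "{..card B}"
    show ?thesis
    \<comment> \<open>\<open>dependent\<close> speaks of a set of vectors and would not see two
      coinciding powers; these are treated apart, with a difference of two monomials as the
      polynomial.\<close>
    proof (cases "inj_on (\<lambda>i. (T ^^ i) v) ?A")
      case False
      then obtain i j where ij: "i \<noteq> j" "(T ^^ i) v = (T ^^ j) v"
        by (auto simp: inj_on_def)
      have m: "ev (monom c k) v = c *\<^sub>C (T ^^ k) v" for c k
        using ev_ge[of "monom c k" k v] degree_monom_le[of c k]
        by (simp add: if_distrib[of "\<lambda>x. x *\<^sub>C _"] cong: if_cong)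
      have "ev (monom 1 i + monom (-1) j) v = 0"
        by (simp add: ev_add m ij complex_vector.scale_minus_left)
      moreover have "coeff (monom 1 i + monom (-1) j) i \<noteq> (0::complex)"
        using ij by simp
      then have "monom 1 i + monom (-1) j \<noteq> (0::complex poly)"
        by (metis coeff_0)
      ultimately show ?thesis
        using v by blast
    next
      case True
      let ?S = "(\<lambda>i. (T ^^ i) v) ` ?A"
      have "complex_vector.dependent ?S"
      proof (rule ccontr)
        assume "\<not> complex_vector.dependent ?S"
        then have "card ?S \<le> card B"
          using complex_vector.independent_span_bound[OF B(1), of ?S] pow v B(2) by blast
        then show False
          using True by (simp add: card_image)
      qed
      then obtain u where u: "\<exists>x\<in>?S. u x \<noteq> 0" "(\<Sum>x\<in>?S. u x *\<^sub>C x) = 0"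
        using complex_vector.dependent_finite[of ?S] by auto
      then obtain i where i: "i \<le> card B" "u ((T ^^ i) v) \<noteq> 0"
        by auto
      define p where "p = Poly (map (\<lambda>i. u ((T ^^ i) v)) [0..<Suc (card B)])"
      have cp: "coeff p j = (if j \<le> card B then u ((T ^^ j) v) else 0)" for j
        unfolding p_def by (simp add: coeff_Poly_eq nth_default_def del: upt_Suc)
      have "degree p \<le> card B"
        by (rule degree_le) (simp add: cp)
      from ev_ge[OF this] have "ev p v = (\<Sum>j\<in>?A. u ((T ^^ j) v) *\<^sub>C (T ^^ j) v)"
        by (simp add: cp)
      also have "\<dots> = (\<Sum>x\<in>?S. u x *\<^sub>C x)"
        using True by (simp add: sum.reindex)
      finally have "ev p v = 0"
        using u by simp
      moreover have "p \<noteq> 0"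
        using i cp[of i] by auto
      ultimately show ?thesis
        using v by blast
    qed
  qed
  define P where "P d \<longleftrightarrow> (\<exists>p v. degree p = d \<and> p \<noteq> 0 \<and> v \<in> V \<and> v \<noteq> 0 \<and> ev p v = 0)" for d
  have "\<exists>d. P d"
    using ex unfolding P_def by blast
  then have least: "P (LEAST d. P d)"
    by (metis LeastI)
  then obtain p v where p: "degree p = (LEAST d. P d)" "p \<noteq> 0" "v \<in> V" "v \<noteq> 0" "ev p v = 0"
    unfolding P_def by blast
  have "degree p \<noteq> 0"
  proof
    assume "degree p = 0"
    then obtain c where "p = [:c:]"
      by (rule degree_eq_zeroE)
    then show False
      using p by (simp add: ev_def)
  qed
  then have "\<not> constant (poly p)"
    by (simp add: constant_degree)
  then obtain a where "poly p a = 0"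
    using fundamental_theorem_of_algebra by blast
  then obtain q where q: "p = [:- a, 1:] * q"
    by (metis poly_eq_0_iff_dvd dvdE)
  have q0: "q \<noteq> 0"
    using p q by auto
  then have "degree p = Suc (degree q)"
    unfolding q by (subst degree_mult_eq) auto
  then have "\<not> P (degree q)"
    using p(1) not_less_Least[of "degree q" P] by auto
  then have nz: "ev q v \<noteq> 0"
    using p q0 unfolding P_def by blast
  have z: "ev 0 v = 0"
    by (simp add: ev_def)
  have "p = smult (- a) q + pCons 0 q"
    unfolding q by simp
  then have "ev p v = ev (smult (- a) q) v + ev (pCons 0 q) v"
    using ev_add by metis
  then have "ev p v = (- a) *\<^sub>C ev q v + T (ev q v)"
    using ev_pCons[OF p(3), of 0 q] by (simp only: ev_smult) simp
  then have "T (ev q v) = a *\<^sub>C ev q v"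
    using p by (simp add: complex_vector.scale_minus_left)
  then show thesis
    using that[of "ev q v" a] evV[OF p(3)] nz by blast
qed

section \<open>Representations of finite groups\<close>

lemma is_repI:
  assumes "fin_dim (rep_space R)"
    and "\<And>g. g \<in> carrier G \<Longrightarrow> linear_on (rep_space R) (rep_act R g)"
    and "\<And>g v. g \<in> carrier G \<Longrightarrow> v \<in> rep_space R \<Longrightarrow> rep_act R g v \<in> rep_space R"
    and "\<And>v. v \<in> rep_space R \<Longrightarrow> rep_act R \<one>\<^bsub>G\<^esub> v = v"
    and "\<And>g h v. g \<in> carrier G \<Longrightarrow> h \<in> carrier G \<Longrightarrow> v \<in> rep_space R \<Longrightarrow>
      rep_act R (g \<otimes>\<^bsub>G\<^esub> h) v = rep_act R g (rep_act R h v)"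
  shows "is_rep G R"
  using assms unfolding is_rep_def fin_dim_def by blast

lemma is_repD:
  assumes "is_rep G R"
  shows "fin_dim (rep_space R)" "csubspace (rep_space R)"
    and "\<And>g. g \<in> carrier G \<Longrightarrow> linear_on (rep_space R) (rep_act R g)"
    and "\<And>g v. g \<in> carrier G \<Longrightarrow> v \<in> rep_space R \<Longrightarrow> rep_act R g v \<in> rep_space R"
    and "\<And>v. v \<in> rep_space R \<Longrightarrow> rep_act R \<one>\<^bsub>G\<^esub> v = v"
    and "\<And>g h v. g \<in> carrier G \<Longrightarrow> h \<in> carrier G \<Longrightarrow> v \<in> rep_space R \<Longrightarrow>
      rep_act R (g \<otimes>\<^bsub>G\<^esub> h) v = rep_act R g (rep_act R h v)"
  using assms unfolding is_rep_def fin_dim_def by blast+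

definition rep_char :: "('g, 'v::complex_vector) rep \<Rightarrow> 'g \<Rightarrow> complex" where
  "rep_char R g = trace_on (rep_space R) (rep_act R g)"

definition rep_hom ::
  "('g, 'm) monoid_scheme \<Rightarrow> ('g, 'v::complex_vector) rep \<Rightarrow> ('g, 'w::complex_vector) rep \<Rightarrow>
   ('v \<Rightarrow> 'w) \<Rightarrow> bool" where
  "rep_hom G R S T \<longleftrightarrow> linear_on (rep_space R) T \<and> T \<in> rep_space R \<rightarrow> rep_space S \<and>
     (\<forall>g\<in>carrier G. \<forall>v\<in>rep_space R. T (rep_act R g v) = rep_act S g (T v))"

definition invariant_subspace ::
  "('g, 'm) monoid_scheme \<Rightarrow> ('g, 'v::complex_vector) rep \<Rightarrow> 'v set \<Rightarrow> bool" where
  "invariant_subspace G R W \<longleftrightarrow> csubspace W \<and> W \<subseteq> rep_space R \<and>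
     (\<forall>g\<in>carrier G. \<forall>w\<in>W. rep_act R g w \<in> W)"

definition subrep :: "('g, 'v::complex_vector) rep \<Rightarrow> 'v set \<Rightarrow> ('g, 'v) rep" where
  "subrep R W = \<lparr>rep_space = W, rep_act = rep_act R\<rparr>"

lemma subrep_simps [simp]: "rep_space (subrep R W) = W" "rep_act (subrep R W) = rep_act R"
  by (simp_all add: subrep_def)

lemma subrep_subrep [simp]: "subrep (subrep R W) X = subrep R X"
  by (simp add: subrep_def)

lemma subrep_self [simp]: "subrep R (rep_space R) = R"
  by (simp add: subrep_def)

lemma irreducible_repD:
  assumes "irreducible_rep G R"
  shows "is_rep G R" "rep_space R \<noteq> {0}"
    and "\<And>W. invariant_subspace G R W \<Longrightarrow> W = {0} \<or> W = rep_space R"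
  using assms unfolding irreducible_rep_def invariant_subspace_def by blast+

lemma irreducible_repI:
  assumes "is_rep G R" "rep_space R \<noteq> {0}"
    and "\<And>W. invariant_subspace G R W \<Longrightarrow> W = {0} \<or> W = rep_space R"
  shows "irreducible_rep G R"
  using assms unfolding irreducible_rep_def invariant_subspace_def by blast

lemma invariant_subspaceD:
  assumes "invariant_subspace G R W"
  shows "csubspace W" "W \<subseteq> rep_space R" "\<And>g w. g \<in> carrier G \<Longrightarrow> w \<in> W \<Longrightarrow> rep_act R g w \<in> W"
  using assms by (auto simp: invariant_subspace_def)

lemma rep_homD:
  assumes "rep_hom G R S T"
  shows "linear_on (rep_space R) T" "T \<in> rep_space R \<rightarrow> rep_space S"
    "\<And>v. v \<in> rep_space R \<Longrightarrow> T v \<in> rep_space S"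
    "\<And>g v. g \<in> carrier G \<Longrightarrow> v \<in> rep_space R \<Longrightarrow> T (rep_act R g v) = rep_act S g (T v)"
  using assms by (auto simp: rep_hom_def)

lemma rep_homI:
  assumes "linear_on (rep_space R) T" "\<And>v. v \<in> rep_space R \<Longrightarrow> T v \<in> rep_space S"
    "\<And>g v. g \<in> carrier G \<Longrightarrow> v \<in> rep_space R \<Longrightarrow> T (rep_act R g v) = rep_act S g (T v)"
  shows "rep_hom G R S T"
  using assms by (auto simp: rep_hom_def)

section \<open>Homomorphisms, isomorphisms and subrepresentations\<close>

lemma rep_isoI:
  assumes "is_rep G R" "is_rep G S" "rep_hom G R S T" "bij_betw T (rep_space R) (rep_space S)"
  shows "rep_iso G R S"
  using assms unfolding rep_iso_def rep_hom_def by blast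

lemma rep_isoE:
  assumes "rep_iso G R S"
  obtains T where "is_rep G R" "is_rep G S" "rep_hom G R S T"
    "bij_betw T (rep_space R) (rep_space S)"
  using assms unfolding rep_iso_def rep_hom_def bij_betw_def by blast

lemma rep_hom_inverse:
  assumes "is_rep G R" "rep_hom G R S T" "bij_betw T (rep_space R) (rep_space S)"
  shows "rep_hom G S R (inv_into (rep_space R) T)"
proof (rule rep_homI)
  note R = is_repD[OF assms(1)] and T = rep_homD[OF assms(2)]
  show "linear_on (rep_space S) (inv_into (rep_space R) T)"
    using T(1) assms(3) R(2) by (rule linear_on_inv_into)
  fix w assume w: "w \<in> rep_space S"
  then show w': "inv_into (rep_space R) T w \<in> rep_space R"
    using assms(3) by (auto simp: bij_betw_def inv_into_into)
  fix g assume g: "g \<in> carrier G"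
  have "T (rep_act R g (inv_into (rep_space R) T w)) = rep_act S g w"
    using T(4)[OF g w'] assms(3) w by (simp add: bij_betw_inv_into_right)
  then show "inv_into (rep_space R) T (rep_act S g w) = rep_act R g (inv_into (rep_space R) T w)"
    using R(4)[OF g w'] assms(3) by (metis bij_betw_inv_into_left)
qed

lemma rep_iso_sym: "rep_iso G R S \<Longrightarrow> rep_iso G S R"
  by (elim rep_isoE) (rule rep_isoI[OF _ _ rep_hom_inverse bij_betw_inv_into])

lemma rep_hom_compose:
  assumes "rep_hom G R S T" "rep_hom G S Q U"
  shows "rep_hom G R Q (\<lambda>v. U (T v))"
  using assms by (auto simp: rep_hom_def Pi_iff intro: linear_on_compose)

lemma rep_iso_trans:
  assumes "rep_iso G R S" "rep_iso G S Q"
  shows "rep_iso G R Q"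
proof -
  obtain T where T: "is_rep G R" "is_rep G S" "rep_hom G R S T" "bij_betw T (rep_space R) (rep_space S)"
    using assms(1) by (rule rep_isoE)
  obtain U where U: "is_rep G Q" "rep_hom G S Q U" "bij_betw U (rep_space S) (rep_space Q)"
    using assms(2) by (rule rep_isoE)
  show ?thesis
    using bij_betw_trans[OF T(4) U(3)]
    by (intro rep_isoI[OF T(1) U(1) rep_hom_compose[OF T(3) U(2)]]) (simp add: comp_def)
qed

lemma rep_iso_char:
  assumes "rep_iso G R S" "g \<in> carrier G"
  shows "rep_char R g = rep_char S g"
proof -
  obtain T where T: "is_rep G R" "is_rep G S" "rep_hom G R S T" "bij_betw T (rep_space R) (rep_space S)"
    using assms(1) by (rule rep_isoE)
  note R = is_repD[OF T(1)] and S = is_repD[OF T(2)] and T' = rep_homD[OF T(3)]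
  note I = rep_homD[OF rep_hom_inverse[OF T(1,3,4)]]
  show ?thesis
    unfolding rep_char_def
  proof (rule trace_on_iso[OF R(1) S(1) T'(1,2) I(1,2)])
    fix w assume w: "w \<in> rep_space S"
    show "rep_act S g w = T (rep_act R g (inv_into (rep_space R) T w))"
      using T'(4)[OF assms(2) I(3)[OF w]] w T(4) by (simp add: bij_betw_inv_into_right)
  qed (use T(4) R assms(2) in \<open>auto simp: bij_betw_inv_into_left\<close>)
qed

lemma rep_iso_dim:
  assumes "rep_iso G R S"
  shows "cdim (rep_space R) = cdim (rep_space S)"
  using assms by (elim rep_isoE) (metis linear_bij_dim is_repD(1) rep_homD(1))

lemma is_rep_subrep:
  assumes "is_rep G R" "invariant_subspace G R W"
  shows "is_rep G (subrep R W)"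
proof -
  note R = is_repD[OF assms(1)] and W = invariant_subspaceD[OF assms(2)]
  show ?thesis
    using R W by (intro is_repI) (auto intro: fin_dim_mono linear_on_subset)
qed

lemma invariant_subrep:
  assumes "invariant_subspace G R W" "invariant_subspace G (subrep R W) X"
  shows "invariant_subspace G R X"
  using assms by (auto simp: invariant_subspace_def)

lemma invariant_kernel:
  assumes "is_rep G R" "is_rep G S" "rep_hom G R S T"
  shows "invariant_subspace G R {v \<in> rep_space R. T v = 0}"
proof -
  note R = is_repD[OF assms(1)] and S = is_repD[OF assms(2)] and T = rep_homD[OF assms(3)]
  show ?thesis
    unfolding invariant_subspace_def
    using csubspace_kernel[OF T(1) R(2)] R(4) T(4) linear_on_zero[OF S(3) complex_vector.subspace_0[OF S(2)]]
    by auto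
qed

lemma invariant_image:
  assumes "is_rep G R" "is_rep G S" "rep_hom G R S T"
  shows "invariant_subspace G S (T ` rep_space R)"
proof -
  note R = is_repD[OF assms(1)] and S = is_repD[OF assms(2)] and T = rep_homD[OF assms(3)]
  have "rep_act S g (T v) \<in> T ` rep_space R" if "g \<in> carrier G" "v \<in> rep_space R" for g v
    using T(4)[OF that] R(4)[OF that] by (metis imageI)
  then show ?thesis
    unfolding invariant_subspace_def
    using csubspace_image[OF T(1) R(2)] T(3) by auto
qed

lemma rep_iso_zero:
  assumes "is_rep G R" "is_rep G S" "rep_space R = {0}" "rep_space S = {0}"
  shows "rep_iso G R S"
proof -
  have "rep_hom G R S (\<lambda>v. 0)"
    using assms is_repD(4)[OF assms(2)] by (intro rep_homI linear_onI) auto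
  then show ?thesis
    using assms by (intro rep_isoI[where T = "\<lambda>v. 0"]) (auto simp: bij_betw_def)
qed

text \<open>Conjugating the action by T moves a representation to any ambient type that has room for
  its space.\<close>

lemma transport_rep:
  fixes W :: "'w::complex_vector set"
  assumes R: "is_rep G R" and T: "linear_on (rep_space R) T" "bij_betw T (rep_space R) W"
  shows "rep_iso G R \<lparr>rep_space = W, rep_act = (\<lambda>g w. T (rep_act R g (inv_into (rep_space R) T w)))\<rparr>"
    (is "rep_iso G R ?S")
proof -
  note r = is_repD[OF R]
  let ?I = "inv_into (rep_space R) T"
  have I: "?I (T v) = v" if "v \<in> rep_space R" for v
    using T(2) that by (simp add: bij_betw_inv_into_left)
  have I': "?I w \<in> rep_space R" "T (?I w) = w" if "w \<in> W" for w
    using T(2) that by (auto simp: bij_betw_inv_into_right bij_betw_def inv_into_into)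
  have TW: "T v \<in> W" if "v \<in> rep_space R" for v
    using T(2) that by (auto simp: bij_betw_def)
  have lI: "linear_on W ?I"
    using T r(2) by (rule linear_on_inv_into)
  have "is_rep G ?S"
  proof (rule is_repI)
    show "fin_dim (rep_space ?S)"
      using fin_dim_image[OF T(1) r(1)] T(2) by (simp add: bij_betw_def)
    fix g assume g: "g \<in> carrier G"
    have "linear_on (rep_space R) (\<lambda>v. T (rep_act R g v))"
      using linear_on_compose[OF r(3)[OF g] T(1)] r(4)[OF g] by auto
    from linear_on_compose[OF lI this]
    show "linear_on (rep_space ?S) (rep_act ?S g)"
      using I' by auto
  qed (use I I' TW r in auto)
  moreover have "rep_hom G R ?S T"
    using T I TW by (auto intro!: rep_homI)
  ultimately show ?thesis
    using R T by (intro rep_isoI) auto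
qed

text \<open>Coordinate vectors in a basis, padded with zeros, embed the space into
  \<open>nat \<Rightarrow> complex\<close>. Hence irreducible representations can be tested in this
  single type, the one used in \<open>is_Irr\<close>.\<close>

lemma rep_iso_nat_complex:
  assumes "is_rep G R"
  obtains S :: "('g, nat \<Rightarrow> complex) rep" where "rep_iso G R S"
proof -
  note r = is_repD[OF assms]
  note b = frameD[OF basis_coord_frame(1)[OF r(1)]]
  define T where "T v = (\<lambda>k. if k < cdim (rep_space R) then coord (rep_space R) k v else 0)" for v
  have T: "linear_on (rep_space R) T"
    by (intro linear_onI)
      (auto simp: T_def fun_eq_iff scaleC_fun_def linear_on_add[OF b(4)] linear_on_scale[OF b(4)])
  have "inj_on T (rep_space R)"
  proof (rule linear_on_inj_on[OF T r(2)])
    fix v assume v: "v \<in> rep_space R" "T v = 0"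
    then have "coord (rep_space R) k v = 0" if "k < cdim (rep_space R)" for k
      using that fun_cong[OF v(2)[unfolded T_def], of k] by simp
    then show "v = 0"
      using b(5)[OF v(1)] by simp
  qed
  then have "bij_betw T (rep_space R) (T ` rep_space R)"
    by (simp add: bij_betw_def)
  from transport_rep[OF assms T this] show thesis
    using that by blast
qed

lemma rep_iso_irreducible:
  assumes "rep_iso G R S" "irreducible_rep G R"
  shows "irreducible_rep G S"
proof -
  obtain T where T: "is_rep G R" "is_rep G S" "rep_hom G R S T" "bij_betw T (rep_space R) (rep_space S)"
    using assms(1) by (rule rep_isoE)
  note I = rep_hom_inverse[OF T(1,3,4)]
  let ?I = "inv_into (rep_space R) T"
  note T' = rep_homD[OF T(3)] and I' = rep_homD[OF I]
  have TI: "T (?I w) = w" if "w \<in> rep_space S" for w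
    using T(4) that by (simp add: bij_betw_inv_into_right)
  have T0: "T 0 = 0"
    using linear_on_zero[OF T'(1) complex_vector.subspace_0[OF is_repD(2)[OF T(1)]]] .
  show ?thesis
  proof (rule irreducible_repI[OF T(2)])
    show "rep_space S \<noteq> {0}"
    proof -
      have 0: "0 \<in> rep_space R"
        by (rule complex_vector.subspace_0[OF is_repD(2)[OF T(1)]])
      then obtain x where x: "x \<in> rep_space R" "x \<noteq> 0"
        using irreducible_repD(2)[OF assms(2)] by blast
      then have "T x \<noteq> T 0"
        using T(4) 0 by (auto simp: bij_betw_def dest: inj_onD)
      then show ?thesis
        using T'(3)[OF x(1)] T0 by auto
    qed
    fix W assume W: "invariant_subspace G S W"
    note w = invariant_subspaceD[OF W]
    have hom: "rep_hom G (subrep S W) R ?I"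
      using I w(2) unfolding rep_hom_def by (auto intro: linear_on_subset)
    have "invariant_subspace G R (?I ` W)"
      using invariant_image[OF is_rep_subrep[OF T(2) W] T(1) hom] by simp
    then have "?I ` W = {0} \<or> ?I ` W = rep_space R"
      by (rule irreducible_repD(3)[OF assms(2)])
    moreover have "T ` ?I ` W = (\<lambda>w. w) ` W"
      unfolding image_image using TI w(2) by (intro image_cong) auto
    then have "W = T ` ?I ` W"
      by simp
    ultimately show "W = {0} \<or> W = rep_space S"
      using T(4) T0 by (auto simp: bij_betw_def)
  qed
qed

subsection \<open>Averaging\<close>

locale fin_group = group G for G (structure) +
  assumes finite_carrier: "finite (carrier G)"
begin

lemma sum_translate:
  assumes "h \<in> carrier G"
  shows "(\<Sum>g\<in>carrier G. f (h \<otimes> g)) = (\<Sum>g\<in>carrier G. f g)"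
  by (rule sum.reindex_bij_witness[where i = "\<lambda>g. inv h \<otimes> g" and j = "\<lambda>g. h \<otimes> g"])
    (use assms in \<open>auto simp: m_assoc[symmetric]\<close>)

lemma sum_translate_right:
  assumes "h \<in> carrier G"
  shows "(\<Sum>g\<in>carrier G. f (g \<otimes> h)) = (\<Sum>g\<in>carrier G. f g)"
  by (rule sum.reindex_bij_witness[where i = "\<lambda>g. g \<otimes> inv h" and j = "\<lambda>g. g \<otimes> h"])
    (use assms in \<open>auto simp: m_assoc\<close>)

lemma sum_inverse: "(\<Sum>g\<in>carrier G. f (inv g)) = (\<Sum>g\<in>carrier G. f g)"
  by (rule sum.reindex_bij_witness[where i = "\<lambda>g. inv g" and j = "\<lambda>g. inv g"]) auto

lemma card_carrier_pos: "0 < card (carrier G)"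
  using finite_carrier one_closed by (auto simp: card_gt_0_iff)

text \<open>The sum is left undivided: \<open>maschke\<close> normalises it by a scalar, and the
  orthogonality relations carry the group order along.\<close>

definition average ::
  "('a, 'v::complex_vector) rep \<Rightarrow> ('a, 'w::complex_vector) rep \<Rightarrow> ('v \<Rightarrow> 'w) \<Rightarrow> 'v \<Rightarrow> 'w" where
  "average R S T v = (\<Sum>g\<in>carrier G. rep_act S g (T (rep_act R (inv g) v)))"

lemma rep_hom_average:
  assumes R: "is_rep G R" and S: "is_rep G S"
    and T: "linear_on (rep_space R) T" "T \<in> rep_space R \<rightarrow> rep_space S"
  shows "rep_hom G R S (average R S T)"
proof (rule rep_homI)
  note r = is_repD[OF R] and s = is_repD[OF S]
  have TR: "T (rep_act R g v) \<in> rep_space S" if "g \<in> carrier G" "v \<in> rep_space R" for g v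
    using r(4)[OF that] T(2) by auto
  show "linear_on (rep_space R) (average R S T)"
    unfolding average_def
  proof (rule linear_on_sum_fun)
    fix g assume g: "g \<in> carrier G"
    have "linear_on (rep_space R) (\<lambda>v. T (rep_act R (inv g) v))"
      using linear_on_compose[OF r(3) T(1), of "inv g"] r(4)[of "inv g"] g by auto
    from linear_on_compose[OF this s(3)[OF g]]
    show "linear_on (rep_space R) (\<lambda>v. rep_act S g (T (rep_act R (inv g) v)))"
      using TR g by auto
  qed
  fix v assume v: "v \<in> rep_space R"
  show "average R S T v \<in> rep_space S"
    unfolding average_def using TR s v by (intro complex_vector.subspace_sum) auto
  fix h assume h: "h \<in> carrier G"
  have "average R S T (rep_act R h v) =
      (\<Sum>g\<in>carrier G. rep_act S g (T (rep_act R (inv g \<otimes> h) v)))"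
    unfolding average_def using r(6)[OF _ h v] by (intro sum.cong) auto
  \<comment> \<open>Replacing g by h g turns \<open>inv g \<otimes> h\<close> into
    \<open>inv g\<close> and leaves h in front.\<close>
  also have "\<dots> = (\<Sum>g\<in>carrier G. rep_act S (h \<otimes> g) (T (rep_act R (inv (h \<otimes> g) \<otimes> h) v)))"
    by (rule sum_translate[OF h, symmetric])
  also have "\<dots> = (\<Sum>g\<in>carrier G. rep_act S h (rep_act S g (T (rep_act R (inv g) v))))"
    using h s(6)[OF h] TR v by (intro sum.cong) (auto simp: inv_mult_group m_assoc)
  also have "\<dots> = rep_act S h (average R S T v)"
    unfolding average_def
    by (rule linear_on_sum[OF s(3)[OF h] s(2), symmetric]) (use TR s v in auto)
  finally show "average R S T (rep_act R h v) = rep_act S h (average R S T v)" .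
qed

text \<open>Averaging a linear projection onto W keeps its values in W, because W is invariant, and
  multiplies each vector of W by the group order, which c divides out.\<close>

lemma maschke:
  assumes R: "is_rep G R" and W: "invariant_subspace G R W"
  obtains P where "rep_hom G R R P" "P \<in> rep_space R \<rightarrow> W" "\<forall>w\<in>W. P w = w"
proof -
  note r = is_repD[OF R] and w = invariant_subspaceD[OF W]
  obtain p where p: "linear_on (rep_space R) p" "p \<in> rep_space R \<rightarrow> W" "\<forall>w\<in>W. p w = w"
    using projection_exists[OF r(1) w(1,2)] by blast
  have p': "p \<in> rep_space R \<rightarrow> rep_space R"
    using p(2) w(2) by auto
  define c where "c = 1 / (of_nat (card (carrier G)) :: complex)"
  define P where "P v = c *\<^sub>C average R R p v" for v
  have c: "c * of_nat (card (carrier G)) = 1"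
    using card_carrier_pos by (simp add: c_def)
  note A = rep_homD[OF rep_hom_average[OF R R p(1) p']]
  have "rep_hom G R R P"
    unfolding P_def using A r
    by (intro rep_homI linear_on_scaled) (auto simp: linear_on_scale[OF r(3)] complex_vector.subspace_scale)
  moreover have "P \<in> rep_space R \<rightarrow> W"
  proof
    fix v assume v: "v \<in> rep_space R"
    have "average R R p v \<in> W"
      unfolding average_def using v w r p(2)
      by (intro complex_vector.subspace_sum) (auto simp: Pi_iff)
    then show "P v \<in> W"
      using w by (simp add: P_def complex_vector.subspace_scale)
  qed
  moreover have "P x = x" if x: "x \<in> W" for x
  proof -
    have "rep_act R g (p (rep_act R (inv g) x)) = x" if g: "g \<in> carrier G" for g
    proof -
      have "p (rep_act R (inv g) x) = rep_act R (inv g) x"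
        using w(3)[of "inv g"] x g p(3) by simp
      then show ?thesis
        using r(6)[of g "inv g" x] r(5)[of x] x g w(2) by auto
    qed
    then have "average R R p x = of_nat (card (carrier G)) *\<^sub>C x"
      unfolding average_def by (simp add: complex_vector.sum_constant_scale)
    then show ?thesis
      using c by (simp add: P_def scaleC_scaleC scaleC_one)
  qed
  ultimately show thesis
    using that by blast
qed

lemma rep_char_split:
  assumes R: "is_rep G R" and W: "invariant_subspace G R W"
    and P: "rep_hom G R R P" "P \<in> rep_space R \<rightarrow> W" "\<forall>w\<in>W. P w = w"
  shows "invariant_subspace G R {v \<in> rep_space R. P v = 0}"
    and "g \<in> carrier G \<Longrightarrow> rep_char R g = rep_char (subrep R W) g +
      rep_char (subrep R {v \<in> rep_space R. P v = 0}) g"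
    and "cdim (rep_space R) = cdim W + cdim {v \<in> rep_space R. P v = 0}"
proof -
  note r = is_repD[OF R] and w = invariant_subspaceD[OF W] and p = rep_homD[OF P(1)]
  show K: "invariant_subspace G R {v \<in> rep_space R. P v = 0}"
    by (rule invariant_kernel[OF R R P(1)])
  note k = invariant_subspaceD[OF K]
  show "rep_char R g = rep_char (subrep R W) g + rep_char (subrep R {v \<in> rep_space R. P v = 0}) g"
    if "g \<in> carrier G"
    unfolding rep_char_def subrep_simps
    by (rule trace_on_split[OF r(1) w(1,2) p(1) P(2,3)]) (use that r(3) w(3) k(3) in auto)
  show "cdim (rep_space R) = cdim W + cdim {v \<in> rep_space R. P v = 0}"
    by (rule cdim_split[OF r(1) w(1,2) p(1) P(2,3)])
qed

text \<open>\<open>rep_act R (inv h)\<close> is a linear automorphism of the space that carries the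
  action of g to that of its conjugate.\<close>

lemma rep_char_conj:
  assumes R: "is_rep G R" and "g \<in> carrier G" "h \<in> carrier G"
  shows "rep_char R (inv h \<otimes> g \<otimes> h) = rep_char R g"
proof -
  note r = is_repD[OF R]
  have "rep_act R (inv h \<otimes> g \<otimes> h) w = rep_act R (inv h) (rep_act R g (rep_act R (inv (inv h)) w))"
    if "w \<in> rep_space R" for w
    using assms that r by simp
  moreover have "rep_act R h (rep_act R (inv h) v) = v" if "v \<in> rep_space R" for v
    using r(6)[of h "inv h" v] r(5) assms that by simp
  ultimately have "rep_char R g = rep_char R (inv h \<otimes> g \<otimes> h)"
    unfolding rep_char_def
    by (intro trace_on_iso[of _ _ "rep_act R (inv h)" "rep_act R h"]) (use r assms in auto)
  then show ?thesis ..
qed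

text \<open>Induction on the dimension: a nonzero representation that is not irreducible has a
  nonzero proper invariant subspace, and this has smaller dimension.\<close>

lemma irreducible_subrep_exists:
  assumes "is_rep G R" "rep_space R \<noteq> {0}"
  obtains W where "invariant_subspace G R W" "irreducible_rep G (subrep R W)"
proof -
  have "\<exists>W. invariant_subspace G R W \<and> irreducible_rep G (subrep R W)"
    using assms
  proof (induction "cdim (rep_space R)" arbitrary: R rule: less_induct)
    case less
    note r = is_repD[OF less.prems(1)]
    show ?case
    proof (cases "irreducible_rep G R")
      case True
      have "invariant_subspace G R (rep_space R)"
        using r by (auto simp: invariant_subspace_def)
      then show ?thesis
        using True by (metis subrep_self)
    next
      case False
      then obtain W where W: "invariant_subspace G R W" "W \<noteq> {0}" "W \<noteq> rep_space R"
        using less.prems irreducible_repI by blast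
      note w = invariant_subspaceD[OF W(1)]
      have "cdim W < cdim (rep_space R)"
        using w W(3) by (intro cdim_psubset r(1)) auto
      then obtain X where X: "invariant_subspace G (subrep R W) X" "irreducible_rep G (subrep (subrep R W) X)"
        using less.hyps[of "subrep R W"] is_rep_subrep[OF less.prems(1) W(1)] W(2) by auto
      then show ?thesis
        using invariant_subrep[OF W(1) X(1)] by (metis subrep_subrep)
    qed
  qed
  then show thesis
    using that by blast
qed

subsection \<open>Schur's lemma and orthogonality\<close>

lemma irreducible_hom_inj:
  assumes R: "irreducible_rep G R" and S: "is_rep G S" and T: "rep_hom G R S T"
    and nz: "v \<in> rep_space R" "T v \<noteq> 0"
  shows "inj_on T (rep_space R)"
proof -
  note r = irreducible_repD[OF R]
  have "{v \<in> rep_space R. T v = 0} = {0} \<or> {v \<in> rep_space R. T v = 0} = rep_space R"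
    by (rule r(3)[OF invariant_kernel[OF r(1) S T]])
  then have "{v \<in> rep_space R. T v = 0} = {0}"
    using nz by blast
  then show ?thesis
    by (intro linear_on_inj_on[OF rep_homD(1)[OF T] is_repD(2)[OF r(1)]]) blast
qed

text \<open>The kernel is invariant and proper, hence zero. The target is an arbitrary
  representation, so that copies of R inside S are found and not only isomorphisms.\<close>

lemma irreducible_hom_image:
  assumes R: "irreducible_rep G R" and S: "is_rep G S" and T: "rep_hom G R S T"
    and nz: "v \<in> rep_space R" "T v \<noteq> 0"
  shows "rep_iso G R (subrep S (T ` rep_space R))" "invariant_subspace G S (T ` rep_space R)"
proof -
  note r = irreducible_repD[OF R]
  show i: "invariant_subspace G S (T ` rep_space R)"
    by (rule invariant_image[OF r(1) S T])
  show "rep_iso G R (subrep S (T ` rep_space R))"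
    using irreducible_hom_inj[OF assms] T
    by (intro rep_isoI[OF r(1) is_rep_subrep[OF S i], of T])
      (auto simp: rep_hom_def bij_betw_def)
qed

text \<open>T has a complex eigenvector, and the kernel of T - c is then a nonzero invariant
  subspace.\<close>

lemma irreducible_hom_scalar:
  assumes R: "irreducible_rep G R" and T: "rep_hom G R R T"
  obtains c where "\<forall>v\<in>rep_space R. T v = c *\<^sub>C v"
proof -
  note r = irreducible_repD[OF R] and t = rep_homD[OF T]
  note r' = is_repD[OF r(1)]
  obtain c v where v: "v \<in> rep_space R" "v \<noteq> 0" "T v = c *\<^sub>C v"
    using linear_exists_eigenvector[OF r'(1) r(2) t(1,2)] .
  define U where "U v = T v - c *\<^sub>C v" for v
  have U: "rep_hom G R R U"
    unfolding U_def using t r'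
    by (intro rep_homI linear_on_minus linear_on_scaled linear_on_id)
      (auto simp: linear_on_diff[OF r'(3) r'(2)] linear_on_scale[OF r'(3)] complex_vector.subspace_diff
          complex_vector.subspace_scale)
  have "{v \<in> rep_space R. U v = 0} = {0} \<or> {v \<in> rep_space R. U v = 0} = rep_space R"
    by (rule r(3)[OF invariant_kernel[OF r(1) r(1) U]])
  moreover have "v \<in> {v \<in> rep_space R. U v = 0}"
    using v by (simp add: U_def)
  ultimately have "{v \<in> rep_space R. U v = 0} = rep_space R"
    using v(2) by blast
  then have "T v = c *\<^sub>C v" if "v \<in> rep_space R" for v
    using that by (auto simp: U_def)
  then show thesis
    using that by blast
qed

text \<open>The usual form has the complex conjugate of \<chi> g in place of \<chi> (inv g); for
  characters the two agree. This version is bilinear and symmetric and refers to no invariant scalar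
  product.\<close>

definition char_ip :: "('a \<Rightarrow> complex) \<Rightarrow> ('a \<Rightarrow> complex) \<Rightarrow> complex" where
  "char_ip \<chi> \<psi> = (\<Sum>g\<in>carrier G. \<chi> (inv g) * \<psi> g) / of_nat (card (carrier G))"

lemma char_ip_cong:
  "(\<And>g. g \<in> carrier G \<Longrightarrow> \<chi> g = \<chi>' g) \<Longrightarrow> (\<And>g. g \<in> carrier G \<Longrightarrow> \<psi> g = \<psi>' g) \<Longrightarrow>
    char_ip \<chi> \<psi> = char_ip \<chi>' \<psi>'"
  by (simp add: char_ip_def)

lemma char_ip_add: "char_ip \<chi> (\<lambda>g. \<phi> g + \<psi> g) = char_ip \<chi> \<phi> + char_ip \<chi> \<psi>"
  by (simp add: char_ip_def ring_distribs sum.distrib add_divide_distrib)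

lemma char_ip_sum: "char_ip \<chi> (\<lambda>g. \<Sum>i\<in>I. \<psi> i g) = (\<Sum>i\<in>I. char_ip \<chi> (\<psi> i))"
  unfolding char_ip_def sum_distrib_left sum_divide_distrib[symmetric] by (subst sum.swap) simp

lemma char_ip_scale: "char_ip \<chi> (\<lambda>g. c * \<psi> g) = c * char_ip \<chi> \<psi>"
  by (simp add: char_ip_def sum_distrib_left mult_ac)

lemma char_ip_commute: "char_ip \<chi> \<psi> = char_ip \<psi> \<chi>"
  unfolding char_ip_def
  by (subst sum_inverse[symmetric]) (simp add: mult.commute)

text \<open>\<open>T k l\<close> is an elementary matrix. The entry of its average in row l and
  column k is the sum over g of a diagonal entry of R at the inverse of g times a diagonal entry of
  S at g; summing over k and l gives the product of the two traces.\<close>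

lemma char_ip_average:
  assumes R: "is_rep G R" and S: "is_rep G S"
  defines "T \<equiv> \<lambda>k l v. coord (rep_space R) k v *\<^sub>C basis_vec (rep_space S) l"
  shows "of_nat (card (carrier G)) * char_ip (rep_char R) (rep_char S) =
    (\<Sum>k<cdim (rep_space R). \<Sum>l<cdim (rep_space S).
       coord (rep_space S) l (average R S (T k l) (basis_vec (rep_space R) k)))"
proof -
  note r = is_repD[OF R] and s = is_repD[OF S]
  note bR = frameD[OF basis_coord_frame(1)[OF r(1)]] and bS = frameD[OF basis_coord_frame(1)[OF s(1)]]
  let ?m = "cdim (rep_space R)" and ?n = "cdim (rep_space S)"
  let ?e = "basis_vec (rep_space R)" and ?f = "basis_vec (rep_space S)"
  let ?x = "coord (rep_space R)" and ?y = "coord (rep_space S)"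
  have av: "?y l (average R S (T k l) (?e k)) =
      (\<Sum>g\<in>carrier G. ?x k (rep_act R (inv g) (?e k)) * ?y l (rep_act S g (?f l)))"
    if "k < ?m" "l < ?n" for k l
  proof -
    have f: "?f l \<in> rep_space S" and y: "linear_on (rep_space S) (?y l)"
      using bS(3,4) that by auto
    have "?y l (average R S (T k l) (?e k)) =
        (\<Sum>g\<in>carrier G. ?y l (rep_act S g (?x k (rep_act R (inv g) (?e k)) *\<^sub>C ?f l)))"
      unfolding average_def T_def using f s
      by (intro linear_on_sum[OF y s(2)]) (auto simp: complex_vector.subspace_scale)
    also have "\<dots> = (\<Sum>g\<in>carrier G. ?x k (rep_act R (inv g) (?e k)) * ?y l (rep_act S g (?f l)))"
      using f s y by (intro sum.cong) (auto simp: linear_on_scale[OF s(3)] linear_on_scale_complex)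
    finally show ?thesis .
  qed
  have "of_nat (card (carrier G)) * char_ip (rep_char R) (rep_char S) =
      (\<Sum>g\<in>carrier G. rep_char R (inv g) * rep_char S g)"
    using card_carrier_pos by (simp add: char_ip_def)
  also have "\<dots> = (\<Sum>g\<in>carrier G. \<Sum>k<?m. \<Sum>l<?n. ?x k (rep_act R (inv g) (?e k)) * ?y l (rep_act S g (?f l)))"
    by (simp add: rep_char_def trace_on_def sum_product)
  also have "\<dots> = (\<Sum>k<?m. \<Sum>g\<in>carrier G. \<Sum>l<?n. ?x k (rep_act R (inv g) (?e k)) * ?y l (rep_act S g (?f l)))"
    by (rule sum.swap)
  also have "\<dots> = (\<Sum>k<?m. \<Sum>l<?n. \<Sum>g\<in>carrier G. ?x k (rep_act R (inv g) (?e k)) * ?y l (rep_act S g (?f l)))"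
    by (intro sum.cong refl sum.swap)
  also have "\<dots> = (\<Sum>k<?m. \<Sum>l<?n. ?y l (average R S (T k l) (?e k)))"
    using av by simp
  finally show ?thesis .
qed

lemma rank_one_map:
  assumes R: "is_rep G R" and S: "is_rep G S" and "k < cdim (rep_space R)" "l < cdim (rep_space S)"
  defines "T \<equiv> \<lambda>v. coord (rep_space R) k v *\<^sub>C basis_vec (rep_space S) l"
  shows "linear_on (rep_space R) T" "T \<in> rep_space R \<rightarrow> rep_space S"
  using assms frameD(4)[OF basis_coord_frame(1)[OF is_repD(1)[OF R]]]
    frameD(3)[OF basis_coord_frame(1)[OF is_repD(1)[OF S]]] is_repD(2)[OF S]
  by (auto intro!: linear_on_rank_one complex_vector.subspace_scale)

text \<open>If all averaged elementary matrices vanished, the double sum in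
  \<open>char_ip_average\<close> would vanish too.\<close>

lemma char_ip_nonzero_hom:
  assumes R: "is_rep G R" and S: "is_rep G S" and nz: "char_ip (rep_char R) (rep_char S) \<noteq> 0"
  obtains T v where "rep_hom G R S T" "v \<in> rep_space R" "T v \<noteq> 0"
proof -
  note bR = frameD[OF basis_coord_frame(1)[OF is_repD(1)[OF R]]]
  note bS = frameD[OF basis_coord_frame(1)[OF is_repD(1)[OF S]]]
  have "(\<Sum>k<cdim (rep_space R). \<Sum>l<cdim (rep_space S).
       coord (rep_space S) l (average R S (\<lambda>v. coord (rep_space R) k v *\<^sub>C basis_vec (rep_space S) l)
         (basis_vec (rep_space R) k))) \<noteq> 0"
    using char_ip_average[OF R S] nz card_carrier_pos by (metis mult_eq_0_iff of_nat_eq_0_iff neq0_conv)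
  then obtain k where k: "k < cdim (rep_space R)" "(\<Sum>l<cdim (rep_space S).
       coord (rep_space S) l (average R S (\<lambda>v. coord (rep_space R) k v *\<^sub>C basis_vec (rep_space S) l)
         (basis_vec (rep_space R) k))) \<noteq> 0"
    by (metis (no_types, lifting) lessThan_iff sum.neutral)
  then obtain l where l: "l < cdim (rep_space S)"
    "coord (rep_space S) l (average R S (\<lambda>v. coord (rep_space R) k v *\<^sub>C basis_vec (rep_space S) l)
         (basis_vec (rep_space R) k)) \<noteq> 0"
    by (metis (no_types, lifting) lessThan_iff sum.neutral)
  let ?T = "average R S (\<lambda>v. coord (rep_space R) k v *\<^sub>C basis_vec (rep_space S) l)"
  have "rep_hom G R S ?T"
    by (intro rep_hom_average R S rank_one_map k(1) l(1))
  moreover have "?T (basis_vec (rep_space R) k) \<noteq> 0"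
    using l linear_on_zero[OF bS(4) bS(3)] by auto
  ultimately show thesis
    using that bR(3)[of k] k(1) by auto
qed

text \<open>Each summand is a conjugate of T and has the trace of T.\<close>

lemma trace_average:
  assumes R: "is_rep G R" and T: "linear_on (rep_space R) T" "T \<in> rep_space R \<rightarrow> rep_space R"
  shows "trace_on (rep_space R) (average R R T) = of_nat (card (carrier G)) * trace_on (rep_space R) T"
proof -
  note r = is_repD[OF R]
  note b = frameD[OF basis_coord_frame(1)[OF r(1)]]
  have c: "rep_act R g (T (rep_act R (inv g) v)) \<in> rep_space R" if "g \<in> carrier G" "v \<in> rep_space R" for g v
    using that r T by (auto simp: Pi_iff)
  have "trace_on (rep_space R) (average R R T) = (\<Sum>k<cdim (rep_space R). \<Sum>g\<in>carrier G.
      coord (rep_space R) k (rep_act R g (T (rep_act R (inv g) (basis_vec (rep_space R) k)))))"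
    unfolding trace_on_def average_def using b c
    by (intro sum.cong refl linear_on_sum[OF _ r(2)]) auto
  also have "\<dots> = (\<Sum>g\<in>carrier G. trace_on (rep_space R) (\<lambda>v. rep_act R g (T (rep_act R (inv g) v))))"
    unfolding trace_on_def by (rule sum.swap)
  also have "\<dots> = (\<Sum>g\<in>carrier G. trace_on (rep_space R) T)"
  proof (rule sum.cong[OF refl])
    fix g assume g: "g \<in> carrier G"
    have "rep_act R (inv g) (rep_act R g v) = v" if "v \<in> rep_space R" for v
      using r(6)[of "inv g" g v] r(5) g that by simp
    then show "trace_on (rep_space R) (\<lambda>v. rep_act R g (T (rep_act R (inv g) v))) = trace_on (rep_space R) T"
      by (intro trace_on_iso[of _ _ "rep_act R g" "rep_act R (inv g)" T, symmetric])
        (use r g T in auto)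
  qed
  finally show ?thesis
    by simp
qed

text \<open>By Schur's lemma the average of the elementary matrix \<open>T k l\<close> is a scalar
  c. Comparing traces, d c is the group order if k = l and 0 otherwise, so the d diagonal terms
  survive, each equal to |G| / d.\<close>

lemma char_ip_irreducible:
  assumes "irreducible_rep G R"
  shows "char_ip (rep_char R) (rep_char R) = 1"
proof -
  note R = irreducible_repD[OF assms]
  note r = is_repD[OF R(1)]
  note bf = basis_coord_frame[OF r(1)]
  note b = frameD[OF bf(1)]
  define d where "d = cdim (rep_space R)"
  let ?e = "basis_vec (rep_space R)" and ?x = "coord (rep_space R)"
  let ?T = "\<lambda>k l v. ?x k v *\<^sub>C ?e l"
  have d: "0 < d"
    using cdim_pos[OF r(1) R(2)] by (simp add: d_def)
  have *: "?x l (average R R (?T k l) (?e k)) = (if k = l then of_nat (card (carrier G)) / of_nat d else 0)"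
    if kl: "k < d" "l < d" for k l
  proof -
    note T = rank_one_map[OF R(1) R(1) kl[unfolded d_def]]
    obtain c where c: "\<forall>v\<in>rep_space R. average R R (?T k l) v = c *\<^sub>C v"
      using irreducible_hom_scalar[OF assms rep_hom_average[OF R(1) R(1) T]] .
    have "trace_on (rep_space R) (average R R (?T k l)) = (\<Sum>j<d. ?x j (c *\<^sub>C ?e j))"
      unfolding trace_on_def d_def[symmetric] using c b(3) by (simp add: d_def)
    also have "\<dots> = (\<Sum>j<d. c)"
      using b(3) bf(2) by (intro sum.cong) (auto simp: d_def linear_on_scale_complex[OF b(4)])
    finally have 1: "trace_on (rep_space R) (average R R (?T k l)) = of_nat d * c"
      by simp
    have "trace_on (rep_space R) (?T k l) = (\<Sum>j<d. if j = k then if k = l then 1 else 0 else 0)"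
      unfolding trace_on_def d_def[symmetric] using b(3) bf(2) kl linear_on_zero[OF b(4) b(3)]
      by (intro sum.cong) (auto simp: d_def linear_on_scale_complex[OF b(4)])
    then have 2: "trace_on (rep_space R) (?T k l) = (if k = l then 1 else 0)"
      using kl by simp
    have "c = (if k = l then of_nat (card (carrier G)) / of_nat d else 0)"
      using trace_average[OF R(1) T] d unfolding 1 2 by (auto simp: field_simps split: if_splits)
    then show ?thesis
      using c b(3) bf(2) kl linear_on_zero[OF b(4) b(3)]
      by (auto simp: d_def linear_on_scale_complex[OF b(4)])
  qed
  have "of_nat (card (carrier G)) * char_ip (rep_char R) (rep_char R) =
      (\<Sum>k<d. \<Sum>l<d. if k = l then of_nat (card (carrier G)) / of_nat d else 0)"
    unfolding char_ip_average[OF R(1) R(1)] d_def[symmetric] using * by simp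
  also have "\<dots> = of_nat (card (carrier G))"
    using d by simp
  finally show ?thesis
    using card_carrier_pos by simp
qed

lemma char_ip_irreducible_pair:
  assumes "irreducible_rep G R" "irreducible_rep G S"
  shows "char_ip (rep_char R) (rep_char S) = (if rep_iso G R S then 1 else 0)"
proof (cases "char_ip (rep_char R) (rep_char S) = 0")
  case True
  have "\<not> rep_iso G R S"
  proof
    assume "rep_iso G R S"
    then have "char_ip (rep_char R) (rep_char S) = char_ip (rep_char R) (rep_char R)"
      by (intro char_ip_cong) (auto simp: rep_iso_char)
    then show False
      using True char_ip_irreducible[OF assms(1)] by simp
  qed
  then show ?thesis
    using True by simp
next
  case False
  note R = irreducible_repD[OF assms(1)] and S = irreducible_repD[OF assms(2)]
  obtain T v where T: "rep_hom G R S T" "v \<in> rep_space R" "T v \<noteq> 0"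
    using char_ip_nonzero_hom[OF R(1) S(1) False] .
  note i = irreducible_hom_image[OF assms(1) S(1) T]
  have "T ` rep_space R = rep_space S"
    using S(3)[OF i(2)] T(2,3) by blast
  then have "subrep S (T ` rep_space R) = S"
    by (simp add: subrep_def)
  then have iso: "rep_iso G R S"
    using i(1) by simp
  then have "char_ip (rep_char R) (rep_char S) = char_ip (rep_char R) (rep_char R)"
    by (intro char_ip_cong) (auto simp: rep_iso_char)
  then show ?thesis
    using iso char_ip_irreducible[OF assms(1)] by simp
qed

section \<open>Multiplicities and complete reducibility\<close>

lemma irreducible_summand:
  assumes R: "irreducible_rep G R" and S: "is_rep G S" and T: "rep_hom G R S T"
    and nz: "v \<in> rep_space R" "T v \<noteq> 0"
  obtains W P where "invariant_subspace G S W" "rep_iso G R (subrep S W)"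
    "rep_hom G S S P" "P \<in> rep_space S \<rightarrow> W" "\<forall>w\<in>W. P w = w"
  using irreducible_hom_image[OF assms] maschke[OF S irreducible_hom_image(2)[OF assms]] by metis

text \<open>The inductive step of the arguments below: when a copy of R is split off, characters,
  inner products and dimensions drop by the contribution of R.\<close>

lemma char_ip_summand:
  assumes S: "is_rep G S" and W: "invariant_subspace G S W" "rep_iso G R (subrep S W)"
    and P: "rep_hom G S S P" "P \<in> rep_space S \<rightarrow> W" "\<forall>w\<in>W. P w = w"
  defines "K \<equiv> {v \<in> rep_space S. P v = 0}"
  shows "invariant_subspace G S K" "is_rep G (subrep S K)"
    "g \<in> carrier G \<Longrightarrow> rep_char S g = rep_char R g + rep_char (subrep S K) g"
    "char_ip \<chi> (rep_char S) = char_ip \<chi> (rep_char R) + char_ip \<chi> (rep_char (subrep S K))"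
    "cdim (rep_space S) = cdim (rep_space R) + cdim K"
proof -
  note s = rep_char_split[OF S W(1) P]
  show K: "invariant_subspace G S K"
    using s(1) by (simp add: K_def)
  show "is_rep G (subrep S K)"
    by (rule is_rep_subrep[OF S K])
  have c: "rep_char S g = rep_char R g + rep_char (subrep S K) g" if "g \<in> carrier G" for g
    using s(2)[OF that] rep_iso_char[OF W(2) that] by (simp add: K_def)
  then show "g \<in> carrier G \<Longrightarrow> rep_char S g = rep_char R g + rep_char (subrep S K) g" .
  show "char_ip \<chi> (rep_char S) = char_ip \<chi> (rep_char R) + char_ip \<chi> (rep_char (subrep S K))"
    unfolding char_ip_add[symmetric] by (rule char_ip_cong[OF refl c])
  show "cdim (rep_space S) = cdim (rep_space R) + cdim K"
    using s(3) rep_iso_dim[OF W(2)] by (simp add: K_def)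
qed

text \<open>Each split-off copy of R contributes 1 by orthogonality and leaves a complement of
  smaller dimension. Integrality excludes cancellation: once R embeds into S, the inner product is 1
  plus a natural number.\<close>

lemma char_ip_nat:
  assumes R: "irreducible_rep G R" and S: "is_rep G S"
  shows "char_ip (rep_char R) (rep_char S) \<in> \<nat>"
  using S
proof (induction "cdim (rep_space S)" arbitrary: S rule: less_induct)
  case less
  note R' = irreducible_repD[OF R]
  show ?case
  proof (cases "char_ip (rep_char R) (rep_char S) = 0")
    case False
    obtain T v where T: "rep_hom G R S T" "v \<in> rep_space R" "T v \<noteq> 0"
      using char_ip_nonzero_hom[OF R'(1) less.prems False] .
    obtain W P where W: "invariant_subspace G S W" "rep_iso G R (subrep S W)"
      "rep_hom G S S P" "P \<in> rep_space S \<rightarrow> W" "\<forall>w\<in>W. P w = w"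
      using irreducible_summand[OF R less.prems T] .
    note s = char_ip_summand[OF less.prems W]
    have "cdim {v \<in> rep_space S. P v = 0} < cdim (rep_space S)"
      using s(5) cdim_pos[OF is_repD(1)[OF R'(1)] R'(2)] by simp
    then have "char_ip (rep_char R) (rep_char (subrep S {v \<in> rep_space S. P v = 0})) \<in> \<nat>"
      using less.hyps[OF _ s(2)] by simp
    then show ?thesis
      using s(4) char_ip_irreducible[OF R] by (simp add: Nats_add)
  qed simp
qed

lemma char_ip_hom_nonzero:
  assumes R: "irreducible_rep G R" and S: "is_rep G S" and T: "rep_hom G R S T"
    and nz: "v \<in> rep_space R" "T v \<noteq> 0"
  shows "char_ip (rep_char R) (rep_char S) \<noteq> 0"
proof -
  obtain W P where W: "invariant_subspace G S W" "rep_iso G R (subrep S W)"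
    "rep_hom G S S P" "P \<in> rep_space S \<rightarrow> W" "\<forall>w\<in>W. P w = w"
    using irreducible_summand[OF assms] .
  note s = char_ip_summand[OF S W]
  obtain m where "char_ip (rep_char R) (rep_char (subrep S {v \<in> rep_space S. P v = 0})) = of_nat m"
    using char_ip_nat[OF R s(2)] by (auto elim: Nats_cases)
  then have "char_ip (rep_char R) (rep_char S) = of_nat (Suc m)"
    using s(4) char_ip_irreducible[OF R] by simp
  then show ?thesis
    by (metis Zero_not_Suc of_nat_eq_0_iff)
qed

text \<open>A nonzero homomorphism to an irreducible representation is onto and splits: it is
  bijective on an invariant complement of its kernel, and the inverse embeds R into S. Restricted
  Specht modules supply maps in this direction.\<close>

lemma char_ip_hom_nonzero':
  assumes R: "irreducible_rep G R" and S: "is_rep G S" and T: "rep_hom G S R T"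
    and nz: "v \<in> rep_space S" "T v \<noteq> 0"
  shows "char_ip (rep_char R) (rep_char S) \<noteq> 0"
proof -
  note R' = irreducible_repD[OF R] and t = rep_homD[OF T] and s = is_repD[OF S]
  define K where "K = {v \<in> rep_space S. T v = 0}"
  have K: "invariant_subspace G S K"
    unfolding K_def by (rule invariant_kernel[OF S R'(1) T])
  note k = invariant_subspaceD[OF K]
  obtain P where P: "rep_hom G S S P" "P \<in> rep_space S \<rightarrow> K" "\<forall>w\<in>K. P w = w"
    using maschke[OF S K] .
  note p = rep_homD[OF P(1)]
  define W where "W = {v \<in> rep_space S. P v = 0}"
  have W: "invariant_subspace G S W"
    unfolding W_def by (rule invariant_kernel[OF S S P(1)])
  note w = invariant_subspaceD[OF W]
  have sub: "is_rep G (subrep S W)"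
    by (rule is_rep_subrep[OF S W])
  have hom: "rep_hom G (subrep S W) R T"
    using T w unfolding rep_hom_def by (auto intro: linear_on_subset)
  have inj: "inj_on T W"
  proof (rule linear_on_inj_on[OF linear_on_subset[OF t(1) w(2)] w(1)])
    fix x assume "x \<in> W" "T x = 0"
    then have "x \<in> K" "P x = 0"
      by (auto simp: K_def W_def)
    then show "x = 0"
      using P(3) by force
  qed
  have "T ` W = {0} \<or> T ` W = rep_space R"
    using R'(3) invariant_image[OF sub R'(1) hom] by simp
  moreover have "v - P v \<in> W" "T (v - P v) \<noteq> 0"
  proof -
    have Pv: "P v \<in> K" "P v \<in> rep_space S" "T (P v) = 0"
      using nz(1) P(2) by (auto simp: K_def)
    show "v - P v \<in> W"
      using Pv nz(1) s(2) P(3)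
      by (simp add: W_def complex_vector.subspace_diff linear_on_diff[OF p(1)])
    show "T (v - P v) \<noteq> 0"
      using Pv nz s(2) by (simp add: linear_on_diff[OF t(1)])
  qed
  ultimately have "T ` W = rep_space R"
    by blast
  then have bij: "bij_betw T (rep_space (subrep S W)) (rep_space R)"
    using inj by (simp add: bij_betw_def)
  have inv: "rep_hom G R (subrep S W) (inv_into W T)"
    using rep_hom_inverse[OF sub hom bij] by simp
  have inv': "rep_hom G R S (inv_into W T)"
    using inv w(2) by (auto simp: rep_hom_def)
  obtain x where x: "x \<in> rep_space R" "x \<noteq> 0"
    using R'(2) complex_vector.subspace_0[OF is_repD(2)[OF R'(1)]] by blast
  have "inv_into W T x \<noteq> 0"
  proof
    assume "inv_into W T x = 0"
    then have "x = T 0"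
      using x(1) bij by (metis bij_betw_inv_into_right subrep_simps(1))
    then show False
      using x linear_on_zero[OF t(1) nz(1)] by simp
  qed
  then show ?thesis
    using char_ip_hom_nonzero[OF R S inv' x(1)] by blast
qed

text \<open>The two isomorphisms are glued to \<open>T (P x) + U (x - P x)\<close>. Applying Q
  recovers the first term, which gives injectivity.\<close>

lemma rep_iso_split:
  assumes R: "is_rep G R" and S: "is_rep G S"
    and V: "invariant_subspace G R V" "rep_hom G R R P" "P \<in> rep_space R \<rightarrow> V" "\<forall>w\<in>V. P w = w"
    and W: "invariant_subspace G S W" "rep_hom G S S Q" "Q \<in> rep_space S \<rightarrow> W" "\<forall>w\<in>W. Q w = w"
    and 1: "rep_iso G (subrep R V) (subrep S W)"
    and 2: "rep_iso G (subrep R {v \<in> rep_space R. P v = 0}) (subrep S {v \<in> rep_space S. Q v = 0})"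
  shows "rep_iso G R S"
proof -
  define V' where "V' = {v \<in> rep_space R. P v = 0}"
  define W' where "W' = {v \<in> rep_space S. Q v = 0}"
  note r = is_repD[OF R] and s = is_repD[OF S] and p = rep_homD[OF V(2)] and q = rep_homD[OF W(2)]
  note v = invariant_subspaceD[OF V(1)] and w = invariant_subspaceD[OF W(1)]
  have V': "invariant_subspace G R V'" and W': "invariant_subspace G S W'"
    unfolding V'_def W'_def by (rule invariant_kernel[OF R R V(2)] invariant_kernel[OF S S W(2)])+
  note v' = invariant_subspaceD[OF V'] and w' = invariant_subspaceD[OF W']
  obtain T where T: "rep_hom G (subrep R V) (subrep S W) T" "bij_betw T V W"
    using 1 by (auto elim: rep_isoE)
  obtain U where U: "rep_hom G (subrep R V') (subrep S W') U" "bij_betw U V' W'"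
    using 2 unfolding V'_def[symmetric] W'_def[symmetric] by (auto elim: rep_isoE)
  note t = rep_homD[OF T(1), unfolded subrep_simps] and u = rep_homD[OF U(1), unfolded subrep_simps]
  have P: "P x \<in> V" "P x \<in> rep_space R" "x - P x \<in> V'" if "x \<in> rep_space R" for x
  proof -
    show Px: "P x \<in> V" "P x \<in> rep_space R"
      using that V(3) v(2) by auto
    show "x - P x \<in> V'"
      using that Px V(4) r(2) linear_on_diff[OF p(1) r(2) that Px(2)]
      by (simp add: V'_def complex_vector.subspace_diff)
  qed
  have Q: "Q x \<in> W" "Q x \<in> rep_space S" "x - Q x \<in> W'" if "x \<in> rep_space S" for x
  proof -
    show Qx: "Q x \<in> W" "Q x \<in> rep_space S"
      using that W(3) w(2) by auto
    show "x - Q x \<in> W'"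
      using that Qx W(4) s(2) linear_on_diff[OF q(1) s(2) that Qx(2)]
      by (simp add: W'_def complex_vector.subspace_diff)
  qed
  define X where "X x = T (P x) + U (x - P x)" for x
  have XS: "X x \<in> rep_space S" if "x \<in> rep_space R" for x
    using P[OF that] t(3) u(3) w(2) w'(2) s(2) unfolding X_def
    by (auto intro!: complex_vector.subspace_add)
  have lin: "linear_on (rep_space R) X"
  proof -
    have "linear_on (rep_space R) (\<lambda>x. T (P x))"
      using linear_on_compose[OF p(1) t(1) V(3)] .
    moreover have "linear_on (rep_space R) (\<lambda>x. U (x - P x))"
      by (rule linear_on_compose[OF linear_on_minus[OF linear_on_id p(1)] u(1)]) (use P in auto)
    ultimately show ?thesis
      unfolding X_def by (rule linear_on_plus)
  qed
  have hom: "rep_hom G R S X"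
  proof (rule rep_homI[OF lin XS])
    fix g x assume g: "g \<in> carrier G" and x: "x \<in> rep_space R"
    have "rep_act R g x - P (rep_act R g x) = rep_act R g (x - P x)"
      using g x P(2)[OF x] p(4) by (simp add: linear_on_diff[OF r(3)[OF g] r(2)])
    then have "X (rep_act R g x) = T (rep_act R g (P x)) + U (rep_act R g (x - P x))"
      using p(4)[OF g x] by (simp add: X_def)
    also have "\<dots> = rep_act S g (T (P x)) + rep_act S g (U (x - P x))"
      using t(4)[OF g] u(4)[OF g] P[OF x] by simp
    also have "\<dots> = rep_act S g (X x)"
      using P[OF x] t(3) u(3) w(2) w'(2) unfolding X_def
      by (intro linear_on_add[OF s(3)[OF g], symmetric]) auto
    finally show "X (rep_act R g x) = rep_act S g (X x)" .
  qed auto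
  have "inj_on X (rep_space R)"
  proof (rule linear_on_inj_on[OF lin r(2)])
    fix x assume x: "x \<in> rep_space R" "X x = 0"
    have TU: "T (P x) \<in> W" "U (x - P x) \<in> W'"
      using P[OF x(1)] t(3) u(3) by auto
    have "Q (X x) = Q (T (P x)) + Q (U (x - P x))"
      unfolding X_def using TU w(2) w'(2) by (intro linear_on_add[OF q(1)]) auto
    then have "Q (X x) = T (P x)"
      using TU W(4) by (auto simp: W'_def)
    then have T0: "T (P x) = 0"
      using x(2) linear_on_zero[OF q(1) XS[OF x(1)]] by simp
    then have U0: "U (x - P x) = 0"
      using x(2) by (simp add: X_def)
    have "P x = 0"
      using T(2) T0 P[OF x(1)] linear_on_zero[OF t(1)] complex_vector.subspace_0[OF v(1)]
      unfolding bij_betw_def inj_on_def by metis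
    moreover have "x - P x = 0"
      using U(2) U0 P[OF x(1)] linear_on_zero[OF u(1)] complex_vector.subspace_0[OF v'(1)]
      unfolding bij_betw_def inj_on_def by metis
    ultimately show "x = 0"
      by simp
  qed
  moreover have "rep_space S \<subseteq> X ` rep_space R"
  proof
    fix y assume y: "y \<in> rep_space S"
    obtain a where a: "a \<in> V" "T a = Q y"
      using T(2) Q(1)[OF y] by (auto simp: bij_betw_def)
    obtain b where b: "b \<in> V'" "U b = y - Q y"
      using U(2) Q(3)[OF y] by (auto simp: bij_betw_def)
    have ab: "a \<in> rep_space R" "b \<in> rep_space R"
      using a b v(2) v'(2) by auto
    have "P (a + b) = a"
      using linear_on_add[OF p(1) ab] V(4) a(1) b(1) by (simp add: V'_def)
    then have "X (a + b) = y"
      using a b by (simp add: X_def)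
    then show "y \<in> X ` rep_space R"
      using ab r(2) by (intro image_eqI[of _ _ "a + b"]) (auto simp: complex_vector.subspace_add)
  qed
  ultimately have "bij_betw X (rep_space R) (rep_space S)"
    using XS by (auto simp: bij_betw_def)
  then show ?thesis
    by (rule rep_isoI[OF R S hom])
qed

text \<open>An irreducible subrepresentation, moved to \<open>nat \<Rightarrow> complex\<close>,
  where the hypothesis of the next theorem is tested.\<close>

lemma irreducible_constituent:
  assumes R: "is_rep G R" and nz: "rep_space R \<noteq> {0}"
  obtains V :: "('a, nat \<Rightarrow> complex) rep"
  where "irreducible_rep G V" "char_ip (rep_char V) (rep_char R) \<noteq> 0"
proof -
  obtain W where W: "invariant_subspace G R W" "irreducible_rep G (subrep R W)"
    using irreducible_subrep_exists[OF R nz] .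
  obtain V :: "('a, nat \<Rightarrow> complex) rep" where V: "rep_iso G (subrep R W) V"
    using rep_iso_nat_complex[OF is_rep_subrep[OF R W(1)]] .
  have hom: "rep_hom G (subrep R W) R (\<lambda>v. v)"
    using invariant_subspaceD[OF W(1)] by (auto intro!: rep_homI linear_on_id)
  obtain x where "x \<in> W" "x \<noteq> 0"
    using irreducible_repD(2)[OF W(2)] complex_vector.subspace_0[OF invariant_subspaceD(1)[OF W(1)]]
    by auto
  then have "char_ip (rep_char (subrep R W)) (rep_char R) \<noteq> 0"
    using char_ip_hom_nonzero[OF W(2) R hom] by simp
  moreover have "char_ip (rep_char (subrep R W)) (rep_char R) = char_ip (rep_char V) (rep_char R)"
    by (rule char_ip_cong) (auto simp: rep_iso_char[OF V])
  ultimately show thesis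
    using that rep_iso_irreducible[OF V W(2)] by metis
qed

text \<open>Induction on the dimension of R. If one of the representations is nonzero, some
  irreducible V occurs in it, hence in both; after one copy of V is split off on each side the
  complements again have equal multiplicities.\<close>

theorem rep_iso_of_char_ip:
  assumes "is_rep G R" "is_rep G S"
    and "\<And>V :: ('a, nat \<Rightarrow> complex) rep. irreducible_rep G V \<Longrightarrow>
      char_ip (rep_char V) (rep_char R) = char_ip (rep_char V) (rep_char S)"
  shows "rep_iso G R S"
  using assms
proof (induction "cdim (rep_space R)" arbitrary: R S rule: less_induct)
  case less
  note R = less.prems(1) and S = less.prems(2)
  note r = is_repD[OF R] and s = is_repD[OF S]
  show ?case
  proof (cases "rep_space R = {0} \<and> rep_space S = {0}")
    case True
    then show ?thesis
      using rep_iso_zero[OF R S] by simp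
  next
    case nz: False
    have "\<exists>V :: ('a, nat \<Rightarrow> complex) rep. irreducible_rep G V \<and>
        (char_ip (rep_char V) (rep_char R) \<noteq> 0 \<or> char_ip (rep_char V) (rep_char S) \<noteq> 0)"
      using irreducible_constituent[OF R] irreducible_constituent[OF S] nz by metis
    then obtain V :: "('a, nat \<Rightarrow> complex) rep" where
      V: "irreducible_rep G V" "char_ip (rep_char V) (rep_char R) \<noteq> 0" "char_ip (rep_char V) (rep_char S) \<noteq> 0"
      using less.prems(3) by metis
    note V' = irreducible_repD[OF V(1)]
    obtain T x where T: "rep_hom G V R T" "x \<in> rep_space V" "T x \<noteq> 0"
      using char_ip_nonzero_hom[OF V'(1) R V(2)] .
    obtain U y where U: "rep_hom G V S U" "y \<in> rep_space V" "U y \<noteq> 0"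
      using char_ip_nonzero_hom[OF V'(1) S V(3)] .
    obtain X P where X: "invariant_subspace G R X" "rep_iso G V (subrep R X)"
      "rep_hom G R R P" "P \<in> rep_space R \<rightarrow> X" "\<forall>w\<in>X. P w = w"
      using irreducible_summand[OF V(1) R T(1), OF T(2,3)] .
    obtain Y Q where Y: "invariant_subspace G S Y" "rep_iso G V (subrep S Y)"
      "rep_hom G S S Q" "Q \<in> rep_space S \<rightarrow> Y" "\<forall>w\<in>Y. Q w = w"
      using irreducible_summand[OF V(1) S U(1), OF U(2,3)] .
    note x = char_ip_summand[OF R X] and y = char_ip_summand[OF S Y]
    have "rep_iso G (subrep R {v \<in> rep_space R. P v = 0}) (subrep S {v \<in> rep_space S. Q v = 0})"
    proof (rule less.hyps[OF _ x(2) y(2)])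
      show "cdim (rep_space (subrep R {v \<in> rep_space R. P v = 0})) < cdim (rep_space R)"
        using x(5) cdim_pos[OF is_repD(1)[OF V'(1)] V'(2)] by simp
      fix Z :: "('a, nat \<Rightarrow> complex) rep"
      assume "irreducible_rep G Z"
      from less.prems(3)[OF this]
      show "char_ip (rep_char Z) (rep_char (subrep R {v \<in> rep_space R. P v = 0})) =
          char_ip (rep_char Z) (rep_char (subrep S {v \<in> rep_space S. Q v = 0}))"
        unfolding x(4) y(4) by simp
    qed
    moreover have "rep_iso G (subrep R X) (subrep S Y)"
      using rep_iso_trans[OF rep_iso_sym[OF X(2)] Y(2)] .
    ultimately show ?thesis
      by (intro rep_iso_split[OF R S X(1,3-5) Y(1,3-5)])
  qed
qed

corollary rep_iso_of_char:
  assumes "is_rep G R" "is_rep G S" "\<And>g. g \<in> carrier G \<Longrightarrow> rep_char R g = rep_char S g"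
  shows "rep_iso G R S"
  using assms by (intro rep_iso_of_char_ip char_ip_cong) auto

text \<open>By orthogonality, splitting off the irreducibles treated so far does not change the
  multiplicity of the next one. The remainder K is kept in the conclusion because a dimension count
  will show that it vanishes.\<close>

lemma sum_irreducibles_le:
  assumes "finite J" "is_rep G S" "\<And>j. j \<in> J \<Longrightarrow> irreducible_rep G (V j)"
    and "\<And>i j. i \<in> J \<Longrightarrow> j \<in> J \<Longrightarrow> i \<noteq> j \<Longrightarrow> \<not> rep_iso G (V i) (V j)"
    and "\<And>j. j \<in> J \<Longrightarrow> char_ip (rep_char (V j)) (rep_char S) \<noteq> 0"
  obtains K where "invariant_subspace G S K"
    "\<And>g. g \<in> carrier G \<Longrightarrow> rep_char S g = (\<Sum>j\<in>J. rep_char (V j) g) + rep_char (subrep S K) g"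
    "cdim (rep_space S) = (\<Sum>j\<in>J. cdim (rep_space (V j))) + cdim K"
proof -
  have "\<exists>K. invariant_subspace G S K \<and>
    (\<forall>g\<in>carrier G. rep_char S g = (\<Sum>j\<in>J. rep_char (V j) g) + rep_char (subrep S K) g) \<and>
    cdim (rep_space S) = (\<Sum>j\<in>J. cdim (rep_space (V j))) + cdim K"
    using assms(1,3-5)
  proof (induction J rule: finite_induct)
    case empty
    have "invariant_subspace G S (rep_space S)"
      using is_repD[OF assms(2)] by (simp add: invariant_subspace_def)
    then show ?case
      by (intro exI[of _ "rep_space S"]) simp
  next
    case (insert j J)
    have "\<exists>K. invariant_subspace G S K \<and>
      (\<forall>g\<in>carrier G. rep_char S g = (\<Sum>j\<in>J. rep_char (V j) g) + rep_char (subrep S K) g) \<and>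
      cdim (rep_space S) = (\<Sum>j\<in>J. cdim (rep_space (V j))) + cdim K"
      by (rule insert.IH) (use insert.prems in auto)
    then obtain K where K: "invariant_subspace G S K"
      "\<And>g. g \<in> carrier G \<Longrightarrow> rep_char S g = (\<Sum>j\<in>J. rep_char (V j) g) + rep_char (subrep S K) g"
      "cdim (rep_space S) = (\<Sum>j\<in>J. cdim (rep_space (V j))) + cdim K"
      by blast
    have sK: "is_rep G (subrep S K)"
      by (rule is_rep_subrep[OF assms(2) K(1)])
    have Vj: "irreducible_rep G (V j)"
      using insert.prems(1) by simp
    have "char_ip (rep_char (V j)) (rep_char S) =
        char_ip (rep_char (V j)) (\<lambda>g. (\<Sum>j\<in>J. rep_char (V j) g) + rep_char (subrep S K) g)"
      by (rule char_ip_cong) (auto simp: K(2))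
    also have "\<dots> = (\<Sum>i\<in>J. char_ip (rep_char (V j)) (rep_char (V i))) + char_ip (rep_char (V j)) (rep_char (subrep S K))"
      by (simp add: char_ip_add char_ip_sum)
    also have "(\<Sum>i\<in>J. char_ip (rep_char (V j)) (rep_char (V i))) = 0"
    proof (rule sum.neutral, rule ballI)
      fix i assume "i \<in> J"
      then show "char_ip (rep_char (V j)) (rep_char (V i)) = 0"
        using insert.prems(1,2) insert.hyps by (subst char_ip_irreducible_pair) auto
    qed
    finally have "char_ip (rep_char (V j)) (rep_char (subrep S K)) \<noteq> 0"
      using insert.prems(3)[of j] by simp
    then obtain T v where T: "rep_hom G (V j) (subrep S K) T" "v \<in> rep_space (V j)" "T v \<noteq> 0"
      using char_ip_nonzero_hom[OF irreducible_repD(1)[OF Vj] sK] by blast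
    obtain W P where W: "invariant_subspace G (subrep S K) W" "rep_iso G (V j) (subrep (subrep S K) W)"
      "rep_hom G (subrep S K) (subrep S K) P" "P \<in> rep_space (subrep S K) \<rightarrow> W" "\<forall>w\<in>W. P w = w"
      using irreducible_summand[OF Vj sK T] .
    note s = char_ip_summand[OF sK W]
    define L where "L = {v \<in> K. P v = 0}"
    have "invariant_subspace G S L"
      using invariant_subrep[OF K(1) s(1)] by (simp add: L_def)
    then show ?case
      using s(3,5) K(2,3) insert.hyps unfolding L_def subrep_simps
      by (intro exI[of _ "{v \<in> K. P v = 0}"]) (auto simp: algebra_simps)
  qed
  then show thesis
    using that by blast
qed

end

section \<open>Direct sums and induced representations\<close>

lemma sum_fun_apply: "(\<Sum>i\<in>I. f i) x = (\<Sum>i\<in>I. f i x)"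
  for f :: "'i \<Rightarrow> 'a \<Rightarrow> 'b::comm_monoid_add"
  by (induction I rule: infinite_finite_induct) auto

lemma scaleC_fun_apply: "(c *\<^sub>C f) x = c *\<^sub>C f x"
  by (simp add: scaleC_fun_def)

section \<open>Direct sums\<close>

lemma direct_sum_frame:
  assumes "finite I" "\<And>i. i \<in> I \<Longrightarrow> is_rep G (R i)"
  shows "frame (SIGMA i:I. {..<cdim (rep_space (R i))})
    (\<lambda>(i, k) j. if j = i then basis_vec (rep_space (R i)) k else 0)
    (\<lambda>(i, k) \<phi>. coord (rep_space (R i)) k (\<phi> i)) (rep_space (direct_sum I R))"
  unfolding frame_def
proof (intro conjI ballI)
  let ?K = "SIGMA i:I. {..<cdim (rep_space (R i))}"
  note b = frameD[OF basis_coord_frame(1)[OF is_repD(1)[OF assms(2)]]]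
  have 0: "0 \<in> rep_space (R i)" if "i \<in> I" for i
    using b(2)[OF that] by (rule complex_vector.subspace_0)
  show "csubspace (rep_space (direct_sum I R))"
    using 0 b(2)
    by (intro csubspace_I)
      (auto simp: direct_sum_def scaleC_fun_apply complex_vector.subspace_add complex_vector.subspace_scale)
  show "finite ?K"
    using assms(1) by auto
  fix k assume k: "k \<in> ?K"
  show "(case k of (i, k) \<Rightarrow> \<lambda>j. if j = i then basis_vec (rep_space (R i)) k else 0)
      \<in> rep_space (direct_sum I R)"
    using k b(3) 0 by (auto simp: direct_sum_def)
  show "linear_on (rep_space (direct_sum I R)) ((\<lambda>(i, k) \<phi>. coord (rep_space (R i)) k (\<phi> i)) k)"
    using k by (auto simp: direct_sum_def scaleC_fun_apply linear_on_add[OF b(4)] linear_on_scale[OF b(4)]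
        intro!: linear_onI)
next
  fix \<phi> assume \<phi>: "\<phi> \<in> rep_space (direct_sum I R)"
  note b = frameD[OF basis_coord_frame(1)[OF is_repD(1)[OF assms(2)]]]
  show "(\<Sum>k\<in>(SIGMA i:I. {..<cdim (rep_space (R i))}).
      (\<lambda>(i, k) \<phi>. coord (rep_space (R i)) k (\<phi> i)) k \<phi> *\<^sub>C
      (case k of (i, k) \<Rightarrow> \<lambda>j. if j = i then basis_vec (rep_space (R i)) k else 0)) = \<phi>" (is "?S = \<phi>")
  proof
    fix j
    have "?S j = (\<Sum>i\<in>I. \<Sum>k<cdim (rep_space (R i)).
        coord (rep_space (R i)) k (\<phi> i) *\<^sub>C (if j = i then basis_vec (rep_space (R i)) k else 0))"
      unfolding sum_fun_apply
      by (subst sum.Sigma) (use assms(1) in \<open>auto simp: scaleC_fun_apply intro!: sum.cong\<close>)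
    also have "\<dots> = (\<Sum>i\<in>I. if j = i then \<phi> i else 0)"
      using \<phi> b(5) by (intro sum.cong) (auto simp: direct_sum_def)
    also have "\<dots> = \<phi> j"
      using assms(1) \<phi> by (auto simp: direct_sum_def)
    finally show "?S j = \<phi> j" .
  qed
qed

lemma is_rep_direct_sum:
  assumes "finite I" "\<And>i. i \<in> I \<Longrightarrow> is_rep G (R i)"
  shows "is_rep G (direct_sum I R)"
proof (rule is_repI)
  note r = is_repD[OF assms(2)]
  show "fin_dim (rep_space (direct_sum I R))"
    using direct_sum_frame[OF assms] by (rule frame_fin_dim)
  fix g assume g: "g \<in> carrier G"
  show "linear_on (rep_space (direct_sum I R)) (rep_act (direct_sum I R) g)"
    using linear_on_add[OF r(3)[OF _ g]] linear_on_scale[OF r(3)[OF _ g]]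
    by (intro linear_onI) (auto simp: direct_sum_def fun_eq_iff scaleC_fun_apply)
qed (use is_repD(4-6)[OF assms(2)] in \<open>auto simp: direct_sum_def fun_eq_iff\<close>)

lemma rep_char_direct_sum:
  assumes "finite I" "\<And>i. i \<in> I \<Longrightarrow> is_rep G (R i)" "g \<in> carrier G"
  shows "rep_char (direct_sum I R) g = (\<Sum>i\<in>I. rep_char (R i) g)"
proof -
  have D: "is_rep G (direct_sum I R)"
    by (rule is_rep_direct_sum[OF assms(1,2)])
  note D = is_repD[OF D]
  have fr: "frame (SIGMA i:I. {..<cdim (rep_space (R i))})
    (\<lambda>(i, k) j. if j = i then basis_vec (rep_space (R i)) k else 0)
    (\<lambda>(i, k) \<phi>. coord (rep_space (R i)) k (\<phi> i)) (rep_space (direct_sum I R))"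
    by (rule direct_sum_frame[OF assms(1,2)])
  have "rep_char (direct_sum I R) g = (\<Sum>i\<in>I. \<Sum>k<cdim (rep_space (R i)).
      coord (rep_space (R i)) k (rep_act (R i) g (basis_vec (rep_space (R i)) k)))"
    unfolding rep_char_def
    by (subst trace_on_frame[OF fr D(3)[OF assms(3)]])
      (use D(4)[OF assms(3)] assms(1) in
        \<open>auto simp: sum.Sigma case_prod_unfold direct_sum_def intro!: sum.cong\<close>)
  then show ?thesis
    by (simp add: rep_char_def trace_on_def)
qed

lemma is_rep_copies: "is_rep G R \<Longrightarrow> is_rep G (copies m R)"
  unfolding copies_def by (rule is_rep_direct_sum) auto

lemma rep_char_copies:
  "is_rep G R \<Longrightarrow> g \<in> carrier G \<Longrightarrow> rep_char (copies m R) g = of_nat m * rep_char R g"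
  unfolding copies_def by (subst rep_char_direct_sum[of _ G]) auto

section \<open>Subgroups, induced representations and induced characters\<close>

locale fin_subgroup = fin_group G + H: group H
  for G :: "('g, 'm) monoid_scheme" (structure) and H :: "('g, 'n) monoid_scheme" +
  assumes carrier_subset: "carrier H \<subseteq> carrier G"
    and mult_eq: "x \<in> carrier H \<Longrightarrow> y \<in> carrier H \<Longrightarrow> x \<otimes>\<^bsub>H\<^esub> y = x \<otimes> y"
begin

lemma carrierH [simp, intro]: "x \<in> carrier H \<Longrightarrow> x \<in> carrier G"
  using carrier_subset by blast

text \<open>\<open>H\<close> is a record of its own, like \<open>sym_group n\<close> inside
  \<open>sym_group (Suc n)\<close>, whose product agrees with that of \<open>G\<close> on its
  carrier. Its unit is idempotent in \<open>G\<close>, hence the unit of \<open>G\<close>.\<close>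

lemma one_eq: "\<one>\<^bsub>H\<^esub> = \<one>"
proof -
  have "\<one>\<^bsub>H\<^esub> \<otimes> \<one>\<^bsub>H\<^esub> = \<one>\<^bsub>H\<^esub>"
    using mult_eq[OF H.one_closed H.one_closed] by simp
  then show ?thesis
    using l_cancel_one'[of "\<one>\<^bsub>H\<^esub>" "\<one>\<^bsub>H\<^esub>"] H.one_closed by auto
qed

lemma inv_eq:
  assumes "x \<in> carrier H"
  shows "inv\<^bsub>H\<^esub> x = inv x"
proof -
  have "inv\<^bsub>H\<^esub> x \<otimes> x = \<one>"
    using assms mult_eq[of "inv\<^bsub>H\<^esub> x" x] by (simp add: one_eq)
  then show ?thesis
    using inv_equality[of "inv\<^bsub>H\<^esub> x" x] assms by auto
qed

lemma inv_closedH [simp]: "x \<in> carrier H \<Longrightarrow> inv x \<in> carrier H"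
  using H.inv_closed inv_eq by metis

lemma m_closedH [simp]: "x \<in> carrier H \<Longrightarrow> y \<in> carrier H \<Longrightarrow> x \<otimes> y \<in> carrier H"
  using H.m_closed mult_eq by metis

lemma mult_in_iff:
  assumes "h \<in> carrier H" "y \<in> carrier G"
  shows "h \<otimes> y \<in> carrier H \<longleftrightarrow> y \<in> carrier H"
proof
  assume "h \<otimes> y \<in> carrier H"
  then have "inv h \<otimes> (h \<otimes> y) \<in> carrier H"
    using assms by simp
  then show "y \<in> carrier H"
    using assms by (simp add: m_assoc[symmetric])
qed (use assms in simp)

lemma finite_carrierH: "finite (carrier H)"
  using finite_carrier carrier_subset finite_subset by blast

sublocale H: fin_group H
  by unfold_locales (rule finite_carrierH)

lemma sum_carrierH: "(\<Sum>x\<in>carrier G. if x \<in> carrier H then f x else 0) = (\<Sum>h\<in>carrier H. f h)"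
  using finite_carrier carrier_subset
  by (simp add: sum.inter_restrict[symmetric] Int_absorb1)

lemma sum_coset:
  assumes "y \<in> carrier G"
  shows "(\<Sum>x\<in>carrier G. if inv y \<otimes> x \<in> carrier H then f x else 0) = (\<Sum>h\<in>carrier H. f (y \<otimes> h))"
proof -
  have "(\<Sum>x\<in>carrier G. if inv y \<otimes> x \<in> carrier H then f x else 0) =
      (\<Sum>x\<in>carrier G. if inv y \<otimes> (y \<otimes> x) \<in> carrier H then f (y \<otimes> x) else 0)"
    using assms by (rule sum_translate[symmetric])
  also have "\<dots> = (\<Sum>x\<in>carrier G. if x \<in> carrier H then f (y \<otimes> x) else 0)"
    using assms by (intro sum.cong) (simp_all add: m_assoc[symmetric])
  finally show ?thesis
    by (simp add: sum_carrierH)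
qed

text \<open>The function supported on the coset xH whose value at x is the k-th basis vector.
  Letting x run through all of G avoids the choice of a transversal.\<close>

definition ind_vec :: "('g, 'v::complex_vector) rep \<Rightarrow> 'g \<times> nat \<Rightarrow> 'g \<Rightarrow> 'v" where
  "ind_vec R = (\<lambda>(x, k) y. if y \<in> carrier G \<and> inv y \<otimes> x \<in> carrier H
     then rep_act R (inv y \<otimes> x) (basis_vec (rep_space R) k) else 0)"

lemma csubspace_induced:
  assumes "is_rep H R"
  shows "csubspace (rep_space (induced G (carrier H) R))"
proof -
  note r = is_repD[OF assms]
  show ?thesis
    using r(2) linear_on_zero[OF r(3)[OF inv_closedH] complex_vector.subspace_0[OF r(2)]]
      linear_on_add[OF r(3)[OF inv_closedH]] linear_on_scale[OF r(3)[OF inv_closedH]]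
    by (intro csubspace_I)
      (auto simp: induced_def scaleC_fun_apply complex_vector.subspace_0 complex_vector.subspace_add
        complex_vector.subspace_scale)
qed

text \<open>At a point y only the |H| elements x of yH contribute. For each of them the sum over k
  rebuilds \<open>\<phi> y\<close> from \<open>\<phi> x\<close> by equivariance, and the weight 1 /
  |H| corrects the multiplicity.\<close>

lemma induced_frame:
  assumes R: "is_rep H R"
  shows "frame (carrier G \<times> {..<cdim (rep_space R)}) (ind_vec R)
    (\<lambda>(x, k) \<phi>. (1 / of_nat (card (carrier H))) * coord (rep_space R) k (\<phi> x))
    (rep_space (induced G (carrier H) R))" (is "frame ?K _ ?\<xi> ?V")
  unfolding frame_def
proof (intro conjI ballI)
  note r = is_repD[OF R]
  note b = frameD[OF basis_coord_frame(1)[OF r(1)]]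
  show "finite ?K"
    using finite_carrier by simp
  show "csubspace ?V"
    by (rule csubspace_induced[OF R])
  fix p assume p: "p \<in> ?K"
  obtain x k where xk: "p = (x, k)" "x \<in> carrier G" "k < cdim (rep_space R)"
    using p by auto
  have "ind_vec R p (y \<otimes> h) = rep_act R (inv h) (ind_vec R p y)"
    if yh: "y \<in> carrier G" "h \<in> carrier H" for y h
  proof -
    have eq: "inv (y \<otimes> h) \<otimes> x = inv h \<otimes> (inv y \<otimes> x)"
      using yh xk by (simp add: inv_mult_group m_assoc)
    have iff: "inv (y \<otimes> h) \<otimes> x \<in> carrier H \<longleftrightarrow> inv y \<otimes> x \<in> carrier H"
      unfolding eq using yh xk by (intro mult_in_iff) auto
    show ?thesis
    proof (cases "inv y \<otimes> x \<in> carrier H")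
      case True
      then have "rep_act R (inv h \<otimes> (inv y \<otimes> x)) (basis_vec (rep_space R) k) =
          rep_act R (inv h) (rep_act R (inv y \<otimes> x) (basis_vec (rep_space R) k))"
        using r(6)[of "inv h" "inv y \<otimes> x" "basis_vec (rep_space R) k"] yh b(3)[of k] xk
        by (simp add: mult_eq)
      then show ?thesis
        using True iff eq yh by (simp add: ind_vec_def xk)
    next
      case False
      then show ?thesis
        using iff linear_on_zero[OF r(3)[of "inv h"] complex_vector.subspace_0[OF r(2)]] yh
        by (simp add: ind_vec_def xk)
    qed
  qed
  then show "ind_vec R p \<in> ?V"
    using r(4) b(3) xk complex_vector.subspace_0[OF r(2)]
    by (auto simp: induced_def ind_vec_def)
  show "linear_on ?V (?\<xi> p)"
    using xk by (auto simp: induced_def scaleC_fun_apply linear_on_add[OF b(4)] linear_on_scale[OF b(4)]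
        scaleC_complex_def algebra_simps add_divide_distrib intro!: linear_onI)
next
  note r = is_repD[OF R]
  note b = frameD[OF basis_coord_frame(1)[OF r(1)]]
  fix \<phi> assume \<phi>: "\<phi> \<in> ?V"
  let ?c = "1 / of_nat (card (carrier H)) :: complex"
  let ?d = "cdim (rep_space R)"
  show "(\<Sum>k\<in>?K. ?\<xi> k \<phi> *\<^sub>C ind_vec R k) = \<phi>" (is "?S = \<phi>")
  proof
    fix y
    show "?S y = \<phi> y"
    proof (cases "y \<in> carrier G")
      case False
      then show ?thesis
        using \<phi> by (simp add: sum_fun_apply ind_vec_def induced_def scaleC_fun_apply case_prod_unfold)
    next
      case y: True
      have inner: "(\<Sum>k<?d. (?c * coord (rep_space R) k (\<phi> x)) *\<^sub>C ind_vec R (x, k) y) =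
          (if inv y \<otimes> x \<in> carrier H then ?c *\<^sub>C \<phi> y else 0)" if x: "x \<in> carrier G" for x
      proof (cases "inv y \<otimes> x \<in> carrier H")
        case True
        have "\<phi> (y \<otimes> (inv y \<otimes> x)) = rep_act R (inv (inv y \<otimes> x)) (\<phi> y)"
          using \<phi> y True by (simp add: induced_def)
        then have "\<phi> x = rep_act R (inv (inv y \<otimes> x)) (\<phi> y)"
          using x y by (simp add: m_assoc[symmetric])
        moreover have "\<phi> y \<in> rep_space R" "\<phi> x \<in> rep_space R"
          using \<phi> x y by (auto simp: induced_def)
        ultimately have \<phi>xy: "rep_act R (inv y \<otimes> x) (\<phi> x) = \<phi> y"
          using r(6)[of "inv y \<otimes> x" "inv (inv y \<otimes> x)" "\<phi> y"] r(5)[of "\<phi> y"] True x y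
          by (simp add: mult_eq one_eq)
        have "(\<Sum>k<?d. (?c * coord (rep_space R) k (\<phi> x)) *\<^sub>C ind_vec R (x, k) y) =
            ?c *\<^sub>C (\<Sum>k<?d. coord (rep_space R) k (\<phi> x) *\<^sub>C rep_act R (inv y \<otimes> x) (basis_vec (rep_space R) k))"
          using True y by (simp add: ind_vec_def complex_vector.scale_sum_right scaleC_scaleC)
        also have "\<dots> = ?c *\<^sub>C rep_act R (inv y \<otimes> x) (\<phi> x)"
          using frame_linear[OF basis_coord_frame(1)[OF r(1)] r(3)[OF True] \<open>\<phi> x \<in> rep_space R\<close>] by simp
        finally show ?thesis
          using True \<phi>xy by simp
      qed (simp add: ind_vec_def)
      have "?S y = (\<Sum>x\<in>carrier G. \<Sum>k<?d. (?c * coord (rep_space R) k (\<phi> x)) *\<^sub>C ind_vec R (x, k) y)"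
        by (simp add: sum_fun_apply scaleC_fun_apply sum.cartesian_product case_prod_unfold)
      also have "\<dots> = (\<Sum>x\<in>carrier G. if inv y \<otimes> x \<in> carrier H then ?c *\<^sub>C \<phi> y else 0)"
        using inner by simp
      also have "\<dots> = (\<Sum>h\<in>carrier H. ?c *\<^sub>C \<phi> y)"
        by (rule sum_coset[OF y])
      also have "\<dots> = \<phi> y"
        using H.card_carrier_pos by (simp add: complex_vector.sum_constant_scale scaleC_scaleC scaleC_one)
      finally show ?thesis .
    qed
  qed
qed

lemma is_rep_induced:
  assumes R: "is_rep H R"
  shows "is_rep G (induced G (carrier H) R)"
proof (rule is_repI)
  show "fin_dim (rep_space (induced G (carrier H) R))"
    using induced_frame[OF R] by (rule frame_fin_dim)
qed (auto simp: induced_def fun_eq_iff scaleC_fun_apply m_assoc[symmetric] inv_mult_group intro!: linear_onI)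

definition ind_char :: "('g \<Rightarrow> complex) \<Rightarrow> 'g \<Rightarrow> complex" where
  "ind_char \<chi> g = (\<Sum>x\<in>carrier G. if inv x \<otimes> g \<otimes> x \<in> carrier H then \<chi> (inv x \<otimes> g \<otimes> x) else 0)
     / of_nat (card (carrier H))"

text \<open>The frame vector at (x, k), moved by g and evaluated at x, is
  \<open>inv x \<otimes> g \<otimes> x\<close> applied to the k-th basis vector, or 0 if this
  element is outside H.\<close>

lemma rep_char_induced:
  assumes R: "is_rep H R" and g: "g \<in> carrier G"
  shows "rep_char (induced G (carrier H) R) g = ind_char (rep_char R) g"
proof -
  note D = is_repD[OF is_rep_induced[OF R]]
  let ?d = "cdim (rep_space R)"
  have inner: "coord (rep_space R) k (rep_act (induced G (carrier H) R) g (ind_vec R (x, k)) x) =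
      (if inv x \<otimes> g \<otimes> x \<in> carrier H
       then coord (rep_space R) k (rep_act R (inv x \<otimes> g \<otimes> x) (basis_vec (rep_space R) k)) else 0)"
    if x: "x \<in> carrier G" and k: "k < ?d" for x k
  proof -
    have "inv (inv g \<otimes> x) \<otimes> x = inv x \<otimes> g \<otimes> x"
      using x g by (simp add: inv_mult_group m_assoc)
    moreover have "coord (rep_space R) k 0 = 0"
      using linear_on_zero[OF frameD(4)[OF basis_coord_frame(1)[OF is_repD(1)[OF R]]]]
        complex_vector.subspace_0[OF is_repD(2)[OF R]] k by auto
    ultimately show ?thesis
      using x g by (simp add: induced_def ind_vec_def)
  qed
  have "rep_char (induced G (carrier H) R) g = (\<Sum>x\<in>carrier G. \<Sum>k<?d.
      (1 / of_nat (card (carrier H))) * coord (rep_space R) k (rep_act (induced G (carrier H) R) g (ind_vec R (x, k)) x))"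
    unfolding rep_char_def
    by (subst trace_on_frame[OF induced_frame[OF R] D(3)[OF g]])
      (use D(4)[OF g] in \<open>auto simp: sum.cartesian_product case_prod_unfold\<close>)
  also have "\<dots> = (\<Sum>x\<in>carrier G. \<Sum>k<?d. (1 / of_nat (card (carrier H))) *
      (if inv x \<otimes> g \<otimes> x \<in> carrier H
       then coord (rep_space R) k (rep_act R (inv x \<otimes> g \<otimes> x) (basis_vec (rep_space R) k)) else 0))"
    using inner by simp
  also have "\<dots> = ind_char (rep_char R) g"
    unfolding ind_char_def rep_char_def trace_on_def sum_divide_distrib
    by (intro sum.cong refl) (simp add: sum_divide_distrib)
  finally show ?thesis .
qed

lemma sum_conjugate:
  assumes "x \<in> carrier G"
  shows "(\<Sum>g\<in>carrier G. f (inv x \<otimes> g \<otimes> x)) = (\<Sum>g\<in>carrier G. f g)"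
  using sum_translate_right[OF assms, of f] sum_translate[of "inv x" "\<lambda>g. f (g \<otimes> x)"] assms by simp

text \<open>Since \<psi> is a class function, every conjugation by x contributes the same sum, and
  the |G| equal contributions cancel the normalisation over G.\<close>

lemma frobenius_reciprocity:
  assumes "\<And>g x. g \<in> carrier G \<Longrightarrow> x \<in> carrier G \<Longrightarrow> \<psi> (inv x \<otimes> g \<otimes> x) = \<psi> g"
  shows "char_ip \<psi> (ind_char \<chi>) = H.char_ip \<psi> \<chi>"
proof -
  define f where "f g = (if g \<in> carrier H then \<psi> (inv g) * \<chi> g else 0)" for g
  let ?h = "of_nat (card (carrier H)) :: complex"
  have "(\<Sum>g\<in>carrier G. \<psi> (inv g) * ind_char \<chi> g) =
      (\<Sum>g\<in>carrier G. \<Sum>x\<in>carrier G. f (inv x \<otimes> g \<otimes> x)) / ?h"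
    unfolding ind_char_def sum_divide_distrib times_divide_eq_right sum_distrib_left
  proof (intro sum.cong refl)
    fix g x assume g: "g \<in> carrier G" and x: "x \<in> carrier G"
    have "inv (inv x \<otimes> g \<otimes> x) = inv x \<otimes> inv g \<otimes> x"
      using g x by (simp add: inv_mult_group m_assoc)
    then have "\<psi> (inv (inv x \<otimes> g \<otimes> x)) = \<psi> (inv g)"
      using assms[of "inv g" x] g x by simp
    then show "\<psi> (inv g) * (if inv x \<otimes> g \<otimes> x \<in> carrier H then \<chi> (inv x \<otimes> g \<otimes> x) else 0) / ?h =
        f (inv x \<otimes> g \<otimes> x) / ?h"
      by (simp add: f_def)
  qed
  also have "(\<Sum>g\<in>carrier G. \<Sum>x\<in>carrier G. f (inv x \<otimes> g \<otimes> x)) =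
      (\<Sum>x\<in>carrier G. \<Sum>g\<in>carrier G. f (inv x \<otimes> g \<otimes> x))"
    by (rule sum.swap)
  also have "\<dots> = of_nat (card (carrier G)) * (\<Sum>g\<in>carrier G. f g)"
    by (simp add: sum_conjugate)
  also have "(\<Sum>g\<in>carrier G. f g) = (\<Sum>h\<in>carrier H. \<psi> (inv\<^bsub>H\<^esub> h) * \<chi> h)"
    unfolding f_def sum_carrierH by (simp add: inv_eq)
  finally show ?thesis
    using card_carrier_pos by (simp add: char_ip_def H.char_ip_def)
qed

end

text \<open>The regular representation is obtained by inducing the trivial representation of the
  trivial subgroup. By Frobenius reciprocity an irreducible V occurs in it dim V times; in the sum
  of dim U_i copies of the U_i it occurs equally often, because V is isomorphic to exactly one U_i.
  This is where completeness of the list \<open>Us\<close> enters.\<close>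

lemma (in fin_group) regular_character:
  assumes Irr: "is_Irr G Us" and f: "f \<in> carrier G"
  shows "(\<Sum>i<length Us. of_nat (rep_dim (Us ! i)) * rep_char (Us ! i) f) =
    (if f = \<one> then of_nat (card (carrier G)) else 0)"
proof -
  define H where "H = \<lparr>carrier = {\<one>}, monoid.mult = mult G, one = \<one>\<rparr>"
  have gH: "group H"
    by (rule groupI) (auto simp: H_def)
  interpret S: fin_subgroup G H
    by (intro fin_subgroup.intro fin_subgroup_axioms.intro gH fin_group_axioms) (auto simp: H_def)
  define T :: "('a, complex) rep" where "T = \<lparr>rep_space = UNIV, rep_act = (\<lambda>g v. v)\<rparr>"
  have fr: "frame {()} (\<lambda>_. 1) (\<lambda>_ v. v) (UNIV :: complex set)"
    by (auto simp: frame_def linear_on_id scaleC_complex_def)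
  have T: "is_rep H T"
    using frame_fin_dim[OF fr] by (intro is_repI) (auto simp: T_def linear_on_id)
  have charT: "rep_char T g = 1" for g
    using trace_on_frame[OF fr linear_on_id] by (simp add: rep_char_def T_def)
  let ?A = "induced G (carrier H) T"
  let ?B = "direct_sum {..<length Us} (\<lambda>i. copies (rep_dim (Us ! i)) (Us ! i))"
  have irr: "irreducible_rep G (Us ! i)" if "i < length Us" for i
    using Irr that by (auto simp: is_Irr_def)
  have B: "is_rep G ?B"
    using irr irreducible_repD(1) by (intro is_rep_direct_sum is_rep_copies) auto
  have charB: "rep_char ?B g = (\<Sum>i<length Us. of_nat (rep_dim (Us ! i)) * rep_char (Us ! i) g)"
    if "g \<in> carrier G" for g
    using irr irreducible_repD(1) that
    by (subst rep_char_direct_sum[of _ G]) (auto simp: rep_char_copies[of G] intro!: is_rep_copies sum.cong)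
  have "rep_iso G ?A ?B"
  proof (rule rep_iso_of_char_ip[OF S.is_rep_induced[OF T] B])
    fix V :: "('a, nat \<Rightarrow> complex) rep" assume V: "irreducible_rep G V"
    note V' = irreducible_repD(1)[OF V]
    have "char_ip (rep_char V) (rep_char ?A) = char_ip (rep_char V) (S.ind_char (rep_char T))"
      using S.rep_char_induced[OF T] by (intro char_ip_cong) auto
    also have "\<dots> = S.H.char_ip (rep_char V) (rep_char T)"
      using rep_char_conj[OF V'] by (intro S.frobenius_reciprocity) auto
    also have "\<dots> = rep_char V \<one>"
      unfolding S.H.char_ip_def using S.inv_eq[of \<one>] by (simp add: H_def charT)
    also have "\<dots> = of_nat (rep_dim V)"
      using trace_on_cong[OF is_repD(1)[OF V'] is_repD(5)[OF V']] trace_on_id[OF is_repD(1)[OF V']]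
      by (simp add: rep_char_def rep_dim_def)
    finally have A: "char_ip (rep_char V) (rep_char ?A) = of_nat (rep_dim V)" .
    obtain j where j: "j < length Us" "rep_iso G V (Us ! j)"
      using Irr V unfolding is_Irr_def by blast
    have iso: "rep_iso G V (Us ! i) \<longleftrightarrow> i = j" if "i < length Us" for i
      using Irr j that rep_iso_trans[OF rep_iso_sym[OF j(2)], of "Us ! i"] unfolding is_Irr_def by metis
    have "char_ip (rep_char V) (rep_char ?B) =
        (\<Sum>i<length Us. of_nat (rep_dim (Us ! i)) * char_ip (rep_char V) (rep_char (Us ! i)))"
      unfolding char_ip_scale[symmetric] char_ip_sum[symmetric] using charB by (intro char_ip_cong) auto
    also have "\<dots> = (\<Sum>i<length Us. if i = j then of_nat (rep_dim (Us ! i)) else 0)"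
      using char_ip_irreducible_pair[OF V irr] iso by (intro sum.cong) auto
    also have "\<dots> = of_nat (rep_dim V)"
      using j rep_iso_dim[OF j(2)] by (simp add: rep_dim_def)
    finally show "char_ip (rep_char V) (rep_char ?A) = char_ip (rep_char V) (rep_char ?B)"
      using A by simp
  qed
  then have "rep_char ?B f = S.ind_char (rep_char T) f"
    using rep_iso_char[OF _ f] S.rep_char_induced[OF T f] by metis
  also have "\<dots> = (\<Sum>x\<in>carrier G. if f = \<one> then 1 else 0)"
  proof -
    have "inv x \<otimes> f \<otimes> x = \<one> \<longleftrightarrow> f = \<one>" if x: "x \<in> carrier G" for x
    proof
      assume "inv x \<otimes> f \<otimes> x = \<one>"
      then have "x \<otimes> (inv x \<otimes> f \<otimes> x) \<otimes> inv x = x \<otimes> \<one> \<otimes> inv x"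
        by simp
      then show "f = \<one>"
        using x f by (simp add: m_assoc) (simp add: m_assoc[symmetric])
    qed (use x f in simp)
    then show ?thesis
      unfolding S.ind_char_def charT by (simp add: H_def)
  qed
  finally show ?thesis
    using charB[OF f] by simp
qed

section \<open>Tensor products\<close>

lemma multilinear_formsD:
  "M \<in> multilinear_forms I V \<Longrightarrow> u \<in> Pi\<^sub>E I V \<Longrightarrow> i \<in> I \<Longrightarrow> linear_on (V i) (\<lambda>v. M (u(i := v)))"
  by (simp add: multilinear_forms_def)

lemma product_form:
  assumes "finite I" "\<And>i. i \<in> I \<Longrightarrow> linear_on (V i) (\<xi> i)"
  shows "(\<lambda>u. \<Prod>i\<in>I. \<xi> i (u i)) \<in> multilinear_forms I V"
  unfolding multilinear_forms_def
proof (intro CollectI ballI)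
  fix u i assume i: "i \<in> I"
  have "(\<Prod>j\<in>I. \<xi> j ((u(i := v)) j)) = (\<Prod>j\<in>I - {i}. \<xi> j (u j)) * \<xi> i v" for v
  proof -
    have "(\<Prod>j\<in>I. \<xi> j ((u(i := v)) j)) = \<xi> i v * (\<Prod>j\<in>I - {i}. \<xi> j ((u(i := v)) j))"
      using prod.remove[OF assms(1) i, of "\<lambda>j. \<xi> j ((u(i := v)) j)"] by simp
    also have "(\<Prod>j\<in>I - {i}. \<xi> j ((u(i := v)) j)) = (\<Prod>j\<in>I - {i}. \<xi> j (u j))"
      by (intro prod.cong) auto
    finally show ?thesis
      by (simp add: mult.commute)
  qed
  then show "linear_on (V i) (\<lambda>v. \<Prod>j\<in>I. \<xi> j ((u(i := v)) j))"
    using linear_on_scaled[OF assms(2)[OF i], of "\<Prod>j\<in>I - {i}. \<xi> j (u j)"]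
    by (simp add: scaleC_complex_def)
qed

text \<open>The arguments are expanded one at a time, those with index in J being done; J = I
  expresses M by its values on frame vectors.\<close>

lemma multilinear_expansion:
  assumes J: "finite J" "J \<subseteq> I" and f: "\<And>i. i \<in> I \<Longrightarrow> frame (K i) (e i) (\<xi> i) (V i)"
    and M: "M \<in> multilinear_forms I V" and u: "u \<in> Pi\<^sub>E I V"
  shows "M u = (\<Sum>k\<in>Pi\<^sub>E J K. (\<Prod>i\<in>J. \<xi> i (k i) (u i)) * M (\<lambda>i. if i \<in> J then e i (k i) else u i))"
  using J
proof (induction J rule: finite_induct)
  case (insert j J)
  then have j: "j \<in> I" and J: "J \<subseteq> I"
    by auto
  note fr = frameD[OF f]
  have uj: "u j \<in> V j"
    using u j by auto
  have step: "M (\<lambda>i. if i \<in> J then e i (k i) else u i) =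
      (\<Sum>y\<in>K j. \<xi> j y (u j) * M (\<lambda>i. if i \<in> insert j J then e i ((k(j := y)) i) else u i))"
    if k: "k \<in> Pi\<^sub>E J K" for k
  proof -
    let ?w = "\<lambda>i. if i \<in> J then e i (k i) else u i"
    have w: "?w \<in> Pi\<^sub>E I V"
    proof
      fix i assume "i \<in> I"
      then show "?w i \<in> V i"
        using u k fr(3) by (cases "i \<in> J") auto
    next
      fix i assume "i \<notin> I"
      then show "?w i = undefined"
        using u J by auto
    qed
    have "M ?w = M (?w(j := u j))"
      using insert.hyps(2) by (intro arg_cong[where f = M]) auto
    also have "\<dots> = (\<Sum>y\<in>K j. \<xi> j y (u j) * M (?w(j := e j y)))"
      using frame_linear_complex[OF f[OF j] multilinear_formsD[OF M w j] uj] by simp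
    also have "\<dots> = (\<Sum>y\<in>K j. \<xi> j y (u j) * M (\<lambda>i. if i \<in> insert j J then e i ((k(j := y)) i) else u i))"
      using insert.hyps(2)
      by (intro sum.cong refl arg_cong2[of _ _ _ _ "(*)"] arg_cong[where f = M]) auto
    finally show ?thesis .
  qed
  let ?g = "\<lambda>k. (\<Prod>i\<in>insert j J. \<xi> i (k i) (u i)) * M (\<lambda>i. if i \<in> insert j J then e i (k i) else u i)"
  have "M u = (\<Sum>k\<in>Pi\<^sub>E J K. (\<Prod>i\<in>J. \<xi> i (k i) (u i)) * M (\<lambda>i. if i \<in> J then e i (k i) else u i))"
    using insert.IH J by simp
  also have "\<dots> = (\<Sum>k\<in>Pi\<^sub>E J K. \<Sum>y\<in>K j. ?g (k(j := y)))"
  proof (rule sum.cong[OF refl])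
    fix k assume k: "k \<in> Pi\<^sub>E J K"
    have *: "(\<Prod>i\<in>J. \<xi> i ((k(j := y)) i) (u i)) = (\<Prod>i\<in>J. \<xi> i (k i) (u i))" for y
      using insert.hyps(2) by (intro prod.cong) auto
    show "(\<Prod>i\<in>J. \<xi> i (k i) (u i)) * M (\<lambda>i. if i \<in> J then e i (k i) else u i) = (\<Sum>y\<in>K j. ?g (k(j := y)))"
      unfolding step[OF k] prod.insert[OF insert.hyps(1,2)] * sum_distrib_left
      by (intro sum.cong refl) (simp add: mult_ac)
  qed
  also have "\<dots> = (\<Sum>(y, k)\<in>K j \<times> Pi\<^sub>E J K. ?g (k(j := y)))"
    by (subst sum.swap) (simp add: sum.cartesian_product)
  also have "\<dots> = (\<Sum>k\<in>Pi\<^sub>E (insert j J) K. ?g k)"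
    unfolding PiE_insert_eq
    by (subst sum.reindex[OF inj_combinator[OF insert.hyps(2)]]) (simp add: case_prod_unfold comp_def)
  finally show ?case .
qed simp

text \<open>A tensor is a functional on multilinear forms, so its coordinate at k is its value on
  the product of the coordinate functionals. On pure tensors the frame identity is the expansion of
  a multilinear form, and both sides are linear.\<close>

lemma tensor_frame:
  assumes I: "finite I" and f: "\<And>i. i \<in> I \<Longrightarrow> frame (K i) (e i) (\<xi> i) (V i)"
  shows "frame (Pi\<^sub>E I K) (\<lambda>k. pure_tensor I V (\<lambda>i\<in>I. e i (k i)))
    (\<lambda>k t. t (\<lambda>u. \<Prod>i\<in>I. \<xi> i (k i) (u i))) (tensor_space I V)"
  unfolding frame_def
proof (intro conjI ballI)
  note fr = frameD[OF f]
  show "finite (Pi\<^sub>E I K)"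
    using I fr(1) by (rule finite_PiE)
  show "csubspace (tensor_space I V)"
    unfolding tensor_space_def by (rule complex_vector.subspace_span)
  fix k assume k: "k \<in> Pi\<^sub>E I K"
  show "pure_tensor I V (\<lambda>i\<in>I. e i (k i)) \<in> tensor_space I V"
    unfolding tensor_space_def using PiE_mem[OF k] fr(3)
    by (intro complex_vector.span_base imageI) auto
  show "linear_on (tensor_space I V) (\<lambda>t. t (\<lambda>u. \<Prod>i\<in>I. \<xi> i (k i) (u i)))"
    by (intro linear_onI) (simp_all add: scaleC_fun_apply)
next
  note fr = frameD[OF f]
  fix t assume t: "t \<in> tensor_space I V"
  let ?m = "\<lambda>k u. \<Prod>i\<in>I. \<xi> i (k i) (u i)"
  let ?e = "\<lambda>k. pure_tensor I V (\<lambda>i\<in>I. e i (k i))"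
  have m: "?m k \<in> multilinear_forms I V" if "k \<in> Pi\<^sub>E I K" for k
    using that fr(4) by (intro product_form I) auto
  show "(\<Sum>k\<in>Pi\<^sub>E I K. t (?m k) *\<^sub>C ?e k) = t"
  proof (rule linear_on_span_eq[where S = "\<lambda>t. \<Sum>k\<in>Pi\<^sub>E I K. t (?m k) *\<^sub>C ?e k" and T = "\<lambda>t. t"
        and B = "pure_tensor I V ` Pi\<^sub>E I V"])
    fix b assume "b \<in> pure_tensor I V ` Pi\<^sub>E I V"
    then obtain u where u: "u \<in> Pi\<^sub>E I V" "b = pure_tensor I V u"
      by auto
    show "(\<Sum>k\<in>Pi\<^sub>E I K. b (?m k) *\<^sub>C ?e k) = b"
    proof
      fix M
      show "(\<Sum>k\<in>Pi\<^sub>E I K. b (?m k) *\<^sub>C ?e k) M = b M"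
      proof (cases "M \<in> multilinear_forms I V")
        case True
        \<comment> \<open>Outside I both families have the value \<open>undefined\<close>.\<close>
        have eq: "(\<lambda>i\<in>I. e i (k i)) = (\<lambda>i. if i \<in> I then e i (k i) else u i)" for k
          using PiE_arb[OF u(1)] by (simp add: restrict_def fun_eq_iff)
        have "(\<Sum>k\<in>Pi\<^sub>E I K. b (?m k) *\<^sub>C ?e k) M =
            (\<Sum>k\<in>Pi\<^sub>E I K. ?m k u * M (\<lambda>i\<in>I. e i (k i)))"
          unfolding sum_fun_apply using m True u(2)
          by (intro sum.cong) (auto simp: scaleC_fun_apply scaleC_complex_def pure_tensor_def)
        also have "\<dots> = (\<Sum>k\<in>Pi\<^sub>E I K. ?m k u * M (\<lambda>i. if i \<in> I then e i (k i) else u i))"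
          unfolding eq ..
        also have "\<dots> = M u"
          using multilinear_expansion[OF I subset_refl f True u(1)] by simp
        finally show ?thesis
          using True u(2) by (simp add: pure_tensor_def)
      next
        case False
        then show ?thesis
          using u(2) by (simp add: sum_fun_apply scaleC_fun_apply pure_tensor_def)
      qed
    qed
  next
    show "linear_on (cspan (pure_tensor I V ` Pi\<^sub>E I V)) (\<lambda>t. \<Sum>k\<in>Pi\<^sub>E I K. t (?m k) *\<^sub>C ?e k)"
      by (intro linear_on_sum_fun linear_on_rank_one linear_onI) (simp_all add: scaleC_fun_apply)
  qed (use t in \<open>auto simp: tensor_space_def linear_on_id\<close>)
qed

lemma linear_on_tensor_map: "linear_on W (tensor_map I V A)"
  by (rule linear_onI) (auto simp: tensor_map_def fun_eq_iff scaleC_fun_apply)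

text \<open>The first clause keeps \<open>tensor_map\<close> inside the tensor space, the second
  makes it send the pure tensor of u to that of \<open>A u\<close>.\<close>

definition multilinear_endo ::
  "'i set \<Rightarrow> ('i \<Rightarrow> 'v::complex_vector set) \<Rightarrow> (('i \<Rightarrow> 'v) \<Rightarrow> 'i \<Rightarrow> 'v) \<Rightarrow> bool" where
  "multilinear_endo I V A \<longleftrightarrow> (\<forall>u\<in>Pi\<^sub>E I V. A u \<in> Pi\<^sub>E I V) \<and>
     (\<forall>M\<in>multilinear_forms I V. (\<lambda>u. M (A u)) \<in> multilinear_forms I V)"

lemma tensor_map_pure:
  "multilinear_endo I V A \<Longrightarrow> tensor_map I V A (pure_tensor I V u) = pure_tensor I V (A u)"
  by (rule tensor_map_pure_tensor) (auto simp: multilinear_endo_def)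

lemma tensor_map_closed:
  assumes A: "multilinear_endo I V A" and t: "t \<in> tensor_space I V"
  shows "tensor_map I V A t \<in> tensor_space I V"
  unfolding tensor_space_def
proof (rule linear_on_span_closed[OF linear_on_tensor_map])
  show "t \<in> cspan (pure_tensor I V ` Pi\<^sub>E I V)"
    using t by (simp add: tensor_space_def)
  fix b assume "b \<in> pure_tensor I V ` Pi\<^sub>E I V"
  then show "tensor_map I V A b \<in> cspan (pure_tensor I V ` Pi\<^sub>E I V)"
    using A by (auto simp: tensor_map_pure multilinear_endo_def intro!: complex_vector.span_base)
qed (rule complex_vector.subspace_span)

lemma tensor_map_id:
  assumes A: "multilinear_endo I V A" "\<And>u. u \<in> Pi\<^sub>E I V \<Longrightarrow> A u = u" and t: "t \<in> tensor_space I V"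
  shows "tensor_map I V A t = t"
proof (rule linear_on_span_eq[OF linear_on_tensor_map linear_on_id])
  show "t \<in> cspan (pure_tensor I V ` Pi\<^sub>E I V)"
    using t by (simp add: tensor_space_def)
qed (use A in \<open>auto simp: tensor_map_pure\<close>)

lemma tensor_map_comp:
  assumes "multilinear_endo I V A" "multilinear_endo I V B" "multilinear_endo I V C"
    and "\<And>u. u \<in> Pi\<^sub>E I V \<Longrightarrow> C u = A (B u)" and t: "t \<in> tensor_space I V"
  shows "tensor_map I V C t = tensor_map I V A (tensor_map I V B t)"
proof (rule linear_on_span_eq[OF linear_on_tensor_map, where T = "\<lambda>t. tensor_map I V A (tensor_map I V B t)"])
  show "t \<in> cspan (pure_tensor I V ` Pi\<^sub>E I V)"
    using t by (simp add: tensor_space_def)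
  show "linear_on (cspan (pure_tensor I V ` Pi\<^sub>E I V)) (\<lambda>t. tensor_map I V A (tensor_map I V B t))"
    by (rule linear_on_compose[OF linear_on_tensor_map linear_on_tensor_map, where W = UNIV]) simp
qed (use assms in \<open>auto simp: tensor_map_pure\<close>)

text \<open>Permuting the tensor factors while applying linear maps covers both the outer tensor product
  (\<open>\<sigma> = id\<close>) and the action of the wreath product.\<close>

lemma multilinear_endo_twist:
  assumes \<sigma>: "bij_betw \<sigma> I I"
    and L: "\<And>x. x \<in> I \<Longrightarrow> linear_on (V (\<sigma> x)) (L x)" "\<And>x. x \<in> I \<Longrightarrow> L x \<in> V (\<sigma> x) \<rightarrow> V x"
  shows "multilinear_endo I V (\<lambda>u. \<lambda>x\<in>I. L x (u (\<sigma> x)))"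
  unfolding multilinear_endo_def
proof (intro conjI ballI)
  have \<sigma>I: "\<sigma> x \<in> I" if "x \<in> I" for x
    using \<sigma> that by (auto simp: bij_betw_def)
  show *: "(\<lambda>x\<in>I. L x (u (\<sigma> x))) \<in> Pi\<^sub>E I V" if "u \<in> Pi\<^sub>E I V" for u
    using L(2) \<sigma>I that by fastforce
  fix M assume M: "M \<in> multilinear_forms I V"
  show "(\<lambda>u. M (\<lambda>x\<in>I. L x (u (\<sigma> x)))) \<in> multilinear_forms I V"
    unfolding multilinear_forms_def
  proof (intro CollectI ballI)
    fix u i assume u: "u \<in> Pi\<^sub>E I V" and i: "i \<in> I"
    \<comment> \<open>Varying u at i changes the image only at the one position that \<sigma> sends
      to i.\<close>
    obtain j where j: "j \<in> I" "\<sigma> j = i"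
      using \<sigma> i unfolding bij_betw_def by (metis imageE)
    have ji: "\<sigma> x = i \<longleftrightarrow> x = j" if "x \<in> I" for x
      using \<sigma> j that by (auto simp: bij_betw_def inj_on_def)
    have "(\<lambda>x\<in>I. L x ((u(i := v)) (\<sigma> x))) = (\<lambda>x\<in>I. L x (u (\<sigma> x)))(j := L j v)" for v
      using j ji by auto
    moreover have "linear_on (V i) (\<lambda>v. M ((\<lambda>x\<in>I. L x (u (\<sigma> x)))(j := L j v)))"
      using linear_on_compose[OF L(1)[OF j(1)] multilinear_formsD[OF M *[OF u] j(1)] L(2)[OF j(1)]] j
      by simp
    ultimately show "linear_on (V i) (\<lambda>v. M (\<lambda>x\<in>I. L x ((u(i := v)) (\<sigma> x))))"
      by simp
  qed
qed

text \<open>In the frame of pure tensors of basis vectors the diagonal entry at k is a product whose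
  factor at x is the matrix entry of \<open>L x\<close> in row \<open>k x\<close> and column
  \<open>k (\<sigma> x)\<close>.\<close>

lemma trace_twist:
  assumes I: "finite I" and V: "\<And>i. i \<in> I \<Longrightarrow> fin_dim (V i)" and \<sigma>: "bij_betw \<sigma> I I"
    and L: "\<And>x. x \<in> I \<Longrightarrow> linear_on (V (\<sigma> x)) (L x)" "\<And>x. x \<in> I \<Longrightarrow> L x \<in> V (\<sigma> x) \<rightarrow> V x"
  shows "trace_on (tensor_space I V) (tensor_map I V (\<lambda>u. \<lambda>x\<in>I. L x (u (\<sigma> x)))) =
    (\<Sum>k\<in>(\<Pi>\<^sub>E x\<in>I. {..<cdim (V x)}). \<Prod>x\<in>I. coord (V x) (k x) (L x (basis_vec (V (\<sigma> x)) (k (\<sigma> x)))))"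
proof -
  have f: "frame {..<cdim (V i)} (basis_vec (V i)) (coord (V i)) (V i)" if "i \<in> I" for i
    using basis_coord_frame(1)[OF V[OF that]] .
  note m = multilinear_endo_twist[where V = V and L = L, OF \<sigma>]
  have m: "multilinear_endo I V (\<lambda>u. \<lambda>x\<in>I. L x (u (\<sigma> x)))"
    using L by (rule m)
  have fr: "frame (\<Pi>\<^sub>E x\<in>I. {..<cdim (V x)}) (\<lambda>k. pure_tensor I V (\<lambda>i\<in>I. basis_vec (V i) (k i)))
    (\<lambda>k t. t (\<lambda>u. \<Prod>i\<in>I. coord (V i) (k i) (u i))) (tensor_space I V)"
    using I f by (rule tensor_frame)
  have \<sigma>I: "\<sigma> x \<in> I" if "x \<in> I" for x
    using \<sigma> that by (auto simp: bij_betw_def)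
  have ml: "(\<lambda>u. \<Prod>i\<in>I. coord (V i) (k i) (u i)) \<in> multilinear_forms I V"
    if "k \<in> (\<Pi>\<^sub>E x\<in>I. {..<cdim (V x)})" for k
    using that frameD(4)[OF f] by (intro product_form I) auto
  have closed: "tensor_map I V (\<lambda>u. \<lambda>x\<in>I. L x (u (\<sigma> x))) \<in> tensor_space I V \<rightarrow> tensor_space I V"
    using tensor_map_closed[OF m] by auto
  show ?thesis
    unfolding trace_on_frame[OF fr linear_on_tensor_map closed] tensor_map_pure[OF m]
    using ml \<sigma>I by (intro sum.cong prod.cong refl) (auto simp: pure_tensor_def intro!: prod.cong)
qed

section \<open>Characters of tensor products\<close>

definition matrix_coef :: "('g, 'v::complex_vector) rep \<Rightarrow> 'g \<Rightarrow> nat \<Rightarrow> nat \<Rightarrow> complex" where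
  "matrix_coef R g a b = coord (rep_space R) a (rep_act R g (basis_vec (rep_space R) b))"

lemma rep_char_matrix_coef: "rep_char R g = (\<Sum>a<rep_dim R. matrix_coef R g a a)"
  by (simp add: rep_char_def trace_on_def matrix_coef_def rep_dim_def)

text \<open>When no factors are permuted, the sum over all index families of products of diagonal
  entries is the product of the separate sums.\<close>

lemma rep_char_outer_tensor:
  assumes I: "finite I" and R: "\<And>i. i \<in> I \<Longrightarrow> is_rep (G i) (R i)" "\<And>i. i \<in> I \<Longrightarrow> g i \<in> carrier (G i)"
  shows "rep_char (outer_tensor I R) g = (\<Prod>i\<in>I. rep_char (R i) (g i))"
proof -
  have "rep_char (outer_tensor I R) g =
      (\<Sum>k\<in>(\<Pi>\<^sub>E x\<in>I. {..<cdim (rep_space (R x))}). \<Prod>x\<in>I. matrix_coef (R x) (g x) (k x) (k x))"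
    unfolding rep_char_def outer_tensor_def rep.simps matrix_coef_def
    by (rule trace_twist[OF I, where \<sigma> = "\<lambda>x. x"])
      (use R is_repD[OF R(1)] in \<open>auto simp: bij_betw_def\<close>)
  then show ?thesis
    unfolding rep_char_matrix_coef rep_dim_def by (subst prod_sum_PiE) (use I in auto)
qed

lemma outer_tensor_multilinear:
  assumes R: "\<And>i. i \<in> I \<Longrightarrow> is_rep (G i) (R i)" "\<And>i. i \<in> I \<Longrightarrow> g i \<in> carrier (G i)"
  shows "multilinear_endo I (\<lambda>i. rep_space (R i)) (\<lambda>u. \<lambda>i\<in>I. rep_act (R i) (g i) (u i))"
  by (rule multilinear_endo_twist[where \<sigma> = "\<lambda>x. x"])
    (use R is_repD[OF R(1)] in \<open>auto simp: bij_betw_def\<close>)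

subsection \<open>Inner tensor products\<close>

text \<open>As for \<open>tensor_frame\<close>, the coordinate at (k, l) is the value on the
  bilinear form made of the two functionals; a bilinear form is expanded first in one argument, then
  in the other.\<close>

lemma inner_tensor_frame:
  assumes f: "frame K e \<xi> (rep_space R)" and g: "frame L d \<eta> (rep_space S)"
  shows "frame (K \<times> L) (\<lambda>(k, l). pure_tensor2 (rep_space R) (rep_space S) (e k) (d l))
    (\<lambda>(k, l) t. t (\<lambda>v w. \<xi> k v * \<eta> l w)) (rep_space (inner_tensor R S))"
  unfolding frame_def
proof (intro conjI ballI)
  note f' = frameD[OF f] and g' = frameD[OF g]
  let ?V = "rep_space R" and ?W = "rep_space S"
  show "finite (K \<times> L)"
    using f'(1) g'(1) by simp
  show "csubspace (rep_space (inner_tensor R S))"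
    by (simp add: inner_tensor_def complex_vector.subspace_span)
  fix p assume p: "p \<in> K \<times> L"
  show "(case p of (k, l) \<Rightarrow> pure_tensor2 ?V ?W (e k) (d l)) \<in> rep_space (inner_tensor R S)"
    using p f'(3) g'(3) by (auto simp: inner_tensor_def intro!: complex_vector.span_base)
  show "linear_on (rep_space (inner_tensor R S)) ((\<lambda>(k, l) t. t (\<lambda>v w. \<xi> k v * \<eta> l w)) p)"
    by (intro linear_onI) (simp_all add: scaleC_fun_apply case_prod_unfold)
next
  note f' = frameD[OF f] and g' = frameD[OF g]
  let ?V = "rep_space R" and ?W = "rep_space S"
  fix t assume t: "t \<in> rep_space (inner_tensor R S)"
  let ?S = "\<lambda>t. \<Sum>p\<in>K \<times> L. (\<lambda>(k, l) t. t (\<lambda>v w. \<xi> k v * \<eta> l w)) p t *\<^sub>C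
    (case p of (k, l) \<Rightarrow> pure_tensor2 ?V ?W (e k) (d l))"
  have m: "(\<lambda>v w. \<xi> k v * \<eta> l w) \<in> bilinear_forms ?V ?W" if "k \<in> K" "l \<in> L" for k l
    using f'(4)[OF that(1)] g'(4)[OF that(2)]
    by (auto simp: bilinear_forms_def scaleC_complex_def linear_on_def algebra_simps)
  show "?S t = t"
  proof (rule linear_on_span_eq[where S = ?S and T = "\<lambda>t. t"
        and B = "{pure_tensor2 ?V ?W v w |v w. v \<in> ?V \<and> w \<in> ?W}"])
    fix b assume "b \<in> {pure_tensor2 ?V ?W v w |v w. v \<in> ?V \<and> w \<in> ?W}"
    then obtain v w where vw: "v \<in> ?V" "w \<in> ?W" "b = pure_tensor2 ?V ?W v w"
      by auto
    show "?S b = b"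
    proof
      fix B
      show "?S b B = b B"
      proof (cases "B \<in> bilinear_forms ?V ?W")
        case True
        then have lin: "linear_on ?V (\<lambda>v. B v w)" "\<And>v. v \<in> ?V \<Longrightarrow> linear_on ?W (\<lambda>w. B v w)"
          using vw by (auto simp: bilinear_forms_def)
        have "?S b B = (\<Sum>k\<in>K. \<Sum>l\<in>L. \<xi> k v * \<eta> l w * B (e k) (d l))"
          unfolding sum_fun_apply sum.cartesian_product using m True vw
          by (intro sum.cong) (auto simp: scaleC_fun_apply scaleC_complex_def pure_tensor2_def)
        also have "\<dots> = (\<Sum>k\<in>K. \<xi> k v * (\<Sum>l\<in>L. \<eta> l w * B (e k) (d l)))"
          by (simp add: sum_distrib_left mult.assoc)
        also have "\<dots> = (\<Sum>k\<in>K. \<xi> k v * B (e k) w)"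
          using frame_linear_complex[OF g lin(2)[OF f'(3)] vw(2)] by simp
        also have "\<dots> = B v w"
          using frame_linear_complex[OF f lin(1) vw(1)] by simp
        finally show ?thesis
          using True vw by (simp add: pure_tensor2_def)
      next
        case False
        then show ?thesis
          using vw by (auto simp: sum_fun_apply scaleC_fun_apply pure_tensor2_def case_prod_unfold)
      qed
    qed
  next
    show "linear_on (cspan {pure_tensor2 ?V ?W v w |v w. v \<in> ?V \<and> w \<in> ?W}) ?S"
      by (intro linear_on_sum_fun linear_on_rank_one linear_onI) (auto simp: scaleC_fun_apply)
  qed (use t in \<open>auto simp: inner_tensor_def linear_on_id\<close>)
qed

lemma linear_on_inner_tensor: "linear_on W (rep_act (inner_tensor R S) g)"
  by (rule linear_onI) (auto simp: inner_tensor_def fun_eq_iff scaleC_fun_apply)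

lemma is_rep_inner_tensor:
  assumes R: "is_rep G R" and S: "is_rep G S" and G: "group G"
  shows "is_rep G (inner_tensor R S)"
proof (rule is_repI)
  interpret group G by (rule G)
  note r = is_repD[OF R] and s = is_repD[OF S]
  let ?B = "{pure_tensor2 (rep_space R) (rep_space S) v w |v w. v \<in> rep_space R \<and> w \<in> rep_space S}"
  let ?a = "rep_act (inner_tensor R S)"
  have sp: "rep_space (inner_tensor R S) = cspan ?B"
    by (simp add: inner_tensor_def)
  note act = inner_tensor_pure_tensor2[OF R S]
  show "fin_dim (rep_space (inner_tensor R S))"
    using inner_tensor_frame[OF basis_coord_frame(1)[OF r(1)] basis_coord_frame(1)[OF s(1)]]
    by (rule frame_fin_dim)
  show closed: "?a g v \<in> rep_space (inner_tensor R S)"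
    if g: "g \<in> carrier G" and v: "v \<in> rep_space (inner_tensor R S)" for g v
    unfolding sp
  proof (rule linear_on_span_closed[OF linear_on_inner_tensor _ complex_vector.subspace_span])
    show "?a g b \<in> cspan ?B" if "b \<in> ?B" for b
    proof -
      obtain v w where vw: "v \<in> rep_space R" "w \<in> rep_space S"
        "b = pure_tensor2 (rep_space R) (rep_space S) v w"
        using \<open>b \<in> ?B\<close> by auto
      have "?a g b \<in> ?B"
        unfolding vw(3) act[OF g] using r(4)[OF g vw(1)] s(4)[OF g vw(2)] by blast
      then show ?thesis
        by (rule complex_vector.span_base)
    qed
  qed (use v sp in auto)
  show "?a \<one>\<^bsub>G\<^esub> v = v" if v: "v \<in> rep_space (inner_tensor R S)" for v
  proof (rule linear_on_span_eq[OF linear_on_inner_tensor linear_on_id])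
    show "?a \<one>\<^bsub>G\<^esub> b = b" if "b \<in> ?B" for b
      using that act[OF one_closed] r(5) s(5) by auto
  qed (use v sp in auto)
  show "?a (g \<otimes>\<^bsub>G\<^esub> h) v = ?a g (?a h v)"
    if gh: "g \<in> carrier G" "h \<in> carrier G" and v: "v \<in> rep_space (inner_tensor R S)" for g h v
  proof (rule linear_on_span_eq[OF linear_on_inner_tensor linear_on_compose[OF linear_on_inner_tensor linear_on_inner_tensor]])
    show "?a (g \<otimes>\<^bsub>G\<^esub> h) b = ?a g (?a h b)" if "b \<in> ?B" for b
      using that gh act r(6)[OF gh] s(6)[OF gh] by auto
    show "?a h \<in> cspan ?B \<rightarrow> UNIV"
      by simp
  qed (use v sp in auto)
qed (rule linear_on_inner_tensor)

lemma rep_char_inner_tensor: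
  assumes R: "is_rep G R" and S: "is_rep G S" and G: "group G" and g: "g \<in> carrier G"
  shows "rep_char (inner_tensor R S) g = rep_char R g * rep_char S g"
proof -
  note r = is_repD[OF R] and s = is_repD[OF S]
  note bR = basis_coord_frame(1)[OF r(1)] and bS = basis_coord_frame(1)[OF s(1)]
  have m: "(\<lambda>v w. coord (rep_space R) k v * coord (rep_space S) l w) \<in> bilinear_forms (rep_space R) (rep_space S)"
    if "k < cdim (rep_space R)" "l < cdim (rep_space S)" for k l
    using frameD(4)[OF bR, of k] frameD(4)[OF bS, of l] that
    by (auto simp: bilinear_forms_def scaleC_complex_def linear_on_def algebra_simps)
  have "rep_act (inner_tensor R S) g \<in> rep_space (inner_tensor R S) \<rightarrow> rep_space (inner_tensor R S)"
    using is_repD(4)[OF is_rep_inner_tensor[OF R S G] g] by auto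
  from trace_on_frame[OF inner_tensor_frame[OF bR bS] linear_on_inner_tensor this]
  have "rep_char (inner_tensor R S) g = (\<Sum>p\<in>{..<cdim (rep_space R)} \<times> {..<cdim (rep_space S)}.
      rep_act (inner_tensor R S) g (pure_tensor2 (rep_space R) (rep_space S)
        (basis_vec (rep_space R) (fst p)) (basis_vec (rep_space S) (snd p)))
      (\<lambda>v w. coord (rep_space R) (fst p) v * coord (rep_space S) (snd p) w))"
    unfolding rep_char_def by (simp add: case_prod_unfold)
  also have "\<dots> = (\<Sum>p\<in>{..<cdim (rep_space R)} \<times> {..<cdim (rep_space S)}.
      coord (rep_space R) (fst p) (rep_act R g (basis_vec (rep_space R) (fst p))) *
      coord (rep_space S) (snd p) (rep_act S g (basis_vec (rep_space S) (snd p))))"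
    unfolding inner_tensor_pure_tensor2[OF R S g] using m
    by (intro sum.cong refl) (auto simp: pure_tensor2_def)
  also have "\<dots> = rep_char R g * rep_char S g"
    by (simp add: rep_char_def trace_on_def sum_product sum.cartesian_product case_prod_unfold)
  finally show ?thesis .
qed

section \<open>Wreath products\<close>

lemma wreath_simps:
  "(f, \<pi>) \<in> carrier (wreath F n H) \<longleftrightarrow>
    (\<forall>x\<in>{1..n}. f x \<in> carrier F) \<and> (\<forall>x. x \<notin> {1..n} \<longrightarrow> f x = \<one>\<^bsub>F\<^esub>) \<and> \<pi> \<in> H"
  "(f, \<pi>) \<otimes>\<^bsub>wreath F n H\<^esub> (f', \<pi>') = (\<lambda>x. f x \<otimes>\<^bsub>F\<^esub> f' (inv' \<pi> x), \<pi> \<circ> \<pi>')"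
  "\<one>\<^bsub>wreath F n H\<^esub> = (\<lambda>_. \<one>\<^bsub>F\<^esub>, id)"
  by (auto simp: wreath_def)

text \<open>A subgroup of S_n given by its set of elements, so that one argument covers both F wr
  S_n and its subgroups over Young subgroups.\<close>

definition perm_group :: "nat \<Rightarrow> (nat \<Rightarrow> nat) set \<Rightarrow> bool" where
  "perm_group n H \<longleftrightarrow> id \<in> H \<and> (\<forall>h\<in>H. h permutes {1..n} \<and> inv' h \<in> H) \<and> (\<forall>g\<in>H. \<forall>h\<in>H. g \<circ> h \<in> H)"

lemma perm_groupD:
  assumes "perm_group n H"
  shows "id \<in> H" "\<And>h. h \<in> H \<Longrightarrow> h permutes {1..n}" "\<And>h. h \<in> H \<Longrightarrow> inv' h \<in> H"
    "\<And>g h. g \<in> H \<Longrightarrow> h \<in> H \<Longrightarrow> g \<circ> h \<in> H"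
  using assms by (auto simp: perm_group_def)

lemma wreath_value:
  assumes "group F" "(f, \<pi>) \<in> carrier (wreath F n H)"
  shows "f x \<in> carrier F"
proof -
  interpret group F by fact
  show ?thesis
    using assms(2) by (cases "x \<in> {1..n}") (auto simp: wreath_simps(1))
qed

lemma permutes_comp_inv:
  assumes "p permutes S" "q permutes S"
  shows "inv' (p \<circ> q) x = inv' q (inv' p x)"
  using o_inv_distrib[OF permutes_bij[OF assms(1)] permutes_bij[OF assms(2)]] by simp

text \<open>In a product with left factor (g, inverse of \<pi>) the function f is evaluated at \<pi>
  x, so the inverse comes from solving g(x) f(\<pi> x) = 1.\<close>

lemma group_wreath:
  assumes F: "group F" and H: "perm_group n H"
  shows "group (wreath F n H)"
    and "\<And>f \<pi>. (f, \<pi>) \<in> carrier (wreath F n H) \<Longrightarrow>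
      inv\<^bsub>wreath F n H\<^esub> (f, \<pi>) = (\<lambda>x. inv\<^bsub>F\<^esub> (f (\<pi> x)), inv' \<pi>)"
proof -
  interpret F: group F by fact
  note h = perm_groupD[OF H]
  let ?W = "wreath F n H"
  have mem: "\<pi> x \<in> {1..n} \<longleftrightarrow> x \<in> {1..n}" "inv' \<pi> x \<in> {1..n} \<longleftrightarrow> x \<in> {1..n}" if "\<pi> \<in> H" for \<pi> x
    using permutes_in_image[OF h(2)[OF that]] permutes_in_image[OF permutes_inv[OF h(2)[OF that]]] by auto
  have pinv: "\<pi> (inv' \<pi> x) = x" "inv' \<pi> (\<pi> x) = x" "inv' (inv' \<pi>) x = \<pi> x" "inv' \<pi> \<circ> \<pi> = id" "\<pi> \<circ> inv' \<pi> = id"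
    if "\<pi> \<in> H" for \<pi> x
    using permutes_inverses[OF h(2)[OF that]] permutes_inv_o[OF h(2)[OF that]]
      inv_inv_eq[OF permutes_bij[OF h(2)[OF that]]] by auto
  have val: "f x \<in> carrier F" if "(f, \<pi>) \<in> carrier ?W" for f \<pi> x
    using wreath_value[OF F that] .
  have H': "\<pi> \<in> H" if "(f, \<pi>) \<in> carrier ?W" for f \<pi>
    using that by (simp add: wreath_simps)
  have invc: "(\<lambda>x. inv\<^bsub>F\<^esub> (f (\<pi> x)), inv' \<pi>) \<in> carrier ?W" if "(f, \<pi>) \<in> carrier ?W" for f \<pi>
  proof -
    have "f (\<pi> x) = \<one>\<^bsub>F\<^esub>" if "x \<notin> {1..n}" for x
    proof -
      have "\<pi> x \<notin> {1..n}"
        using mem(1)[OF H'[OF \<open>(f, \<pi>) \<in> carrier ?W\<close>]] that by blast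
      then show ?thesis
        using \<open>(f, \<pi>) \<in> carrier ?W\<close> by (simp add: wreath_simps(1))
    qed
    then show ?thesis
      using that val[OF that] h(3) unfolding wreath_simps(1) by simp
  qed
  have invm: "(\<lambda>x. inv\<^bsub>F\<^esub> (f (\<pi> x)), inv' \<pi>) \<otimes>\<^bsub>?W\<^esub> (f, \<pi>) = \<one>\<^bsub>?W\<^esub>"
    if "(f, \<pi>) \<in> carrier ?W" for f \<pi>
    using val[OF that] pinv[OF H'[OF that]] by (simp add: wreath_simps(2,3))
  show g: "group ?W"
  proof (rule groupI)
    fix x y assume "x \<in> carrier ?W" "y \<in> carrier ?W"
    then obtain f \<pi> f' \<pi>' where xy: "x = (f, \<pi>)" "y = (f', \<pi>')" "(f, \<pi>) \<in> carrier ?W" "(f', \<pi>') \<in> carrier ?W"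
      by (cases x, cases y) auto
    have "f z \<otimes>\<^bsub>F\<^esub> f' (inv' \<pi> z) = \<one>\<^bsub>F\<^esub>" if "z \<notin> {1..n}" for z
    proof -
      have "inv' \<pi> z \<notin> {1..n}"
        using mem[OF H'[OF xy(3)]] that by blast
      then show ?thesis
        using xy that by (simp add: wreath_simps(1))
    qed
    then show "x \<otimes>\<^bsub>?W\<^esub> y \<in> carrier ?W"
      using xy(3,4) val[OF xy(3)] val[OF xy(4)] h(4)
      unfolding xy(1,2) by (auto simp: wreath_simps)
    fix z assume "z \<in> carrier ?W"
    then obtain f'' \<pi>'' where z: "z = (f'', \<pi>'')" "(f'', \<pi>'') \<in> carrier ?W"
      by (cases z) auto
    show "x \<otimes>\<^bsub>?W\<^esub> y \<otimes>\<^bsub>?W\<^esub> z = x \<otimes>\<^bsub>?W\<^esub> (y \<otimes>\<^bsub>?W\<^esub> z)"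
      unfolding xy(1,2) z(1) wreath_simps
      using val[OF xy(3)] val[OF xy(4)] val[OF z(2)] permutes_comp_inv[OF h(2)[OF H'[OF xy(3)]] h(2)[OF H'[OF xy(4)]]]
      by (simp add: F.m_assoc comp_assoc)
  next
    show "\<one>\<^bsub>?W\<^esub> \<in> carrier ?W"
      using h(1) by (simp add: wreath_simps)
  next
    fix x assume "x \<in> carrier ?W"
    then obtain f \<pi> where x: "x = (f, \<pi>)" "(f, \<pi>) \<in> carrier ?W"
      by (cases x) auto
    show "\<one>\<^bsub>?W\<^esub> \<otimes>\<^bsub>?W\<^esub> x = x"
      using val[OF x(2)] unfolding x(1) wreath_simps by (simp add: inv_id)
    show "\<exists>y\<in>carrier ?W. y \<otimes>\<^bsub>?W\<^esub> x = \<one>\<^bsub>?W\<^esub>"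
      using invc[OF x(2)] invm[OF x(2)] x(1) by blast
  qed
  show "inv\<^bsub>?W\<^esub> (f, \<pi>) = (\<lambda>x. inv\<^bsub>F\<^esub> (f (\<pi> x)), inv' \<pi>)" if "(f, \<pi>) \<in> carrier ?W" for f \<pi>
    using group.inv_equality[OF g invm[OF that] that invc[OF that]] .
qed

lemma finite_wreath:
  assumes "finite (carrier F)" "perm_group n H"
  shows "finite (carrier (wreath F n H))"
proof -
  have "H \<subseteq> {p. p permutes {1..n}}"
    using perm_groupD(2)[OF assms(2)] by blast
  then have "finite H"
    using finite_permutations[of "{1..n}"] finite_subset by blast
  moreover have "finite {f. (\<forall>x. (x \<in> {1..n} \<longrightarrow> f x \<in> carrier F) \<and> (x \<notin> {1..n} \<longrightarrow> f x = \<one>\<^bsub>F\<^esub>))}"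
    using assms(1) by (intro finite_set_of_finite_funs) auto
  ultimately have "finite ({f. (\<forall>x. (x \<in> {1..n} \<longrightarrow> f x \<in> carrier F) \<and> (x \<notin> {1..n} \<longrightarrow> f x = \<one>\<^bsub>F\<^esub>))} \<times> H)"
    by simp
  then show ?thesis
    by (rule finite_subset[rotated]) (auto simp: wreath_def)
qed

lemma perm_group_sym: "perm_group n (carrier (sym_group n))"
  by (auto simp: perm_group_def sym_group_carrier permutes_id permutes_inv permutes_compose)

subsection \<open>Blocks and Young subgroups\<close>

lemma offset_0 [simp]: "offset ns 0 = 0"
  by (simp add: offset_def)

lemma offset_Suc: "i < length ns \<Longrightarrow> offset ns (Suc i) = offset ns i + ns ! i"
  by (simp add: offset_def take_Suc_conv_app_nth)

lemma offset_length: "offset ns (length ns) = sum_list ns"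
  by (simp add: offset_def)

lemma offset_mono: "i \<le> j \<Longrightarrow> offset ns i \<le> offset ns j"
  by (metis offset_def le_add1 le_add_diff_inverse sum_list_append take_add)

lemma block_subset: "i < length ns \<Longrightarrow> block ns i \<subseteq> {1..sum_list ns}"
  using offset_mono[of "Suc i" "length ns" ns] by (auto simp: block_def offset_Suc offset_length)

lemma block_exists:
  assumes "x \<in> {1..sum_list ns}"
  obtains i where "i < length ns" "x \<in> block ns i"
proof -
  have "\<exists>i<m. x \<in> block ns i" if "m \<le> length ns" "1 \<le> x" "x \<le> offset ns m" for m
    using that
  proof (induction m)
    case (Suc m)
    show ?case
    proof (cases "x \<le> offset ns m")
      case True
      then show ?thesis
        using Suc less_Suc_eq by auto
    next
      case False
      then have "x \<in> block ns m"
        using Suc.prems by (simp add: block_def offset_Suc)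
      then show ?thesis
        by blast
    qed
  qed simp
  from this[of "length ns"] show thesis
    using assms that by (auto simp: offset_length)
qed

lemma block_disjoint:
  assumes "x \<in> block ns i" "x \<in> block ns j" "i < length ns" "j < length ns"
  shows "i = j"
proof (rule ccontr)
  assume "i \<noteq> j"
  then consider "Suc i \<le> j" | "Suc j \<le> i"
    by linarith
  then show False
    using assms offset_mono[of "Suc i" j ns] offset_mono[of "Suc j" i ns]
    by cases (auto simp: block_def offset_Suc)
qed

text \<open>Stated for an arbitrary list \<open>Xs\<close>, because it serves both for the tensor
  factors \<open>Us\<close> and for the block indices in \<open>color\<close>.\<close>

lemma nth_concat_replicate:
  assumes "length Xs = length ns" "i < length ns" "x \<in> block ns i"
  shows "concat (map2 replicate ns Xs) ! (x - 1) = Xs ! i"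
  using assms
proof (induction ns arbitrary: Xs i x)
  case (Cons m ns)
  then obtain X Ys where Xs: "Xs = X # Ys" "length Ys = length ns"
    by (cases Xs) auto
  show ?case
  proof (cases i)
    case 0
    then have "x - 1 < m"
      using Cons.prems by (simp add: block_def offset_def) linarith
    then show ?thesis
      using 0 Xs by (simp add: nth_append)
  next
    case (Suc j)
    have off: "offset (m # ns) (Suc j) = m + offset ns j"
      by (simp add: offset_def)
    have "x - m \<in> block ns j" "x > m" "j < length ns"
      using Cons.prems Suc off by (auto simp: block_def)
    then have "concat (map2 replicate ns Ys) ! (x - m - 1) = Ys ! j"
      using Cons.IH[of Ys j "x - m"] Xs by simp
    moreover have "\<not> x - 1 < m"
      using \<open>x > m\<close> by linarith
    ultimately show ?thesis
      using Suc Xs \<open>x > m\<close> by (simp add: nth_append)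
  qed
qed simp

text \<open>Built like \<open>factor_rep\<close>, with indices in place of representations, so that
  the tensor factor at x becomes \<open>Us ! color ns x\<close>.\<close>

definition color :: "nat list \<Rightarrow> nat \<Rightarrow> nat" where
  "color ns x = concat (map2 replicate ns [0..<length ns]) ! (x - 1)"

lemma color_block: "i < length ns \<Longrightarrow> x \<in> block ns i \<Longrightarrow> color ns x = i"
  unfolding color_def by (subst nth_concat_replicate) auto

lemma color_less: "x \<in> {1..sum_list ns} \<Longrightarrow> color ns x < length ns"
  by (metis block_exists color_block)

lemma factor_rep_color:
  assumes "length Us = length ns" "x \<in> {1..sum_list ns}"
  shows "factor_rep Us ns x = Us ! color ns x"
  using assms unfolding factor_rep_def by (metis block_exists color_block nth_concat_replicate)

lemma young_subgroup_color:
  assumes "h \<in> young_subgroup ns" "x \<in> {1..sum_list ns}"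
  shows "color ns (h x) = color ns x"
proof -
  obtain i where i: "i < length ns" "x \<in> block ns i"
    using assms(2) by (rule block_exists)
  then have "h x \<in> block ns i"
    using assms(1) by (auto simp: young_subgroup_def)
  then show ?thesis
    using i by (simp add: color_block)
qed

lemma perm_group_young: "perm_group (sum_list ns) (young_subgroup ns)"
  unfolding perm_group_def
proof (intro conjI ballI)
  show "id \<in> young_subgroup ns"
    by (simp add: young_subgroup_def permutes_id)
  fix h assume h: "h \<in> young_subgroup ns"
  then show p: "h permutes {1..sum_list ns}"
    by (simp add: young_subgroup_def)
  have "inv' h ` block ns i = block ns i" if "i < length ns" for i
  proof -
    have "h ` block ns i = block ns i"
      using h that by (simp add: young_subgroup_def)
    then have "inv' h ` block ns i = inv' h ` h ` block ns i"
      by simp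
    also have "\<dots> = block ns i"
      using permutes_inj[OF p] by (simp add: image_comp)
    finally show ?thesis .
  qed
  then show "inv' h \<in> young_subgroup ns"
    using p by (simp add: young_subgroup_def permutes_inv)
next
  fix g h assume gh: "g \<in> young_subgroup ns" "h \<in> young_subgroup ns"
  have "(g \<circ> h) ` block ns i = block ns i" if "i < length ns" for i
  proof -
    have "(g \<circ> h) ` block ns i = g ` h ` block ns i"
      by (simp only: image_comp)
    then show ?thesis
      using gh that by (simp add: young_subgroup_def)
  qed
  then show "g \<circ> h \<in> young_subgroup ns"
    using gh by (simp add: young_subgroup_def permutes_compose)
qed

lemma young_subgroup_block:
  assumes "h \<in> young_subgroup ns" "i < length ns" "y \<in> {1..ns ! i}"
  shows "h (offset ns i + y) \<in> block ns i"
proof -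
  have "offset ns i + y \<in> block ns i"
    using assms(3) by (auto simp: block_def)
  then show ?thesis
    using assms(1,2) by (auto simp: young_subgroup_def)
qed

lemma block_perm_value:
  assumes "h \<in> young_subgroup ns" "i < length ns" "y \<in> {1..ns ! i}"
  shows "offset ns i + block_perm ns i h y = h (offset ns i + y)" "block_perm ns i h y \<in> {1..ns ! i}"
  using young_subgroup_block[OF assms] assms(3) by (auto simp: block_perm_def block_def)

lemma block_perm_comp:
  assumes "g \<in> young_subgroup ns" "h \<in> young_subgroup ns" "i < length ns"
  shows "block_perm ns i (g \<circ> h) = block_perm ns i g \<circ> block_perm ns i h"
proof
  fix y
  show "block_perm ns i (g \<circ> h) y = (block_perm ns i g \<circ> block_perm ns i h) y"
  proof (cases "y \<in> {1..ns ! i}")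
    case True
    have "g \<circ> h \<in> young_subgroup ns"
      using perm_groupD(4)[OF perm_group_young] assms by blast
    then have "offset ns i + block_perm ns i (g \<circ> h) y =
        offset ns i + block_perm ns i g (block_perm ns i h y)"
      using block_perm_value[OF _ assms(3)] True assms by simp
    then show ?thesis
      by simp
  qed (auto simp: block_perm_def)
qed

lemma block_perm_id: "block_perm ns i id = id"
  by (auto simp: block_perm_def fun_eq_iff)

text \<open>The block component of the inverse of h is a two-sided inverse.\<close>

lemma block_perm_permutes:
  assumes "h \<in> young_subgroup ns" "i < length ns"
  shows "block_perm ns i h permutes {1..ns ! i}"
proof -
  have h': "inv' h \<in> young_subgroup ns"
    using perm_groupD(3)[OF perm_group_young] assms by blast
  have p: "h permutes {1..sum_list ns}"
    using assms by (simp add: young_subgroup_def)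
  have 1: "block_perm ns i (inv' h) \<circ> block_perm ns i h = id"
    using block_perm_comp[OF h' assms] by (simp add: block_perm_id permutes_inv_o[OF p])
  have 2: "block_perm ns i h \<circ> block_perm ns i (inv' h) = id"
    using block_perm_comp[OF assms(1) h' assms(2)] by (simp add: block_perm_id permutes_inv_o[OF p])
  have "bij (block_perm ns i h)"
    using o_bij[OF 1 2] .
  moreover have "\<forall>x. x \<notin> {1..ns ! i} \<longrightarrow> block_perm ns i h x = x"
    by (simp add: block_perm_def)
  ultimately show ?thesis
    unfolding permutes_def bij_iff by blast
qed

section \<open>Specht modules\<close>

text \<open>The value 0 beyond the last row lets partitions of different lengths be compared row by
  row.\<close>

definition row_length :: "nat list \<Rightarrow> nat \<Rightarrow> nat" where
  "row_length \<mu> i = (if i < length \<mu> then \<mu> ! i else 0)"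

lemma diagram_row_length: "(i, j) \<in> diagram \<mu> \<longleftrightarrow> j < row_length \<mu> i"
  by (auto simp: diagram_def row_length_def)

lemma partition_antimono:
  assumes "is_partition \<mu> n" "i \<le> j"
  shows "row_length \<mu> j \<le> row_length \<mu> i"
  using assms by (cases "i = j") (auto simp: row_length_def is_partition_def sorted_wrt_iff_nth_less)

lemma partition_eqI:
  assumes "is_partition \<kappa> m" "is_partition \<mu> n" "\<And>i. row_length \<kappa> i = row_length \<mu> i"
  shows "\<kappa> = \<mu>"
proof -
  have pos: "i < length \<nu> \<longleftrightarrow> 0 < row_length \<nu> i" if "is_partition \<nu> k" for \<nu> k i
    using that by (auto simp: is_partition_def row_length_def)
  have "i < length \<kappa> \<longleftrightarrow> i < length \<mu>" for i
    using pos[OF assms(1)] pos[OF assms(2)] assms(3) by simp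
  then have "length \<kappa> = length \<mu>"
    by (meson linorder_neqE_nat less_irrefl)
  then show ?thesis
  proof (rule nth_equalityI)
    fix i assume "i < length \<kappa>"
    then show "\<kappa> ! i = \<mu> ! i"
      using assms(3)[of i] \<open>length \<kappa> = length \<mu>\<close> by (simp add: row_length_def)
  qed
qed

lemma diagram_Sigma: "diagram \<mu> = (SIGMA i:{..<length \<mu>}. {..<\<mu> ! i})"
  by (auto simp: diagram_def)

lemma finite_diagram: "finite (diagram \<mu>)"
  by (simp add: diagram_Sigma)

lemma card_diagram: "card (diagram \<mu>) = sum_list \<mu>"
  by (simp add: diagram_Sigma sum_list_sum_nth atLeast0LessThan)

lemma tableau_exists: obtains t where "t \<in> tableaux \<mu>"
proof -
  have "\<exists>t. bij_betw t (diagram \<mu>) {1..sum_list \<mu>}"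
    by (rule finite_same_card_bij) (simp_all add: finite_diagram card_diagram)
  then show thesis
    using that by (auto simp: tableaux_def)
qed

lemma tableauD:
  assumes "t \<in> tableaux \<mu>"
  shows "bij_betw t (diagram \<mu>) {1..sum_list \<mu>}" "inj_on t (diagram \<mu>)"
    "t ` diagram \<mu> = {1..sum_list \<mu>}" "\<And>b. b \<in> diagram \<mu> \<Longrightarrow> t b \<in> {1..sum_list \<mu>}"
  using assms by (auto simp: tableaux_def bij_betw_def)

section \<open>Tabloids and the permutation module\<close>

definition perm_act :: "(nat \<Rightarrow> nat) \<Rightarrow> (nat set list \<Rightarrow> complex) \<Rightarrow> nat set list \<Rightarrow> complex" where
  "perm_act \<pi> v T = v (map (image (inv' \<pi>)) T)"

lemma rep_act_specht: "rep_act (specht \<mu>) = perm_act"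
  by (simp add: specht_def perm_act_def fun_eq_iff)

lemma perm_act_linear:
  "perm_act \<pi> (v + w) = perm_act \<pi> v + perm_act \<pi> w" "perm_act \<pi> (c *\<^sub>C v) = c *\<^sub>C perm_act \<pi> v"
  "perm_act \<pi> 0 = 0" "perm_act \<pi> (sum f I) = (\<Sum>i\<in>I. perm_act \<pi> (f i))"
  by (simp_all add: perm_act_def fun_eq_iff scaleC_fun_apply sum_fun_apply)

lemma linear_on_perm_act: "linear_on V (perm_act \<pi>)"
  by (rule linear_onI) (simp_all add: perm_act_linear)

lemma perm_act_comp:
  assumes "\<pi> permutes S" "\<rho> permutes S"
  shows "perm_act (\<pi> \<circ> \<rho>) v = perm_act \<pi> (perm_act \<rho> v)"
proof
  fix T
  have "inv' (\<pi> \<circ> \<rho>) = inv' \<rho> \<circ> inv' \<pi>"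
    using o_inv_distrib[OF permutes_bij[OF assms(1)] permutes_bij[OF assms(2)]] .
  moreover have "map (image (inv' \<rho> \<circ> inv' \<pi>)) T = map (image (inv' \<rho>)) (map (image (inv' \<pi>)) T)"
    by (simp add: image_comp)
  ultimately show "perm_act (\<pi> \<circ> \<rho>) v T = perm_act \<pi> (perm_act \<rho> v) T"
    by (simp only: perm_act_def)
qed

lemma perm_act_id: "perm_act id v = v"
  by (simp add: perm_act_def fun_eq_iff inv_id)

definition tabloids :: "nat list \<Rightarrow> nat set list set" where
  "tabloids \<mu> = tabloid \<mu> ` tableaux \<mu>"

lemma length_tabloid [simp]: "length (tabloid \<mu> t) = length \<mu>"
  by (simp add: tabloid_def)

lemma nth_tabloid: "i < length \<mu> \<Longrightarrow> tabloid \<mu> t ! i = {t (i, j) | j. j < \<mu> ! i}"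
  by (simp add: tabloid_def)

lemma image_tabloid: "map (image \<pi>) (tabloid \<mu> t) = tabloid \<mu> (\<pi> \<circ> t)"
  by (auto simp: tabloid_def)

lemma tableau_comp:
  assumes "t \<in> tableaux \<mu>" "\<pi> permutes {1..sum_list \<mu>}"
  shows "\<pi> \<circ> t \<in> tableaux \<mu>"
  using assms unfolding tableaux_def
  by (auto intro: bij_betw_trans[OF _ permutes_imp_bij])

lemma tabloids_closed: "S \<in> tabloids \<mu> \<Longrightarrow> \<pi> permutes {1..sum_list \<mu>} \<Longrightarrow> map (image \<pi>) S \<in> tabloids \<mu>"
  by (auto simp: tabloids_def image_tabloid simp del: One_nat_def intro!: imageI tableau_comp)

lemma map_image_inverse:
  assumes "\<pi> permutes S"
  shows "map (image \<pi>) (map (image (inv' \<pi>)) T) = T" "map (image (inv' \<pi>)) (map (image \<pi>) T) = T"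
  using permutes_inv_o[OF assms] by (simp_all add: image_comp comp_def[of "image _"] id_def[symmetric])

lemma finite_tabloids: "finite (tabloids \<mu>)"
proof (rule finite_subset)
  show "tabloids \<mu> \<subseteq> {xs. set xs \<subseteq> Pow {1..sum_list \<mu>} \<and> length xs = length \<mu>}"
    using tableauD(4) by (fastforce simp: tabloids_def tabloid_def diagram_def)
qed (simp add: finite_lists_length_eq)

definition tabloid_vec :: "nat set list \<Rightarrow> nat set list \<Rightarrow> complex" where
  "tabloid_vec S = (\<lambda>T. if T = S then 1 else 0)"

lemma perm_act_tabloid_vec:
  assumes "\<pi> permutes S"
  shows "perm_act \<pi> (tabloid_vec T) = tabloid_vec (map (image \<pi>) T)"
proof -
  have "map (image (inv' \<pi>)) X = T \<longleftrightarrow> X = map (image \<pi>) T" for X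
    using map_image_inverse[OF assms] by metis
  then show ?thesis
    by (simp add: perm_act_def tabloid_vec_def fun_eq_iff)
qed

text \<open>Young's permutation module on the tabloids of shape \<mu>. Specht modules are treated as
  its submodules, which supplies finite dimension and a basis to expand in.\<close>

definition perm_module :: "nat list \<Rightarrow> (nat \<Rightarrow> nat, nat set list \<Rightarrow> complex) rep" where
  "perm_module \<mu> = \<lparr>rep_space = {v. \<forall>T. T \<notin> tabloids \<mu> \<longrightarrow> v T = 0}, rep_act = perm_act\<rparr>"

lemma tabloid_vec_in: "S \<in> tabloids \<mu> \<Longrightarrow> tabloid_vec S \<in> rep_space (perm_module \<mu>)"
  by (auto simp: perm_module_def tabloid_vec_def)

lemma perm_module_frame:
  "frame (tabloids \<mu>) tabloid_vec (\<lambda>T v. v T) (rep_space (perm_module \<mu>))"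
  unfolding frame_def
proof (intro conjI ballI)
  fix v assume v: "v \<in> rep_space (perm_module \<mu>)"
  show "(\<Sum>S\<in>tabloids \<mu>. v S *\<^sub>C tabloid_vec S) = v"
  proof
    fix T
    have "(\<Sum>S\<in>tabloids \<mu>. v S *\<^sub>C tabloid_vec S) T = (\<Sum>S\<in>tabloids \<mu>. if T = S then v S else 0)"
      unfolding sum_fun_apply
      by (intro sum.cong) (auto simp: scaleC_fun_apply scaleC_complex_def tabloid_vec_def)
    also have "\<dots> = v T"
      using v finite_tabloids by (auto simp: perm_module_def)
    finally show "(\<Sum>S\<in>tabloids \<mu>. v S *\<^sub>C tabloid_vec S) T = v T" .
  qed
qed (auto simp: finite_tabloids perm_module_def tabloid_vec_def scaleC_fun_apply
    intro!: csubspace_I linear_onI)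

lemma is_rep_perm_module: "is_rep (sym_group (sum_list \<mu>)) (perm_module \<mu>)"
proof (rule is_repI)
  show "fin_dim (rep_space (perm_module \<mu>))"
    by (rule frame_fin_dim[OF perm_module_frame])
  fix \<pi> v assume \<pi>: "\<pi> \<in> carrier (sym_group (sum_list \<mu>))" and v: "v \<in> rep_space (perm_module \<mu>)"
  then have p: "\<pi> permutes {1..sum_list \<mu>}"
    by (simp add: sym_group_carrier)
  have "map (image (inv' \<pi>)) T \<notin> tabloids \<mu>" if "T \<notin> tabloids \<mu>" for T
    using that tabloids_closed[OF _ p, of "map (image (inv' \<pi>)) T"] map_image_inverse(1)[OF p, of T] by metis
  then show "rep_act (perm_module \<mu>) \<pi> v \<in> rep_space (perm_module \<mu>)"
    using v by (simp add: perm_module_def perm_act_def)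
qed (auto simp: perm_module_def linear_on_perm_act sym_group_one sym_group_mult perm_act_id
    sym_group_carrier perm_act_comp)

section \<open>Column stabilizers and polytabloids\<close>

definition column :: "nat list \<Rightarrow> (nat \<times> nat \<Rightarrow> nat) \<Rightarrow> nat \<Rightarrow> nat set" where
  "column \<mu> t j = {t (i, j) | i. (i, j) \<in> diagram \<mu>}"

lemma column_stabilizer_column:
  "column_stabilizer \<mu> t = {\<sigma>. \<sigma> permutes {1..sum_list \<mu>} \<and> (\<forall>j. \<sigma> ` column \<mu> t j = column \<mu> t j)}"
  by (simp add: column_stabilizer_def column_def)

lemma column_comp: "column \<mu> (\<pi> \<circ> t) j = \<pi> ` column \<mu> t j"
  by (auto simp: column_def)

lemma column_cong: "(\<And>b. b \<in> diagram \<mu> \<Longrightarrow> s b = t b) \<Longrightarrow> column \<mu> s j = column \<mu> t j"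
  by (force simp: column_def)

lemma tabloid_cong: "(\<And>b. b \<in> diagram \<mu> \<Longrightarrow> s b = t b) \<Longrightarrow> tabloid \<mu> s = tabloid \<mu> t"
  by (force simp: tabloid_def diagram_def)

text \<open>Tableaux are functions on all pairs of naturals, whereas a polytabloid sees only their
  values on the diagram.\<close>

lemma polytabloid_cong:
  assumes "\<And>b. b \<in> diagram \<mu> \<Longrightarrow> s b = t b"
  shows "polytabloid \<mu> s = polytabloid \<mu> t"
proof -
  have "column_stabilizer \<mu> s = column_stabilizer \<mu> t" "tabloid \<mu> s = tabloid \<mu> t"
    unfolding column_stabilizer_column using column_cong[of \<mu> s t] tabloid_cong[of \<mu> s t] assms by auto
  then show ?thesis
    by (simp add: polytabloid_def)
qed

lemma column_stabilizerD:
  assumes "\<sigma> \<in> column_stabilizer \<mu> t"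
  shows "\<sigma> permutes {1..sum_list \<mu>}" "\<sigma> ` column \<mu> t j = column \<mu> t j"
  using assms by (auto simp: column_stabilizer_column)

lemma column_stabilizer_id: "id \<in> column_stabilizer \<mu> t"
  by (simp add: column_stabilizer_column permutes_id)

lemma column_stabilizer_comp:
  assumes "\<sigma> \<in> column_stabilizer \<mu> t" "\<tau> \<in> column_stabilizer \<mu> t"
  shows "\<sigma> \<circ> \<tau> \<in> column_stabilizer \<mu> t"
proof -
  have "(\<sigma> \<circ> \<tau>) ` column \<mu> t j = column \<mu> t j" for j
  proof -
    have "(\<sigma> \<circ> \<tau>) ` column \<mu> t j = \<sigma> ` \<tau> ` column \<mu> t j"
      by (simp only: image_comp)
    then show ?thesis
      using assms by (simp add: column_stabilizerD(2))
  qed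
  then show ?thesis
    using assms by (simp add: column_stabilizer_column permutes_compose)
qed

lemma column_stabilizer_inv:
  assumes "\<sigma> \<in> column_stabilizer \<mu> t"
  shows "inv' \<sigma> \<in> column_stabilizer \<mu> t"
proof -
  note s = column_stabilizerD[OF assms]
  have "inv' \<sigma> ` column \<mu> t j = column \<mu> t j" for j
  proof -
    have "inv' \<sigma> ` column \<mu> t j = inv' \<sigma> ` \<sigma> ` column \<mu> t j"
      using s(2) by simp
    also have "\<dots> = column \<mu> t j"
      using permutes_inj[OF s(1)] by (simp add: image_comp)
    finally show ?thesis .
  qed
  then show ?thesis
    using s(1) by (simp add: column_stabilizer_column permutes_inv)
qed

lemma finite_column_stabilizer: "finite (column_stabilizer \<mu> t)"
  using finite_permutations[of "{1..sum_list \<mu>}"]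
  by (rule finite_subset[rotated]) (auto simp: column_stabilizer_def)

lemma card_column_stabilizer_pos: "0 < card (column_stabilizer \<mu> t)"
  using finite_column_stabilizer column_stabilizer_id by (metis card_gt_0_iff empty_iff)

text \<open>The column antisymmetriser of t. It is applied to arbitrary coefficient functions, since
  a tableau of one shape has to act on tabloids of another.\<close>

definition signed_sum ::
  "nat list \<Rightarrow> (nat \<times> nat \<Rightarrow> nat) \<Rightarrow> (nat set list \<Rightarrow> complex) \<Rightarrow> nat set list \<Rightarrow> complex" where
  "signed_sum \<mu> t v = (\<Sum>\<sigma>\<in>column_stabilizer \<mu> t. of_int (sign \<sigma>) *\<^sub>C perm_act \<sigma> v)"

lemma linear_on_signed_sum: "linear_on V (signed_sum \<mu> t)"
  unfolding signed_sum_def by (intro linear_on_sum_fun linear_on_scaled linear_on_perm_act)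

lemma polytabloid_signed_sum: "polytabloid \<mu> t = signed_sum \<mu> t (tabloid_vec (tabloid \<mu> t))"
proof
  fix T
  show "polytabloid \<mu> t T = signed_sum \<mu> t (tabloid_vec (tabloid \<mu> t)) T"
    unfolding polytabloid_def signed_sum_def sum_fun_apply
  proof (intro sum.cong refl)
    fix \<sigma> assume "\<sigma> \<in> column_stabilizer \<mu> t"
    from perm_act_tabloid_vec[OF column_stabilizerD(1)[OF this]]
    show "(if T = map ((`) \<sigma>) (tabloid \<mu> t) then of_int (sign \<sigma>) else 0) =
        (of_int (sign \<sigma>) *\<^sub>C perm_act \<sigma> (tabloid_vec (tabloid \<mu> t))) T"
      by (simp add: scaleC_fun_apply scaleC_complex_def tabloid_vec_def)
  qed
qed

lemma permutes_permutation: "\<sigma> permutes {1..n::nat} \<Longrightarrow> permutation \<sigma>"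
  using permutation_permutes by blast

text \<open>Right translation by \<sigma> permutes the column stabilizer and multiplies each sign by
  the sign of \<sigma>.\<close>

lemma signed_sum_perm_act:
  assumes "\<sigma> \<in> column_stabilizer \<mu> t"
  shows "signed_sum \<mu> t (perm_act \<sigma> v) = of_int (sign \<sigma>) *\<^sub>C signed_sum \<mu> t v"
proof -
  note s = column_stabilizerD(1)[OF assms]
  have "signed_sum \<mu> t (perm_act \<sigma> v) =
      (\<Sum>\<tau>\<in>column_stabilizer \<mu> t. of_int (sign \<tau>) *\<^sub>C perm_act (\<tau> \<circ> \<sigma>) v)"
    unfolding signed_sum_def using perm_act_comp[OF column_stabilizerD(1) s] by simp
  also have "\<dots> = (\<Sum>\<tau>\<in>column_stabilizer \<mu> t. of_int (sign \<sigma> * sign \<tau>) *\<^sub>C perm_act \<tau> v)"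
  proof (rule sum.reindex_bij_witness[where i = "\<lambda>\<tau>. \<tau> \<circ> inv' \<sigma>" and j = "\<lambda>\<tau>. \<tau> \<circ> \<sigma>"])
    fix \<tau> assume t: "\<tau> \<in> column_stabilizer \<mu> t"
    show "\<tau> \<circ> \<sigma> \<in> column_stabilizer \<mu> t" "\<tau> \<circ> inv' \<sigma> \<in> column_stabilizer \<mu> t"
      using assms t by (auto intro: column_stabilizer_comp column_stabilizer_inv)
    show "\<tau> \<circ> \<sigma> \<circ> inv' \<sigma> = \<tau>" "\<tau> \<circ> inv' \<sigma> \<circ> \<sigma> = \<tau>"
      using permutes_inv_o[OF s] by (simp_all add: comp_assoc)
    have "sign \<sigma> * sign (\<tau> \<circ> \<sigma>) = sign \<tau> * (sign \<sigma> * sign \<sigma>)"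
      using permutes_permutation[OF s] permutes_permutation[OF column_stabilizerD(1)[OF t]]
      by (simp add: sign_compose)
    then show "of_int (sign \<sigma> * sign (\<tau> \<circ> \<sigma>)) *\<^sub>C perm_act (\<tau> \<circ> \<sigma>) v = of_int (sign \<tau>) *\<^sub>C perm_act (\<tau> \<circ> \<sigma>) v"
      by (simp add: sign_idempotent)
  qed
  also have "\<dots> = of_int (sign \<sigma>) *\<^sub>C signed_sum \<mu> t v"
    unfolding signed_sum_def by (simp add: complex_vector.scale_sum_right scaleC_scaleC)
  finally show ?thesis .
qed

text \<open>Each summand of the inner sum reproduces the outer sum, the two equal signs
  cancelling.\<close>

lemma signed_sum_signed_sum:
  "signed_sum \<mu> t (signed_sum \<mu> t v) = of_nat (card (column_stabilizer \<mu> t)) *\<^sub>C signed_sum \<mu> t v"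
proof -
  have "signed_sum \<mu> t (signed_sum \<mu> t v) =
      (\<Sum>\<sigma>\<in>column_stabilizer \<mu> t. of_int (sign \<sigma>) *\<^sub>C signed_sum \<mu> t (perm_act \<sigma> v))"
    unfolding signed_sum_def[of \<mu> t v]
    by (rule linear_on_sum_scale[OF linear_on_signed_sum, of UNIV]) auto
  also have "\<dots> = (\<Sum>\<sigma>\<in>column_stabilizer \<mu> t. signed_sum \<mu> t v)"
  proof (intro sum.cong refl)
    fix \<sigma> assume "\<sigma> \<in> column_stabilizer \<mu> t"
    have "complex_of_int (sign \<sigma>) * of_int (sign \<sigma>) = 1"
      unfolding of_int_mult[symmetric] sign_idempotent by simp
    then show "of_int (sign \<sigma>) *\<^sub>C signed_sum \<mu> t (perm_act \<sigma> v) = signed_sum \<mu> t v"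
      using signed_sum_perm_act[OF \<open>\<sigma> \<in> _\<close>, of v] by (simp add: scaleC_scaleC scaleC_one)
  qed
  finally show ?thesis
    by (simp only: complex_vector.sum_constant_scale)
qed

lemma signed_sum_polytabloid:
  "signed_sum \<mu> t (polytabloid \<mu> t) = of_nat (card (column_stabilizer \<mu> t)) *\<^sub>C polytabloid \<mu> t"
  unfolding polytabloid_signed_sum by (rule signed_sum_signed_sum)

text \<open>Conjugation by \<pi> carries the column stabilizer of t to that of \<pi> \<circ> t and
  preserves signs.\<close>

lemma perm_act_polytabloid:
  assumes "\<pi> permutes {1..sum_list \<mu>}"
  shows "perm_act \<pi> (polytabloid \<mu> t) = polytabloid \<mu> (\<pi> \<circ> t)"
proof -
  have conj: "\<pi> \<circ> \<sigma> \<circ> inv' \<pi> \<in> column_stabilizer \<mu> (\<pi> \<circ> t)" if s: "\<sigma> \<in> column_stabilizer \<mu> t" for \<sigma>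
  proof -
    note s = column_stabilizerD[OF s]
    have "(\<pi> \<circ> \<sigma> \<circ> inv' \<pi>) ` column \<mu> (\<pi> \<circ> t) j = column \<mu> (\<pi> \<circ> t) j" for j
    proof -
      have "(\<pi> \<circ> \<sigma> \<circ> inv' \<pi>) ` column \<mu> (\<pi> \<circ> t) j = (\<pi> \<circ> \<sigma> \<circ> (inv' \<pi> \<circ> \<pi>)) ` column \<mu> t j"
        unfolding column_comp image_comp by (simp add: comp_assoc)
      also have "\<dots> = \<pi> ` \<sigma> ` column \<mu> t j"
        using permutes_inv_o[OF assms] by (simp add: image_comp)
      finally show ?thesis
        using s(2) by (simp add: column_comp)
    qed
    moreover have "\<pi> \<circ> \<sigma> \<circ> inv' \<pi> permutes {1..sum_list \<mu>}"
      using assms s(1) by (intro permutes_compose permutes_inv)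
    ultimately show ?thesis
      by (simp add: column_stabilizer_column)
  qed
  have conj': "inv' \<pi> \<circ> \<sigma> \<circ> \<pi> \<in> column_stabilizer \<mu> t" if s: "\<sigma> \<in> column_stabilizer \<mu> (\<pi> \<circ> t)" for \<sigma>
  proof -
    note s = column_stabilizerD[OF s]
    have "(inv' \<pi> \<circ> \<sigma> \<circ> \<pi>) ` column \<mu> t j = column \<mu> t j" for j
    proof -
      have "(inv' \<pi> \<circ> \<sigma> \<circ> \<pi>) ` column \<mu> t j = inv' \<pi> ` \<sigma> ` column \<mu> (\<pi> \<circ> t) j"
        unfolding column_comp by (simp add: image_comp comp_assoc)
      also have "\<dots> = inv' \<pi> ` column \<mu> (\<pi> \<circ> t) j"
        by (simp only: s(2))
      also have "\<dots> = (inv' \<pi> \<circ> \<pi>) ` column \<mu> t j"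
        by (simp only: column_comp image_comp)
      finally show ?thesis
        using permutes_inv_o[OF assms] by simp
    qed
    moreover have "inv' \<pi> \<circ> \<sigma> \<circ> \<pi> permutes {1..sum_list \<mu>}"
      using assms s(1) by (intro permutes_compose permutes_inv)
    ultimately show ?thesis
      by (simp add: column_stabilizer_column)
  qed
  have p: "permutation \<pi>"
    using permutes_permutation[OF assms] .
  have "perm_act \<pi> (polytabloid \<mu> t) =
      (\<Sum>\<sigma>\<in>column_stabilizer \<mu> t. of_int (sign \<sigma>) *\<^sub>C tabloid_vec (map (image (\<pi> \<circ> \<sigma>)) (tabloid \<mu> t)))"
    unfolding polytabloid_signed_sum signed_sum_def perm_act_linear(4)
  proof (intro sum.cong refl)
    fix \<sigma> assume "\<sigma> \<in> column_stabilizer \<mu> t"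
    note s = column_stabilizerD(1)[OF this]
    show "perm_act \<pi> (of_int (sign \<sigma>) *\<^sub>C perm_act \<sigma> (tabloid_vec (tabloid \<mu> t))) =
        of_int (sign \<sigma>) *\<^sub>C tabloid_vec (map ((`) (\<pi> \<circ> \<sigma>)) (tabloid \<mu> t))"
      by (simp add: perm_act_linear perm_act_tabloid_vec[OF s] perm_act_tabloid_vec[OF assms] image_comp comp_def)
  qed
  also have "\<dots> = (\<Sum>\<sigma>\<in>column_stabilizer \<mu> (\<pi> \<circ> t). of_int (sign \<sigma>) *\<^sub>C tabloid_vec (map (image (\<sigma> \<circ> \<pi>)) (tabloid \<mu> t)))"
  proof (rule sum.reindex_bij_witness[where j = "\<lambda>\<sigma>. \<pi> \<circ> \<sigma> \<circ> inv' \<pi>" and i = "\<lambda>\<sigma>. inv' \<pi> \<circ> \<sigma> \<circ> \<pi>"])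
    fix \<sigma> assume s: "\<sigma> \<in> column_stabilizer \<mu> t"
    then show "\<pi> \<circ> \<sigma> \<circ> inv' \<pi> \<in> column_stabilizer \<mu> (\<pi> \<circ> t)"
      by (rule conj)
    have eq: "\<pi> \<circ> \<sigma> \<circ> inv' \<pi> \<circ> \<pi> = \<pi> \<circ> \<sigma>"
      using permutes_inv_o[OF assms] by (simp add: comp_assoc)
    then show "inv' \<pi> \<circ> (\<pi> \<circ> \<sigma> \<circ> inv' \<pi>) \<circ> \<pi> = \<sigma>"
      using permutes_inv_o[OF assms] by (simp add: comp_assoc) (simp add: comp_assoc[symmetric])
    have "sign (\<pi> \<circ> \<sigma> \<circ> inv' \<pi>) = sign \<sigma> * (sign \<pi> * sign \<pi>)"
      using p permutes_permutation[OF column_stabilizerD(1)[OF s]]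
      by (simp add: sign_compose sign_inverse permutation_compose permutation_inverse)
    then have "sign (\<pi> \<circ> \<sigma> \<circ> inv' \<pi>) = sign \<sigma>"
      by (simp add: sign_idempotent)
    then show "of_int (sign (\<pi> \<circ> \<sigma> \<circ> inv' \<pi>)) *\<^sub>C tabloid_vec (map ((`) (\<pi> \<circ> \<sigma> \<circ> inv' \<pi> \<circ> \<pi>)) (tabloid \<mu> t)) =
        of_int (sign \<sigma>) *\<^sub>C tabloid_vec (map ((`) (\<pi> \<circ> \<sigma>)) (tabloid \<mu> t))"
      unfolding eq by simp
  next
    fix \<sigma> assume s: "\<sigma> \<in> column_stabilizer \<mu> (\<pi> \<circ> t)"
    then show "inv' \<pi> \<circ> \<sigma> \<circ> \<pi> \<in> column_stabilizer \<mu> t"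
      by (rule conj')
    show "\<pi> \<circ> (inv' \<pi> \<circ> \<sigma> \<circ> \<pi>) \<circ> inv' \<pi> = \<sigma>"
      using permutes_inv_o[OF assms] by (simp add: comp_assoc) (simp add: comp_assoc[symmetric])
  qed
  also have "\<dots> = polytabloid \<mu> (\<pi> \<circ> t)"
    unfolding polytabloid_signed_sum signed_sum_def
  proof (intro sum.cong refl)
    fix \<sigma> assume "\<sigma> \<in> column_stabilizer \<mu> (\<pi> \<circ> t)"
    note s = column_stabilizerD(1)[OF this]
    show "of_int (sign \<sigma>) *\<^sub>C tabloid_vec (map ((`) (\<sigma> \<circ> \<pi>)) (tabloid \<mu> t)) =
        of_int (sign \<sigma>) *\<^sub>C perm_act \<sigma> (tabloid_vec (tabloid \<mu> (\<pi> \<circ> t)))"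
      unfolding perm_act_tabloid_vec[OF s] image_tabloid by (simp add: comp_assoc)
  qed
  finally show ?thesis .
qed

section \<open>Specht modules inside permutation modules\<close>

lemma rep_space_specht: "rep_space (specht \<mu>) = cspan (polytabloid \<mu> ` tableaux \<mu>)"
  by (simp add: specht_def)

lemma tabloid_vec_stable:
  "S \<in> tabloids \<mu> \<Longrightarrow> \<sigma> permutes {1..sum_list \<mu>} \<Longrightarrow> perm_act \<sigma> (tabloid_vec S) \<in> rep_space (perm_module \<mu>)"
  using is_repD(4)[OF is_rep_perm_module, of \<sigma> \<mu> "tabloid_vec S"] tabloid_vec_in
  by (simp add: sym_group_carrier perm_module_def)

lemma polytabloid_in_perm_module:
  assumes "t \<in> tableaux \<mu>"
  shows "polytabloid \<mu> t \<in> rep_space (perm_module \<mu>)"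
  unfolding polytabloid_signed_sum signed_sum_def
  using assms tabloid_vec_stable[of "tabloid \<mu> t" \<mu>] is_repD(2)[OF is_rep_perm_module] column_stabilizerD(1)
  by (intro complex_vector.subspace_sum complex_vector.subspace_scale) (auto simp: tabloids_def)

lemma invariant_specht:
  "invariant_subspace (sym_group (sum_list \<mu>)) (perm_module \<mu>) (rep_space (specht \<mu>))"
  unfolding invariant_subspace_def
proof (intro conjI ballI)
  show "csubspace (rep_space (specht \<mu>))"
    by (simp add: rep_space_specht complex_vector.subspace_span)
  show "rep_space (specht \<mu>) \<subseteq> rep_space (perm_module \<mu>)"
    unfolding rep_space_specht
    using polytabloid_in_perm_module is_repD(2)[OF is_rep_perm_module]
    by (intro complex_vector.span_minimal) auto
  fix \<pi> v assume \<pi>: "\<pi> \<in> carrier (sym_group (sum_list \<mu>))" and v: "v \<in> rep_space (specht \<mu>)"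
  show "rep_act (perm_module \<mu>) \<pi> v \<in> rep_space (specht \<mu>)"
    unfolding rep_space_specht
  proof (rule linear_on_span_closed[where B = "polytabloid \<mu> ` tableaux \<mu>" and T = "rep_act (perm_module \<mu>) \<pi>",
        OF _ _ complex_vector.subspace_span])
    show "linear_on (cspan (polytabloid \<mu> ` tableaux \<mu>)) (rep_act (perm_module \<mu>) \<pi>)"
      by (simp add: perm_module_def linear_on_perm_act)
    fix b assume "b \<in> polytabloid \<mu> ` tableaux \<mu>"
    then show "rep_act (perm_module \<mu>) \<pi> b \<in> cspan (polytabloid \<mu> ` tableaux \<mu>)"
      using \<pi> by (auto simp: perm_module_def sym_group_carrier perm_act_polytabloid
          intro!: complex_vector.span_base tableau_comp)
  qed (use v in \<open>simp add: rep_space_specht\<close>)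
qed

lemma subrep_specht: "subrep (perm_module \<mu>) (rep_space (specht \<mu>)) = specht \<mu>"
  by (simp add: subrep_def perm_module_def rep_act_specht[symmetric, of \<mu>])

lemma is_rep_specht: "is_rep (sym_group (sum_list \<mu>)) (specht \<mu>)"
  using is_rep_subrep[OF is_rep_perm_module invariant_specht] by (simp add: subrep_specht)

lemma polytabloid_in_specht: "t \<in> tableaux \<mu> \<Longrightarrow> polytabloid \<mu> t \<in> rep_space (specht \<mu>)"
  by (simp add: rep_space_specht complex_vector.span_base)

lemma specht_subset: "v \<in> rep_space (specht \<mu>) \<Longrightarrow> v \<in> rep_space (perm_module \<mu>)"
  using invariant_subspaceD(2)[OF invariant_specht] by blast

text \<open>The coefficient at the tabloid of t is 1: a column permutation that also preserves the
  rows fixes every entry, because an entry is determined by its row and its column.\<close>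

lemma polytabloid_nonzero:
  assumes t: "t \<in> tableaux \<mu>"
  shows "polytabloid \<mu> t \<noteq> 0"
proof -
  note T = tableauD[OF t]
  have "\<sigma> = id" if s: "\<sigma> \<in> column_stabilizer \<mu> t" and eq: "tabloid \<mu> t = map (image \<sigma>) (tabloid \<mu> t)" for \<sigma>
  proof
    fix x
    note s' = column_stabilizerD[OF s]
    show "\<sigma> x = id x"
    proof (cases "x \<in> {1..sum_list \<mu>}")
      case True
      then obtain i j where ij: "(i, j) \<in> diagram \<mu>" "x = t (i, j)"
        using T(3) by force
      have i: "i < length \<mu>" "j < \<mu> ! i"
        using ij(1) by (auto simp: diagram_def)
      have "x \<in> tabloid \<mu> t ! i"
        using ij i by (auto simp: nth_tabloid)
      then have "\<sigma> x \<in> map (image \<sigma>) (tabloid \<mu> t) ! i"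
        using i by simp
      then have "\<sigma> x \<in> tabloid \<mu> t ! i"
        using eq by simp
      then obtain j' where j': "(i, j') \<in> diagram \<mu>" "\<sigma> x = t (i, j')"
        using i by (auto simp: nth_tabloid diagram_def)
      have "x \<in> column \<mu> t j"
        using ij by (auto simp: column_def)
      then have "\<sigma> x \<in> column \<mu> t j"
        using s'(2) by blast
      then obtain i' where i': "(i', j) \<in> diagram \<mu>" "\<sigma> x = t (i', j)"
        by (auto simp: column_def)
      then have "(i, j') = (i', j)"
        using j' T(2) by (auto dest: inj_onD)
      then show ?thesis
        using j' ij by simp
    next
      case False
      then show ?thesis
        using permutes_not_in[OF s'(1)] by simp
    qed
  qed
  then have "polytabloid \<mu> t (tabloid \<mu> t) =
      (\<Sum>\<sigma>\<in>column_stabilizer \<mu> t. if \<sigma> = id then 1 else 0)"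
    unfolding polytabloid_def by (intro sum.cong) (auto simp: sign_id)
  then have "polytabloid \<mu> t (tabloid \<mu> t) = 1"
    using finite_column_stabilizer column_stabilizer_id by simp
  then show ?thesis
    by auto
qed

subsection \<open>Irreducibility of Specht modules\<close>

definition cells_above :: "nat list \<Rightarrow> nat \<Rightarrow> (nat \<times> nat) set" where
  "cells_above \<mu> k = {b \<in> diagram \<mu>. fst b < k}"

text \<open>The hypothesis of the dominance lemma, for tableaux of possibly different shapes: two
  entries of one column of t never share a row of s.\<close>

definition meets_rows_once ::
  "nat list \<Rightarrow> (nat \<times> nat \<Rightarrow> nat) \<Rightarrow> nat list \<Rightarrow> (nat \<times> nat \<Rightarrow> nat) \<Rightarrow> bool" where
  "meets_rows_once \<kappa> t \<mu> s \<longleftrightarrow> (\<forall>i i' j. \<forall>b\<in>diagram \<mu>. \<forall>b'\<in>diagram \<mu>.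
     (i, j) \<in> diagram \<kappa> \<longrightarrow> (i', j) \<in> diagram \<kappa> \<longrightarrow> t (i, j) = s b \<longrightarrow> t (i', j) = s b' \<longrightarrow>
     fst b = fst b' \<longrightarrow> i = i')"

text \<open>If two entries \<open>a \<noteq> b\<close> of a column of \<open>t\<close> lie in the same row of \<open>s\<close>, the transposition of \<open>a\<close>
  and \<open>b\<close> fixes the tabloid of \<open>s\<close> and changes the sign of the signed column sum.\<close>

lemma signed_sum_zero:
  assumes t: "t \<in> tableaux \<kappa>" and s: "s \<in> tableaux \<mu>" and n: "sum_list \<kappa> = sum_list \<mu>"
    and nz: "signed_sum \<kappa> t (tabloid_vec (tabloid \<mu> s)) \<noteq> 0"
  shows "meets_rows_once \<kappa> t \<mu> s"
  unfolding meets_rows_once_def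
proof (intro allI ballI impI)
  fix i i' j b b'
  assume b: "b \<in> diagram \<mu>" "b' \<in> diagram \<mu>" and ij: "(i, j) \<in> diagram \<kappa>" "(i', j) \<in> diagram \<kappa>"
    and eq: "t (i, j) = s b" "t (i', j) = s b'" "fst b = fst b'"
  show "i = i'"
  proof (rule ccontr)
    assume "i \<noteq> i'"
    note T = tableauD[OF t] and S = tableauD[OF s]
    let ?x = "t (i, j)" and ?y = "t (i', j)"
    let ?\<tau> = "Transposition.transpose ?x ?y"
    have xy: "?x \<noteq> ?y"
      using \<open>i \<noteq> i'\<close> T(2) ij by (auto dest: inj_onD)
    have perm: "?\<tau> permutes {1..sum_list \<kappa>}"
      using T(4) ij by (intro permutes_swap_id) auto
    have col: "?x \<in> column \<kappa> t k \<longleftrightarrow> ?y \<in> column \<kappa> t k" for k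
    proof -
      have "t (a, j) \<in> column \<kappa> t k \<longleftrightarrow> k = j" if "(a, j) \<in> diagram \<kappa>" for a
        using that T(2) by (fastforce simp: column_def dest: inj_onD)
      then show ?thesis
        using ij by simp
    qed
    have "?\<tau> ` column \<kappa> t k = column \<kappa> t k" for k
      using col by (intro transpose_image_eq)
    then have C: "?\<tau> \<in> column_stabilizer \<kappa> t"
      using perm by (simp add: column_stabilizer_column)
    have "map (image ?\<tau>) (tabloid \<mu> s) = tabloid \<mu> s"
    proof (rule nth_equalityI)
      fix k assume "k < length (map (image ?\<tau>) (tabloid \<mu> s))"
      then have k: "k < length \<mu>"
        by simp
      have "s c \<in> tabloid \<mu> s ! k \<longleftrightarrow> k = fst c" if "c \<in> diagram \<mu>" for c
        using that k S(2) by (cases c) (fastforce simp: nth_tabloid diagram_def dest: inj_onD)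
      then have "?x \<in> tabloid \<mu> s ! k \<longleftrightarrow> ?y \<in> tabloid \<mu> s ! k"
        using b eq by simp
      then show "map (image ?\<tau>) (tabloid \<mu> s) ! k = tabloid \<mu> s ! k"
        using k transpose_image_eq by simp
    qed simp
    then have "signed_sum \<kappa> t (tabloid_vec (tabloid \<mu> s)) =
        of_int (sign ?\<tau>) *\<^sub>C signed_sum \<kappa> t (tabloid_vec (tabloid \<mu> s))"
      using signed_sum_perm_act[OF C, of "tabloid_vec (tabloid \<mu> s)"] perm_act_tabloid_vec[OF perm] by simp
    then have "signed_sum \<kappa> t (tabloid_vec (tabloid \<mu> s)) = - signed_sum \<kappa> t (tabloid_vec (tabloid \<mu> s))"
      using xy by (simp add: sign_swap_id complex_vector.scale_minus_left scaleC_one)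
    then have "(2::complex) *\<^sub>C signed_sum \<kappa> t (tabloid_vec (tabloid \<mu> s)) = 0"
      using scaleC_add_left[of 1 1 "signed_sum \<kappa> t (tabloid_vec (tabloid \<mu> s))"]
      by (simp add: scaleC_one)
    then show False
      using nz by simp
  qed
qed

definition column_cells_above ::
  "nat list \<Rightarrow> (nat \<times> nat \<Rightarrow> nat) \<Rightarrow> nat list \<Rightarrow> (nat \<times> nat \<Rightarrow> nat) \<Rightarrow> nat \<Rightarrow> nat \<Rightarrow> nat set" where
  "column_cells_above \<kappa> t \<mu> s k j = {i. (i, j) \<in> diagram \<kappa> \<and> t (i, j) \<in> s ` cells_above \<mu> k}"

lemma finite_downset_nat:
  fixes A :: "nat set"
  assumes "finite A" "\<And>i i'. i \<in> A \<Longrightarrow> i' \<le> i \<Longrightarrow> i' \<in> A"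
  shows "A = {..<card A}"
proof (rule ccontr)
  assume ne: "A \<noteq> {..<card A}"
  show False
  proof (cases "{..<card A} \<subseteq> A")
    case True
    then show False
      using ne card_subset_eq[OF assms(1) True] by simp
  next
    case False
    then obtain i where i: "i < card A" "i \<notin> A"
      by auto
    have "A \<subseteq> {..<i}"
    proof
      fix i' assume "i' \<in> A"
      then show "i' \<in> {..<i}"
        using assms(2)[of i' i] i(2) by (cases "i \<le> i'") auto
    qed
    then have "card A \<le> card {..<i}"
      by (intro card_mono) auto
    then show False
      using i by simp
  qed
qed

lemma diagram_down:
  assumes "is_partition \<kappa> n" "(i, j) \<in> diagram \<kappa>" "i' \<le> i" "j' \<le> j"
  shows "(i', j') \<in> diagram \<kappa>"
  using assms(2,4) partition_antimono[OF assms(1,3)] by (simp add: diagram_row_length)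

lemma column_height:
  assumes "is_partition \<kappa> n"
  shows "\<exists>h. \<forall>i. (i, j) \<in> diagram \<kappa> \<longleftrightarrow> i < h"
proof -
  have fin: "finite {i. (i, j) \<in> diagram \<kappa>}"
    by (rule finite_subset[of _ "fst ` diagram \<kappa>"]) (auto simp: finite_diagram intro: rev_image_eqI)
  have "{i. (i, j) \<in> diagram \<kappa>} = {..<card {i. (i, j) \<in> diagram \<kappa>}}"
    using diagram_down[OF assms] by (intro finite_downset_nat fin) auto
  then show ?thesis
    by (metis lessThan_iff mem_Collect_eq)
qed

text \<open>The entries counted lie in different rows among the first k rows of s, so there are at
  most k of them, and at most as many as column j has cells. The minimum of the two bounds is what
  the first k rows of \<kappa> cut out of column j.\<close>

lemma card_column_cells_above:
  assumes part: "is_partition \<kappa> n" and t: "t \<in> tableaux \<kappa>" and s: "s \<in> tableaux \<mu>"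
    and m: "meets_rows_once \<kappa> t \<mu> s"
  shows "finite (column_cells_above \<kappa> t \<mu> s k j)"
    and "card (column_cells_above \<kappa> t \<mu> s k j) \<le> card {i. (i, j) \<in> cells_above \<kappa> k}"
proof -
  obtain h where h: "\<And>i. (i, j) \<in> diagram \<kappa> \<longleftrightarrow> i < h"
    using column_height[OF part] by blast
  let ?B = "column_cells_above \<kappa> t \<mu> s k j"
  have sub: "?B \<subseteq> {..<h}"
    using h by (auto simp: column_cells_above_def)
  then show fin: "finite ?B"
    using finite_subset by blast
  define r where "r i = fst (SOME b. b \<in> cells_above \<mu> k \<and> t (i, j) = s b)" for i
  have r: "\<exists>b. b \<in> cells_above \<mu> k \<and> t (i, j) = s b \<and> r i = fst b" if "i \<in> ?B" for i
  proof -
    have "\<exists>b. b \<in> cells_above \<mu> k \<and> t (i, j) = s b"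
      using that by (auto simp: column_cells_above_def)
    from someI_ex[OF this] show ?thesis
      unfolding r_def by blast
  qed
  have "inj_on r ?B"
  proof (rule inj_onI)
    fix i i' assume i: "i \<in> ?B" "i' \<in> ?B" "r i = r i'"
    obtain b where b: "b \<in> cells_above \<mu> k" "t (i, j) = s b" "r i = fst b"
      using r[OF i(1)] by blast
    obtain b' where b': "b' \<in> cells_above \<mu> k" "t (i', j) = s b'" "r i' = fst b'"
      using r[OF i(2)] by blast
    have "(i, j) \<in> diagram \<kappa>" "(i', j) \<in> diagram \<kappa>" "b \<in> diagram \<mu>" "b' \<in> diagram \<mu>" "fst b = fst b'"
      using i b b' by (auto simp: column_cells_above_def cells_above_def)
    then show "i = i'"
      using m b(2) b'(2) unfolding meets_rows_once_def by blast
  qed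
  moreover have "r ` ?B \<subseteq> {..<k}"
    using r by (force simp: cells_above_def)
  ultimately have "card ?B \<le> k"
    using card_inj_on_le[of r ?B "{..<k}"] by simp
  moreover have "card ?B \<le> h"
    using card_mono[OF _ sub] by simp
  moreover have "{i. (i, j) \<in> cells_above \<kappa> k} = {..<min h k}"
    by (rule Set.set_eqI) (simp add: cells_above_def h)
  then have "card {i. (i, j) \<in> cells_above \<kappa> k} = min h k"
    by (simp only: card_lessThan)
  ultimately show "card ?B \<le> card {i. (i, j) \<in> cells_above \<kappa> k}"
    by linarith
qed

lemma finite_cells_above: "finite (cells_above \<mu> k)"
  using finite_diagram by (auto simp: cells_above_def)

lemma card_by_columns:
  assumes "finite D" "finite J" "snd ` D \<subseteq> J"
  shows "card D = (\<Sum>j\<in>J. card {i. (i, j) \<in> D})"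
proof -
  have fin: "finite {i. (i, j) \<in> D}" for j
    by (rule finite_subset[of _ "fst ` D"]) (use assms(1) in \<open>auto intro: rev_image_eqI\<close>)
  have "bij_betw prod.swap D (SIGMA j:J. {i. (i, j) \<in> D})"
    using assms(3) by (intro bij_betwI[where g = prod.swap]) auto
  then have "card D = card (SIGMA j:J. {i. (i, j) \<in> D})"
    by (rule bij_betw_same_card)
  then show ?thesis
    using fin assms(2) by simp
qed

text \<open>Both tableaux are bijections onto the same entries, so the entries in the first k rows
  of s can be counted by the columns of t that contain them.\<close>

lemma card_cells_above_columns:
  assumes t: "t \<in> tableaux \<kappa>" and s: "s \<in> tableaux \<mu>" and n: "sum_list \<kappa> = sum_list \<mu>"
  shows "card (cells_above \<mu> k) = (\<Sum>j\<in>snd ` diagram \<kappa>. card (column_cells_above \<kappa> t \<mu> s k j))"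
proof -
  note T = tableauD[OF t] and S = tableauD[OF s]
  let ?D = "{b \<in> diagram \<kappa>. t b \<in> s ` cells_above \<mu> k}"
  have "s ` cells_above \<mu> k \<subseteq> s ` diagram \<mu>"
    by (intro image_mono) (simp add: cells_above_def)
  then have "s ` cells_above \<mu> k \<subseteq> t ` diagram \<kappa>"
    unfolding S(3) T(3) n .
  moreover have "t ` {b \<in> diagram \<kappa>. t b \<in> A} = A" if "A \<subseteq> t ` diagram \<kappa>" for A
    using that by blast
  ultimately have "t ` ?D = s ` cells_above \<mu> k"
    by blast
  moreover have "inj_on t ?D" "inj_on s (cells_above \<mu> k)"
    using T(2) S(2) by (auto simp: inj_on_def cells_above_def)
  ultimately have "card (cells_above \<mu> k) = card ?D"
    by (metis card_image)
  also have "\<dots> = (\<Sum>j\<in>snd ` diagram \<kappa>. card {i. (i, j) \<in> ?D})"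
    by (rule card_by_columns) (auto simp: finite_diagram)
  finally show ?thesis
    by (simp add: column_cells_above_def)
qed

text \<open>The bounds for the single columns are added up. For all k together the inequality is the
  dominance order on partitions.\<close>

lemma dominance:
  assumes part: "is_partition \<kappa> n" and t: "t \<in> tableaux \<kappa>" and s: "s \<in> tableaux \<mu>"
    and n: "sum_list \<kappa> = sum_list \<mu>" and m: "meets_rows_once \<kappa> t \<mu> s"
  shows "card (cells_above \<mu> k) \<le> card (cells_above \<kappa> k)"
proof -
  have "card (cells_above \<mu> k) \<le> (\<Sum>j\<in>snd ` diagram \<kappa>. card {i. (i, j) \<in> cells_above \<kappa> k})"
    unfolding card_cells_above_columns[OF t s n]
    by (intro sum_mono card_column_cells_above(2)[OF part t s m])
  also have "\<dots> = card (cells_above \<kappa> k)"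
    by (rule card_by_columns[symmetric]) (auto simp: finite_cells_above finite_diagram cells_above_def)
  finally show ?thesis .
qed

text \<open>Differences of consecutive counts are row lengths. This gives antisymmetry of the
  dominance order.\<close>

lemma cells_above_eq_imp_eq:
  assumes "is_partition \<kappa> m" "is_partition \<mu> n" "\<And>k. card (cells_above \<kappa> k) = card (cells_above \<mu> k)"
  shows "\<kappa> = \<mu>"
proof (rule partition_eqI[OF assms(1,2)])
  fix i
  have "card (cells_above \<nu> (Suc i)) = card (cells_above \<nu> i) + row_length \<nu> i" for \<nu>
  proof -
    have "cells_above \<nu> (Suc i) = cells_above \<nu> i \<union> Pair i ` {..<row_length \<nu> i}"
      by (auto simp: cells_above_def less_Suc_eq diagram_row_length)
    moreover have "cells_above \<nu> i \<inter> Pair i ` {..<row_length \<nu> i} = {}"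
      by (auto simp: cells_above_def)
    ultimately show ?thesis
      by (simp add: card_Un_disjoint finite_cells_above card_image inj_on_def)
  qed
  then show "row_length \<kappa> i = row_length \<mu> i"
    using assms(3)[of i] assms(3)[of "Suc i"] by simp
qed

text \<open>For equal shapes the column bounds add up to an equality, so each of them is sharp.
  Hence for every cell (i, j) column j of t contains an entry of row i of s, and sending t (i, j) to
  that entry defines \<sigma>.\<close>

lemma same_tabloid_up_to_columns:
  assumes part: "is_partition \<mu> n" and t: "t \<in> tableaux \<mu>" and s: "s \<in> tableaux \<mu>"
    and m: "meets_rows_once \<mu> t \<mu> s"
  obtains \<sigma> where "\<sigma> \<in> column_stabilizer \<mu> t" "tabloid \<mu> s = map (image \<sigma>) (tabloid \<mu> t)"
proof -
  note T = tableauD[OF t] and S = tableauD[OF s]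
  have eq: "card (column_cells_above \<mu> t \<mu> s k j) = card {i. (i, j) \<in> cells_above \<mu> k}"
    if "j \<in> snd ` diagram \<mu>" for k j
  proof (rule ccontr)
    assume ne: "card (column_cells_above \<mu> t \<mu> s k j) \<noteq> card {i. (i, j) \<in> cells_above \<mu> k}"
    have "(\<Sum>j\<in>snd ` diagram \<mu>. card (column_cells_above \<mu> t \<mu> s k j)) <
        (\<Sum>j\<in>snd ` diagram \<mu>. card {i. (i, j) \<in> cells_above \<mu> k})"
      using ne finite_diagram card_column_cells_above(2)[OF part t s m]
      by (intro sum_strict_mono_ex1 bexI[OF _ that]) (auto simp: order_less_le)
    also have "\<dots> = card (cells_above \<mu> k)"
      by (rule card_by_columns[symmetric]) (auto simp: finite_cells_above finite_diagram cells_above_def)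
    finally show False
      using card_cells_above_columns[OF t s] by simp
  qed
  have "\<exists>i'. (i', j) \<in> diagram \<mu> \<and> (\<exists>j'. (i, j') \<in> diagram \<mu> \<and> t (i', j) = s (i, j'))"
    if ij: "(i, j) \<in> diagram \<mu>" for i j
  proof -
    have j: "j \<in> snd ` diagram \<mu>"
      using ij by force
    have ins: "{i'. (i', j) \<in> cells_above \<mu> (Suc i)} = insert i {i'. (i', j) \<in> cells_above \<mu> i}"
      using ij by (auto simp: cells_above_def less_Suc_eq)
    have fin: "finite {i'. (i', j) \<in> cells_above \<mu> i}"
      by (rule finite_subset[of _ "{..<i}"]) (auto simp: cells_above_def)
    \<comment> \<open>Passing from i to i + 1 rows adds the cell (i, j) to the count of cells, hence
      by \<open>eq\<close> also an entry of column j of t that lies in row i of s.\<close>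
    have "card {i'. (i', j) \<in> cells_above \<mu> i} < card {i'. (i', j) \<in> cells_above \<mu> (Suc i)}"
      unfolding ins using fin by (subst card_insert_disjoint) (auto simp: cells_above_def)
    then have "\<not> column_cells_above \<mu> t \<mu> s (Suc i) j \<subseteq> column_cells_above \<mu> t \<mu> s i j"
      using eq[OF j] card_mono[OF card_column_cells_above(1)[OF part t s m]] by (metis not_le)
    then obtain i' where i': "(i', j) \<in> diagram \<mu>" "t (i', j) \<in> s ` cells_above \<mu> (Suc i)"
      "t (i', j) \<notin> s ` cells_above \<mu> i"
      by (auto simp: column_cells_above_def)
    then obtain b where b: "b \<in> cells_above \<mu> (Suc i)" "t (i', j) = s b" "b \<notin> cells_above \<mu> i"
      by auto
    then have "fst b = i" "b \<in> diagram \<mu>"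
      by (auto simp: cells_above_def)
    then show ?thesis
      using i'(1) b(2) by (metis prod.collapse)
  qed
  then obtain \<rho> where \<rho>: "\<And>i j. (i, j) \<in> diagram \<mu> \<Longrightarrow> (\<rho> i j, j) \<in> diagram \<mu>"
    "\<And>i j. (i, j) \<in> diagram \<mu> \<Longrightarrow> \<exists>j'. (i, j') \<in> diagram \<mu> \<and> t (\<rho> i j, j) = s (i, j')"
    by metis
  define f where "f = (\<lambda>(i, j). t (\<rho> i j, j))"
  have f_in: "f b \<in> {1..sum_list \<mu>}" if "b \<in> diagram \<mu>" for b
    using that \<rho>(1) T(4) by (cases b) (auto simp: f_def)
  \<comment> \<open>The entry f (i, j) lies in column j of t and in row i of s, and these two facts
    determine (i, j).\<close>
  have f_inj: "inj_on f (diagram \<mu>)"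
  proof (rule inj_onI)
    fix b b' assume b: "b \<in> diagram \<mu>" "b' \<in> diagram \<mu>" "f b = f b'"
    obtain i j i' j' where ij: "b = (i, j)" "b' = (i', j')"
      by (cases b, cases b')
    have "(\<rho> i j, j) = (\<rho> i' j', j')"
      using b \<rho>(1) T(2) unfolding ij f_def by (auto dest: inj_onD)
    moreover obtain c where c: "(i, c) \<in> diagram \<mu>" "t (\<rho> i j, j) = s (i, c)"
      using \<rho>(2) b(1) ij by blast
    moreover obtain c' where c': "(i', c') \<in> diagram \<mu>" "t (\<rho> i' j', j') = s (i', c')"
      using \<rho>(2) b(2) ij by blast
    ultimately have "(i, c) = (i', c')"
      using S(2) by (auto dest: inj_onD)
    then show "b = b'"
      using \<open>(\<rho> i j, j) = (\<rho> i' j', j')\<close> ij by simp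
  qed
  let ?N = "{1..sum_list \<mu>}"
  define \<sigma> where "\<sigma> x = (if x \<in> ?N then f (inv_into (diagram \<mu>) t x) else x)" for x
  have \<sigma>t: "\<sigma> (t b) = f b" if "b \<in> diagram \<mu>" for b
    using that T(2,4) by (simp add: \<sigma>_def del: atLeastAtMost_iff)
  have inj: "inj_on \<sigma> ?N"
    unfolding T(3)[symmetric]
  proof (rule inj_onI)
    fix x y assume "x \<in> t ` diagram \<mu>" "y \<in> t ` diagram \<mu>" "\<sigma> x = \<sigma> y"
    then obtain b b' where "b \<in> diagram \<mu>" "b' \<in> diagram \<mu>" "x = t b" "y = t b'" "f b = f b'"
      using \<sigma>t by auto
    then show "x = y"
      using f_inj by (auto dest: inj_onD)
  qed
  have into: "\<sigma> ` ?N \<subseteq> ?N"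
  proof (rule image_subsetI)
    fix x assume "x \<in> ?N"
    then have "x \<in> t ` diagram \<mu>"
      using T(3) by simp
    then obtain b where "b \<in> diagram \<mu>" "x = t b"
      by blast
    then show "\<sigma> x \<in> ?N"
      using \<sigma>t f_in by (simp del: atLeastAtMost_iff)
  qed
  have perm: "\<sigma> permutes ?N"
    using endo_inj_surj[OF _ into inj] inj
    by (intro bij_imp_permutes) (auto simp: bij_betw_def \<sigma>_def)
  have "\<sigma> ` column \<mu> t j = column \<mu> t j" for j
  proof (rule endo_inj_surj)
    have sub: "column \<mu> t j \<subseteq> ?N"
      using T(4) by (auto simp: column_def)
    then show "finite (column \<mu> t j)"
      using finite_subset by blast
    show "inj_on \<sigma> (column \<mu> t j)"
      using inj sub by (rule inj_on_subset)
    show "\<sigma> ` column \<mu> t j \<subseteq> column \<mu> t j"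
      using \<sigma>t \<rho>(1) by (auto simp: column_def f_def)
  qed
  then have C: "\<sigma> \<in> column_stabilizer \<mu> t"
    using perm by (simp add: column_stabilizer_column)
  have "tabloid \<mu> s = map (image \<sigma>) (tabloid \<mu> t)"
  proof (rule nth_equalityI)
    fix i assume "i < length (tabloid \<mu> s)"
    then have i: "i < length \<mu>"
      by simp
    have row: "tabloid \<mu> u ! i = u ` (Pair i ` {..<\<mu> ! i})" for u
      using i by (auto simp: nth_tabloid)
    have sub: "Pair i ` {..<\<mu> ! i} \<subseteq> diagram \<mu>"
      using i by (auto simp: diagram_def)
    have "\<sigma> ` tabloid \<mu> t ! i \<subseteq> tabloid \<mu> s ! i"
    proof
      fix x assume "x \<in> \<sigma> ` tabloid \<mu> t ! i"
      then obtain j where j: "j < \<mu> ! i" "x = \<sigma> (t (i, j))"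
        unfolding row by auto
      then have ij: "(i, j) \<in> diagram \<mu>"
        using i by (simp add: diagram_def)
      obtain j' where "(i, j') \<in> diagram \<mu>" "t (\<rho> i j, j) = s (i, j')"
        using \<rho>(2)[OF ij] by blast
      then show "x \<in> tabloid \<mu> s ! i"
        using j(2) \<sigma>t[OF ij] i by (auto simp: f_def nth_tabloid diagram_def)
    qed
    moreover have "card (\<sigma> ` tabloid \<mu> t ! i) = card (tabloid \<mu> s ! i)"
    proof -
      have "card (\<sigma> ` tabloid \<mu> t ! i) = card (tabloid \<mu> t ! i)"
        using permutes_inj[OF perm] by (intro card_image) (auto simp: inj_on_def)
      also have "\<dots> = card (tabloid \<mu> s ! i)"
        unfolding row using inj_on_subset[OF T(2) sub] inj_on_subset[OF S(2) sub] by (simp add: card_image)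
      finally show ?thesis .
    qed
    moreover have "finite (tabloid \<mu> s ! i)"
      unfolding row by simp
    ultimately have "\<sigma> ` tabloid \<mu> t ! i = tabloid \<mu> s ! i"
      by (intro card_subset_eq)
    then show "tabloid \<mu> s ! i = map (image \<sigma>) (tabloid \<mu> t) ! i"
      using i by simp
  qed simp
  then show thesis
    using that C by blast
qed

text \<open>By linearity it is enough to look at a tabloid. If the antisymmetriser does not
  annihilate it, it arises from the tabloid of t by a column permutation, and the result is the
  polytabloid up to sign.\<close>

lemma signed_sum_multiple:
  assumes part: "is_partition \<mu> n" and t: "t \<in> tableaux \<mu>" and v: "v \<in> rep_space (perm_module \<mu>)"
  obtains c where "signed_sum \<mu> t v = c *\<^sub>C polytabloid \<mu> t"
proof -
  have "\<exists>c. signed_sum \<mu> t (tabloid_vec S) = c *\<^sub>C polytabloid \<mu> t" if "S \<in> tabloids \<mu>" for S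
  proof (cases "signed_sum \<mu> t (tabloid_vec S) = 0")
    case True
    then show ?thesis
      by (intro exI[of _ 0]) simp
  next
    case False
    obtain s where s: "s \<in> tableaux \<mu>" "S = tabloid \<mu> s"
      using \<open>S \<in> tabloids \<mu>\<close> by (auto simp: tabloids_def)
    have "meets_rows_once \<mu> t \<mu> s"
      using signed_sum_zero[OF t s(1)] False s(2) by simp
    then obtain \<sigma> where \<sigma>: "\<sigma> \<in> column_stabilizer \<mu> t" "tabloid \<mu> s = map (image \<sigma>) (tabloid \<mu> t)"
      using same_tabloid_up_to_columns[OF part t s(1)] by blast
    have "signed_sum \<mu> t (tabloid_vec S) = of_int (sign \<sigma>) *\<^sub>C polytabloid \<mu> t"
      using signed_sum_perm_act[OF \<sigma>(1)] perm_act_tabloid_vec[OF column_stabilizerD(1)[OF \<sigma>(1)]] \<sigma>(2) s(2)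
      by (metis polytabloid_signed_sum)
    then show ?thesis
      by blast
  qed
  then obtain c where c: "\<And>S. S \<in> tabloids \<mu> \<Longrightarrow> signed_sum \<mu> t (tabloid_vec S) = c S *\<^sub>C polytabloid \<mu> t"
    by metis
  have "signed_sum \<mu> t v = (\<Sum>S\<in>tabloids \<mu>. v S *\<^sub>C signed_sum \<mu> t (tabloid_vec S))"
    by (rule frame_linear[OF perm_module_frame linear_on_signed_sum v])
  also have "\<dots> = (\<Sum>S\<in>tabloids \<mu>. v S * c S) *\<^sub>C polytabloid \<mu> t"
    using c by (simp add: scaleC_scaleC complex_vector.scale_sum_left)
  finally show thesis
    by (rule that)
qed

text \<open>Two tableaux of one shape differ by a permutation of the entries. Thus an equivariant
  map on a Specht module is determined by its value on one polytabloid.\<close>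

lemma polytabloid_translate:
  assumes "t \<in> tableaux \<mu>" "s \<in> tableaux \<mu>"
  obtains \<pi> where "\<pi> permutes {1..sum_list \<mu>}" "polytabloid \<mu> s = perm_act \<pi> (polytabloid \<mu> t)"
proof -
  note T = tableauD[OF assms(1)] and S = tableauD[OF assms(2)]
  define \<pi> where "\<pi> x = (if x \<in> {1..sum_list \<mu>} then s (inv_into (diagram \<mu>) t x) else x)" for x
  have "bij_betw (s \<circ> inv_into (diagram \<mu>) t) {1..sum_list \<mu>} {1..sum_list \<mu>}"
    using bij_betw_trans[OF bij_betw_inv_into[OF T(1)] S(1)] .
  then have "bij_betw \<pi> {1..sum_list \<mu>} {1..sum_list \<mu>}"
    by (rule bij_betw_cong[THEN iffD1, rotated]) (simp add: \<pi>_def)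
  then have p: "\<pi> permutes {1..sum_list \<mu>}"
    by (rule bij_imp_permutes) (auto simp: \<pi>_def)
  have "(\<pi> \<circ> t) b = s b" if "b \<in> diagram \<mu>" for b
    using that T(2,4) by (simp add: \<pi>_def del: atLeastAtMost_iff)
  then have "polytabloid \<mu> (\<pi> \<circ> t) = polytabloid \<mu> s"
    by (rule polytabloid_cong)
  then show thesis
    using that p perm_act_polytabloid[OF p] by metis
qed

section \<open>Specht modules are irreducible and pairwise non-isomorphic\<close>

lemma signed_sum_hom:
  assumes T: "rep_hom (sym_group (sum_list \<kappa>)) (specht \<mu>) (specht \<nu>) T" and v: "v \<in> rep_space (specht \<mu>)"
    and n: "sum_list \<mu> = sum_list \<kappa>"
  shows "T (signed_sum \<kappa> t v) = signed_sum \<kappa> t (T v)"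
proof -
  note h = rep_homD[OF T] and r = is_repD[OF is_rep_specht[of \<mu>]]
  have g: "\<sigma> \<in> carrier (sym_group (sum_list \<kappa>))" if "\<sigma> \<in> column_stabilizer \<kappa> t" for \<sigma>
    using column_stabilizerD(1)[OF that] by (simp add: sym_group_carrier)
  have "T (signed_sum \<kappa> t v) = (\<Sum>\<sigma>\<in>column_stabilizer \<kappa> t. of_int (sign \<sigma>) *\<^sub>C T (perm_act \<sigma> v))"
    unfolding signed_sum_def
    using r(4)[OF _ v] g n by (intro linear_on_sum_scale[OF h(1) r(2)]) (simp add: rep_act_specht)
  also have "\<dots> = (\<Sum>\<sigma>\<in>column_stabilizer \<kappa> t. of_int (sign \<sigma>) *\<^sub>C perm_act \<sigma> (T v))"
    using h(4)[OF g v] by (simp add: rep_act_specht)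
  finally show ?thesis
    by (simp add: signed_sum_def)
qed

lemma finite_sym_group: "finite (carrier (sym_group n))"
  using finite_permutations[of "{1..n}"] by (simp add: sym_group_def)

lemma fin_group_sym: "fin_group (sym_group n)"
  by (intro fin_group.intro fin_group_axioms.intro sym_group_is_group finite_sym_group)

text \<open>A complement of a submodule gives an equivariant projection \<open>P\<close>; since the signed column sum has
  rank one, the polytabloid of \<open>t\<close> is an eigenvector of \<open>P\<close>, hence it lies in the image or in the
  kernel of \<open>P\<close>.\<close>

lemma irreducible_specht:
  assumes part: "is_partition \<mu> n"
  shows "irreducible_rep (sym_group (sum_list \<mu>)) (specht \<mu>)"
proof (rule irreducible_repI[OF is_rep_specht])
  interpret S: fin_group "sym_group (sum_list \<mu>)"
    by (rule fin_group_sym)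
  obtain t where t: "t \<in> tableaux \<mu>"
    by (rule tableau_exists)
  let ?e = "polytabloid \<mu> t" and ?c = "of_nat (card (column_stabilizer \<mu> t)) :: complex"
  have e: "?e \<in> rep_space (specht \<mu>)" "?e \<noteq> 0"
    using polytabloid_in_specht[OF t] polytabloid_nonzero[OF t] by auto
  show "rep_space (specht \<mu>) \<noteq> {0}"
    using e by blast
  fix W assume W: "invariant_subspace (sym_group (sum_list \<mu>)) (specht \<mu>) W"
  note w = invariant_subspaceD[OF W]
  obtain P where P: "rep_hom (sym_group (sum_list \<mu>)) (specht \<mu>) (specht \<mu>) P"
    "P \<in> rep_space (specht \<mu>) \<rightarrow> W" "\<forall>w\<in>W. P w = w"
    using S.maschke[OF is_rep_specht W] .
  note p = rep_homD[OF P(1)]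
  have c: "?c \<noteq> 0"
    using card_column_stabilizer_pos[of \<mu> t] by simp
  have "?c *\<^sub>C P ?e = P (signed_sum \<mu> t ?e)"
    unfolding signed_sum_polytabloid using linear_on_scale[OF p(1) e(1)] by simp
  also have "\<dots> = signed_sum \<mu> t (P ?e)"
    by (rule signed_sum_hom[OF P(1) e(1)]) simp
  finally obtain d where "?c *\<^sub>C P ?e = d *\<^sub>C ?e"
    using signed_sum_multiple[OF part t specht_subset[OF p(3)[OF e(1)]]] by metis
  then have "(1 / ?c) *\<^sub>C (?c *\<^sub>C P ?e) = (1 / ?c) *\<^sub>C (d *\<^sub>C ?e)"
    by simp
  then have Pe: "P ?e = (d / ?c) *\<^sub>C ?e"
    using c by (simp add: scaleC_scaleC scaleC_one)
  have gen: "P (polytabloid \<mu> s) = (d / ?c) *\<^sub>C polytabloid \<mu> s" if s: "s \<in> tableaux \<mu>" for s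
  proof -
    obtain \<pi> where \<pi>: "\<pi> permutes {1..sum_list \<mu>}" "polytabloid \<mu> s = perm_act \<pi> ?e"
      using polytabloid_translate[OF t s] .
    then have "P (polytabloid \<mu> s) = perm_act \<pi> (P ?e)"
      using p(4)[of \<pi> ?e] e(1) by (simp add: rep_act_specht sym_group_carrier)
    then show ?thesis
      using Pe \<pi>(2) by (simp add: perm_act_linear)
  qed
  have PS: "P v = (d / ?c) *\<^sub>C v" if "v \<in> rep_space (specht \<mu>)" for v
    by (rule linear_on_span_eq[where S = P and B = "polytabloid \<mu> ` tableaux \<mu>"])
      (use that p(1) gen linear_on_scaled[OF linear_on_id] in \<open>auto simp: rep_space_specht\<close>)
  show "W = {0} \<or> W = rep_space (specht \<mu>)"
  proof (cases "d = 0")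
    case True
    then have "w = 0" if "w \<in> W" for w
      using PS[of w] P(3) w(2) that by auto
    then show ?thesis
      using complex_vector.subspace_0[OF w(1)] by blast
  next
    case False
    have "v \<in> W" if v: "v \<in> rep_space (specht \<mu>)" for v
    proof -
      have "(?c / d) *\<^sub>C P v = v"
        using PS[OF v] False c by (simp add: scaleC_scaleC scaleC_one)
      moreover have "P v \<in> W"
        using P(2) v by auto
      ultimately show ?thesis
        using complex_vector.subspace_scale[OF w(1), of "P v" "?c / d"] by simp
    qed
    then show ?thesis
      using w(2) by blast
  qed
qed

text \<open>The image of the polytabloid of t is nonzero and, up to the order of the column
  stabilizer, lies in the image of the antisymmetriser of t. So some tabloid of shape \<mu> is not
  annihilated, and the dominance lemma applies to it.\<close>

lemma specht_iso_imp_dominates: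
  assumes part: "is_partition \<kappa> n" "is_partition \<mu> n" and iso: "rep_iso (sym_group n) (specht \<kappa>) (specht \<mu>)"
  shows "card (cells_above \<mu> k) \<le> card (cells_above \<kappa> k)"
proof -
  have n: "sum_list \<kappa> = n" "sum_list \<mu> = n"
    using part by (auto simp: is_partition_def)
  obtain T where T: "rep_hom (sym_group n) (specht \<kappa>) (specht \<mu>) T"
    "bij_betw T (rep_space (specht \<kappa>)) (rep_space (specht \<mu>))"
    using iso by (rule rep_isoE)
  note h = rep_homD[OF T(1)]
  obtain t where t: "t \<in> tableaux \<kappa>"
    by (rule tableau_exists)
  let ?e = "polytabloid \<kappa> t" and ?c = "of_nat (card (column_stabilizer \<kappa> t)) :: complex"
  have e: "?e \<in> rep_space (specht \<kappa>)" "?e \<noteq> 0"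
    using polytabloid_in_specht[OF t] polytabloid_nonzero[OF t] by auto
  have 0: "0 \<in> rep_space (specht \<kappa>)"
    by (rule complex_vector.subspace_0[OF is_repD(2)[OF is_rep_specht]])
  have "T ?e \<noteq> 0"
    using T(2) e 0 linear_on_zero[OF h(1) 0] unfolding bij_betw_def inj_on_def by metis
  moreover have "?c \<noteq> 0"
    using card_column_stabilizer_pos[of \<kappa> t] by simp
  ultimately have "?c *\<^sub>C T ?e \<noteq> 0"
    by simp
  moreover have "?c *\<^sub>C T ?e = signed_sum \<kappa> t (T ?e)"
    using signed_sum_hom[of \<kappa> \<kappa> \<mu> T ?e t] T(1) e(1) n linear_on_scale[OF h(1) e(1)]
    by (simp add: signed_sum_polytabloid)
  ultimately have "(\<Sum>S\<in>tabloids \<mu>. T ?e S *\<^sub>C signed_sum \<kappa> t (tabloid_vec S)) \<noteq> 0"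
    using frame_linear[OF perm_module_frame linear_on_signed_sum specht_subset[OF h(3)[OF e(1)]], of \<kappa> t]
    by simp
  then obtain S where S: "S \<in> tabloids \<mu>" "signed_sum \<kappa> t (tabloid_vec S) \<noteq> 0"
    by (metis (no_types, lifting) complex_vector.scale_zero_right sum.neutral)
  then obtain s where s: "s \<in> tableaux \<mu>" "S = tabloid \<mu> s"
    by (auto simp: tabloids_def)
  have "meets_rows_once \<kappa> t \<mu> s"
    using signed_sum_zero[OF t s(1)] S(2) s(2) n by simp
  then show ?thesis
    using dominance[OF part(1) t s(1)] n by simp
qed

lemma specht_iso_imp_eq:
  assumes "is_partition \<kappa> n" "is_partition \<mu> n" "rep_iso (sym_group n) (specht \<kappa>) (specht \<mu>)"
  shows "\<kappa> = \<mu>"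
  using specht_iso_imp_dominates[OF assms] specht_iso_imp_dominates[OF assms(2,1) rep_iso_sym[OF assms(3)]]
  by (intro cells_above_eq_imp_eq[OF assms(1,2)] antisym)

section \<open>The branching rule\<close>

subsection \<open>Young's lattice\<close>

definition Yminus :: "nat list \<Rightarrow> nat list set" where
  "Yminus \<gamma> = {\<mu>. is_partition \<mu> (sum_list \<mu>) \<and> \<gamma> \<in> Yplus \<mu>}"

text \<open>Young diagrams are the finite order ideals of pairs of naturals. In this form unions and
  intersections of diagrams can be taken.\<close>

definition downset :: "(nat \<times> nat) set \<Rightarrow> bool" where
  "downset D \<longleftrightarrow> finite D \<and> (\<forall>i j i' j'. (i, j) \<in> D \<longrightarrow> i' \<le> i \<longrightarrow> j' \<le> j \<longrightarrow> (i', j') \<in> D)"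

lemma downset_diagram: "is_partition \<mu> n \<Longrightarrow> downset (diagram \<mu>)"
  using diagram_down unfolding downset_def by (blast intro: finite_diagram)

lemma partition_sum: "is_partition \<mu> n \<Longrightarrow> sum_list \<mu> = n"
  by (simp add: is_partition_def)

lemma partition_self: "is_partition \<mu> n \<Longrightarrow> is_partition \<mu> (sum_list \<mu>)"
  by (simp add: is_partition_def)

lemma card_diagram_partition: "is_partition \<mu> n \<Longrightarrow> card (diagram \<mu>) = n"
  by (simp add: card_diagram partition_sum)

lemma diagram_inject:
  assumes "is_partition \<mu> m" "is_partition \<nu> n" "diagram \<mu> = diagram \<nu>"
  shows "\<mu> = \<nu>"
proof (rule partition_eqI[OF assms(1,2)])
  fix i
  have "j < row_length \<mu> i \<longleftrightarrow> j < row_length \<nu> i" for j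
    using assms(3) diagram_row_length by metis
  then show "row_length \<mu> i = row_length \<nu> i"
    by (meson linorder_neqE_nat less_irrefl)
qed

text \<open>The horizontal sections are initial segments of the naturals, and their lengths are the
  parts.\<close>

lemma partition_of_downset:
  assumes "downset D"
  obtains \<mu> where "is_partition \<mu> (card D)" "diagram \<mu> = D"
proof -
  have fin: "finite D" and down: "\<And>i j i' j'. (i, j) \<in> D \<Longrightarrow> i' \<le> i \<Longrightarrow> j' \<le> j \<Longrightarrow> (i', j') \<in> D"
    using assms unfolding downset_def by blast+
  define l where "l i = card {j. (i, j) \<in> D}" for i
  define h where "h = card {i. (i, 0) \<in> D}"
  have finr: "finite {j. (i, j) \<in> D}" for i
    by (rule finite_subset[of _ "snd ` D"]) (auto simp: fin intro: rev_image_eqI)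
  have l: "(i, j) \<in> D \<longleftrightarrow> j < l i" for i j
  proof -
    have "{j. (i, j) \<in> D} = {..<l i}"
      unfolding l_def using down by (intro finite_downset_nat finr) blast
    then show ?thesis
      by blast
  qed
  have h: "(i, 0) \<in> D \<longleftrightarrow> i < h" for i
  proof -
    have "finite {i. (i, 0) \<in> D}"
      by (rule finite_subset[of _ "fst ` D"]) (auto simp: fin intro: rev_image_eqI)
    then have "{i. (i, 0) \<in> D} = {..<h}"
      unfolding h_def using down by (intro finite_downset_nat) blast+
    then show ?thesis
      by blast
  qed
  define \<mu> where "\<mu> = map l [0..<h]"
  have D: "diagram \<mu> = D"
  proof (rule Set.set_eqI)
    fix b :: "nat \<times> nat"
    obtain i j where "b = (i, j)"
      by (cases b)
    moreover have "i < h" if "j < l i"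
      using that l h down[of i j i 0] by auto
    ultimately show "b \<in> diagram \<mu> \<longleftrightarrow> b \<in> D"
      using l by (auto simp: diagram_def \<mu>_def)
  qed
  have "l j \<le> l i" if "i \<le> j" for i j
    unfolding l_def using down that by (intro card_mono finr) blast
  then have "sorted_wrt (\<ge>) \<mu>"
    by (simp add: \<mu>_def sorted_wrt_iff_nth_less)
  moreover have "0 < l i" if "i < h" for i
    using that l h by auto
  then have "\<forall>p\<in>set \<mu>. 0 < p"
    by (auto simp: \<mu>_def)
  moreover have "sum_list \<mu> = card D"
    using card_diagram[of \<mu>] D by simp
  ultimately have "is_partition \<mu> (card D)"
    by (simp add: is_partition_def)
  then show thesis
    using that D by blast
qed

text \<open>A diagram that contains another one and has one cell more differs from it by a single
  box. This describes covers by inclusion and size, which fits unions and intersections.\<close>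

lemma Yplus_iff:
  assumes "is_partition \<mu> n"
  shows "\<gamma> \<in> Yplus \<mu> \<longleftrightarrow> is_partition \<gamma> (Suc n) \<and> diagram \<mu> \<subseteq> diagram \<gamma>"
proof (intro iffI conjI)
  assume "is_partition \<gamma> (Suc n) \<and> diagram \<mu> \<subseteq> diagram \<gamma>"
  then have \<gamma>: "is_partition \<gamma> (Suc n)" "diagram \<mu> \<subseteq> diagram \<gamma>"
    by auto
  have "card (diagram \<gamma> - diagram \<mu>) = 1"
    using card_diagram_partition[OF assms] card_diagram_partition[OF \<gamma>(1)] \<gamma>(2)
    by (simp add: card_Diff_subset finite_diagram)
  then obtain b where "diagram \<gamma> - diagram \<mu> = {b}"
    by (auto simp: card_Suc_eq)
  then have "b \<notin> diagram \<mu>" "diagram \<gamma> = insert b (diagram \<mu>)"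
    using \<gamma>(2) by auto
  moreover have "is_partition \<gamma> (Suc (sum_list \<mu>))"
    using \<gamma>(1) partition_sum[OF assms] by simp
  ultimately show "\<gamma> \<in> Yplus \<mu>"
    unfolding Yplus_def by blast
qed (use partition_sum[OF assms] in \<open>auto simp: Yplus_def\<close>)

lemma Yminus_iff:
  assumes "is_partition \<gamma> (Suc n)"
  shows "\<mu> \<in> Yminus \<gamma> \<longleftrightarrow> is_partition \<mu> n \<and> diagram \<mu> \<subseteq> diagram \<gamma>"
proof
  assume "\<mu> \<in> Yminus \<gamma>"
  then have \<mu>: "is_partition \<mu> (sum_list \<mu>)" "\<gamma> \<in> Yplus \<mu>"
    by (auto simp: Yminus_def)
  then have \<gamma>: "is_partition \<gamma> (Suc (sum_list \<mu>))" "diagram \<mu> \<subseteq> diagram \<gamma>"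
    using Yplus_iff by blast+
  have "n = sum_list \<mu>"
    using partition_sum[OF assms] partition_sum[OF \<gamma>(1)] by simp
  then show "is_partition \<mu> n \<and> diagram \<mu> \<subseteq> diagram \<gamma>"
    using \<mu>(1) \<gamma>(2) by simp
next
  assume "is_partition \<mu> n \<and> diagram \<mu> \<subseteq> diagram \<gamma>"
  then show "\<mu> \<in> Yminus \<gamma>"
    using Yplus_iff[of \<mu> n \<gamma>] assms by (auto simp: Yminus_def intro: partition_self)
qed

lemma Yminus_empty: "is_partition \<gamma> 0 \<Longrightarrow> Yminus \<gamma> = {}"
  by (auto simp: Yminus_def Yplus_def dest!: partition_sum)

lemma finite_partitions: "finite {\<mu>. is_partition \<mu> n}"
proof (rule finite_subset)
  have len: "length \<mu> \<le> sum_list \<mu>" if "\<forall>p\<in>set \<mu>. 0 < p" for \<mu> :: "nat list"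
    using that by (induction \<mu>) auto
  show "{\<mu>. is_partition \<mu> n} \<subseteq> {xs. set xs \<subseteq> {..n} \<and> length xs \<le> n}"
    using len member_le_sum_list by (fastforce simp: is_partition_def)
qed (simp add: finite_lists_length_le)

lemma finite_Yplus: "finite (Yplus \<mu>)"
  by (rule finite_subset[OF _ finite_partitions[of "Suc (sum_list \<mu>)"]]) (auto simp: Yplus_def)

lemma finite_Yminus: "finite (Yminus \<gamma>)"
  by (rule finite_subset[OF _ finite_partitions[of "sum_list \<gamma> - 1"]])
    (auto simp: Yminus_def Yplus_def is_partition_def)

text \<open>A common upper cover contains the union of the diagrams and has n + 1 cells; a common
  lower cover lies in the intersection and has n - 1 cells. The sizes of union and intersection add
  up to 2 n, so either both have the critical size, and there is exactly one cover of each kind, or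
  there is none of either kind.\<close>

lemma card_Yplus_Yminus_distinct:
  assumes "is_partition \<kappa> n" "is_partition \<mu> n" "\<kappa> \<noteq> \<mu>"
  shows "card (Yplus \<kappa> \<inter> Yplus \<mu>) = card (Yminus \<kappa> \<inter> Yminus \<mu>)"
proof -
  let ?A = "diagram \<kappa>" and ?B = "diagram \<mu>"
  have AB: "card ?A = n" "card ?B = n" "?A \<noteq> ?B"
    using assms card_diagram_partition diagram_inject by blast+
  have fin: "finite ?A" "finite ?B"
    by (rule finite_diagram)+
  have sum: "card (?A \<union> ?B) + card (?A \<inter> ?B) = 2 * n"
    using card_Un_Int[OF fin] AB by simp
  have lt: "card (?A \<inter> ?B) < n"
  proof (rule ccontr)
    assume "\<not> card (?A \<inter> ?B) < n"
    then have "card (?A \<inter> ?B) = n"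
      using card_mono[OF fin(1), of "?A \<inter> ?B"] AB(1) by simp
    then have "?A \<inter> ?B = ?A" "?A \<inter> ?B = ?B"
      using AB(1,2) fin by (intro card_subset_eq; simp)+
    then show False
      using AB(3) by blast
  qed
  \<comment> \<open>Two distinct shapes exist only for n > 0; the common lower covers have size m =
    n - 1.\<close>
  obtain m where m: "n = Suc m"
    using lt by (cases n) auto
  have dU: "downset (?A \<union> ?B)" and dI: "downset (?A \<inter> ?B)"
    using downset_diagram[OF assms(1)] downset_diagram[OF assms(2)] unfolding downset_def by blast+
  have up: "\<gamma> \<in> Yplus \<kappa> \<inter> Yplus \<mu> \<longleftrightarrow> is_partition \<gamma> (Suc n) \<and> ?A \<union> ?B \<subseteq> diagram \<gamma>" for \<gamma>
    using Yplus_iff assms by auto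
  have lo: "\<nu> \<in> Yminus \<kappa> \<inter> Yminus \<mu> \<longleftrightarrow> is_partition \<nu> m \<and> diagram \<nu> \<subseteq> ?A \<inter> ?B" for \<nu>
    using Yminus_iff assms unfolding m by auto
  show ?thesis
  proof (cases "card (?A \<inter> ?B) = m")
    case True
    then have cU: "card (?A \<union> ?B) = Suc n"
      using sum m by simp
    obtain \<gamma> where \<gamma>: "is_partition \<gamma> (Suc n)" "diagram \<gamma> = ?A \<union> ?B"
      using partition_of_downset[OF dU] cU by metis
    obtain \<nu> where \<nu>: "is_partition \<nu> m" "diagram \<nu> = ?A \<inter> ?B"
      using partition_of_downset[OF dI] True by metis
    have "\<gamma>' = \<gamma>" if "\<gamma>' \<in> Yplus \<kappa> \<inter> Yplus \<mu>" for \<gamma>'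
    proof -
      have g: "is_partition \<gamma>' (Suc n)" "?A \<union> ?B \<subseteq> diagram \<gamma>'"
        using that up by auto
      then have "?A \<union> ?B = diagram \<gamma>'"
        using card_diagram_partition[OF g(1)] cU by (intro card_subset_eq finite_diagram) auto
      then show ?thesis
        using diagram_inject[OF g(1) \<gamma>(1)] \<gamma>(2) by simp
    qed
    then have "Yplus \<kappa> \<inter> Yplus \<mu> = {\<gamma>}"
      using up \<gamma> by blast
    moreover have "\<nu>' = \<nu>" if "\<nu>' \<in> Yminus \<kappa> \<inter> Yminus \<mu>" for \<nu>'
    proof -
      have g: "is_partition \<nu>' m" "diagram \<nu>' \<subseteq> ?A \<inter> ?B"
        using that lo by auto
      then have "diagram \<nu>' = ?A \<inter> ?B"
        using card_diagram_partition[OF g(1)] True fin by (intro card_subset_eq) auto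
      then show ?thesis
        using diagram_inject[OF g(1) \<nu>(1)] \<nu>(2) by simp
    qed
    then have "Yminus \<kappa> \<inter> Yminus \<mu> = {\<nu>}"
      using lo \<nu> by blast
    ultimately show ?thesis
      by simp
  next
    case False
    have "\<gamma> \<notin> Yplus \<kappa> \<inter> Yplus \<mu>" for \<gamma>
    proof
      assume "\<gamma> \<in> Yplus \<kappa> \<inter> Yplus \<mu>"
      then have g: "is_partition \<gamma> (Suc n)" "?A \<union> ?B \<subseteq> diagram \<gamma>"
        using up by auto
      have "card (?A \<union> ?B) \<le> Suc n"
        using card_mono[OF finite_diagram g(2)] card_diagram_partition[OF g(1)] by simp
      then show False
        using sum lt False m by linarith
    qed
    moreover have "\<nu> \<notin> Yminus \<kappa> \<inter> Yminus \<mu>" for \<nu>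
    proof
      assume "\<nu> \<in> Yminus \<kappa> \<inter> Yminus \<mu>"
      then have g: "is_partition \<nu> m" "diagram \<nu> \<subseteq> ?A \<inter> ?B"
        using lo by auto
      have "m \<le> card (?A \<inter> ?B)"
        using card_mono[OF _ g(2)] card_diagram_partition[OF g(1)] fin by simp
      then show False
        using lt False m by linarith
    qed
    ultimately have "Yplus \<kappa> \<inter> Yplus \<mu> = {}" "Yminus \<kappa> \<inter> Yminus \<mu> = {}"
      by blast+
    then show ?thesis
      by simp
  qed
qed

section \<open>Numbers of upper and lower covers\<close>

definition removable_rows :: "nat list \<Rightarrow> nat set" where
  "removable_rows \<mu> = {r. row_length \<mu> (Suc r) < row_length \<mu> r}"

text \<open>A box can be removed exactly at the end of a row that is longer than the next
  one.\<close>

lemma card_Yminus_rows: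
  assumes part: "is_partition \<mu> n"
  shows "card (Yminus \<mu>) = card (removable_rows \<mu>)"
proof -
  let ?D = "diagram \<mu>" and ?l = "row_length \<mu>"
  have img: "diagram ` Yminus \<mu> = (\<lambda>r. ?D - {(r, ?l r - 1)}) ` removable_rows \<mu>"
  proof (intro equalityI subsetI)
    fix E assume "E \<in> diagram ` Yminus \<mu>"
    then obtain \<nu> where \<nu>: "\<nu> \<in> Yminus \<mu>" "E = diagram \<nu>"
      by blast
    then obtain b where b: "b \<notin> E" "?D = insert b E" and p: "is_partition \<nu> (sum_list \<nu>)"
      by (auto simp: Yminus_def Yplus_def)
    obtain r c where rc: "b = (r, c)"
      by (cases b)
    have "(r, Suc c) \<notin> ?D"
    proof
      assume "(r, Suc c) \<in> ?D"
      then have "(r, Suc c) \<in> diagram \<nu>"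
        using b rc \<nu>(2) by auto
      then show False
        using diagram_down[OF p, of r "Suc c" r c] b(1) rc \<nu>(2) by auto
    qed
    moreover have "(r, c) \<in> ?D"
      using b rc by auto
    ultimately have c: "Suc c = ?l r"
      by (simp add: diagram_row_length)
    have "(Suc r, c) \<notin> ?D"
    proof
      assume "(Suc r, c) \<in> ?D"
      then have "(Suc r, c) \<in> diagram \<nu>"
        using b rc \<nu>(2) by auto
      then show False
        using diagram_down[OF p, of "Suc r" c r c] b(1) rc \<nu>(2) by auto
    qed
    then have "r \<in> removable_rows \<mu>"
      using c by (auto simp: removable_rows_def diagram_row_length)
    moreover have "E = ?D - {(r, ?l r - 1)}"
      using b rc c by (auto simp: c[symmetric])
    ultimately show "E \<in> (\<lambda>r. ?D - {(r, ?l r - 1)}) ` removable_rows \<mu>"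
      by blast
  next
    fix E assume "E \<in> (\<lambda>r. ?D - {(r, ?l r - 1)}) ` removable_rows \<mu>"
    then obtain r where r: "?l (Suc r) < ?l r" "E = ?D - {(r, ?l r - 1)}"
      by (auto simp: removable_rows_def)
    have "downset E"
      unfolding downset_def
    proof (intro conjI allI impI)
      show "finite E"
        using r(2) finite_diagram by simp
      fix i j i' j' assume ij: "(i, j) \<in> E" "i' \<le> i" "j' \<le> j"
      have D: "(i', j') \<in> ?D" "j < ?l i"
        using diagram_down[OF part] ij r(2) by (auto simp: diagram_row_length)
      have "(i', j') \<noteq> (r, ?l r - 1)"
      proof
        assume eq: "(i', j') = (r, ?l r - 1)"
        show False
        proof (cases "i = r")
          case True
          then have "j = ?l r - 1"
            using D(2) eq ij(3) by auto
          then show False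
            using ij(1) r(2) True by simp
        next
          case False
          then have "Suc r \<le> i"
            using eq ij(2) by simp
          then have "?l i \<le> ?l (Suc r)"
            using partition_antimono[OF part] by simp
          then show False
            using D(2) r(1) eq ij(3) by simp
        qed
      qed
      then show "(i', j') \<in> E"
        using D(1) r(2) by simp
    qed
    then obtain \<nu> where \<nu>: "is_partition \<nu> (card E)" "diagram \<nu> = E"
      using partition_of_downset by metis
    have rD: "(r, ?l r - 1) \<in> ?D"
      using r(1) by (simp add: diagram_row_length)
    then have "Suc (card E) = n"
      using r(2) card_diagram_partition[OF part] card_Suc_Diff1[OF finite_diagram rD] by simp
    then have "\<nu> \<in> Yminus \<mu>"
      using Yminus_iff[of \<mu> "card E" \<nu>] part \<nu> r(2) by auto
    then show "E \<in> diagram ` Yminus \<mu>"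
      using \<nu>(2) by blast
  qed
  have inj: "inj_on diagram (Yminus \<mu>)"
    by (rule inj_onI) (auto simp: Yminus_def intro: diagram_inject)
  have inj': "inj_on (\<lambda>r. ?D - {(r, ?l r - 1)}) (removable_rows \<mu>)"
  proof (rule inj_onI)
    fix r s assume rs: "r \<in> removable_rows \<mu>" "s \<in> removable_rows \<mu>" "?D - {(r, ?l r - 1)} = ?D - {(s, ?l s - 1)}"
    have "(r, ?l r - 1) \<in> ?D" "(s, ?l s - 1) \<in> ?D"
      using rs(1,2) by (auto simp: removable_rows_def diagram_row_length)
    then have "(r, ?l r - 1) = (s, ?l s - 1)"
      using rs(3) by blast
    then show "r = s"
      by simp
  qed
  show ?thesis
    using card_image[OF inj] card_image[OF inj'] unfolding img by (rule trans[OF sym])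
qed

text \<open>A box can be added at the end of row 0 or of a row shorter than the preceding one, that
  is, of a row that follows a removable one. Row 0 accounts for the one additional upper
  cover.\<close>

lemma card_Yplus_rows:
  assumes part: "is_partition \<mu> n"
  shows "card (Yplus \<mu>) = card (insert 0 (Suc ` removable_rows \<mu>))"
proof -
  let ?D = "diagram \<mu>" and ?l = "row_length \<mu>" and ?R = "insert 0 (Suc ` removable_rows \<mu>)"
  have R: "r \<in> ?R \<longleftrightarrow> r = 0 \<or> ?l r < ?l (r - 1)" for r
    by (cases r) (auto simp: removable_rows_def)
  have img: "diagram ` Yplus \<mu> = (\<lambda>r. insert (r, ?l r) ?D) ` ?R"
  proof (intro equalityI subsetI)
    fix E assume "E \<in> diagram ` Yplus \<mu>"
    then obtain \<gamma> where \<gamma>: "\<gamma> \<in> Yplus \<mu>" "E = diagram \<gamma>"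
      by blast
    then obtain b where b: "b \<notin> ?D" "E = insert b ?D" and p: "is_partition \<gamma> (Suc (sum_list \<mu>))"
      by (auto simp: Yplus_def)
    obtain r c where rc: "b = (r, c)"
      by (cases b)
    have c: "c = ?l r"
    proof (rule ccontr)
      assume "c \<noteq> ?l r"
      then have "?l r < c"
        using b(1) rc by (simp add: diagram_row_length)
      then have "(r, ?l r) \<in> E"
        using diagram_down[OF p, of r c r "?l r"] b(2) rc \<gamma>(2) by auto
      then show False
        using b(2) rc \<open>?l r < c\<close> by (simp add: diagram_row_length)
    qed
    have "?l r < ?l (r - 1)" if "r \<noteq> 0"
    proof -
      have "(r - 1, c) \<in> E"
        using diagram_down[OF p, of r c "r - 1" c] b(2) rc \<gamma>(2) by auto
      then show ?thesis
        using b(2) rc c that by (cases r) (auto simp: diagram_row_length)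
    qed
    then have "r \<in> ?R"
      using R by blast
    then show "E \<in> (\<lambda>r. insert (r, ?l r) ?D) ` ?R"
      using b(2) rc c by blast
  next
    fix E assume "E \<in> (\<lambda>r. insert (r, ?l r) ?D) ` ?R"
    then obtain r where r: "r = 0 \<or> ?l r < ?l (r - 1)" "E = insert (r, ?l r) ?D"
      using R by blast
    have "downset E"
      unfolding downset_def
    proof (intro conjI allI impI)
      show "finite E"
        using r(2) finite_diagram by simp
      fix i j i' j' assume ij: "(i, j) \<in> E" "i' \<le> i" "j' \<le> j"
      show "(i', j') \<in> E"
      proof (cases "(i, j) \<in> ?D")
        case True
        then show ?thesis
          using diagram_down[OF part True ij(2,3)] r(2) by simp
      next
        case False
        then have eq: "i = r" "j = ?l r"
          using ij(1) r(2) by auto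
        show ?thesis
        proof (cases "i' = r")
          case True
          then show ?thesis
            using eq ij(3) r(2) by (auto simp: diagram_row_length)
        next
          case False
          then have "i' \<le> r - 1" "r \<noteq> 0"
            using ij(2) eq by auto
          then have "j' < ?l i'"
            using partition_antimono[OF part, of i' "r - 1"] r(1) ij(3) eq by auto
          then show ?thesis
            using r(2) by (simp add: diagram_row_length)
        qed
      qed
    qed
    then obtain \<gamma> where \<gamma>: "is_partition \<gamma> (card E)" "diagram \<gamma> = E"
      using partition_of_downset by metis
    have "(r, ?l r) \<notin> ?D"
      by (simp add: diagram_row_length)
    then have "card E = Suc n"
      using r(2) card_diagram_partition[OF part] finite_diagram by simp
    then have "\<gamma> \<in> Yplus \<mu>"
      using Yplus_iff[OF part] \<gamma> r(2) by auto
    then show "E \<in> diagram ` Yplus \<mu>"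
      using \<gamma>(2) by blast
  qed
  have inj: "inj_on diagram (Yplus \<mu>)"
    by (rule inj_onI) (auto simp: Yplus_def intro: diagram_inject)
  have inj': "inj_on (\<lambda>r. insert (r, ?l r) ?D) ?R"
  proof (rule inj_onI)
    fix r s assume rs: "insert (r, ?l r) ?D = insert (s, ?l s) ?D"
    have "(r, ?l r) \<notin> ?D" "(s, ?l s) \<notin> ?D"
      by (simp_all add: diagram_row_length)
    then have "(r, ?l r) = (s, ?l s)"
      using rs by blast
    then show "r = s"
      by simp
  qed
  show ?thesis
    using card_image[OF inj] card_image[OF inj'] unfolding img by (rule trans[OF sym])
qed

lemma finite_removable_rows: "finite (removable_rows \<mu>)"
  by (rule finite_subset[of _ "{..<length \<mu>}"]) (auto simp: removable_rows_def row_length_def split: if_splits)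

lemma card_Yplus_Yminus: "is_partition \<mu> n \<Longrightarrow> card (Yplus \<mu>) = Suc (card (Yminus \<mu>))"
  by (simp add: card_Yplus_rows card_Yminus_rows finite_removable_rows card_image)

text \<open>The last row is always removable.\<close>

lemma Yminus_nonempty:
  assumes "is_partition \<gamma> (Suc n)"
  shows "Yminus \<gamma> \<noteq> {}"
proof -
  have "\<gamma> \<noteq> []"
    using assms by (auto simp: is_partition_def)
  then have "length \<gamma> - 1 \<in> removable_rows \<gamma>"
    using assms by (auto simp: removable_rows_def row_length_def is_partition_def)
  then have "card (Yminus \<gamma>) \<noteq> 0"
    using card_Yminus_rows[OF assms] finite_removable_rows[of \<gamma>] by auto
  then show ?thesis
    by auto
qed

text \<open>This is the commutation relation \<open>DU - UD = 1\<close> for the up and down operators of Young's lattice.\<close>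

lemma young_lattice_commutation:
  fixes d :: "nat list \<Rightarrow> nat"
  assumes part: "is_partition \<kappa> n"
  shows "(\<Sum>\<gamma>\<in>Yplus \<kappa>. \<Sum>\<mu>\<in>Yminus \<gamma>. d \<mu>) = d \<kappa> + (\<Sum>\<nu>\<in>Yminus \<kappa>. \<Sum>\<mu>\<in>Yplus \<nu>. d \<mu>)"
proof -
  let ?P = "{\<mu>. is_partition \<mu> n}"
  have fP: "finite ?P"
    by (rule finite_partitions)
  have up: "Yminus \<gamma> = {\<mu> \<in> ?P. \<gamma> \<in> Yplus \<mu>}" if "\<gamma> \<in> Yplus \<kappa>" for \<gamma>
    using Yplus_iff[OF part] Yminus_iff Yplus_iff that by blast
  have lo: "Yplus \<nu> = {\<mu> \<in> ?P. \<nu> \<in> Yminus \<mu>}" if "\<nu> \<in> Yminus \<kappa>" for \<nu>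
  proof -
    have \<nu>: "is_partition \<nu> (sum_list \<nu>)" "\<kappa> \<in> Yplus \<nu>"
      using that by (auto simp: Yminus_def)
    then have "n = Suc (sum_list \<nu>)"
      using Yplus_iff partition_sum part by metis
    then show ?thesis
      using \<nu>(1) by (auto simp: Yminus_def Yplus_iff)
  qed
  have "(\<Sum>\<gamma>\<in>Yplus \<kappa>. \<Sum>\<mu>\<in>Yminus \<gamma>. d \<mu>) = (\<Sum>\<gamma>\<in>Yplus \<kappa>. \<Sum>\<mu>\<in>?P. if \<gamma> \<in> Yplus \<mu> then d \<mu> else 0)"
    by (rule sum.cong[OF refl]) (simp only: up sum.inter_filter[OF fP])
  also have "\<dots> = (\<Sum>\<mu>\<in>?P. \<Sum>\<gamma>\<in>Yplus \<kappa>. if \<gamma> \<in> Yplus \<mu> then d \<mu> else 0)"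
    by (rule sum.swap)
  also have "\<dots> = (\<Sum>\<mu>\<in>?P. card (Yplus \<kappa> \<inter> Yplus \<mu>) * d \<mu>)"
    by (intro sum.cong refl) (simp add: sum.inter_restrict[symmetric] finite_Yplus)
  \<comment> \<open>Off the diagonal the numbers of common upper and common lower covers agree; on
    the diagonal there is one upper cover more.\<close>
  also have "\<dots> = (\<Sum>\<mu>\<in>?P. (if \<mu> = \<kappa> then d \<mu> else 0) + card (Yminus \<kappa> \<inter> Yminus \<mu>) * d \<mu>)"
    using card_Yplus_Yminus_distinct[OF part] card_Yplus_Yminus[OF part] by (intro sum.cong refl) auto
  also have "\<dots> = d \<kappa> + (\<Sum>\<mu>\<in>?P. card (Yminus \<kappa> \<inter> Yminus \<mu>) * d \<mu>)"
    using part fP by (simp add: sum.distrib)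
  also have "(\<Sum>\<mu>\<in>?P. card (Yminus \<kappa> \<inter> Yminus \<mu>) * d \<mu>) =
      (\<Sum>\<mu>\<in>?P. \<Sum>\<nu>\<in>Yminus \<kappa>. if \<nu> \<in> Yminus \<mu> then d \<mu> else 0)"
    by (intro sum.cong refl) (simp add: sum.inter_restrict[symmetric] finite_Yminus)
  also have "\<dots> = (\<Sum>\<nu>\<in>Yminus \<kappa>. \<Sum>\<mu>\<in>?P. if \<nu> \<in> Yminus \<mu> then d \<mu> else 0)"
    by (rule sum.swap)
  also have "\<dots> = (\<Sum>\<nu>\<in>Yminus \<kappa>. \<Sum>\<mu>\<in>Yplus \<nu>. d \<mu>)"
    by (rule sum.cong[OF refl]) (simp only: lo sum.inter_filter[OF fP])
  finally show ?thesis .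
qed

subsection \<open>Restriction of Specht modules\<close>

lemma (in fin_subgroup) is_rep_restrict: "is_rep G R \<Longrightarrow> is_rep H R"
  using is_repD[of G R] by (intro is_repI) (auto simp: one_eq mult_eq)

lemma fin_subgroup_sym: "fin_subgroup (sym_group (Suc n)) (sym_group n)"
proof (intro fin_subgroup.intro fin_subgroup_axioms.intro fin_group_sym sym_group_is_group)
  have sub: "{1..n} \<subseteq> {1..Suc n}"
    by auto
  show "carrier (sym_group n) \<subseteq> carrier (sym_group (Suc n))"
    using permutes_subset[OF _ sub] by (simp add: sym_group_carrier subset_iff)
qed (simp add: sym_group_mult)

text \<open>One filling t serves both shapes: with the largest entry n + 1 in the added box, it is
  also a tableau of the smaller shape.\<close>

locale added_box =
  fixes \<kappa> \<gamma> :: "nat list" and n r c :: nat and t :: "nat \<times> nat \<Rightarrow> nat"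
  assumes \<kappa>: "is_partition \<kappa> n" and \<gamma>: "is_partition \<gamma> (Suc n)"
    and box: "(r, c) \<notin> diagram \<kappa>" "diagram \<gamma> = insert (r, c) (diagram \<kappa>)"
    and t: "t \<in> tableaux \<gamma>" "t (r, c) = Suc n"
begin

lemma sums: "sum_list \<kappa> = n" "sum_list \<gamma> = Suc n"
  using \<kappa> \<gamma> by (auto simp: is_partition_def)

lemma row_length_box:
  "row_length \<gamma> i = row_length \<kappa> i + (if i = r then 1 else 0)" "c = row_length \<kappa> r"
proof -
  have *: "j < row_length \<gamma> i \<longleftrightarrow> (i, j) = (r, c) \<or> j < row_length \<kappa> i" for i j
    using box(2) diagram_row_length by (metis insert_iff)
  have c: "row_length \<kappa> r \<le> c"
    using box(1) by (simp add: diagram_row_length)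
  have "row_length \<kappa> r < row_length \<gamma> r"
    using *[of c r] * c by (metis le_less_trans)
  then show c': "c = row_length \<kappa> r"
    using * by auto
  show "row_length \<gamma> i = row_length \<kappa> i + (if i = r then 1 else 0)"
  proof (rule antisym; rule ccontr)
    assume "\<not> row_length \<gamma> i \<le> row_length \<kappa> i + (if i = r then 1 else 0)"
    then show False
      using *[of "row_length \<kappa> i + (if i = r then 1 else 0)" i] c' by (auto split: if_splits)
  next
    assume "\<not> row_length \<kappa> i + (if i = r then 1 else 0) \<le> row_length \<gamma> i"
    then show False
      using *[of "row_length \<gamma> i" i] c' by (auto split: if_splits)
  qed
qed

lemma length_box: "length \<kappa> \<le> length \<gamma>" "r < length \<gamma>"
proof -
  have pos: "i < length \<nu> \<longleftrightarrow> 0 < row_length \<nu> i" if "is_partition \<nu> k" for \<nu> k i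
    using that by (auto simp: is_partition_def row_length_def)
  show "r < length \<gamma>"
    using pos[OF \<gamma>, of r] row_length_box(1)[of r] by simp
  show "length \<kappa> \<le> length \<gamma>"
  proof (rule ccontr)
    assume "\<not> length \<kappa> \<le> length \<gamma>"
    then show False
      using pos[OF \<gamma>, of "length \<gamma>"] pos[OF \<kappa>, of "length \<gamma>"] row_length_box(1)[of "length \<gamma>"] by simp
  qed
qed

lemma t_small: "t \<in> tableaux \<kappa>"
proof -
  note T = tableauD[OF t(1)]
  have sub: "diagram \<kappa> \<subseteq> diagram \<gamma>"
    using box by blast
  have "t ` diagram \<kappa> = t ` (diagram \<gamma> - {(r, c)})"
    using box by simp
  also have "\<dots> = t ` diagram \<gamma> - t ` {(r, c)}"
    using T(2) box(2) by (intro inj_on_image_set_diff[of t "diagram \<gamma>"]) auto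
  also have "\<dots> = {1..n}"
    unfolding T(3) sums using t(2) by auto
  finally show ?thesis
    using inj_on_subset[OF T(2) sub] by (simp add: tableaux_def bij_betw_def sums)
qed

text \<open>The added box may start a new row; the tabloid of \<kappa> is then shorter than that of
  \<gamma>, and the missing row is read as empty before n + 1 is put in.\<close>

definition insert_entry :: "nat set list \<Rightarrow> nat set list" where
  "insert_entry T = map (\<lambda>i. (if i < length T then T ! i else {}) \<union> (if i = r then {Suc n} else {}))
     [0..<length \<gamma>]"

lemma length_insert_entry [simp]: "length (insert_entry T) = length \<gamma>"
  by (simp add: insert_entry_def)

lemma nth_insert_entry:
  "i < length \<gamma> \<Longrightarrow>
    insert_entry T ! i = (if i < length T then T ! i else {}) \<union> (if i = r then {Suc n} else {})"
  by (simp add: insert_entry_def)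

lemma tabloid_insert_entry:
  "tabloid \<gamma> t = insert_entry (tabloid \<kappa> t)"
proof (rule nth_equalityI)
  fix i assume "i < length (tabloid \<gamma> t)"
  then have i: "i < length \<gamma>"
    by simp
  have small: "(if i < length \<kappa> then tabloid \<kappa> t ! i else {}) = {t (i, j) | j. j < row_length \<kappa> i}"
    by (simp add: nth_tabloid row_length_def)
  have large: "tabloid \<gamma> t ! i = {t (i, j) | j. j < row_length \<gamma> i}"
    using i by (simp add: nth_tabloid row_length_def)
  have "{t (i, j) | j. j < Suc m} = {t (i, j) | j. j < m} \<union> {t (i, m)}" for m
    by (auto simp: less_Suc_eq)
  then show "tabloid \<gamma> t ! i = insert_entry (tabloid \<kappa> t) ! i"
    unfolding large row_length_box(1)[of i] nth_insert_entry[OF i] length_tabloid small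
    using t(2) row_length_box(2) by (cases "i = r") simp_all
qed simp

lemma map_insert_entry:
  assumes "\<sigma> (Suc n) = Suc n"
  shows "map (image \<sigma>) (insert_entry T) = insert_entry (map (image \<sigma>) T)"
  using assms by (auto simp: insert_entry_def)

lemma tabloid_entries:
  assumes "T \<in> tabloids \<kappa>" "i < length T"
  shows "Suc n \<notin> T ! i"
proof -
  obtain s where s: "s \<in> tableaux \<kappa>" "T = tabloid \<kappa> s"
    using assms(1) by (auto simp: tabloids_def)
  have "s (i, j) \<in> {1..n}" if "j < \<kappa> ! i" for j
    using tableauD(4)[OF s(1), of "(i, j)"] that assms(2) s(2) sums by (auto simp: diagram_def)
  then show ?thesis
    using s(2) assms(2) by (fastforce simp: nth_tabloid)
qed

lemma length_tabloids: "T \<in> tabloids \<kappa> \<Longrightarrow> length T = length \<kappa>"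
  by (auto simp: tabloids_def)

text \<open>The entry n + 1 does not occur in a tabloid of \<kappa>, so its insertion can be
  undone.\<close>

lemma insert_entry_inject:
  assumes S: "S \<in> tabloids \<kappa>" and T: "T \<in> tabloids \<kappa>" and eq: "insert_entry S = insert_entry T"
  shows "S = T"
proof (rule nth_equalityI)
  show len: "length S = length T"
    using length_tabloids S T by simp
  fix i assume i: "i < length S"
  then have "i < length \<gamma>"
    using length_tabloids[OF S] length_box(1) by simp
  then have "S ! i \<union> (if i = r then {Suc n} else {}) = T ! i \<union> (if i = r then {Suc n} else {})"
    using nth_insert_entry[of i S] nth_insert_entry[of i T] eq i len by simp
  moreover have "Suc n \<notin> S ! i" "Suc n \<notin> T ! i"
    using tabloid_entries S T i len by auto
  ultimately show "S ! i = T ! i"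
    by (cases "i = r") (simp_all add: insert_ident)
qed

lemma column_box: "column \<gamma> t j = column \<kappa> t j \<union> (if j = c then {Suc n} else {})"
  using t(2) unfolding column_def box(2) by auto metis

lemma column_small: "column \<kappa> t j = column \<gamma> t j - {Suc n}"
proof -
  have "Suc n \<notin> column \<kappa> t j"
    using tableauD(4)[OF t_small] sums by (fastforce simp: column_def)
  then show ?thesis
    by (auto simp: column_box)
qed

text \<open>The columns of t for the two shapes differ only by the entry n + 1.\<close>

lemma column_stabilizer_small:
  "column_stabilizer \<kappa> t = {\<sigma> \<in> column_stabilizer \<gamma> t. \<sigma> (Suc n) = Suc n}"
proof (intro equalityI subsetI)
  fix \<sigma> assume s: "\<sigma> \<in> column_stabilizer \<kappa> t"
  note s' = column_stabilizerD[OF s, unfolded sums]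
  have fx: "\<sigma> (Suc n) = Suc n"
    using permutes_not_in[OF s'(1)] by simp
  have "\<sigma> permutes {1..Suc n}"
    using s'(1) by (rule permutes_subset) auto
  moreover have "\<sigma> ` column \<gamma> t j = column \<gamma> t j" for j
    unfolding column_box image_Un s'(2) using fx by simp
  ultimately show "\<sigma> \<in> {\<sigma> \<in> column_stabilizer \<gamma> t. \<sigma> (Suc n) = Suc n}"
    using fx by (simp add: column_stabilizer_column sums)
next
  fix \<sigma> assume "\<sigma> \<in> {\<sigma> \<in> column_stabilizer \<gamma> t. \<sigma> (Suc n) = Suc n}"
  then have s: "\<sigma> \<in> column_stabilizer \<gamma> t" and fx: "\<sigma> (Suc n) = Suc n"
    by auto
  note s' = column_stabilizerD[OF s, unfolded sums]
  have "\<sigma> permutes {1..n}"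
    using s'(1) by (rule permutes_superset) (use fx in \<open>auto simp: le_Suc_eq\<close>)
  moreover have "\<sigma> ` column \<kappa> t j = column \<kappa> t j" for j
  proof -
    have "\<sigma> ` column \<kappa> t j = \<sigma> ` column \<gamma> t j - \<sigma> ` {Suc n}"
      unfolding column_small by (rule image_set_diff[OF permutes_inj[OF s'(1)]])
    then show ?thesis
      unfolding s'(2) using fx by (simp add: column_small)
  qed
  ultimately show "\<sigma> \<in> column_stabilizer \<kappa> t"
    by (simp add: column_stabilizer_column sums)
qed

text \<open>Tabloids with n + 1 in row r lose this entry, all others are sent to 0. The map commutes
  with S_n, since S_n fixes n + 1.\<close>

definition restrict_vec :: "(nat set list \<Rightarrow> complex) \<Rightarrow> nat set list \<Rightarrow> complex" where
  "restrict_vec v T = (if T \<in> tabloids \<kappa> then v (insert_entry T) else 0)"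

text \<open>The term of \<sigma> survives only if \<sigma> puts n + 1 into row r. A column
  permutation keeps n + 1 in its column, and the cell of that column in row r is the added box
  itself; hence \<sigma> fixes n + 1 and belongs to the column stabilizer for \<kappa>.\<close>

lemma restrict_vec_polytabloid: "restrict_vec (polytabloid \<gamma> t) = polytabloid \<kappa> t"
proof
  fix T
  show "restrict_vec (polytabloid \<gamma> t) T = polytabloid \<kappa> t T"
  proof (cases "T \<in> tabloids \<kappa>")
    case False
    then show ?thesis
      using polytabloid_in_perm_module[OF t_small] by (simp add: restrict_vec_def perm_module_def)
  next
    case T: True
    have "polytabloid \<gamma> t (insert_entry T) = polytabloid \<kappa> t T"
      unfolding polytabloid_def
    proof (rule sum.mono_neutral_cong_right[OF finite_column_stabilizer])
      show "column_stabilizer \<kappa> t \<subseteq> column_stabilizer \<gamma> t"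
        by (auto simp: column_stabilizer_small)
      show "\<forall>\<sigma>\<in>column_stabilizer \<gamma> t - column_stabilizer \<kappa> t.
          (if insert_entry T = map (image \<sigma>) (tabloid \<gamma> t) then of_int (sign \<sigma>) else 0) = (0::complex)"
      proof
        fix \<sigma> assume "\<sigma> \<in> column_stabilizer \<gamma> t - column_stabilizer \<kappa> t"
        then have s: "\<sigma> \<in> column_stabilizer \<gamma> t" and nf: "\<sigma> (Suc n) \<noteq> Suc n"
          by (auto simp: column_stabilizer_small)
        have "insert_entry T \<noteq> map (image \<sigma>) (tabloid \<gamma> t)"
        proof
          assume eq: "insert_entry T = map (image \<sigma>) (tabloid \<gamma> t)"
          have "Suc n \<in> insert_entry T ! r"
            using length_box(2) by (simp add: nth_insert_entry)
          then have "Suc n \<in> \<sigma> ` (tabloid \<gamma> t ! r)"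
            using eq length_box(2) by simp
          then obtain j where j: "j < \<gamma> ! r" "Suc n = \<sigma> (t (r, j))"
            using length_box(2) by (auto simp: nth_tabloid)
          have rj: "(r, j) \<in> diagram \<gamma>"
            using j(1) length_box(2) by (simp add: diagram_def)
          then have "t (r, j) \<in> column \<gamma> t j"
            by (auto simp: column_def)
          then have "Suc n \<in> column \<gamma> t j"
            using column_stabilizerD(2)[OF s, of j] j(2) by (metis imageI)
          then obtain i where i: "(i, j) \<in> diagram \<gamma>" "t (i, j) = t (r, c)"
            using t(2) by (auto simp: column_def)
          then have "(i, j) = (r, c)"
            using tableauD(2)[OF t(1)] box(2) by (intro inj_onD[of t "diagram \<gamma>"]) auto
          then show False
            using j(2) nf t(2) by simp
        qed
        then show "(if insert_entry T = map (image \<sigma>) (tabloid \<gamma> t) then of_int (sign \<sigma>) else 0) = (0::complex)"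
          by simp
      qed
      fix \<sigma> assume s: "\<sigma> \<in> column_stabilizer \<kappa> t"
      then have "map (image \<sigma>) (tabloid \<gamma> t) = insert_entry (map (image \<sigma>) (tabloid \<kappa> t))"
        unfolding tabloid_insert_entry by (intro map_insert_entry) (auto simp: column_stabilizer_small)
      moreover have "map (image \<sigma>) (tabloid \<kappa> t) \<in> tabloids \<kappa>"
        using t_small column_stabilizerD(1)[OF s] by (intro tabloids_closed) (auto simp: tabloids_def)
      ultimately show "(if insert_entry T = map (image \<sigma>) (tabloid \<gamma> t) then of_int (sign \<sigma>) else 0) =
          (if T = map (image \<sigma>) (tabloid \<kappa> t) then of_int (sign \<sigma>) else (0::complex))"
        using insert_entry_inject[OF T] by auto
    qed
    then show ?thesis
      using T by (simp add: restrict_vec_def)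
  qed
qed

lemma rep_hom_restrict_vec: "rep_hom (sym_group n) (specht \<gamma>) (perm_module \<kappa>) restrict_vec"
proof (rule rep_homI)
  show "linear_on (rep_space (specht \<gamma>)) restrict_vec"
    by (intro linear_onI) (auto simp: restrict_vec_def fun_eq_iff scaleC_fun_apply)
  show "restrict_vec v \<in> rep_space (perm_module \<kappa>)" for v
    by (simp add: perm_module_def restrict_vec_def)
  fix \<pi> v assume \<pi>: "\<pi> \<in> carrier (sym_group n)"
  then have p: "\<pi> permutes {1..sum_list \<kappa>}"
    by (simp add: sym_group_carrier sums)
  have "map (image (inv' \<pi>)) T \<in> tabloids \<kappa> \<longleftrightarrow> T \<in> tabloids \<kappa>" for T
    using tabloids_closed[OF _ p, of "map (image (inv' \<pi>)) T"] tabloids_closed[OF _ permutes_inv[OF p], of T]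
      map_image_inverse(1)[OF p, of T] by metis
  moreover have "inv' \<pi> (Suc n) = Suc n"
    using permutes_not_in[OF permutes_inv[OF p], of "Suc n"] sums by simp
  ultimately show "restrict_vec (rep_act (specht \<gamma>) \<pi> v) = rep_act (perm_module \<kappa>) \<pi> (restrict_vec v)"
    by (simp add: fun_eq_iff restrict_vec_def rep_act_specht perm_module_def perm_act_def map_insert_entry)
qed

end

text \<open>The homomorphism is nonzero because it takes the polytabloid of t for \<gamma> to the
  one for \<kappa>. Only a nonzero multiplicity is obtained here; the full decomposition will follow
  from dimensions.\<close>

lemma specht_restriction:
  assumes \<kappa>: "is_partition \<kappa> n" and \<gamma>: "\<gamma> \<in> Yplus \<kappa>"
  shows "fin_group.char_ip (sym_group n) (rep_char (specht \<kappa>)) (rep_char (specht \<gamma>)) \<noteq> 0"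
proof -
  interpret S: fin_subgroup "sym_group (Suc n)" "sym_group n"
    by (rule fin_subgroup_sym)
  have \<gamma>': "is_partition \<gamma> (Suc n)"
    using \<gamma> Yplus_iff[OF \<kappa>] by blast
  have n: "sum_list \<kappa> = n" "sum_list \<gamma> = Suc n"
    using \<kappa> \<gamma>' by (auto simp: is_partition_def)
  obtain b where b: "b \<notin> diagram \<kappa>" "diagram \<gamma> = insert b (diagram \<kappa>)"
    using \<gamma> by (auto simp: Yplus_def)
  obtain r c where rc: "b = (r, c)"
    by (cases b)
  obtain s where s: "s \<in> tableaux \<gamma>"
    by (rule tableau_exists)
  have "s b \<in> {1..Suc n}"
    using tableauD(4)[OF s] b n by auto
  then have p: "Transposition.transpose (s b) (Suc n) permutes {1..sum_list \<gamma>}"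
    unfolding n by (intro permutes_swap_id) auto
  \<comment> \<open>Any tableau of \<gamma> will do, once the entry of the added box is exchanged
    with n + 1.\<close>
  define t where "t = Transposition.transpose (s b) (Suc n) \<circ> s"
  have t: "t \<in> tableaux \<gamma>" "t b = Suc n"
    using tableau_comp[OF s p] by (auto simp: t_def)
  interpret B: added_box \<kappa> \<gamma> n r c t
    using \<kappa> \<gamma>' b t rc by unfold_locales auto
  have irr: "irreducible_rep (sym_group n) (specht \<kappa>)"
    using irreducible_specht[OF \<kappa>] n by simp
  \<comment> \<open>The values of the restriction map are only known to lie in the permutation
    module. The projection onto the Specht module fixes the polytabloid of t and makes the target
    irreducible.\<close>
  obtain P where P: "rep_hom (sym_group n) (perm_module \<kappa>) (perm_module \<kappa>) P"
    "P \<in> rep_space (perm_module \<kappa>) \<rightarrow> rep_space (specht \<kappa>)" "\<forall>w\<in>rep_space (specht \<kappa>). P w = w"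
    using S.H.maschke[of "perm_module \<kappa>" "rep_space (specht \<kappa>)"] is_rep_perm_module[of \<kappa>] invariant_specht[of \<kappa>] n
    by auto
  have "rep_hom (sym_group n) (perm_module \<kappa>) (specht \<kappa>) P"
    using P(1,2) by (auto simp: rep_hom_def rep_act_specht perm_module_def)
  from rep_hom_compose[OF B.rep_hom_restrict_vec this]
  have hom: "rep_hom (sym_group n) (specht \<gamma>) (specht \<kappa>) (\<lambda>v. P (B.restrict_vec v))" .
  have "P (B.restrict_vec (polytabloid \<gamma> t)) = polytabloid \<kappa> t"
    using P(3) polytabloid_in_specht[OF B.t_small] by (simp add: B.restrict_vec_polytabloid)
  then have nz: "P (B.restrict_vec (polytabloid \<gamma> t)) \<noteq> 0"
    using polytabloid_nonzero[OF B.t_small] by simp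
  have "is_rep (sym_group n) (specht \<gamma>)"
    using S.is_rep_restrict is_rep_specht[of \<gamma>] n by simp
  from S.H.char_ip_hom_nonzero'[OF irr this hom, OF polytabloid_in_specht[OF t(1)] nz]
  show ?thesis .
qed

section \<open>The dimension count behind the branching rule\<close>

definition specht_dim :: "nat list \<Rightarrow> nat" where
  "specht_dim \<mu> = cdim (rep_space (specht \<mu>))"

text \<open>The Specht modules of the lower covers are pairwise non-isomorphic irreducible
  constituents of the restriction to S_n, so together they fit into it.\<close>

lemma Yminus_specht_dim:
  assumes \<gamma>: "is_partition \<gamma> (Suc n)"
  shows "(\<Sum>\<mu>\<in>Yminus \<gamma>. specht_dim \<mu>) \<le> specht_dim \<gamma>"
proof -
  interpret S: fin_subgroup "sym_group (Suc n)" "sym_group n"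
    by (rule fin_subgroup_sym)
  have part: "is_partition \<mu> n" "sum_list \<mu> = n" "\<gamma> \<in> Yplus \<mu>" if "\<mu> \<in> Yminus \<gamma>" for \<mu>
    using that Yminus_iff[OF \<gamma>] by (auto simp: Yminus_def is_partition_def)
  have "is_rep (sym_group n) (specht \<gamma>)"
    using S.is_rep_restrict is_rep_specht[of \<gamma>] partition_sum[OF \<gamma>] by simp
  then show ?thesis
  proof (rule S.H.sum_irreducibles_le[OF finite_Yminus, where V = specht])
    show "irreducible_rep (sym_group n) (specht \<mu>)" if "\<mu> \<in> Yminus \<gamma>" for \<mu>
      using irreducible_specht[OF part(1)[OF that]] part(2)[OF that] by simp
    show "\<not> rep_iso (sym_group n) (specht \<mu>) (specht \<nu>)"
      if "\<mu> \<in> Yminus \<gamma>" "\<nu> \<in> Yminus \<gamma>" "\<mu> \<noteq> \<nu>" for \<mu> \<nu>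
      using specht_iso_imp_eq part that by blast
    show "S.H.char_ip (rep_char (specht \<mu>)) (rep_char (specht \<gamma>)) \<noteq> 0" if "\<mu> \<in> Yminus \<gamma>" for \<mu>
      using specht_restriction part that by blast
  qed (simp add: specht_dim_def)
qed

text \<open>By Frobenius reciprocity the Specht modules of all upper covers occur in the
  representation induced from that of \<kappa>, whose dimension is multiplied by (n + 1)! / n!. If
  the dimensions exhaust it, the remaining summand K is zero and the characters agree.\<close>

lemma Yplus_specht_dim:
  assumes \<kappa>: "is_partition \<kappa> n"
  shows "(\<Sum>\<gamma>\<in>Yplus \<kappa>. specht_dim \<gamma>) \<le> Suc n * specht_dim \<kappa>"
    and "(\<Sum>\<gamma>\<in>Yplus \<kappa>. specht_dim \<gamma>) = Suc n * specht_dim \<kappa> \<Longrightarrow> g \<in> carrier (sym_group (Suc n)) \<Longrightarrow>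
      fin_subgroup.ind_char (sym_group (Suc n)) (sym_group n) (rep_char (specht \<kappa>)) g =
      (\<Sum>\<gamma>\<in>Yplus \<kappa>. rep_char (specht \<gamma>) g)"
proof -
  interpret S: fin_subgroup "sym_group (Suc n)" "sym_group n"
    by (rule fin_subgroup_sym)
  have part: "is_partition \<gamma> (Suc n)" "sum_list \<gamma> = Suc n" if "\<gamma> \<in> Yplus \<kappa>" for \<gamma>
    using that Yplus_iff[OF \<kappa>] by (auto simp: is_partition_def)
  have n: "sum_list \<kappa> = n"
    using \<kappa> by (simp add: is_partition_def)
  have rep: "is_rep (sym_group n) (specht \<kappa>)"
    using is_rep_specht[of \<kappa>] n by simp
  have irr: "irreducible_rep (sym_group (Suc n)) (specht \<gamma>)" if "\<gamma> \<in> Yplus \<kappa>" for \<gamma>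
    using irreducible_specht[OF part(1)[OF that]] part(2)[OF that] by simp
  let ?I = "induced (sym_group (Suc n)) (carrier (sym_group n)) (specht \<kappa>)"
  have I: "is_rep (sym_group (Suc n)) ?I"
    by (rule S.is_rep_induced[OF rep])
  have ip: "S.char_ip (rep_char (specht \<gamma>)) (rep_char ?I) \<noteq> 0" if "\<gamma> \<in> Yplus \<kappa>" for \<gamma>
  proof -
    have "S.char_ip (rep_char (specht \<gamma>)) (rep_char ?I) =
        S.char_ip (rep_char (specht \<gamma>)) (S.ind_char (rep_char (specht \<kappa>)))"
      using S.rep_char_induced[OF rep] by (intro S.char_ip_cong) auto
    also have "\<dots> = S.H.char_ip (rep_char (specht \<gamma>)) (rep_char (specht \<kappa>))"
      using S.rep_char_conj[OF irreducible_repD(1)[OF irr[OF that]]] by (intro S.frobenius_reciprocity) auto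
    also have "\<dots> = S.H.char_ip (rep_char (specht \<kappa>)) (rep_char (specht \<gamma>))"
      by (rule S.H.char_ip_commute)
    finally show ?thesis
      using specht_restriction[OF \<kappa> that] by simp
  qed
  obtain K where K: "invariant_subspace (sym_group (Suc n)) ?I K"
    "\<And>g. g \<in> carrier (sym_group (Suc n)) \<Longrightarrow>
      rep_char ?I g = (\<Sum>\<gamma>\<in>Yplus \<kappa>. rep_char (specht \<gamma>) g) + rep_char (subrep ?I K) g"
    "cdim (rep_space ?I) = (\<Sum>\<gamma>\<in>Yplus \<kappa>. cdim (rep_space (specht \<gamma>))) + cdim K"
  proof (rule S.sum_irreducibles_le[OF finite_Yplus I, where V = specht])
    show "\<not> rep_iso (sym_group (Suc n)) (specht \<mu>) (specht \<nu>)"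
      if "\<mu> \<in> Yplus \<kappa>" "\<nu> \<in> Yplus \<kappa>" "\<mu> \<noteq> \<nu>" for \<mu> \<nu>
      using specht_iso_imp_eq part that by blast
  qed (use irr ip in auto)
  \<comment> \<open>The dimension of the induced representation is found by evaluating its character
    at the unit.\<close>
  have char_one: "rep_char R \<one>\<^bsub>G\<^esub> = of_nat (cdim (rep_space R))" if "is_rep G R"
    for G :: "(nat \<Rightarrow> nat) monoid" and R :: "(nat \<Rightarrow> nat, 'v::complex_vector) rep"
    using trace_on_cong[OF is_repD(1)[OF that] is_repD(5)[OF that]] trace_on_id[OF is_repD(1)[OF that]]
    by (simp add: rep_char_def)
  have card: "card (carrier (sym_group k)) = fact k" for k
    using card_permutations[of "{1..k}" k] by (simp add: sym_group_def)
  have "of_nat (cdim (rep_space ?I)) = S.ind_char (rep_char (specht \<kappa>)) \<one>\<^bsub>sym_group (Suc n)\<^esub>"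
    using char_one[OF I] S.rep_char_induced[OF rep S.one_closed] by simp
  also have "\<dots> = (\<Sum>x\<in>carrier (sym_group (Suc n)). of_nat (specht_dim \<kappa>)) / fact n"
  proof -
    have "\<one>\<^bsub>sym_group (Suc n)\<^esub> \<in> carrier (sym_group n)"
      using S.one_eq S.H.one_closed by simp
    moreover have "inv\<^bsub>sym_group (Suc n)\<^esub> x \<otimes>\<^bsub>sym_group (Suc n)\<^esub> \<one>\<^bsub>sym_group (Suc n)\<^esub> \<otimes>\<^bsub>sym_group (Suc n)\<^esub> x =
        \<one>\<^bsub>sym_group (Suc n)\<^esub>" if "x \<in> carrier (sym_group (Suc n))" for x
      using that by (metis S.inv_closed S.l_inv S.r_one)
    ultimately show ?thesis
      using char_one[OF rep] unfolding S.ind_char_def card of_nat_fact specht_dim_def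
      by (intro arg_cong2[of _ _ _ _ "(/)"] sum.cong refl) (simp add: S.one_eq)
  qed
  also have "\<dots> = of_nat (Suc n * specht_dim \<kappa>)"
    by (simp add: card field_simps)
  finally have dim: "cdim (rep_space ?I) = Suc n * specht_dim \<kappa>"
    by (metis of_nat_eq_iff)
  show "(\<Sum>\<gamma>\<in>Yplus \<kappa>. specht_dim \<gamma>) \<le> Suc n * specht_dim \<kappa>"
    using K(3) dim by (simp add: specht_dim_def)
  assume eq: "(\<Sum>\<gamma>\<in>Yplus \<kappa>. specht_dim \<gamma>) = Suc n * specht_dim \<kappa>" and g: "g \<in> carrier (sym_group (Suc n))"
  then have "cdim K = 0"
    using K(3) dim by (simp add: specht_dim_def)
  then have "rep_char (subrep ?I K) g = 0"
    by (simp add: rep_char_def trace_on_def)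
  then show "S.ind_char (rep_char (specht \<kappa>)) g = (\<Sum>\<gamma>\<in>Yplus \<kappa>. rep_char (specht \<gamma>) g)"
    using K(2)[OF g] S.rep_char_induced[OF rep g] by simp
qed

text \<open>The two families of inequalities between the dimensions of Specht modules are played off against
  each other with the commutation relation, so no formula for the dimension is needed.\<close>

lemma specht_dim_branching:
  "(\<forall>\<kappa>. is_partition \<kappa> n \<longrightarrow> (\<Sum>\<gamma>\<in>Yplus \<kappa>. specht_dim \<gamma>) = Suc n * specht_dim \<kappa>) \<and>
   (\<forall>\<gamma>. is_partition \<gamma> (Suc n) \<longrightarrow> (\<Sum>\<mu>\<in>Yminus \<gamma>. specht_dim \<mu>) = specht_dim \<gamma>)"
proof (induction n)
  \<comment> \<open>The premise \<open>low\<close> is what the preceding level supplies: going down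
    and then up multiplies dimensions by n. At level 0 it is an empty sum.\<close>
  have step: "(\<forall>\<kappa>. is_partition \<kappa> n \<longrightarrow> (\<Sum>\<gamma>\<in>Yplus \<kappa>. specht_dim \<gamma>) = Suc n * specht_dim \<kappa>) \<and>
     (\<forall>\<gamma>. is_partition \<gamma> (Suc n) \<longrightarrow> (\<Sum>\<mu>\<in>Yminus \<gamma>. specht_dim \<mu>) = specht_dim \<gamma>)"
    if low: "\<And>\<kappa>. is_partition \<kappa> n \<Longrightarrow>
      (\<Sum>\<nu>\<in>Yminus \<kappa>. \<Sum>\<mu>\<in>Yplus \<nu>. specht_dim \<mu>) = n * specht_dim \<kappa>" for n
  proof -
    have le: "(\<Sum>\<mu>\<in>Yminus \<gamma>. specht_dim \<mu>) \<le> specht_dim \<gamma>" if "is_partition \<kappa> n" "\<gamma> \<in> Yplus \<kappa>" for \<kappa> \<gamma>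
      using Yminus_specht_dim Yplus_iff[OF that(1)] that(2) by blast
    have sum: "(\<Sum>\<gamma>\<in>Yplus \<kappa>. \<Sum>\<mu>\<in>Yminus \<gamma>. specht_dim \<mu>) = Suc n * specht_dim \<kappa>" if "is_partition \<kappa> n" for \<kappa>
      using young_lattice_commutation[OF that, of specht_dim] low[OF that] by simp
    have A: "(\<Sum>\<gamma>\<in>Yplus \<kappa>. specht_dim \<gamma>) = Suc n * specht_dim \<kappa>" if "is_partition \<kappa> n" for \<kappa>
    proof (rule antisym)
      show "(\<Sum>\<gamma>\<in>Yplus \<kappa>. specht_dim \<gamma>) \<le> Suc n * specht_dim \<kappa>"
        by (rule Yplus_specht_dim(1)[OF that])
      \<comment> \<open>By the commutation relation the double sum is n + 1 times the dimension for
        \<kappa>, and its inner sums are bounded by the dimensions of the upper covers. With the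
        opposite bound this forces equality.\<close>
      show "Suc n * specht_dim \<kappa> \<le> (\<Sum>\<gamma>\<in>Yplus \<kappa>. specht_dim \<gamma>)"
        unfolding sum[OF that, symmetric] using le[OF that] by (rule sum_mono)
    qed
    have "(\<Sum>\<mu>\<in>Yminus \<gamma>. specht_dim \<mu>) = specht_dim \<gamma>" if \<gamma>: "is_partition \<gamma> (Suc n)" for \<gamma>
    proof (rule ccontr)
      assume ne: "(\<Sum>\<mu>\<in>Yminus \<gamma>. specht_dim \<mu>) \<noteq> specht_dim \<gamma>"
      obtain \<kappa> where "\<kappa> \<in> Yminus \<gamma>"
        using Yminus_nonempty[OF \<gamma>] by blast
      then have \<kappa>: "is_partition \<kappa> n" "\<gamma> \<in> Yplus \<kappa>"
        using Yminus_iff[OF \<gamma>] by (auto simp: Yminus_def)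
      \<comment> \<open>A single strict inequality at \<gamma> would make the sum over the upper
        covers of any \<kappa> below \<gamma> strict as well.\<close>
      have "(\<Sum>\<gamma>\<in>Yplus \<kappa>. \<Sum>\<mu>\<in>Yminus \<gamma>. specht_dim \<mu>) < (\<Sum>\<gamma>\<in>Yplus \<kappa>. specht_dim \<gamma>)"
        using le[OF \<kappa>(1)] ne le[OF \<kappa>]
        by (intro sum_strict_mono_ex1 finite_Yplus bexI[OF _ \<kappa>(2)]) auto
      then show False
        using sum[OF \<kappa>(1)] A[OF \<kappa>(1)] by simp
    qed
    then show ?thesis
      using A by blast
  qed
  case 0
  show ?case
    by (rule step) (simp add: Yminus_empty)
  case (Suc n)
  show ?case
  proof (rule step)
    fix \<kappa> assume \<kappa>: "is_partition \<kappa> (Suc n)"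
    have "(\<Sum>\<nu>\<in>Yminus \<kappa>. \<Sum>\<mu>\<in>Yplus \<nu>. specht_dim \<mu>) = (\<Sum>\<nu>\<in>Yminus \<kappa>. Suc n * specht_dim \<nu>)"
      using Suc Yminus_iff[OF \<kappa>] by (intro sum.cong refl) blast
    also have "\<dots> = Suc n * specht_dim \<kappa>"
      using Suc \<kappa> by (simp add: sum_distrib_left[symmetric] del: mult_Suc)
    finally show "(\<Sum>\<nu>\<in>Yminus \<kappa>. \<Sum>\<mu>\<in>Yplus \<nu>. specht_dim \<mu>) = Suc n * specht_dim \<kappa>" .
  qed
qed

theorem branching_rule:
  assumes "is_partition \<kappa> n" "g \<in> carrier (sym_group (Suc n))"
  shows "fin_subgroup.ind_char (sym_group (Suc n)) (sym_group n) (rep_char (specht \<kappa>)) g =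
    (\<Sum>\<gamma>\<in>Yplus \<kappa>. rep_char (specht \<gamma>) g)"
  using Yplus_specht_dim(2)[OF assms(1) _ assms(2)] specht_dim_branching assms(1) by blast

section \<open>Characters of the representations of the wreath product\<close>

context fin_group
begin

text \<open>An induced character is such a sum of the character extended by zero, divided by the
  order of the subgroup. With that order kept outside, functions supported on different subgroups
  can be compared.\<close>

definition conj_sum :: "('a \<Rightarrow> complex) \<Rightarrow> 'a \<Rightarrow> complex" where
  "conj_sum Z g = (\<Sum>x\<in>carrier G. Z (inv x \<otimes> g \<otimes> x))"

lemma conj_sum_cong:
  assumes "g \<in> carrier G" "\<And>z. z \<in> carrier G \<Longrightarrow> Z z = Z' z"
  shows "conj_sum Z g = conj_sum Z' g"
  unfolding conj_sum_def using assms by (intro sum.cong) auto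

text \<open>Right translation of the summation variable by y. It is used both to remove the average
  over a block and to move the last point of a block to n + 1.\<close>

lemma conj_sum_conj:
  assumes "g \<in> carrier G" "y \<in> carrier G"
  shows "conj_sum (\<lambda>z. Z (inv y \<otimes> z \<otimes> y)) g = conj_sum Z g"
proof -
  have "conj_sum (\<lambda>z. Z (inv y \<otimes> z \<otimes> y)) g =
      (\<Sum>x\<in>carrier G. Z (inv (x \<otimes> y) \<otimes> g \<otimes> (x \<otimes> y)))"
    unfolding conj_sum_def using assms
    by (intro sum.cong refl arg_cong[of _ _ Z]) (simp add: inv_mult_group m_assoc)
  also have "\<dots> = conj_sum Z g"
    unfolding conj_sum_def by (rule sum_translate_right[OF assms(2)])
  finally show ?thesis .
qed

lemma conj_sum_sum: "conj_sum (\<lambda>z. \<Sum>i\<in>I. Z i z) g = (\<Sum>i\<in>I. conj_sum (Z i) g)"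
  unfolding conj_sum_def by (rule sum.swap)

lemma conj_sum_scale: "conj_sum (\<lambda>z. c * Z z) g = c * conj_sum Z g"
  by (simp add: conj_sum_def sum_distrib_left)

end

context fin_subgroup
begin

lemma ind_char_conj_sum:
  "ind_char \<chi> g = conj_sum (\<lambda>z. if z \<in> carrier H then \<chi> z else 0) g / of_nat (card (carrier H))"
  by (simp add: ind_char_def conj_sum_def)

text \<open>A conjugate of z by an element of H can lie in K only if z is in H. So the inner
  character extended by zero is itself a sum of conjugates over H, and each of these |H|
  conjugations is absorbed by the outer sum.\<close>

lemma ind_char_transitive:
  fixes K :: "('g, 'k) monoid_scheme"
  assumes K: "fin_subgroup H K" and g: "g \<in> carrier G"
  shows "ind_char (fin_subgroup.ind_char H K \<chi>) g =
    conj_sum (\<lambda>z. if z \<in> carrier K then \<chi> z else 0) g / of_nat (card (carrier K))"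
proof -
  interpret K: fin_subgroup H K
    by (rule K)
  let ?Z = "\<lambda>z. if z \<in> carrier K then \<chi> z else 0"
  have *: "(if z \<in> carrier H then K.ind_char \<chi> z else 0) =
      (1 / of_nat (card (carrier K))) * (\<Sum>y\<in>carrier H. ?Z (inv y \<otimes> z \<otimes> y))"
    if z: "z \<in> carrier G" for z
  proof (cases "z \<in> carrier H")
    case True
    have "inv\<^bsub>H\<^esub> y \<otimes>\<^bsub>H\<^esub> z \<otimes>\<^bsub>H\<^esub> y = inv y \<otimes> z \<otimes> y" if "y \<in> carrier H" for y
      using True that by (simp add: inv_eq mult_eq)
    then have "(\<Sum>y\<in>carrier H. ?Z (inv\<^bsub>H\<^esub> y \<otimes>\<^bsub>H\<^esub> z \<otimes>\<^bsub>H\<^esub> y)) = (\<Sum>y\<in>carrier H. ?Z (inv y \<otimes> z \<otimes> y))"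
      by (intro sum.cong refl) (simp only:)
    then show ?thesis
      using True by (simp add: K.ind_char_def)
  next
    case False
    have "inv y \<otimes> z \<otimes> y \<notin> carrier K" if y: "y \<in> carrier H" for y
    proof
      assume "inv y \<otimes> z \<otimes> y \<in> carrier K"
      then have "y \<otimes> (inv y \<otimes> z \<otimes> y) \<otimes> inv y \<in> carrier H"
        using y by simp
      moreover have "y \<otimes> (inv y \<otimes> z \<otimes> y) \<otimes> inv y = z"
        using y z by (simp add: m_assoc) (simp add: m_assoc[symmetric])
      ultimately show False
        using False by simp
    qed
    then show ?thesis
      using False by (simp cong: sum.cong)
  qed
  have "ind_char (K.ind_char \<chi>) g =
      conj_sum (\<lambda>z. (1 / of_nat (card (carrier K))) * (\<Sum>y\<in>carrier H. ?Z (inv y \<otimes> z \<otimes> y))) g /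
      of_nat (card (carrier H))"
    unfolding ind_char_conj_sum using conj_sum_cong[OF g *] by simp
  also have "\<dots> = (1 / of_nat (card (carrier K))) * (\<Sum>y\<in>carrier H. conj_sum ?Z g) / of_nat (card (carrier H))"
  proof -
    have "(\<Sum>y\<in>carrier H. conj_sum (\<lambda>z. ?Z (inv y \<otimes> z \<otimes> y)) g) = (\<Sum>y\<in>carrier H. conj_sum ?Z g)"
      by (rule sum.cong[OF refl]) (rule conj_sum_conj[OF g carrierH])
    then show ?thesis
      unfolding conj_sum_scale conj_sum_sum by (simp only:)
  qed
  also have "\<dots> = conj_sum ?Z g / of_nat (card (carrier K))"
    using H.card_carrier_pos by simp
  finally show ?thesis .
qed

end

text \<open>The trace of (f, h) on the tensor product of the spaces of \<open>Us ! c x\<close> for x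
  in A, when h preserves the colouring c. The colouring is a parameter so that the expression can be
  carried along permutations of the positions.\<close>

definition color_trace ::
  "('f, 'v::complex_vector) rep list \<Rightarrow> nat set \<Rightarrow> (nat \<Rightarrow> nat) \<Rightarrow> (nat \<Rightarrow> 'f) \<Rightarrow> (nat \<Rightarrow> nat) \<Rightarrow> complex" where
  "color_trace Us A c f h = (\<Sum>k\<in>(\<Pi>\<^sub>E x\<in>A. {..<rep_dim (Us ! c x)}).
     \<Prod>x\<in>A. matrix_coef (Us ! c x) (f x) (k x) (k (inv' h x)))"

lemma color_trace_cong:
  assumes "\<And>x. x \<in> A \<Longrightarrow> c x = c' x"
  shows "color_trace Us A c f h = color_trace Us A c' f h"
  unfolding color_trace_def using assms by (intro sum.cong prod.cong PiE_cong) auto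

text \<open>Renaming the positions by \<pi> in the index families as well as in c, f and h leaves
  every summand unchanged.\<close>

lemma color_trace_conj:
  assumes \<pi>: "\<pi> permutes A" and h: "h permutes A"
  shows "color_trace Us A (c \<circ> \<pi>) (f \<circ> \<pi>) (inv' \<pi> \<circ> h \<circ> \<pi>) = color_trace Us A c f h"
  unfolding color_trace_def
proof (rule sum.reindex_bij_witness[where j = "\<lambda>k. k \<circ> inv' \<pi>" and i = "\<lambda>k. k \<circ> \<pi>"])
  note p = permutes_inverses[OF \<pi>] and pA = permutes_in_image[OF \<pi>] permutes_in_image[OF permutes_inv[OF \<pi>]]
  have inv: "inv' (inv' \<pi> \<circ> h \<circ> \<pi>) x = inv' \<pi> (inv' h (\<pi> x))" for x
    using permutes_comp_inv[OF permutes_compose[OF h permutes_inv[OF \<pi>]] \<pi>]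
      permutes_comp_inv[OF permutes_inv[OF \<pi>] h] inv_inv_eq[OF permutes_bij[OF \<pi>]] by simp
  fix k assume k: "k \<in> (\<Pi>\<^sub>E x\<in>A. {..<rep_dim (Us ! (c \<circ> \<pi>) x)})"
  show "k \<circ> inv' \<pi> \<circ> \<pi> = k"
    using p by (simp add: fun_eq_iff)
  show "k \<circ> inv' \<pi> \<in> (\<Pi>\<^sub>E x\<in>A. {..<rep_dim (Us ! c x)})"
  proof (rule PiE_I)
    fix x assume "x \<in> A"
    then have "k (inv' \<pi> x) \<in> {..<rep_dim (Us ! (c \<circ> \<pi>) (inv' \<pi> x))}"
      using k pA by (intro PiE_mem[OF k]) simp
    then show "(k \<circ> inv' \<pi>) x \<in> {..<rep_dim (Us ! c x)}"
      using p by simp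
  next
    fix x assume "x \<notin> A"
    then show "(k \<circ> inv' \<pi>) x = undefined"
      using PiE_arb[OF k, of "inv' \<pi> x"] pA by simp
  qed
  have "(\<Prod>x\<in>A. matrix_coef (Us ! c x) (f x) ((k \<circ> inv' \<pi>) x) ((k \<circ> inv' \<pi>) (inv' h x))) =
      (\<Prod>x\<in>A. matrix_coef (Us ! c (\<pi> x)) (f (\<pi> x)) ((k \<circ> inv' \<pi>) (\<pi> x)) ((k \<circ> inv' \<pi>) (inv' h (\<pi> x))))"
    by (rule prod.reindex_bij_betw[OF permutes_imp_bij[OF \<pi>], symmetric])
  then show "(\<Prod>x\<in>A. matrix_coef (Us ! c x) (f x) ((k \<circ> inv' \<pi>) x) ((k \<circ> inv' \<pi>) (inv' h x))) =
      (\<Prod>x\<in>A. matrix_coef (Us ! (c \<circ> \<pi>) x) ((f \<circ> \<pi>) x) (k x) (k (inv' (inv' \<pi> \<circ> h \<circ> \<pi>) x)))"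
    using p inv by simp
next
  note p = permutes_inverses[OF \<pi>] and pA = permutes_in_image[OF \<pi>] permutes_in_image[OF permutes_inv[OF \<pi>]]
  fix k assume k: "k \<in> (\<Pi>\<^sub>E x\<in>A. {..<rep_dim (Us ! c x)})"
  show "k \<circ> \<pi> \<circ> inv' \<pi> = k"
    using p by (simp add: fun_eq_iff)
  show "k \<circ> \<pi> \<in> (\<Pi>\<^sub>E x\<in>A. {..<rep_dim (Us ! (c \<circ> \<pi>) x)})"
  proof (rule PiE_I)
    fix x assume "x \<in> A"
    then show "(k \<circ> \<pi>) x \<in> {..<rep_dim (Us ! (c \<circ> \<pi>) x)}"
      using PiE_mem[OF k, of "\<pi> x"] pA by simp
  next
    fix x assume "x \<notin> A"
    then show "(k \<circ> \<pi>) x = undefined"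
      using PiE_arb[OF k, of "\<pi> x"] pA by simp
  qed
qed

text \<open>The index at the fixed point n + 1 enters only the factor at n + 1, as a diagonal entry;
  summing over it gives a character value of F.\<close>

lemma color_trace_fixed_point:
  assumes h: "h permutes {1..n}"
  shows "color_trace Us {1..Suc n} c f h =
    color_trace Us {1..n} c f h * rep_char (Us ! c (Suc n)) (f (Suc n))"
proof -
  let ?K = "\<lambda>x. {..<rep_dim (Us ! c x)}"
  let ?g = "\<lambda>k x. matrix_coef (Us ! c x) (f x) (k x) (k (inv' h x))"
  have ins: "{1..Suc n} = insert (Suc n) {1..n}" and nin: "Suc n \<notin> {1..n}"
    by auto
  have inv: "inv' h (Suc n) = Suc n" "\<And>x. x \<in> {1..n} \<Longrightarrow> inv' h x \<in> {1..n}"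
    using permutes_not_in[OF permutes_inv[OF h] nin] permutes_in_image[OF permutes_inv[OF h]] by auto
  have prod_eq: "(\<Prod>x\<in>insert (Suc n) {1..n}. ?g (k(Suc n := y)) x) =
      matrix_coef (Us ! c (Suc n)) (f (Suc n)) y y * (\<Prod>x\<in>{1..n}. ?g k x)" for k y
  proof -
    have "(\<Prod>x\<in>{1..n}. ?g (k(Suc n := y)) x) = (\<Prod>x\<in>{1..n}. ?g k x)"
    proof (rule prod.cong[OF refl])
      fix x assume x: "x \<in> {1..n}"
      then have "x \<noteq> Suc n" "inv' h x \<noteq> Suc n"
        using inv(2)[OF x] by auto
      then show "?g (k(Suc n := y)) x = ?g k x"
        by simp
    qed
    then show ?thesis
      using nin inv(1) by (subst prod.insert) auto
  qed
  have "color_trace Us {1..Suc n} c f h =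
      (\<Sum>k\<in>(\<lambda>(y, k). k(Suc n := y)) ` (?K (Suc n) \<times> Pi\<^sub>E {1..n} ?K). \<Prod>x\<in>insert (Suc n) {1..n}. ?g k x)"
    unfolding color_trace_def ins PiE_insert_eq ..
  also have "\<dots> = (\<Sum>(y, k)\<in>?K (Suc n) \<times> Pi\<^sub>E {1..n} ?K. \<Prod>x\<in>insert (Suc n) {1..n}. ?g (k(Suc n := y)) x)"
    by (subst sum.reindex[OF inj_combinator[OF nin]]) (simp add: case_prod_unfold comp_def)
  also have "\<dots> = (\<Sum>y\<in>?K (Suc n). matrix_coef (Us ! c (Suc n)) (f (Suc n)) y y) *
      (\<Sum>k\<in>Pi\<^sub>E {1..n} ?K. \<Prod>x\<in>{1..n}. ?g k x)"
    unfolding prod_eq by (simp add: sum_product sum.cartesian_product)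
  finally show ?thesis
    by (simp add: color_trace_def rep_char_matrix_coef mult.commute)
qed

section \<open>Characters of the representations \<Phi>\<close>

locale wreath_reps =
  fixes F :: "('f, 'm) monoid_scheme" and Us :: "('f, 'v::complex_vector) rep list"
  assumes group_F: "group F" and finite_F: "finite (carrier F)"
    and Us: "\<And>i. i < length Us \<Longrightarrow> is_rep F (Us ! i)"
begin

abbreviation young_wreath :: "nat list \<Rightarrow> ((nat \<Rightarrow> 'f) \<times> (nat \<Rightarrow> nat)) monoid" where
  "young_wreath ns \<equiv> wreath F (sum_list ns) (young_subgroup ns)"

lemma fin_group_wreath_sym: "fin_group (wreath_sym F n)"
  by (intro fin_group.intro fin_group_axioms.intro group_wreath group_F perm_group_sym finite_wreath finite_F)

lemma fin_subgroup_young: "fin_subgroup (wreath_sym F (sum_list ns)) (young_wreath ns)"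
proof (intro fin_subgroup.intro fin_subgroup_axioms.intro fin_group_wreath_sym
    group_wreath(1)[OF group_F perm_group_young])
  show "carrier (young_wreath ns) \<subseteq> carrier (wreath_sym F (sum_list ns))"
    using perm_groupD(2)[OF perm_group_young] by (auto simp: wreath_simps(1) sym_group_carrier)
qed (simp add: wreath_def)

lemma fin_subgroup_wreath_sym: "fin_subgroup (wreath_sym F (Suc n)) (wreath_sym F n)"
proof (intro fin_subgroup.intro fin_subgroup_axioms.intro fin_group_wreath_sym
    group_wreath(1)[OF group_F perm_group_sym])
  interpret F: group F
    by (rule group_F)
  show "carrier (wreath_sym F n) \<subseteq> carrier (wreath_sym F (Suc n))"
  proof
    fix z assume "z \<in> carrier (wreath_sym F n)"
    then obtain f \<pi> where z: "z = (f, \<pi>)" "(f, \<pi>) \<in> carrier (wreath_sym F n)"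
      by (cases z) auto
    have "\<pi> \<in> carrier (sym_group (Suc n))"
      using z(2) fin_subgroup.carrier_subset[OF fin_subgroup_sym[of n]] by (auto simp: wreath_simps(1))
    then show "z \<in> carrier (wreath_sym F (Suc n))"
      using wreath_value[OF group_F z(2)] z by (auto simp: wreath_simps(1))
  qed
qed (simp add: wreath_def)

lemma is_rep_U_tilde:
  assumes len: "length Us = length ns"
  shows "is_rep (young_wreath ns) (U_tilde Us ns)"
    and "(f, h) \<in> carrier (young_wreath ns) \<Longrightarrow>
      rep_char (U_tilde Us ns) (f, h) = color_trace Us {1..sum_list ns} (color ns) f h"
proof -
  let ?I = "{1..sum_list ns}" and ?R = "factor_rep Us ns"
  let ?V = "\<lambda>x. rep_space (?R x)"
  define A where "A f h u = (\<lambda>x\<in>?I. rep_act (?R x) (f x) (u (inv' h x)))"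
    for f :: "nat \<Rightarrow> 'f" and h :: "nat \<Rightarrow> nat" and u :: "nat \<Rightarrow> 'v"
  interpret Y: group "young_wreath ns"
    by (rule group_wreath(1)[OF group_F perm_group_young])
  note Y = perm_groupD[OF perm_group_young[of ns]]
  have R: "is_rep F (?R x)" if "x \<in> ?I" for x
    using factor_rep_color[OF len that] Us color_less[OF that] len by simp
  note r = is_repD[OF R]
  have act: "rep_act (U_tilde Us ns) (f, h) = tensor_map ?I ?V (A f h)" for f h
    by (simp add: U_tilde_def A_def[abs_def])
  have sp: "rep_space (U_tilde Us ns) = tensor_space ?I ?V"
    by (simp add: U_tilde_def outer_tensor_def)
  \<comment> \<open>As h preserves the blocks, the factors at x and at its preimage are the same
    representation, so moving tensor factors makes sense.\<close>
  have hI: "inv' h x \<in> ?I" and hR: "?R (inv' h x) = ?R x" if "h \<in> young_subgroup ns" "x \<in> ?I" for h x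
  proof -
    show I: "inv' h x \<in> ?I"
      using permutes_in_image[OF Y(2)[OF Y(3)[OF that(1)]]] that(2) by blast
    show "?R (inv' h x) = ?R x"
      using young_subgroup_color[OF Y(3)[OF that(1)] that(2)] factor_rep_color[OF len I]
        factor_rep_color[OF len that(2)] by simp
  qed
  have mem: "h \<in> young_subgroup ns" "\<And>x. f x \<in> carrier F" if "(f, h) \<in> carrier (young_wreath ns)" for f h
    using that wreath_value[OF group_F that] by (auto simp: wreath_simps(1))
  have bij: "bij_betw (inv' h) ?I ?I" if "h \<in> young_subgroup ns" for h
    using permutes_imp_bij[OF Y(2)[OF Y(3)[OF that]]] .
  have m: "multilinear_endo ?I ?V (A f h)" if "(f, h) \<in> carrier (young_wreath ns)" for f h
    unfolding A_def[abs_def]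
    by (rule multilinear_endo_twist[OF bij[OF mem(1)[OF that]], where L = "\<lambda>x. rep_act (?R x) (f x)"])
      (use hR[OF mem(1)[OF that]] mem(2)[OF that] r in auto)
  have fr: "frame (\<Pi>\<^sub>E x\<in>?I. {..<cdim (?V x)}) (\<lambda>k. pure_tensor ?I ?V (\<lambda>i\<in>?I. basis_vec (?V i) (k i)))
    (\<lambda>k t. t (\<lambda>u. \<Prod>i\<in>?I. coord (?V i) (k i) (u i))) (tensor_space ?I ?V)"
    using basis_coord_frame(1)[OF r(1)] by (intro tensor_frame) auto
  show "is_rep (young_wreath ns) (U_tilde Us ns)"
  proof (rule is_repI)
    show "fin_dim (rep_space (U_tilde Us ns))"
      unfolding sp using fr by (rule frame_fin_dim)
    fix g assume g: "g \<in> carrier (young_wreath ns)"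
    obtain f h where fh: "g = (f, h)"
      by (cases g)
    show "linear_on (rep_space (U_tilde Us ns)) (rep_act (U_tilde Us ns) g)"
      unfolding fh act by (rule linear_on_tensor_map)
    fix v assume v: "v \<in> rep_space (U_tilde Us ns)"
    show "rep_act (U_tilde Us ns) g v \<in> rep_space (U_tilde Us ns)"
      using tensor_map_closed[OF m] g v unfolding fh act sp by blast
    fix g' assume g': "g' \<in> carrier (young_wreath ns)"
    obtain f' h' where fh': "g' = (f', h')"
      by (cases g')
    have gg: "g \<otimes>\<^bsub>young_wreath ns\<^esub> g' = (\<lambda>x. f x \<otimes>\<^bsub>F\<^esub> f' (inv' h x), h \<circ> h')"
      by (simp add: fh fh' wreath_simps(2))
    note mg = mem[OF g[unfolded fh]] and mg' = mem[OF g'[unfolded fh']]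
    have "A (\<lambda>x. f x \<otimes>\<^bsub>F\<^esub> f' (inv' h x)) (h \<circ> h') u = A f h (A f' h' u)" if u: "u \<in> Pi\<^sub>E ?I ?V" for u
    proof
      fix x
      show "A (\<lambda>x. f x \<otimes>\<^bsub>F\<^esub> f' (inv' h x)) (h \<circ> h') u x = A f h (A f' h' u) x"
      proof (cases "x \<in> ?I")
        case True
        note x1 = hI[OF mg(1) True] and x1' = hR[OF mg(1) True]
        note x2 = hI[OF mg'(1) x1] and x2' = hR[OF mg'(1) x1]
        have "u (inv' h' (inv' h x)) \<in> ?V x"
          using PiE_mem[OF u x2] x2' x1' by simp
        then show ?thesis
          using True x1 x1' r(6)[OF True mg(2) mg'(2)] permutes_comp_inv[OF Y(2)[OF mg(1)] Y(2)[OF mg'(1)]]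
          by (simp add: A_def)
      next
        case False
        then show ?thesis
          by (simp only: A_def restrict_def if_False)
      qed
    qed
    then show "rep_act (U_tilde Us ns) (g \<otimes>\<^bsub>young_wreath ns\<^esub> g') v =
        rep_act (U_tilde Us ns) g (rep_act (U_tilde Us ns) g' v)"
      using v unfolding gg unfolding fh fh' act sp
      by (intro tensor_map_comp m g[unfolded fh] g'[unfolded fh'])
        (use Y.m_closed[OF g g'] gg in \<open>auto simp: fh fh'\<close>)
  next
    fix v assume v: "v \<in> rep_space (U_tilde Us ns)"
    have "(\<lambda>_. \<one>\<^bsub>F\<^esub>, id) \<in> carrier (young_wreath ns)"
      using Y.one_closed by (simp add: wreath_simps(3))
    then show "rep_act (U_tilde Us ns) \<one>\<^bsub>young_wreath ns\<^esub> v = v"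
      unfolding wreath_simps(3) act
    proof (intro tensor_map_id m)
      fix u assume u: "u \<in> Pi\<^sub>E ?I ?V"
      show "A (\<lambda>_. \<one>\<^bsub>F\<^esub>) id u = u"
      proof
        fix x
        show "A (\<lambda>_. \<one>\<^bsub>F\<^esub>) id u x = u x"
          using PiE_mem[OF u, of x] PiE_arb[OF u, of x] r(5)[of x "u x"]
          by (cases "x \<in> ?I") (simp_all add: A_def inv_id)
      qed
    qed (use v[unfolded sp] in simp_all)
  qed
  assume g: "(f, h) \<in> carrier (young_wreath ns)"
  note mg = mem[OF g]
  have "rep_char (U_tilde Us ns) (f, h) = (\<Sum>k\<in>(\<Pi>\<^sub>E x\<in>?I. {..<cdim (?V x)}).
      \<Prod>x\<in>?I. coord (?V x) (k x) (rep_act (?R x) (f x) (basis_vec (?V (inv' h x)) (k (inv' h x)))))"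
    unfolding rep_char_def sp act A_def[abs_def]
    by (rule trace_twist[OF _ r(1) bij[OF mg(1)]]) (use hR[OF mg(1)] mg(2) r in auto)
  also have "\<dots> = color_trace Us ?I (color ns) f h"
    unfolding color_trace_def matrix_coef_def rep_dim_def
    using hR[OF mg(1)] factor_rep_color[OF len]
    by (intro sum.cong prod.cong PiE_cong) auto
  finally show "rep_char (U_tilde Us ns) (f, h) = color_trace Us ?I (color ns) f h" .
qed

text \<open>The functions f act trivially, so the representation and its character are those of the
  outer tensor product, evaluated at the block components of h.\<close>

lemma is_rep_S_bar:
  assumes ns: "ns = map sum_list \<Lambda>"
  shows "is_rep (young_wreath ns) (S_bar \<Lambda> :: ((nat \<Rightarrow> 'f) \<times> (nat \<Rightarrow> nat), _) rep)"
    and "(f, h) \<in> carrier (young_wreath ns) \<Longrightarrow> rep_char (S_bar \<Lambda>) (f, h) =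
      (\<Prod>i<length \<Lambda>. rep_char (specht (\<Lambda> ! i)) (block_perm ns i h))"
proof -
  let ?I = "{..<length \<Lambda>}" and ?R = "\<lambda>i. specht (\<Lambda> ! i)"
  let ?V = "\<lambda>i. rep_space (?R i)"
  define A where "A h u = (\<lambda>i\<in>?I. rep_act (?R i) (block_perm ns i h) (u i))"
    for h and u :: "nat \<Rightarrow> nat set list \<Rightarrow> complex"
  interpret Y: group "young_wreath ns"
    by (rule group_wreath(1)[OF group_F perm_group_young])
  note Y = perm_groupD[OF perm_group_young[of ns]]
  have R: "is_rep (sym_group (ns ! i)) (?R i)" if "i \<in> ?I" for i
    using is_rep_specht[of "\<Lambda> ! i"] that ns by simp
  note r = is_repD[OF R]
  have act: "rep_act (S_bar \<Lambda>) (f, h) = tensor_map ?I ?V (A h)" for f :: "nat \<Rightarrow> 'f" and h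
    by (simp add: S_bar_def Let_def A_def[abs_def] outer_tensor_def ns)
  have act': "rep_act (S_bar \<Lambda>) (f, h) = rep_act (outer_tensor ?I ?R) (\<lambda>i. block_perm ns i h)"
    for f :: "nat \<Rightarrow> 'f" and h
    by (simp add: S_bar_def Let_def ns)
  have sp: "rep_space (S_bar \<Lambda> :: ((nat \<Rightarrow> 'f) \<times> (nat \<Rightarrow> nat), _) rep) = tensor_space ?I ?V"
    by (simp add: S_bar_def Let_def outer_tensor_def)
  have mem: "h \<in> young_subgroup ns" if "(f, h) \<in> carrier (young_wreath ns)" for f h
    using that by (simp add: wreath_simps(1))
  have bp: "block_perm ns i h \<in> carrier (sym_group (ns ! i))" if "h \<in> young_subgroup ns" "i \<in> ?I" for h i
    using block_perm_permutes[OF that(1), of i] that(2) ns by (simp add: sym_group_carrier)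
  have m: "multilinear_endo ?I ?V (A h)" if "h \<in> young_subgroup ns" for h
    unfolding A_def[abs_def] using R bp[OF that] by (rule outer_tensor_multilinear)
  have fr: "frame (\<Pi>\<^sub>E x\<in>?I. {..<cdim (?V x)}) (\<lambda>k. pure_tensor ?I ?V (\<lambda>i\<in>?I. basis_vec (?V i) (k i)))
    (\<lambda>k t. t (\<lambda>u. \<Prod>i\<in>?I. coord (?V i) (k i) (u i))) (tensor_space ?I ?V)"
    using basis_coord_frame(1)[OF r(1)] by (intro tensor_frame) auto
  show "is_rep (young_wreath ns) (S_bar \<Lambda> :: ((nat \<Rightarrow> 'f) \<times> (nat \<Rightarrow> nat), _) rep)"
  proof (rule is_repI)
    show "fin_dim (rep_space (S_bar \<Lambda> :: ((nat \<Rightarrow> 'f) \<times> (nat \<Rightarrow> nat), _) rep))"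
      unfolding sp using fr by (rule frame_fin_dim)
    fix g :: "(nat \<Rightarrow> 'f) \<times> (nat \<Rightarrow> nat)" assume g: "g \<in> carrier (young_wreath ns)"
    obtain f h where fh: "g = (f, h)"
      by (cases g)
    show "linear_on (rep_space (S_bar \<Lambda> :: ((nat \<Rightarrow> 'f) \<times> (nat \<Rightarrow> nat), _) rep)) (rep_act (S_bar \<Lambda>) g)"
      unfolding fh act by (rule linear_on_tensor_map)
    fix v assume v: "v \<in> rep_space (S_bar \<Lambda> :: ((nat \<Rightarrow> 'f) \<times> (nat \<Rightarrow> nat), _) rep)"
    note mg = mem[OF g[unfolded fh]]
    show "rep_act (S_bar \<Lambda>) g v \<in> rep_space (S_bar \<Lambda> :: ((nat \<Rightarrow> 'f) \<times> (nat \<Rightarrow> nat), _) rep)"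
      using tensor_map_closed[OF m[OF mg]] v unfolding fh act sp by blast
    fix g' :: "(nat \<Rightarrow> 'f) \<times> (nat \<Rightarrow> nat)" assume g': "g' \<in> carrier (young_wreath ns)"
    obtain f' h' where fh': "g' = (f', h')"
      by (cases g')
    note mg' = mem[OF g'[unfolded fh']]
    have gg: "g \<otimes>\<^bsub>young_wreath ns\<^esub> g' = (\<lambda>x. f x \<otimes>\<^bsub>F\<^esub> f' (inv' h x), h \<circ> h')"
      by (simp add: fh fh' wreath_simps(2))
    have "A (h \<circ> h') u = A h (A h' u)" if u: "u \<in> Pi\<^sub>E ?I ?V" for u
    proof
      fix i
      show "A (h \<circ> h') u i = A h (A h' u) i"
      proof (cases "i \<in> ?I")
        case True
        then show ?thesis
          using r(6)[OF True bp[OF mg True] bp[OF mg' True] PiE_mem[OF u True]] block_perm_comp[OF mg mg', of i] ns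
          by (simp add: A_def sym_group_mult)
      qed (simp add: A_def)
    qed
    then show "rep_act (S_bar \<Lambda>) (g \<otimes>\<^bsub>young_wreath ns\<^esub> g') v = rep_act (S_bar \<Lambda>) g (rep_act (S_bar \<Lambda>) g' v)"
      using v unfolding gg unfolding fh fh' act sp
      by (intro tensor_map_comp m mg mg' Y(4))
  next
    fix v assume v: "v \<in> rep_space (S_bar \<Lambda> :: ((nat \<Rightarrow> 'f) \<times> (nat \<Rightarrow> nat), _) rep)"
    show "rep_act (S_bar \<Lambda>) \<one>\<^bsub>young_wreath ns\<^esub> v = v"
      unfolding wreath_simps(3) act
    proof (rule tensor_map_id[OF m[OF Y(1)]])
      fix u assume u: "u \<in> Pi\<^sub>E ?I ?V"
      show "A id u = u"
      proof
        fix i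
        show "A id u i = u i"
          using PiE_mem[OF u, of i] PiE_arb[OF u, of i] r(5)[of i "u i"]
          by (cases "i \<in> ?I") (simp_all add: A_def block_perm_id sym_group_one)
      qed
    qed (use v sp in simp)
  qed
  assume g: "(f, h) \<in> carrier (young_wreath ns)"
  have "rep_char (S_bar \<Lambda>) (f, h) = rep_char (outer_tensor ?I ?R) (\<lambda>i. block_perm ns i h)"
    unfolding rep_char_def act' sp by (simp add: outer_tensor_def)
  also have "\<dots> = (\<Prod>i<length \<Lambda>. rep_char (specht (\<Lambda> ! i)) (block_perm ns i h))"
    using R bp[OF mem[OF g]] by (intro rep_char_outer_tensor) auto
  finally show "rep_char (S_bar \<Lambda>) (f, h) =
      (\<Prod>i<length \<Lambda>. rep_char (specht (\<Lambda> ! i)) (block_perm ns i h))" .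
qed

text \<open>The character of the representation from which \<Phi> is induced. The formula makes
  sense for all pairs but describes a trace only where h preserves the blocks.\<close>

definition young_char :: "nat list list \<Rightarrow> nat list \<Rightarrow> (nat \<Rightarrow> 'f) \<times> (nat \<Rightarrow> nat) \<Rightarrow> complex" where
  "young_char \<Lambda> ns = (\<lambda>(f, h). color_trace Us {1..sum_list ns} (color ns) f h *
     (\<Prod>i<length \<Lambda>. rep_char (specht (\<Lambda> ! i)) (block_perm ns i h)))"

lemma is_rep_Phi:
  assumes len: "length Us = length \<Lambda>" and ns: "ns = map sum_list \<Lambda>"
  shows "is_rep (wreath_sym F (sum_list ns)) (Phi F Us \<Lambda>)"
    and "g \<in> carrier (wreath_sym F (sum_list ns)) \<Longrightarrow> rep_char (Phi F Us \<Lambda>) g =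
      fin_subgroup.ind_char (wreath_sym F (sum_list ns)) (young_wreath ns) (young_char \<Lambda> ns) g"
proof -
  interpret S: fin_subgroup "wreath_sym F (sum_list ns)" "young_wreath ns"
    by (rule fin_subgroup_young)
  have len': "length Us = length ns"
    using len ns by simp
  let ?T = "inner_tensor (U_tilde Us ns) (S_bar \<Lambda>)"
  have Phi: "Phi F Us \<Lambda> = induced (wreath_sym F (sum_list ns)) (carrier (young_wreath ns)) ?T"
    by (simp add: Phi_def Let_def ns)
  have T: "is_rep (young_wreath ns) ?T"
    by (intro is_rep_inner_tensor is_rep_U_tilde(1) is_rep_S_bar(1) len' ns S.H.is_group)
  have charT: "rep_char ?T z = young_char \<Lambda> ns z" if z: "z \<in> carrier (young_wreath ns)" for z
  proof -
    obtain f h where fh: "z = (f, h)"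
      by (cases z)
    show ?thesis
      using rep_char_inner_tensor[OF is_rep_U_tilde(1)[OF len'] is_rep_S_bar(1)[OF ns] S.H.is_group z]
        is_rep_U_tilde(2)[OF len'] is_rep_S_bar(2)[OF ns] z
      by (simp add: fh young_char_def)
  qed
  show "is_rep (wreath_sym F (sum_list ns)) (Phi F Us \<Lambda>)"
    unfolding Phi by (rule S.is_rep_induced[OF T])
  show "rep_char (Phi F Us \<Lambda>) g = S.ind_char (young_char \<Lambda> ns) g"
    if "g \<in> carrier (wreath_sym F (sum_list ns))"
    unfolding Phi S.rep_char_induced[OF T that] S.ind_char_def
    by (intro arg_cong2[of _ _ _ _ "(/)"] sum.cong refl) (simp add: charT)
qed

end

section \<open>The branching rule for wreath products\<close>

lemma block_image: "block ns i = (\<lambda>y. offset ns i + y) ` {1..ns ! i}"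
  unfolding block_def by (simp add: image_add_atLeastAtMost add.commute)

text \<open>The embedding of the symmetric group of block i into the Young subgroup, a section of
  \<open>block_perm ns i\<close>.\<close>

definition block_embed :: "nat list \<Rightarrow> nat \<Rightarrow> (nat \<Rightarrow> nat) \<Rightarrow> nat \<Rightarrow> nat" where
  "block_embed ns i \<tau> = (\<lambda>x. if x \<in> block ns i then offset ns i + \<tau> (x - offset ns i) else x)"

lemma block_embed_in:
  assumes "\<tau> permutes {1..ns ! i}" "y \<in> {1..ns ! i}"
  shows "block_embed ns i \<tau> (offset ns i + y) = offset ns i + \<tau> y" "\<tau> y \<in> {1..ns ! i}"
  using assms permutes_in_image[OF assms(1), of y] by (auto simp: block_embed_def block_def)

lemma block_embed_comp:
  assumes "\<tau> permutes {1..ns ! i}" "\<rho> permutes {1..ns ! i}"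
  shows "block_embed ns i \<tau> \<circ> block_embed ns i \<rho> = block_embed ns i (\<tau> \<circ> \<rho>)"
proof
  fix x
  show "(block_embed ns i \<tau> \<circ> block_embed ns i \<rho>) x = block_embed ns i (\<tau> \<circ> \<rho>) x"
  proof (cases "x \<in> block ns i")
    case True
    then obtain y where y: "y \<in> {1..ns ! i}" "x = offset ns i + y"
      unfolding block_image by blast
    show ?thesis
      using block_embed_in[OF assms(2) y(1)] block_embed_in(1)[OF assms(1) block_embed_in(2)[OF assms(2) y(1)]]
        block_embed_in(1)[OF permutes_compose[OF assms(2,1)] y(1)] y(2) by simp
  qed (simp add: block_embed_def)
qed

lemma block_embed_young:
  assumes i: "i < length ns" and \<tau>: "\<tau> permutes {1..ns ! i}"
  shows "block_embed ns i \<tau> \<in> young_subgroup ns"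
proof -
  let ?e = "block_embed ns i"
  have id: "?e id = id"
    by (auto simp: block_embed_def block_def fun_eq_iff)
  have "?e \<tau> \<circ> ?e (inv' \<tau>) = id" "?e (inv' \<tau>) \<circ> ?e \<tau> = id"
    using block_embed_comp[OF \<tau> permutes_inv[OF \<tau>]] block_embed_comp[OF permutes_inv[OF \<tau>] \<tau>]
      permutes_inv_o[OF \<tau>] id by auto
  then have bij: "bij (?e \<tau>)"
    using o_bij by blast
  moreover have "\<forall>x. x \<notin> {1..sum_list ns} \<longrightarrow> ?e \<tau> x = x"
    using block_subset[OF i] by (auto simp: block_embed_def simp del: atLeastAtMost_iff)
  ultimately have perm: "?e \<tau> permutes {1..sum_list ns}"
    unfolding permutes_def bij_iff by blast
  have "?e \<tau> ` block ns j = block ns j" if "j < length ns" for j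
  proof (cases "j = i")
    case True
    have "?e \<tau> ` block ns i = (\<lambda>y. offset ns i + \<tau> y) ` {1..ns ! i}"
      unfolding block_image image_image using block_embed_in(1)[OF \<tau>] by (intro image_cong) auto
    also have "\<dots> = (\<lambda>y. offset ns i + y) ` \<tau> ` {1..ns ! i}"
      by (simp add: image_image)
    finally show ?thesis
      using permutes_image[OF \<tau>] True by (simp add: block_image)
  next
    case False
    have "?e \<tau> x = x" if "x \<in> block ns j" for x
      using block_disjoint[OF that _ \<open>j < length ns\<close> i] False by (auto simp: block_embed_def)
    then have "?e \<tau> ` block ns j = (\<lambda>x. x) ` block ns j"
      by (intro image_cong) auto
    then show ?thesis
      by simp
  qed
  then show ?thesis
    using perm by (simp add: young_subgroup_def)
qed

lemma block_perm_block_embed: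
  assumes i: "i < length ns" and \<tau>: "\<tau> permutes {1..ns ! i}" and j: "j < length ns"
  shows "block_perm ns j (block_embed ns i \<tau>) = (if j = i then \<tau> else id)"
proof
  fix y
  show "block_perm ns j (block_embed ns i \<tau>) y = (if j = i then \<tau> else id) y"
  proof (cases "y \<in> {1..ns ! j}")
    case True
    have x: "offset ns j + y \<in> block ns j"
      using True unfolding block_image by blast
    show ?thesis
    proof (cases "j = i")
      case j: True
      then show ?thesis
        using block_embed_in(1)[OF \<tau>, of y] True by (simp add: block_perm_def)
    next
      case False
      then have "offset ns j + y \<notin> block ns i"
        using block_disjoint[OF x _ j i] by blast
      then show ?thesis
        using False True by (simp add: block_perm_def block_embed_def)
    qed
  next
    case False
    then show ?thesis
      using permutes_not_in[OF \<tau>] by (auto simp: block_perm_def)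
  qed
qed

lemma block_perm_inv:
  assumes "h \<in> young_subgroup ns" "i < length ns"
  shows "block_perm ns i (inv' h) = inv' (block_perm ns i h)"
proof -
  have h': "inv' h \<in> young_subgroup ns"
    using perm_groupD(3)[OF perm_group_young] assms by blast
  have p: "h permutes {1..sum_list ns}"
    using assms by (simp add: young_subgroup_def)
  have "block_perm ns i (inv' h) \<circ> block_perm ns i h = id" "block_perm ns i h \<circ> block_perm ns i (inv' h) = id"
    using block_perm_comp[OF h' assms] block_perm_comp[OF assms(1) h' assms(2)]
    by (simp_all add: block_perm_id permutes_inv_o[OF p])
  then show ?thesis
    by (metis inv_unique_comp)
qed

lemma sum_list_update_Suc:
  "i < length ns \<Longrightarrow> sum_list (ns[i := Suc (ns ! i)]) = Suc (sum_list ns)"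
  by (simp add: sum_list_update)

lemma offset_update:
  assumes "i < length ns"
  shows "offset (ns[i := Suc (ns ! i)]) j = offset ns j + (if i < j then 1 else 0)"
proof (cases "i < j")
  case True
  have i: "i < length (take j ns)"
    using True assms by simp
  have "sum_list ((take j ns)[i := Suc (take j ns ! i)]) = Suc (sum_list (take j ns))"
    by (rule sum_list_update_Suc[OF i])
  then show ?thesis
    using True by (simp add: offset_def take_update_swap)
next
  case False
  then show ?thesis
    by (simp add: offset_def take_update_swap list_update_beyond)
qed

text \<open>The new point \<open>n + 1\<close> has to be moved to the last position \<open>p\<close> of the enlarged \<open>i\<close>-th block; the
  permutation \<open>c\<close> does this and keeps the order of the other points.\<close>

locale enlarged_block =
  fixes ns :: "nat list" and i n :: nat
  assumes i: "i < length ns" and n: "sum_list ns = n"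
begin

definition ms :: "nat list" where
  "ms = ns[i := Suc (ns ! i)]"

definition p :: nat where
  "p = Suc (offset ns i + ns ! i)"

definition c :: "nat \<Rightarrow> nat" where
  "c x = (if x = Suc n then p else if p \<le> x \<and> x \<le> n then Suc x else x)"

lemma length_ms [simp]: "length ms = length ns"
  by (simp add: ms_def)

lemma nth_ms: "j < length ns \<Longrightarrow> ms ! j = (if j = i then Suc (ns ! i) else ns ! j)"
  by (simp add: ms_def)

lemma sum_ms: "sum_list ms = Suc n"
  using sum_list_update_Suc[OF i] n by (simp add: ms_def)

lemma offset_ms: "offset ms j = offset ns j + (if i < j then 1 else 0)"
  unfolding ms_def by (rule offset_update[OF i])

lemma p_range: "1 \<le> p" "p \<le> Suc n"
  using offset_mono[of "Suc i" "length ns" ns] i n by (auto simp: p_def offset_Suc offset_length)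

lemma c_permutes: "c permutes {1..Suc n}"
proof -
  have inj: "inj_on c {1..Suc n}"
    by (rule inj_onI) (use p_range in \<open>auto simp: c_def split: if_splits\<close>)
  have "c ` {1..Suc n} \<subseteq> {1..Suc n}"
    using p_range by (auto simp: c_def)
  then have "c ` {1..Suc n} = {1..Suc n}"
    using inj by (intro endo_inj_surj) auto
  then show ?thesis
    using inj by (intro bij_imp_permutes) (auto simp: bij_betw_def c_def)
qed

lemma c_last: "c (Suc n) = p"
  by (simp add: c_def)

text \<open>Among the old points c raises exactly those behind block i by one, and these are the
  blocks whose offset grows by one in \<open>ms\<close>.\<close>

lemma c_block:
  assumes j: "j < length ns" and y: "y \<in> {1..ns ! j}"
  shows "c (offset ns j + y) = offset ms j + y"
proof -
  have "offset ns j + y \<le> offset ns (Suc j)"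
    using y by (simp add: offset_Suc[OF j])
  also have "\<dots> \<le> n"
    using offset_mono[of "Suc j" "length ns" ns] j n by (simp add: offset_length)
  finally have n': "offset ns j + y \<le> n" .
  show ?thesis
  proof (cases "i < j")
    case True
    then have "offset ns (Suc i) \<le> offset ns j"
      by (intro offset_mono) simp
    then have "p \<le> offset ns j + y"
      using y by (simp add: p_def offset_Suc[OF i])
    then show ?thesis
      using n' True by (simp add: c_def offset_ms)
  next
    case False
    then have "offset ns (Suc j) \<le> offset ns (Suc i)"
      by (intro offset_mono) simp
    then have "offset ns j + y < p"
      using y by (simp add: p_def offset_Suc[OF i] offset_Suc[OF j])
    then show ?thesis
      using n' False by (simp add: c_def offset_ms)
  qed
qed

lemma c_image_block:
  assumes "j < length ns"
  shows "block ms j = (if j = i then insert p (c ` block ns j) else c ` block ns j)"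
proof -
  have c: "c ` block ns j = (\<lambda>y. offset ms j + y) ` {1..ns ! j}"
    unfolding block_image image_image using c_block[OF assms] by (intro image_cong) auto
  have "{1..Suc (ns ! i)} = insert (Suc (ns ! i)) {1..ns ! i}"
    by auto
  then show ?thesis
    unfolding c unfolding block_image by (auto simp: nth_ms[OF assms] p_def offset_ms)
qed

lemma p_block: "p \<in> block ms i"
  using c_image_block[OF i] by simp

lemma p_not_c_block:
  assumes "j < length ns"
  shows "p \<notin> c ` block ns j"
proof
  assume "p \<in> c ` block ns j"
  then obtain x where x: "x \<in> block ns j" "c x = c (Suc n)"
    using c_last by auto
  then have "x = Suc n"
    using permutes_inj[OF c_permutes] by (auto dest: injD)
  then show False
    using x(1) block_subset[OF assms] n by auto
qed

lemma block_ms_subset: "j < length ns \<Longrightarrow> block ms j \<subseteq> {1..Suc n}"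
  using block_subset[of j ms] sum_ms by simp

lemma c_color:
  assumes "x \<in> {1..n}"
  shows "color ms (c x) = color ns x"
proof -
  obtain j where j: "j < length ns" "x \<in> block ns j"
    using block_exists[of x ns] assms n by blast
  then have "c x \<in> block ms j"
    using c_image_block[OF j(1)] by auto
  then show ?thesis
    using color_block[of j ms "c x"] color_block[of j ns x] j by simp
qed

lemma color_p: "color ms p = i"
  using color_block[of i ms p] p_block i by simp

definition conj_c :: "(nat \<Rightarrow> nat) \<Rightarrow> nat \<Rightarrow> nat" where
  "conj_c h = inv' c \<circ> h \<circ> c"

lemma conj_c_permutes: "h permutes {1..Suc n} \<Longrightarrow> conj_c h permutes {1..Suc n}"
  unfolding conj_c_def by (intro permutes_compose permutes_inv c_permutes)

lemma c_conj_c: "c (conj_c h x) = h (c x)"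
  using permutes_inverses[OF c_permutes] by (simp add: conj_c_def)

text \<open>c carries each old block to the new one, except that p is missing in block i. For h
  fixing p, preserving the new block amounts to preserving it without p.\<close>

lemma conj_c_young:
  assumes h: "h permutes {1..Suc n}"
  shows "conj_c h \<in> young_subgroup ns \<longleftrightarrow> h \<in> young_subgroup ms \<and> h p = p"
proof -
  have h': "conj_c h permutes {1..Suc n}"
    using h by (rule conj_c_permutes)
  have c_image: "c ` conj_c h ` A = h ` c ` A" for A
    by (simp add: image_image c_conj_c)
  have eq: "conj_c h ` A = A \<longleftrightarrow> h ` c ` A = c ` A" for A
    unfolding c_image[symmetric] by (simp only: inj_image_eq_iff[OF permutes_inj[OF c_permutes]])
  have hp: "h p = p \<longleftrightarrow> conj_c h (Suc n) = Suc n"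
  proof -
    have "h p = c (conj_c h (Suc n))"
      by (simp add: c_conj_c c_last)
    then show ?thesis
      using c_last permutes_inj[OF c_permutes] by (metis injD)
  qed
  have block: "h ` block ms j = block ms j \<longleftrightarrow> conj_c h ` block ns j = block ns j"
    if j: "j < length ns" and fp: "h p = p" for j
  proof (cases "j = i")
    case True
    have "p \<notin> h ` c ` block ns j"
    proof
      assume "p \<in> h ` c ` block ns j"
      then obtain x where x: "x \<in> c ` block ns j" "p = h x"
        by blast
      then have "x = p"
        using fp permutes_inj[OF h] by (metis injD)
      then show False
        using x(1) p_not_c_block[OF j] by simp
    qed
    then show ?thesis
      unfolding eq c_image_block[OF j] using True fp p_not_c_block[OF j] by (simp add: insert_ident)
  next
    case False
    then show ?thesis
      unfolding eq c_image_block[OF j] by simp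
  qed
  show ?thesis
  proof
    assume y: "conj_c h \<in> young_subgroup ns"
    then have "conj_c h permutes {1..n}"
      by (simp add: young_subgroup_def n)
    then have "h p = p"
      unfolding hp by (rule permutes_not_in) simp
    then show "h \<in> young_subgroup ms \<and> h p = p"
      using h block y by (simp add: young_subgroup_def sum_ms)
  next
    assume y: "h \<in> young_subgroup ms \<and> h p = p"
    then have "conj_c h permutes {1..n}"
      using h' hp by (intro permutes_superset[OF h']) (auto simp: le_Suc_eq)
    then show "conj_c h \<in> young_subgroup ns"
      using block y by (simp add: young_subgroup_def n)
  qed
qed

lemma block_perm_conj_c:
  assumes h: "h \<in> young_subgroup ms" "h p = p" and j: "j < length ns"
  shows "block_perm ms j h = block_perm ns j (conj_c h)"
proof
  have hp: "h permutes {1..Suc n}"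
    using h(1) by (simp add: young_subgroup_def sum_ms)
  have y': "conj_c h \<in> young_subgroup ns"
    using conj_c_young[OF hp] h by simp
  fix y
  show "block_perm ms j h y = block_perm ns j (conj_c h) y"
  proof (cases "y \<in> {1..ns ! j}")
    case True
    note b = block_perm_value[OF y' j True]
    have y2: "y \<in> {1..ms ! j}"
      using True by (auto simp: nth_ms[OF j])
    have "offset ms j + block_perm ms j h y = h (offset ms j + y)"
      using block_perm_value(1)[OF h(1) _ y2] j by simp
    also have "\<dots> = c (conj_c h (offset ns j + y))"
      by (simp add: c_conj_c c_block[OF j True])
    also have "\<dots> = offset ms j + block_perm ns j (conj_c h) y"
      unfolding b(1)[symmetric] by (rule c_block[OF j b(2)])
    finally show ?thesis
      by simp
  next
    case False
    show ?thesis
    \<comment> \<open>Only the last point of the enlarged block lies in the new range but not in the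
      old one. It is the position p, which h fixes.\<close>
    proof (cases "j = i \<and> y = Suc (ns ! i)")
      case True
      then have "offset ms j + y = p"
        by (simp add: offset_ms p_def)
      then show ?thesis
        using h(2) True False by (auto simp: block_perm_def nth_ms[OF i])
    next
      case 2: False
      then have "y \<notin> {1..ms ! j}"
        using False by (auto simp: nth_ms[OF j])
      then show ?thesis
        using False by (simp only: block_perm_def if_False)
    qed
  qed
qed

text \<open>The last point of the enlarged block is p. This translates the support condition of a
  character induced from the smaller symmetric group into the condition h p = p.\<close>

lemma block_perm_fixes_iff:
  assumes h: "h \<in> young_subgroup ms"
  shows "block_perm ms i h \<in> carrier (sym_group (ns ! i)) \<longleftrightarrow> h p = p"
proof -
  have y: "Suc (ns ! i) \<in> {1..ms ! i}"
    by (simp add: nth_ms[OF i])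
  have off: "offset ms i + Suc (ns ! i) = p"
    by (simp add: offset_ms p_def)
  have val: "offset ms i + block_perm ms i h (Suc (ns ! i)) = h p"
    using block_perm_value(1)[OF h _ y] i off by simp
  have perm: "block_perm ms i h permutes {1..Suc (ns ! i)}"
    using block_perm_permutes[OF h, of i] i by (simp add: nth_ms[OF i])
  have "block_perm ms i h permutes {1..ns ! i} \<longleftrightarrow> block_perm ms i h (Suc (ns ! i)) = Suc (ns ! i)"
  proof
    assume "block_perm ms i h permutes {1..ns ! i}"
    then show "block_perm ms i h (Suc (ns ! i)) = Suc (ns ! i)"
      by (rule permutes_not_in) simp
  next
    assume "block_perm ms i h (Suc (ns ! i)) = Suc (ns ! i)"
    then show "block_perm ms i h permutes {1..ns ! i}"
      by (intro permutes_superset[OF perm]) (auto simp: le_Suc_eq)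
  qed
  then show ?thesis
    using val off by (simp add: sym_group_carrier) linarith
qed

text \<open>Orbit counting: the image of p runs over the n_i + 1 points of the enlarged block, each
  fibre is a translate of the stabilizer of p, and conjugation by c identifies this stabilizer with
  the old Young subgroup.\<close>

lemma card_young_subgroup: "card (young_subgroup ms) = Suc (ns ! i) * card (young_subgroup ns)"
proof -
  let ?Y = "young_subgroup ms"
  note Y = perm_groupD[OF perm_group_young[of ms], unfolded sum_ms]
  have fin: "finite ?Y"
    by (rule finite_subset[of _ "{h. h permutes {1..Suc n}}"])
      (use Y(2) in \<open>auto intro: finite_permutations simp del: One_nat_def\<close>)
  have c_back: "conj_c (c \<circ> h \<circ> inv' c) = h" "c \<circ> conj_c h \<circ> inv' c = h" for h
    using permutes_inverses[OF c_permutes] by (auto simp: conj_c_def fun_eq_iff)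
  have "bij_betw conj_c {h \<in> ?Y. h p = p} (young_subgroup ns)"
  proof (rule bij_betwI[where g = "\<lambda>h. c \<circ> h \<circ> inv' c"])
    show "conj_c \<in> {h \<in> ?Y. h p = p} \<rightarrow> young_subgroup ns"
      using conj_c_young Y(2) by auto
    have sub: "{1..n} \<subseteq> {1..Suc n}"
      by auto
    show "(\<lambda>h. c \<circ> h \<circ> inv' c) \<in> young_subgroup ns \<rightarrow> {h \<in> ?Y. h p = p}"
    proof
      fix h assume h: "h \<in> young_subgroup ns"
      then have "h permutes {1..n}"
        by (simp add: young_subgroup_def n)
      then have "c \<circ> h \<circ> inv' c permutes {1..Suc n}"
        by (intro permutes_compose permutes_inv c_permutes permutes_subset[OF _ sub])
      then show "c \<circ> h \<circ> inv' c \<in> {h \<in> ?Y. h p = p}"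
        using conj_c_young[of "c \<circ> h \<circ> inv' c"] h c_back(1) by simp
    qed
  qed (simp_all add: c_back)
  then have stab: "card {h \<in> ?Y. h p = p} = card (young_subgroup ns)"
    by (rule bij_betw_same_card)
  have fiber: "card {h \<in> ?Y. h p = q} = card {h \<in> ?Y. h p = p}" if q: "q \<in> block ms i" for q
  proof -
    \<comment> \<open>p and q lie in one block, so exchanging them stays in the Young
      subgroup.\<close>
    let ?\<tau> = "Transposition.transpose p q"
    have "?\<tau> permutes {1..Suc n}"
      using q p_block block_ms_subset[OF i] by (intro permutes_swap_id) auto
    moreover have "?\<tau> ` block ms j = block ms j" if "j < length ns" for j
    proof (rule transpose_image_eq)
      show "p \<in> block ms j \<longleftrightarrow> q \<in> block ms j"
        using block_disjoint[of p ms i j] block_disjoint[of q ms i j] q p_block i that by auto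
    qed
    ultimately have \<tau>: "?\<tau> \<in> ?Y"
      by (simp add: young_subgroup_def sum_ms)
    have "bij_betw (\<lambda>h. ?\<tau> \<circ> h) {h \<in> ?Y. h p = q} {h \<in> ?Y. h p = p}"
      by (rule bij_betwI[where g = "\<lambda>h. ?\<tau> \<circ> h"]) (use Y(4)[OF \<tau>] in \<open>auto simp: fun_eq_iff\<close>)
    then show ?thesis
      by (rule bij_betw_same_card)
  qed
  have "card ?Y = card (\<Union>q\<in>block ms i. {h \<in> ?Y. h p = q})"
  proof (rule arg_cong[where f = card])
    have "h p \<in> block ms i" if "h \<in> ?Y" for h
      using that p_block i unfolding young_subgroup_def by auto
    then show "?Y = (\<Union>q\<in>block ms i. {h \<in> ?Y. h p = q})"
      by blast
  qed
  also have "\<dots> = (\<Sum>q\<in>block ms i. card {h \<in> ?Y. h p = q})"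
    by (rule card_UN_disjoint) (use fin in \<open>auto simp: block_def\<close>)
  also have "\<dots> = card (block ms i) * card (young_subgroup ns)"
    using fiber stab by simp
  also have "card (block ms i) = Suc (ns ! i)"
    by (simp add: block_def nth_ms[OF i])
  finally show ?thesis .
qed

end

section \<open>Order of wreath products and conjugation by permutations\<close>

lemma card_wreath:
  assumes "group F" "finite (carrier F)"
  shows "card (carrier (wreath F n H)) = card (carrier F) ^ n * card H"
proof -
  interpret group F by fact
  \<comment> \<open>Functions in the wreath product are extended by the unit of F, those in
    \<open>PiE\<close> by \<open>undefined\<close>; the bijection exchanges the two default
    values.\<close>
  let ?E = "\<lambda>f x. if x \<in> {1..n} then f x else \<one>\<^bsub>F\<^esub>"
  have "bij_betw (\<lambda>(f, \<pi>). (restrict f {1..n}, \<pi>)) (carrier (wreath F n H)) (({1..n} \<rightarrow>\<^sub>E carrier F) \<times> H)"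
  proof (rule bij_betwI[where g = "\<lambda>(f, \<pi>). (?E f, \<pi>)"])
    show "(\<lambda>(f, \<pi>). (restrict f {1..n}, \<pi>)) \<in> carrier (wreath F n H) \<rightarrow> ({1..n} \<rightarrow>\<^sub>E carrier F) \<times> H"
      by (auto simp: wreath_simps(1))
    show "(\<lambda>(f, \<pi>). (?E f, \<pi>)) \<in> ({1..n} \<rightarrow>\<^sub>E carrier F) \<times> H \<rightarrow> carrier (wreath F n H)"
      by (auto simp: wreath_simps(1) PiE_iff)
    fix z assume "z \<in> carrier (wreath F n H)"
    then show "(\<lambda>(f, \<pi>). (?E f, \<pi>)) ((\<lambda>(f, \<pi>). (restrict f {1..n}, \<pi>)) z) = z"
      by (cases z) (auto simp: wreath_simps(1) fun_eq_iff)
  next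
    fix z assume "z \<in> ({1..n} \<rightarrow>\<^sub>E carrier F) \<times> H"
    then show "(\<lambda>(f, \<pi>). (restrict f {1..n}, \<pi>)) ((\<lambda>(f, \<pi>). (?E f, \<pi>)) z) = z"
      by (cases z) (auto simp: fun_eq_iff PiE_iff extensional_def)
  qed
  then have "card (carrier (wreath F n H)) = card (({1..n} \<rightarrow>\<^sub>E carrier F) \<times> H)"
    by (rule bij_betw_same_card)
  then show ?thesis
    by (simp add: card_cartesian_product card_PiE)
qed

text \<open>Conjugation by a pure permutation renames the positions in both coordinates.\<close>

lemma wreath_conj:
  assumes F: "group F" and z: "(f, h) \<in> carrier (wreath_sym F n)" and \<pi>: "\<pi> permutes {1..n}"
  shows "(\<lambda>_. \<one>\<^bsub>F\<^esub>, \<pi>) \<in> carrier (wreath_sym F n)"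
    and "inv\<^bsub>wreath_sym F n\<^esub> (\<lambda>_. \<one>\<^bsub>F\<^esub>, \<pi>) \<otimes>\<^bsub>wreath_sym F n\<^esub> (f, h) \<otimes>\<^bsub>wreath_sym F n\<^esub> (\<lambda>_. \<one>\<^bsub>F\<^esub>, \<pi>) =
      (f \<circ> \<pi>, inv' \<pi> \<circ> h \<circ> \<pi>)"
proof -
  interpret F: group F by (rule F)
  show e: "(\<lambda>_. \<one>\<^bsub>F\<^esub>, \<pi>) \<in> carrier (wreath_sym F n)"
    using \<pi> by (simp add: wreath_simps(1) sym_group_carrier)
  show "inv\<^bsub>wreath_sym F n\<^esub> (\<lambda>_. \<one>\<^bsub>F\<^esub>, \<pi>) \<otimes>\<^bsub>wreath_sym F n\<^esub> (f, h) \<otimes>\<^bsub>wreath_sym F n\<^esub> (\<lambda>_. \<one>\<^bsub>F\<^esub>, \<pi>) =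
      (f \<circ> \<pi>, inv' \<pi> \<circ> h \<circ> \<pi>)"
    unfolding group_wreath(2)[OF F perm_group_sym e] wreath_simps(2)
    using wreath_value[OF F z] inv_inv_eq[OF permutes_bij[OF \<pi>]] by (simp add: fun_eq_iff)
qed

section \<open>Comparison of the characters for one enlarged block\<close>

locale wreath_block = wreath_reps F Us + enlarged_block ns i n
  for F :: "('f, 'm) monoid_scheme" and Us :: "('f, 'v::complex_vector) rep list" and ns i n +
  fixes \<Lambda> :: "nat list list"
  assumes lengths: "length ns = length Us" "length \<Lambda> = length Us"
    and \<Lambda>: "\<And>j. j < length Us \<Longrightarrow> is_partition (\<Lambda> ! j) (ns ! j)"
begin

text \<open>Where h fixes p, its component on block i is a permutation of the first n_i points, so
  the character of the old partition \<open>\<Lambda> ! i\<close> can be evaluated there. Colours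
  and blocks are those of the enlarged composition.\<close>

definition restricted_char :: "(nat \<Rightarrow> 'f) \<times> (nat \<Rightarrow> nat) \<Rightarrow> complex" where
  "restricted_char = (\<lambda>(f, h). if h \<in> young_subgroup ms \<and> h p = p
     then color_trace Us {1..Suc n} (color ms) f h *
       (\<Prod>j<length \<Lambda>. rep_char (specht (\<Lambda> ! j)) (block_perm ms j h)) else 0)"

text \<open>The conjugate of \<open>restricted_char\<close> under c. It puts no condition on f (n +
  1); the sum over i, weighted by the dimensions, will turn the last factor into |F| times the
  indicator of f (n + 1) = 1.\<close>

definition split_char :: "(nat \<Rightarrow> 'f) \<times> (nat \<Rightarrow> nat) \<Rightarrow> complex" where
  "split_char = (\<lambda>(f, h). if h \<in> young_subgroup ns
     then young_char \<Lambda> ns (f, h) * rep_char (Us ! i) (f (Suc n)) else 0)"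

text \<open>Conjugation by c moves p to n + 1. There the colour trace splits off a factor, of colour
  i because p lies in block i, while the block components of the permutation remain the
  same.\<close>

lemma restricted_char_conj:
  assumes z: "(f, h) \<in> carrier (wreath_sym F (Suc n))"
  shows "restricted_char (f, h) = split_char (f \<circ> c, conj_c h)"
proof -
  have hp: "h permutes {1..Suc n}"
    using z by (simp add: wreath_simps(1) sym_group_carrier)
  show ?thesis
  proof (cases "h \<in> young_subgroup ms \<and> h p = p")
    case True
    then have y: "conj_c h \<in> young_subgroup ns"
      using conj_c_young[OF hp] by simp
    then have perm: "conj_c h permutes {1..n}"
      by (simp add: young_subgroup_def n)
    have "color_trace Us {1..Suc n} (color ms) f h =
        color_trace Us {1..Suc n} (color ms \<circ> c) (f \<circ> c) (conj_c h)"
      unfolding conj_c_def by (rule color_trace_conj[OF c_permutes hp, symmetric])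
    also have "\<dots> = color_trace Us {1..n} (color ms \<circ> c) (f \<circ> c) (conj_c h) *
        rep_char (Us ! i) ((f \<circ> c) (Suc n))"
      by (simp only: color_trace_fixed_point[OF perm] comp_apply c_last color_p)
    also have "color_trace Us {1..n} (color ms \<circ> c) (f \<circ> c) (conj_c h) =
        color_trace Us {1..n} (color ns) (f \<circ> c) (conj_c h)"
      using c_color by (intro color_trace_cong) simp
    finally have ct: "color_trace Us {1..Suc n} (color ms) f h =
        color_trace Us {1..n} (color ns) (f \<circ> c) (conj_c h) * rep_char (Us ! i) ((f \<circ> c) (Suc n))" .
    have "(\<Prod>j<length \<Lambda>. rep_char (specht (\<Lambda> ! j)) (block_perm ms j h)) =
        (\<Prod>j<length \<Lambda>. rep_char (specht (\<Lambda> ! j)) (block_perm ns j (conj_c h)))"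
      using block_perm_conj_c True lengths by (intro prod.cong) auto
    then show ?thesis
      using True y ct by (simp add: restricted_char_def split_char_def young_char_def n)
  next
    case False
    then have "conj_c h \<notin> young_subgroup ns"
      using conj_c_young[OF hp] by simp
    then show ?thesis
      using False by (simp only: restricted_char_def split_char_def case_prod_conv if_False)
  qed
qed

text \<open>Only the i-th factor depends on \<gamma>, and the branching rule turns its sum into an
  average over conjugates of the i-th component of h. Conjugation by the embedded \<tau> changes
  just this component; the other components and the colour trace are unaffected, because the
  embedded \<tau> preserves all blocks.\<close>

lemma Yplus_young_char:
  assumes z: "(f, h) \<in> carrier (wreath_sym F (Suc n))"
  shows "(\<Sum>\<gamma>\<in>Yplus (\<Lambda> ! i). if h \<in> young_subgroup ms then young_char (\<Lambda>[i := \<gamma>]) ms (f, h) else 0) =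
    (1 / fact (ns ! i)) * (\<Sum>\<tau>\<in>carrier (sym_group (Suc (ns ! i))).
       restricted_char (f \<circ> block_embed ms i \<tau>, inv' (block_embed ms i \<tau>) \<circ> h \<circ> block_embed ms i \<tau>))"
    (is "?L = _ * (\<Sum>\<tau>\<in>?S. ?Q \<tau>)")
proof -
  note Y = perm_groupD[OF perm_group_young[of ms]]
  have hp: "h permutes {1..Suc n}"
    using z by (simp add: wreath_simps(1) sym_group_carrier)
  have e: "block_embed ms i \<tau> \<in> young_subgroup ms" and \<tau>': "\<tau> permutes {1..ms ! i}" if "\<tau> \<in> ?S" for \<tau>
    using block_embed_young[of i ms \<tau>] that i by (simp_all add: sym_group_carrier nth_ms[OF i])
  show ?thesis
  proof (cases "h \<in> young_subgroup ms")
    case False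
    \<comment> \<open>The embedded \<tau> lies in the Young subgroup, so conjugating by it cannot
      bring h into that subgroup.\<close>
    have "?Q \<tau> = 0" if t: "\<tau> \<in> ?S" for \<tau>
    proof -
      let ?e = "block_embed ms i \<tau>"
      have "inv' ?e \<circ> h \<circ> ?e \<notin> young_subgroup ms"
      proof
        assume "inv' ?e \<circ> h \<circ> ?e \<in> young_subgroup ms"
        then have "?e \<circ> (inv' ?e \<circ> h \<circ> ?e) \<circ> inv' ?e \<in> young_subgroup ms"
          using e[OF t] Y(3,4) by blast
        moreover have "?e \<circ> (inv' ?e \<circ> h \<circ> ?e) \<circ> inv' ?e = h"
          using permutes_inverses[OF Y(2)[OF e[OF t]]] by (auto simp: fun_eq_iff)
        ultimately show False
          using False by simp
      qed
      then show ?thesis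
        by (simp add: restricted_char_def)
    qed
    then show ?thesis
      using False by simp
  next
    case True
    define P where "P = (\<Prod>j\<in>{..<length \<Lambda>} - {i}. rep_char (specht (\<Lambda> ! j)) (block_perm ms j h))"
    define u where "u = color_trace Us {1..Suc n} (color ms) f h"
    have iL: "i \<in> {..<length \<Lambda>}"
      using i lengths by simp
    have part: "is_partition (\<Lambda> ! i) (ns ! i)"
      using \<Lambda> i lengths by simp
    have bpi: "block_perm ms i h \<in> carrier (sym_group (Suc (ns ! i)))"
      using block_perm_permutes[OF True, of i] i by (simp add: sym_group_carrier nth_ms[OF i])
    have "young_char (\<Lambda>[i := \<gamma>]) ms (f, h) = u * P * rep_char (specht \<gamma>) (block_perm ms i h)" for \<gamma>
    proof -
      have "(\<Prod>j<length \<Lambda>. rep_char (specht (\<Lambda>[i := \<gamma>] ! j)) (block_perm ms j h)) =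
          rep_char (specht \<gamma>) (block_perm ms i h) *
          (\<Prod>j\<in>{..<length \<Lambda>} - {i}. rep_char (specht (\<Lambda>[i := \<gamma>] ! j)) (block_perm ms j h))"
        using prod.remove[OF _ iL, of "\<lambda>j. rep_char (specht (\<Lambda>[i := \<gamma>] ! j)) (block_perm ms j h)"] iL by simp
      also have "(\<Prod>j\<in>{..<length \<Lambda>} - {i}. rep_char (specht (\<Lambda>[i := \<gamma>] ! j)) (block_perm ms j h)) = P"
        unfolding P_def by (intro prod.cong) auto
      finally show ?thesis
        by (simp add: young_char_def u_def sum_ms)
    qed
    then have "?L = u * P * (\<Sum>\<gamma>\<in>Yplus (\<Lambda> ! i). rep_char (specht \<gamma>) (block_perm ms i h))"
      using True by (simp add: sum_distrib_left)
    also have "(\<Sum>\<gamma>\<in>Yplus (\<Lambda> ! i). rep_char (specht \<gamma>) (block_perm ms i h)) =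
        fin_subgroup.ind_char (sym_group (Suc (ns ! i))) (sym_group (ns ! i)) (rep_char (specht (\<Lambda> ! i))) (block_perm ms i h)"
      by (rule branching_rule[OF part bpi, symmetric])
    also have "\<dots> = (\<Sum>\<tau>\<in>?S. if inv' \<tau> \<circ> block_perm ms i h \<circ> \<tau> \<in> carrier (sym_group (ns ! i))
        then rep_char (specht (\<Lambda> ! i)) (inv' \<tau> \<circ> block_perm ms i h \<circ> \<tau>) else 0) / fact (ns ! i)"
    proof -
      have "card (carrier (sym_group (ns ! i))) = fact (ns ! i)"
        using card_permutations[of "{1..ns ! i}" "ns ! i"] by (simp add: sym_group_def)
      then show ?thesis
        unfolding fin_subgroup.ind_char_def[OF fin_subgroup_sym]
        by (intro arg_cong2[of _ _ _ _ "(/)"] sum.cong refl) (simp_all add: sym_group_mult cong: if_cong)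
    qed
    finally have L: "?L = (1 / fact (ns ! i)) * (u * P * (\<Sum>\<tau>\<in>?S.
        if inv' \<tau> \<circ> block_perm ms i h \<circ> \<tau> \<in> carrier (sym_group (ns ! i))
        then rep_char (specht (\<Lambda> ! i)) (inv' \<tau> \<circ> block_perm ms i h \<circ> \<tau>) else 0))"
      by (simp only: times_divide_eq_right times_divide_eq_left mult_1_left)
    have Q: "?Q \<tau> = u * P * (if inv' \<tau> \<circ> block_perm ms i h \<circ> \<tau> \<in> carrier (sym_group (ns ! i))
        then rep_char (specht (\<Lambda> ! i)) (inv' \<tau> \<circ> block_perm ms i h \<circ> \<tau>) else 0)" if t: "\<tau> \<in> ?S" for \<tau>
    proof -
      let ?e = "block_embed ms i \<tau>"
      let ?h = "inv' ?e \<circ> h \<circ> ?e"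
      note e = e[OF t] and \<tau> = \<tau>'[OF t]
      have y: "?h \<in> young_subgroup ms"
        using e Y(3,4) True by blast
      have bp: "block_perm ms j ?h = (if j = i then inv' \<tau> \<circ> block_perm ms i h \<circ> \<tau> else block_perm ms j h)"
        if j: "j < length ms" for j
      proof -
        have "block_perm ms j ?h = block_perm ms j (inv' ?e) \<circ> block_perm ms j h \<circ> block_perm ms j ?e"
          using block_perm_comp[OF Y(4)[OF Y(3)[OF e] True] e j] block_perm_comp[OF Y(3)[OF e] True j] by simp
        then show ?thesis
          using block_perm_inv[OF e j] block_perm_block_embed[OF _ \<tau> j] i by (simp add: inv_id)
      qed
      have bpi': "block_perm ms i ?h = inv' \<tau> \<circ> block_perm ms i h \<circ> \<tau>"
        using bp[of i] i by simp
      have "color_trace Us {1..Suc n} (color ms) (f \<circ> ?e) ?h =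
          color_trace Us {1..Suc n} (color ms \<circ> ?e) (f \<circ> ?e) ?h"
        using young_subgroup_color[OF e] sum_ms by (intro color_trace_cong) simp
      also have "\<dots> = u"
        unfolding u_def using Y(2)[OF e] sum_ms by (intro color_trace_conj hp) simp
      finally have ct: "color_trace Us {1..Suc n} (color ms) (f \<circ> ?e) ?h = u" .
      have "(\<Prod>j<length \<Lambda>. rep_char (specht (\<Lambda> ! j)) (block_perm ms j ?h)) =
          rep_char (specht (\<Lambda> ! i)) (block_perm ms i ?h) *
          (\<Prod>j\<in>{..<length \<Lambda>} - {i}. rep_char (specht (\<Lambda> ! j)) (block_perm ms j ?h))"
        using prod.remove[OF _ iL, of "\<lambda>j. rep_char (specht (\<Lambda> ! j)) (block_perm ms j ?h)"] by simp
      also have "(\<Prod>j\<in>{..<length \<Lambda>} - {i}. rep_char (specht (\<Lambda> ! j)) (block_perm ms j ?h)) = P"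
        unfolding P_def using bp lengths by (intro prod.cong) auto
      finally have pr: "(\<Prod>j<length \<Lambda>. rep_char (specht (\<Lambda> ! j)) (block_perm ms j ?h)) =
          rep_char (specht (\<Lambda> ! i)) (inv' \<tau> \<circ> block_perm ms i h \<circ> \<tau>) * P"
        unfolding bpi' .
      have "?h p = p \<longleftrightarrow> inv' \<tau> \<circ> block_perm ms i h \<circ> \<tau> \<in> carrier (sym_group (ns ! i))"
        using block_perm_fixes_iff[OF y] unfolding bpi' by (rule sym)
      then show ?thesis
        unfolding restricted_char_def case_prod_conv ct pr using y by (simp del: comp_apply)
    qed
    show ?thesis
      unfolding L sum_distrib_left by (rule sum.cong[OF refl]) (simp only: Q)
  qed
qed

text \<open>Under \<open>conj_sum\<close> the (n_i + 1)! terms of the average become equal. Divided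
  by n_i! they leave n_i + 1, which cancels against the growth of the Young subgroup, while the
  additional coordinate of f leaves |F| in the denominator.\<close>

lemma sum_rep_char_Phi:
  assumes g: "g \<in> carrier (wreath_sym F (Suc n))"
  shows "(\<Sum>\<gamma>\<in>Yplus (\<Lambda> ! i). rep_char (Phi F Us (\<Lambda>[i := \<gamma>])) g) =
    fin_group.conj_sum (wreath_sym F (Suc n))
      (\<lambda>(f, h). if h \<in> young_subgroup ns then young_char \<Lambda> ns (f, h) * rep_char (Us ! i) (f (Suc n)) else 0) g /
    (of_nat (card (carrier F)) * of_nat (card (carrier (young_wreath ns))))"
proof -
  interpret W: fin_group "wreath_sym F (Suc n)"
    by (rule fin_group_wreath_sym)
  interpret S: fin_subgroup "wreath_sym F (Suc n)" "young_wreath ms"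
    using fin_subgroup_young[of ms] by (simp add: sum_ms)
  let ?W = "wreath_sym F (Suc n)" and ?S = "carrier (sym_group (Suc (ns ! i)))"
  have iU: "i < length Us"
    using i lengths by simp
  have sizes: "map sum_list \<Lambda> = ns"
    using lengths \<Lambda> by (intro nth_equalityI) (auto simp: is_partition_def)
  have ms: "ms = map sum_list (\<Lambda>[i := \<gamma>])" if "\<gamma> \<in> Yplus (\<Lambda> ! i)" for \<gamma>
  proof -
    have "sum_list \<gamma> = Suc (ns ! i)"
      using that partition_sum[OF \<Lambda>[OF iU]] by (auto simp: Yplus_def is_partition_def)
    then show ?thesis
      by (simp add: ms_def map_update sizes)
  qed
  have mem: "(f, h) \<in> carrier (young_wreath ms) \<longleftrightarrow> h \<in> young_subgroup ms" if "(f, h) \<in> carrier ?W" for f h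
    using that by (auto simp: wreath_simps(1) sum_ms)
  let ?E = "\<lambda>\<pi>. (\<lambda>_. \<one>\<^bsub>F\<^esub>, \<pi>)"
  have e: "block_embed ms i \<tau> permutes {1..Suc n}" if "\<tau> \<in> ?S" for \<tau>
    using perm_groupD(2)[OF perm_group_young[of ms] block_embed_young[of i ms \<tau>]] that i sum_ms
    by (simp add: sym_group_carrier nth_ms[OF i])
  have avg: "(\<Sum>\<gamma>\<in>Yplus (\<Lambda> ! i). if z \<in> carrier (young_wreath ms) then young_char (\<Lambda>[i := \<gamma>]) ms z else 0) =
      (1 / fact (ns ! i)) * (\<Sum>\<tau>\<in>?S. restricted_char
        (inv\<^bsub>?W\<^esub> ?E (block_embed ms i \<tau>) \<otimes>\<^bsub>?W\<^esub> z \<otimes>\<^bsub>?W\<^esub> ?E (block_embed ms i \<tau>)))"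
    if z: "z \<in> carrier ?W" for z
  proof -
    obtain f h where fh: "z = (f, h)"
      by (cases z)
    show ?thesis
      unfolding fh mem[OF z[unfolded fh]] Yplus_young_char[OF z[unfolded fh]]
      by (intro arg_cong2[of _ _ _ _ "(*)"] sum.cong refl arg_cong[of _ _ restricted_char])
        (simp only: wreath_conj(2)[OF group_F z[unfolded fh] e])
  qed
  have shift: "restricted_char z = split_char (inv\<^bsub>?W\<^esub> ?E c \<otimes>\<^bsub>?W\<^esub> z \<otimes>\<^bsub>?W\<^esub> ?E c)"
    if z: "z \<in> carrier ?W" for z
  proof -
    obtain f h where fh: "z = (f, h)"
      by (cases z)
    show ?thesis
      unfolding fh restricted_char_conj[OF z[unfolded fh]]
        wreath_conj(2)[OF group_F z[unfolded fh] c_permutes] conj_c_def ..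
  qed
  have inW: "?E \<pi> \<in> carrier ?W" if "\<pi> permutes {1..Suc n}" for \<pi>
    using wreath_conj(1)[OF group_F W.one_closed[unfolded wreath_simps(3)] that] .
  have cardS: "card ?S = fact (Suc (ns ! i))"
    using card_permutations[of "{1..Suc (ns ! i)}" "Suc (ns ! i)"] by (simp add: sym_group_def)
  have "(\<Sum>\<gamma>\<in>Yplus (\<Lambda> ! i). W.conj_sum (\<lambda>z. if z \<in> carrier (young_wreath ms) then young_char (\<Lambda>[i := \<gamma>]) ms z else 0) g) =
      W.conj_sum (\<lambda>z. (1 / fact (ns ! i)) * (\<Sum>\<tau>\<in>?S. restricted_char
        (inv\<^bsub>?W\<^esub> ?E (block_embed ms i \<tau>) \<otimes>\<^bsub>?W\<^esub> z \<otimes>\<^bsub>?W\<^esub> ?E (block_embed ms i \<tau>)))) g"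
    unfolding W.conj_sum_sum[symmetric] using avg by (intro W.conj_sum_cong g)
  also have "\<dots> = (1 / fact (ns ! i)) * (\<Sum>\<tau>\<in>?S. W.conj_sum restricted_char g)"
    unfolding W.conj_sum_scale W.conj_sum_sum
    by (intro arg_cong2[of _ _ _ _ "(*)"] sum.cong refl W.conj_sum_conj[OF g] inW e)
  also have "\<dots> = of_nat (Suc (ns ! i)) * W.conj_sum restricted_char g"
    by (simp add: cardS field_simps)
  also have "W.conj_sum restricted_char g = W.conj_sum (\<lambda>z. split_char (inv\<^bsub>?W\<^esub> ?E c \<otimes>\<^bsub>?W\<^esub> z \<otimes>\<^bsub>?W\<^esub> ?E c)) g"
    using shift by (intro W.conj_sum_cong g)
  also have "\<dots> = W.conj_sum split_char g"
    by (rule W.conj_sum_conj[OF g inW[OF c_permutes]])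
  finally have sum: "(\<Sum>\<gamma>\<in>Yplus (\<Lambda> ! i). W.conj_sum (\<lambda>z. if z \<in> carrier (young_wreath ms) then young_char (\<Lambda>[i := \<gamma>]) ms z else 0) g) =
      of_nat (Suc (ns ! i)) * W.conj_sum split_char g" .
  have card: "card (carrier (young_wreath ms)) = card (carrier F) * (Suc (ns ! i) * card (carrier (young_wreath ns)))"
    unfolding card_wreath[OF group_F finite_F] sum_ms n card_young_subgroup by (simp add: algebra_simps)
  have "(\<Sum>\<gamma>\<in>Yplus (\<Lambda> ! i). rep_char (Phi F Us (\<Lambda>[i := \<gamma>])) g) =
      (\<Sum>\<gamma>\<in>Yplus (\<Lambda> ! i). W.conj_sum (\<lambda>z. if z \<in> carrier (young_wreath ms) then young_char (\<Lambda>[i := \<gamma>]) ms z else 0) g) /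
      of_nat (card (carrier (young_wreath ms)))"
    unfolding sum_divide_distrib
  proof (rule sum.cong[OF refl])
    fix \<gamma> assume \<gamma>: "\<gamma> \<in> Yplus (\<Lambda> ! i)"
    have "rep_char (Phi F Us (\<Lambda>[i := \<gamma>])) g = S.ind_char (young_char (\<Lambda>[i := \<gamma>]) ms) g"
      using is_rep_Phi(2)[OF _ ms[OF \<gamma>], of g, unfolded sum_ms] g lengths unfolding sum_ms by simp
    then show "rep_char (Phi F Us (\<Lambda>[i := \<gamma>])) g =
        W.conj_sum (\<lambda>z. if z \<in> carrier (young_wreath ms) then young_char (\<Lambda>[i := \<gamma>]) ms z else 0) g /
        of_nat (card (carrier (young_wreath ms)))"
      by (simp only: S.ind_char_conj_sum)
  qed
  also have "\<dots> = of_nat (Suc (ns ! i)) * W.conj_sum split_char g / of_nat (card (carrier (young_wreath ms)))"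
    by (simp only: sum)
  also have "\<dots> = W.conj_sum split_char g / (of_nat (card (carrier F)) * of_nat (card (carrier (young_wreath ns))))"
    unfolding card of_nat_mult by (simp add: field_simps del: of_nat_Suc)
  finally show ?thesis
    unfolding split_char_def .
qed

lemma is_rep_Phi_update:
  assumes \<gamma>: "\<gamma> \<in> Yplus (\<Lambda> ! i)"
  shows "is_rep (wreath_sym F (Suc n)) (Phi F Us (\<Lambda>[i := \<gamma>]))"
proof -
  have "sum_list \<gamma> = Suc (ns ! i)"
    using \<gamma> partition_sum[OF \<Lambda>] i lengths by (auto simp: Yplus_def is_partition_def)
  moreover have "map sum_list \<Lambda> = ns"
    using lengths \<Lambda> by (intro nth_equalityI) (auto simp: is_partition_def)
  ultimately have ms: "ms = map sum_list (\<Lambda>[i := \<gamma>])"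
    by (simp add: ms_def map_update)
  show ?thesis
    using is_rep_Phi(1)[OF _ ms] lengths unfolding sum_ms by simp
qed

end

theorem theorem5p1:
  fixes F :: "('f, 'm) monoid_scheme"
    and Us :: "('f, 'v::complex_vector) rep list"
    and n :: nat and ns :: "nat list" and \<Lambda> :: "nat list list"
  assumes "group F" and "finite (carrier F)"
    and "is_Irr F Us"
    and "length ns = length Us" and "is_composition ns n"
    and "is_multipartition \<Lambda> ns"
  shows "rep_iso (wreath_sym F (n + 1))
           (induced (wreath_sym F (n + 1)) (carrier (wreath_sym F n)) (Phi F Us \<Lambda>))
           (direct_sum {..<length Us} (\<lambda>i. copies (rep_dim (Us ! i))
              (direct_sum (Yplus (\<Lambda> ! i)) (\<lambda>\<gamma>. Phi F Us (\<Lambda>[i := \<gamma>])))))"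
proof -
  have Us: "is_rep F (Us ! i)" if "i < length Us" for i
    using assms(3) that irreducible_repD(1) unfolding is_Irr_def by blast
  interpret F: fin_group F
    using assms(1,2) by (simp add: fin_group_def fin_group_axioms_def)
  interpret wreath_reps F Us
    using assms(1,2) Us by unfold_locales
  have n: "sum_list ns = n"
    using assms(5) by (simp add: is_composition_def)
  have len: "length \<Lambda> = length Us" and part: "\<And>i. i < length Us \<Longrightarrow> is_partition (\<Lambda> ! i) (ns ! i)"
    using assms(4,6) by (auto simp: is_multipartition_def)
  have sizes: "ns = map sum_list \<Lambda>"
    using len part assms(4) by (intro nth_equalityI) (auto simp: is_partition_def)
  have block: "wreath_block F Us ns i n \<Lambda>" if "i < length Us" for i
    using that assms(4) n len part by unfold_locales auto
  let ?W = "wreath_sym F (Suc n)" and ?H = "young_wreath ns"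
  interpret S: fin_subgroup ?W "wreath_sym F n"
    by (rule fin_subgroup_wreath_sym)
  have H: "fin_subgroup (wreath_sym F n) ?H"
    using fin_subgroup_young[of ns] n by simp
  have HW: "?H = wreath F n (young_subgroup ns)"
    using n by simp
  let ?L = "induced ?W (carrier (wreath_sym F n)) (Phi F Us \<Lambda>)"
  let ?D = "\<lambda>i. direct_sum (Yplus (\<Lambda> ! i)) (\<lambda>\<gamma>. Phi F Us (\<Lambda>[i := \<gamma>]))"
  let ?R = "direct_sum {..<length Us} (\<lambda>i. copies (rep_dim (Us ! i)) (?D i))"
  have Phi: "is_rep (wreath_sym F n) (Phi F Us \<Lambda>)"
    using is_rep_Phi(1)[OF len[symmetric] sizes] n by simp
  have L: "is_rep ?W ?L"
    by (rule S.is_rep_induced[OF Phi])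
  have D: "is_rep ?W (?D i)" if "i < length Us" for i
    using wreath_block.is_rep_Phi_update[OF block[OF that]] by (intro is_rep_direct_sum finite_Yplus)
  have R: "is_rep ?W ?R"
    by (rule is_rep_direct_sum) (auto intro!: is_rep_copies D)
  have "rep_char ?L g = rep_char ?R g" if g: "g \<in> carrier ?W" for g
  proof -
    let ?Z = "\<lambda>z. if z \<in> carrier ?H then young_char \<Lambda> ns z else 0"
    let ?Y = "\<lambda>i (f, h). if h \<in> young_subgroup ns then young_char \<Lambda> ns (f, h) * rep_char (Us ! i) (f (Suc n)) else 0"
    let ?f = "of_nat (card (carrier F)) :: complex" and ?h = "of_nat (card (carrier ?H)) :: complex"
    have "rep_char ?L g = S.ind_char (rep_char (Phi F Us \<Lambda>)) g"
      by (rule S.rep_char_induced[OF Phi g])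
    also have "\<dots> = S.ind_char (fin_subgroup.ind_char (wreath_sym F n) ?H (young_char \<Lambda> ns)) g"
    proof -
      have "rep_char (Phi F Us \<Lambda>) z = fin_subgroup.ind_char (wreath_sym F n) ?H (young_char \<Lambda> ns) z"
        if "z \<in> carrier (wreath_sym F n)" for z
        using is_rep_Phi(2)[OF len[symmetric] sizes, of z] that n by simp
      then show ?thesis
        unfolding S.ind_char_def by (intro arg_cong2[of _ _ _ _ "(/)"] sum.cong refl) (simp cong: if_cong)
    qed
    also have "\<dots> = S.conj_sum ?Z g / ?h"
      by (rule S.ind_char_transitive[OF H g])
    finally have charL: "rep_char ?L g = S.conj_sum ?Z g / ?h" .
    have "rep_char ?R g = (\<Sum>i<length Us. of_nat (rep_dim (Us ! i)) *
        (\<Sum>\<gamma>\<in>Yplus (\<Lambda> ! i). rep_char (Phi F Us (\<Lambda>[i := \<gamma>])) g))"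
    proof -
      have "rep_char ?R g = (\<Sum>i<length Us. rep_char (copies (rep_dim (Us ! i)) (?D i)) g)"
        by (rule rep_char_direct_sum[OF _ _ g]) (auto intro!: is_rep_copies D)
      also have "\<dots> = (\<Sum>i<length Us. of_nat (rep_dim (Us ! i)) * rep_char (?D i) g)"
        using D g by (intro sum.cong refl rep_char_copies) auto
      also have "\<dots> = (\<Sum>i<length Us. of_nat (rep_dim (Us ! i)) *
          (\<Sum>\<gamma>\<in>Yplus (\<Lambda> ! i). rep_char (Phi F Us (\<Lambda>[i := \<gamma>])) g))"
        using wreath_block.is_rep_Phi_update[OF block] finite_Yplus g
        by (intro sum.cong refl arg_cong2[of _ _ _ _ "(*)"] rep_char_direct_sum) auto
      finally show ?thesis .
    qed
    also have "\<dots> = (\<Sum>i<length Us. of_nat (rep_dim (Us ! i)) * (S.conj_sum (?Y i) g / (?f * ?h)))"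
      using wreath_block.sum_rep_char_Phi[OF block g] by (intro sum.cong) simp_all
    also have "\<dots> = S.conj_sum (\<lambda>z. \<Sum>i<length Us. of_nat (rep_dim (Us ! i)) * ?Y i z) g / (?f * ?h)"
      unfolding S.conj_sum_sum S.conj_sum_scale by (simp add: sum_divide_distrib)
    \<comment> \<open>The equality holds for each z separately: the weighted sum over i is the
      regular character of F at f (n + 1), which is |F| or 0.\<close>
    also have "S.conj_sum (\<lambda>z. \<Sum>i<length Us. of_nat (rep_dim (Us ! i)) * ?Y i z) g = S.conj_sum (\<lambda>z. ?f * ?Z z) g"
    proof (rule S.conj_sum_cong[OF g])
      fix z assume z: "z \<in> carrier ?W"
      obtain f h where fh: "z = (f, h)"
        by (cases z)
      have fF: "f (Suc n) \<in> carrier F"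
        using wreath_value[OF assms(1) z[unfolded fh]] .
      \<comment> \<open>Within the larger wreath product f (n + 1) = 1 is the only condition besides
        the one on h; that h fixes n + 1 is part of membership in
        \<open>young_subgroup ns\<close>.\<close>
      have mem: "(f, h) \<in> carrier ?H \<longleftrightarrow> h \<in> young_subgroup ns \<and> f (Suc n) = \<one>\<^bsub>F\<^esub>"
        using z unfolding fh HW by (auto simp: wreath_simps(1) le_Suc_eq)
      have "(\<Sum>i<length Us. of_nat (rep_dim (Us ! i)) * ?Y i (f, h)) =
          (if h \<in> young_subgroup ns then young_char \<Lambda> ns (f, h) *
            (\<Sum>i<length Us. of_nat (rep_dim (Us ! i)) * rep_char (Us ! i) (f (Suc n))) else 0)"
        by (simp add: sum_distrib_left mult_ac)
      also have "\<dots> = ?f * ?Z (f, h)"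
        unfolding F.regular_character[OF assms(3) fF] mem by simp
      finally show "(\<Sum>i<length Us. of_nat (rep_dim (Us ! i)) * ?Y i z) = ?f * ?Z z"
        unfolding fh .
    qed
    also have "S.conj_sum (\<lambda>z. ?f * ?Z z) g / (?f * ?h) = S.conj_sum ?Z g / ?h"
      unfolding S.conj_sum_scale using F.card_carrier_pos by simp
    finally show ?thesis
      using charL by simp
  qed
  then have "rep_iso ?W ?L ?R"
    by (rule S.rep_iso_of_char[OF L R])
  then show ?thesis
    by simp
qed

end
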